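(* Let $\Omega\subset\mathbb{R}^N$ be a bounded smooth domain and $p_1,p_2\in C_+(\overline{\Omega})$. Let $f:\Omega\times\mathbb{R}\to\mathbb{R}$ satisfy: (f$_0$) $f$ is Carathéodory and $|f(x,t)|\le C_1+C_2|t|^{\alpha(x)-1}$ for all $(x,t)\in\Omega\times\mathbb{R}$, where $\alpha\in C_+(\overline\Omega)$ and $\alpha(x)<p_M^*(x)$ for all $x\in\overline\Omega$; (f$_1$) there exist $M>0$ and $\theta>p_M^+$ such that $0<\theta F(x,t)\le tf(x,t)$ for all $|t|\ge M$, $x\in\Omega$, where $F(x,t)=\int_0^tf(x,s)ds$; (f$_3$) $f(x,-t)=-f(x,t)$ for all $x\in\Omega$, $t\in\mathbb{R}$; and suppose $p_M^+<\alpha^+$. Then the functional $$\varphi(u)=\int_\Omega\frac{1}{p_1(x)}|\nabla u|^{p_1(x)}dx+\int_\Omega\frac{1}{p_2(x)}|\nabla u|^{p_2(x)}dx-\int_\Omega F(x,u)\,dx,\quad u\in X,$$ has a sequence of critical points $\{u_n\}$ with $\varphi(u_n)\to+\infty$, and the problem $$-\mathrm{div}(|\nabla u|^{p_1(x)-2}\nabla u)-\mathrm{div}(|\nabla u|^{p_2(x)-2}\nabla u)=f(x,u)\ \text{in }\Omega,\qquad u=0\ \text{on }\partial\Omega$$ has infinitely many pairs of weak solutions.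
   Context: $C_+(\overline{\Omega})=\{h\in C(\overline{\Omega}):h>1\text{ on }\overline\Omega\}$; $h^+=\max_{\overline\Omega}h$. $p_M(x)=\max\{p_1(x),p_2(x)\}$; for $p\in C_+(\overline\Omega)$, $p^*(x)=\frac{Np(x)}{N-p(x)}$ if $p(x)<N$, $p^*(x)=\infty$ otherwise. $L^{p(x)}(\Omega)$ is the variable exponent Lebesgue space with Luxemburg norm $|u|_{p(x)}=\inf\{\lambda>0:\int_\Omega|u/\lambda|^{p(x)}dx\le1\}$, $W^{1,p(x)}(\Omega)=\{u\in L^{p(x)}:|\nabla u|\in L^{p(x)}\}$ with norm $\|u\|_{p(x)}=|u|_{p(x)}+|\nabla u|_{p(x)}$, $W_0^{1,p(x)}(\Omega)$ the closure of $C_0^\infty(\Omega)$ in it. $X:=W_0^{1,p_1(x)}(\Omega)\cap W_0^{1,p_2(x)}(\Omega)$ with norm $\|u\|_{p_1(x)}+\|u\|_{p_2(x)}$; $\varphi\in C^1(X,\mathbb{R})$ and its critical points are exactly the weak solutions, i.e. $u\in X$ with $\int_\Omega|\nabla u|^{p_1(x)-2}\nabla u\cdot\nabla v\,dx+\int_\Omega|\nabla u|^{p_2(x)-2}\nabla u\cdot\nabla v\,dx=\int_\Omega f(x,u)v\,dx$ for all $v\in X$. A pair of solutions means $\{u,-u\}$. *)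

theory Defs
  imports "HOL-Analysis.Analysis"
begin

fun Ck_on :: "nat \<Rightarrow> 'a::euclidean_space set \<Rightarrow> ('a \<Rightarrow> real) \<Rightarrow> bool" where
  "Ck_on 0 U f = continuous_on U f"
| "Ck_on (Suc k) U f =
     ((\<forall>x\<in>U. f differentiable (at x)) \<and>
      (\<forall>i\<in>Basis. Ck_on k U (\<lambda>x. frechet_derivative f (at x) i)))"

definition smooth_on :: "'a::euclidean_space set \<Rightarrow> ('a \<Rightarrow> real) \<Rightarrow> bool" where
  "smooth_on U f \<longleftrightarrow> (\<forall>k. Ck_on k U f)"

definition smooth_bounded_domain :: "'a::euclidean_space set \<Rightarrow> bool" where
  "smooth_bounded_domain \<Omega> \<longleftrightarrow>
     open \<Omega> \<and> connected \<Omega> \<and> \<Omega> \<noteq> {} \<and> bounded \<Omega> \<and>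
     (\<forall>z\<in>frontier \<Omega>. \<exists>U g. open U \<and> z \<in> U \<and> smooth_on U g \<and>
        (\<forall>x\<in>U. frechet_derivative g (at x) \<noteq> (\<lambda>v. 0)) \<and>
        \<Omega> \<inter> U = {x\<in>U. g x < 0})"

definition test_fns :: "'a::euclidean_space set \<Rightarrow> ('a \<Rightarrow> real) set" where
  "test_fns \<Omega> = {\<phi>. smooth_on UNIV \<phi> \<and> compact (closure {x. \<phi> x \<noteq> 0})
                     \<and> closure {x. \<phi> x \<noteq> 0} \<subseteq> \<Omega>}"

definition loc_integrable :: "'a::euclidean_space set \<Rightarrow> ('a \<Rightarrow> 'b::{banach,second_countable_topology}) \<Rightarrow> bool" where
  "loc_integrable \<Omega> u \<longleftrightarrow> (\<forall>K. compact K \<and> K \<subseteq> \<Omega> \<longrightarrow> integrable (lebesgue_on K) u)"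

definition has_weak_gradient :: "'a::euclidean_space set \<Rightarrow> ('a \<Rightarrow> real) \<Rightarrow> ('a \<Rightarrow> 'a) \<Rightarrow> bool" where
  "has_weak_gradient \<Omega> u g \<longleftrightarrow>
     loc_integrable \<Omega> u \<and> loc_integrable \<Omega> g \<and>
     (\<forall>i\<in>Basis. \<forall>\<phi>\<in>test_fns \<Omega>.
        (\<integral>x. u x * frechet_derivative \<phi> (at x) i \<partial>lebesgue_on \<Omega>)
          = - (\<integral>x. (g x \<bullet> i) * \<phi> x \<partial>lebesgue_on \<Omega>))"

definition wgrad :: "'a::euclidean_space set \<Rightarrow> ('a \<Rightarrow> real) \<Rightarrow> ('a \<Rightarrow> 'a)" where
  "wgrad \<Omega> u = (SOME g. has_weak_gradient \<Omega> u g)"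

definition C_plus :: "'a::euclidean_space set \<Rightarrow> ('a \<Rightarrow> real) \<Rightarrow> bool" where
  "C_plus \<Omega> h \<longleftrightarrow> continuous_on (closure \<Omega>) h \<and> (\<forall>x\<in>closure \<Omega>. h x > 1)"

definition sup_cl :: "'a::euclidean_space set \<Rightarrow> ('a \<Rightarrow> real) \<Rightarrow> real" where
  "sup_cl \<Omega> h = (SUP x\<in>closure \<Omega>. h x)"

definition modular :: "'a::euclidean_space set \<Rightarrow> ('a \<Rightarrow> real) \<Rightarrow> ('a \<Rightarrow> real) \<Rightarrow> ennreal" where
  "modular \<Omega> p u = (\<integral>\<^sup>+ x. ennreal (\<bar>u x\<bar> powr p x) \<partial>lebesgue_on \<Omega>)"

definition in_Lp :: "'a::euclidean_space set \<Rightarrow> ('a \<Rightarrow> real) \<Rightarrow> ('a \<Rightarrow> real) \<Rightarrow> bool" where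
  "in_Lp \<Omega> p u \<longleftrightarrow> u \<in> borel_measurable (lebesgue_on \<Omega>) \<and>
                     (\<exists>c>0. modular \<Omega> p (\<lambda>x. u x / c) < \<infinity>)"

definition lux_norm :: "'a::euclidean_space set \<Rightarrow> ('a \<Rightarrow> real) \<Rightarrow> ('a \<Rightarrow> real) \<Rightarrow> real" where
  "lux_norm \<Omega> p u = Inf {c. c > 0 \<and> modular \<Omega> p (\<lambda>x. u x / c) \<le> 1}"

definition W1p :: "'a::euclidean_space set \<Rightarrow> ('a \<Rightarrow> real) \<Rightarrow> ('a \<Rightarrow> real) \<Rightarrow> bool" where
  "W1p \<Omega> p u \<longleftrightarrow> in_Lp \<Omega> p u \<and>
     (\<exists>g. has_weak_gradient \<Omega> u g \<and> in_Lp \<Omega> p (\<lambda>x. norm (g x)))"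

definition W_norm :: "'a::euclidean_space set \<Rightarrow> ('a \<Rightarrow> real) \<Rightarrow> ('a \<Rightarrow> real) \<Rightarrow> real" where
  "W_norm \<Omega> p u = lux_norm \<Omega> p u + lux_norm \<Omega> p (\<lambda>x. norm (wgrad \<Omega> u x))"

definition W0 :: "'a::euclidean_space set \<Rightarrow> ('a \<Rightarrow> real) \<Rightarrow> ('a \<Rightarrow> real) \<Rightarrow> bool" where
  "W0 \<Omega> p u \<longleftrightarrow> W1p \<Omega> p u \<and>
     (\<exists>\<phi>. (\<forall>k. \<phi> k \<in> test_fns \<Omega>) \<and>
          (\<lambda>k. W_norm \<Omega> p (\<lambda>x. \<phi> k x - u x)) \<longlonglongrightarrow> 0)"

definition Xsp :: "'a::euclidean_space set \<Rightarrow> ('a \<Rightarrow> real) \<Rightarrow> ('a \<Rightarrow> real) \<Rightarrow> ('a \<Rightarrow> real) set" where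
  "Xsp \<Omega> p1 p2 = {u. W0 \<Omega> p1 u \<and> W0 \<Omega> p2 u}"

definition caratheodory :: "'a::euclidean_space set \<Rightarrow> ('a \<Rightarrow> real \<Rightarrow> real) \<Rightarrow> bool" where
  "caratheodory \<Omega> f \<longleftrightarrow> (\<forall>t. (\<lambda>x. f x t) \<in> borel_measurable (lebesgue_on \<Omega>)) \<and>
                          (AE x in lebesgue_on \<Omega>. continuous_on UNIV (f x))"

definition Fprim :: "('a \<Rightarrow> real \<Rightarrow> real) \<Rightarrow> 'a \<Rightarrow> real \<Rightarrow> real" where
  "Fprim f x t = (LBINT s=ereal 0..ereal t. f x s)"

definition energy :: "'a::euclidean_space set \<Rightarrow> ('a \<Rightarrow> real) \<Rightarrow> ('a \<Rightarrow> real)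
                        \<Rightarrow> ('a \<Rightarrow> real \<Rightarrow> real) \<Rightarrow> ('a \<Rightarrow> real) \<Rightarrow> real" where
  "energy \<Omega> p1 p2 f u =
     (\<integral>x. norm (wgrad \<Omega> u x) powr p1 x / p1 x \<partial>lebesgue_on \<Omega>)
   + (\<integral>x. norm (wgrad \<Omega> u x) powr p2 x / p2 x \<partial>lebesgue_on \<Omega>)
   - (\<integral>x. Fprim f x (u x) \<partial>lebesgue_on \<Omega>)"

text \<open>Critical point of the energy on X: all directional (Gateaux) derivatives in
directions of X vanish (for the C^1 functional this is vanishing of the derivative).\<close>
definition critical_point :: "'a::euclidean_space set \<Rightarrow> ('a \<Rightarrow> real) \<Rightarrow> ('a \<Rightarrow> real)
                        \<Rightarrow> ('a \<Rightarrow> real \<Rightarrow> real) \<Rightarrow> ('a \<Rightarrow> real) \<Rightarrow> bool" where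
  "critical_point \<Omega> p1 p2 f u \<longleftrightarrow> u \<in> Xsp \<Omega> p1 p2 \<and>
     (\<forall>v\<in>Xsp \<Omega> p1 p2.
        ((\<lambda>s. energy \<Omega> p1 p2 f (\<lambda>x. u x + s * v x)) has_real_derivative 0) (at 0))"

definition weak_solution :: "'a::euclidean_space set \<Rightarrow> ('a \<Rightarrow> real) \<Rightarrow> ('a \<Rightarrow> real)
                        \<Rightarrow> ('a \<Rightarrow> real \<Rightarrow> real) \<Rightarrow> ('a \<Rightarrow> real) \<Rightarrow> bool" where
  "weak_solution \<Omega> p1 p2 f u \<longleftrightarrow> u \<in> Xsp \<Omega> p1 p2 \<and>
     (\<forall>v\<in>Xsp \<Omega> p1 p2.
        (\<integral>x. norm (wgrad \<Omega> u x) powr (p1 x - 2) * (wgrad \<Omega> u x \<bullet> wgrad \<Omega> v x) \<partial>lebesgue_on \<Omega>)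
      + (\<integral>x. norm (wgrad \<Omega> u x) powr (p2 x - 2) * (wgrad \<Omega> u x \<bullet> wgrad \<Omega> v x) \<partial>lebesgue_on \<Omega>)
      = (\<integral>x. f x (u x) * v x \<partial>lebesgue_on \<Omega>))"

end

theory Submission
  imports Defs "HOL-Homology.Invariance_of_Domain"
begin

text \<open>Galerkin minimax. On the span of the first n elements of a dense sequence of test functions the energy
is even and nonnegative only on a bounded set. If it had no critical value in [a, b] there, a discrete gradient
flow followed by the Borsuk-Ulam theorem would contradict a lower bound on a level set of the convex part J.
That bound needs only finitely many odd constraints, the averages of u over dyadic cells: by the Poincare
inequality on cells and subcriticality of alpha, a function with bounded J and vanishing averages over small
cells has small modular of exponent alpha. The same estimate makes Galerkin solutions whose cell averages
converge (Tychonoff) a Cauchy sequence for that modular; uniform convexity of the p(x)-modulars then gives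
convergence of the gradients, so the limit is a critical point with energy in [a, b].\<close>

text \<open>The energies of the Galerkin solutions must stay in a window [a, b] that does not move
  with the Galerkin space. The lower end comes from the mesh: \<open>card (reps j)\<close> vanishing
  cell averages on a level set of J already force energy at least a. Hence k is one more than that
  number, and Borsuk-Ulam makes the flowed sphere meet a fixed k-dimensional space, whose maximal
  energy is the upper end b. Adjoining directions changes neither number.

  The spaces are indexed by arbitrary finite sets of directions, so their solutions form a net; a
  cluster point of the cell integrals replaces weak compactness, and for each direction a sequence
  is drawn from the net. Since cell integrals determine a function almost everywhere, all these
  limits coincide. Every solution is adjoined to the later test directions, so that later solutions
  can be tested against earlier ones; this makes J almost decreasing along the sequence, which
  uniform convexity needs.

  The variable exponent rules out scaling arguments. Estimates are made on cells so small that the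
  exponents are nearly constant, and with modulars instead of norms.\<close>

hide_const (open) Order.top
hide_fact (open) Henstock_Kurzweil_Integration.integrable_bound
  Henstock_Kurzweil_Integration.integral_cong
  Henstock_Kurzweil_Integration.integral_add
  Henstock_Kurzweil_Integration.integrable_add

section \<open>The Borsuk-Ulam theorem\<close>

text \<open>Keeping the spheres inside one type of real sequences lets the dimension vary and makes
  them nested. The index counts coordinates, so \<open>nsphere m\<close> is
  \<open>Sph (Suc m)\<close>.\<close>

definition Sph :: "nat => (nat => real) set" where
  "Sph n = {x. (\<Sum>i<n. (x i)\<^sup>2) = 1 \<and> (\<forall>i\<ge>n. x i = 0)}"

lemma nsphere_eq_Sph: "nsphere m = top_of_set (Sph (Suc m))"
  by (simp add: nsphere Sph_def euclidean_product_topology lessThan_Suc_atMost Suc_le_eq)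

lemma topspace_nsphere_Sph: "topspace (nsphere m) = Sph (Suc m)"
  by (simp add: nsphere_eq_Sph)

lemma continuous_on_coord: "continuous_on S (%x::nat => real. x i)"
  by (rule continuous_on_subset[OF continuous_on_product_coordinates]) simp

lemma Sph_abs_le: assumes "x \<in> Sph n" shows "\<bar>x i\<bar> \<le> 1"
proof (cases "i < n")
  case True
  have "(x i)\<^sup>2 \<le> (\<Sum>i<n. (x i)\<^sup>2)"
    by (rule member_le_sum) (use True in auto)
  with assms show ?thesis by (simp add: Sph_def abs_square_le_1)
qed (use assms in \<open>simp add: Sph_def\<close>)

text \<open>Tychonoff for an arbitrary index type: used for coordinate vectors here and for the
  family of all cell integrals in the passage to the limit.\<close>

lemma compact_box_fun: "compact {y::'i => real. \<forall>i. \<bar>y i\<bar> \<le> B}"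
proof -
  have "compactin (product_topology (%i::'i. euclidean :: real topology) UNIV) (PiE UNIV (%i. {- B..B}))"
    by (subst compactin_PiE) auto
  then have "compact (PiE UNIV (%i::'i. {- B..B}))"
    by (simp add: euclidean_product_topology)
  moreover have "PiE UNIV (%i::'i. {- B..B}) = {y. \<forall>i. \<bar>y i\<bar> \<le> B}"
    by (auto simp: PiE_def Pi_def abs_le_iff minus_le_iff)
  ultimately show ?thesis by simp
qed

lemma closed_tail_zero: "closed {y::nat => real. \<forall>i\<ge>n. y i = 0}"
proof -
  have "{y::nat => real. \<forall>i\<ge>n. y i = 0} = (\<Inter>i\<in>{n..}. {y. y i = 0})" by auto
  then show ?thesis
    by (auto intro!: closed_INT closed_Collect_eq continuous_on_coord)
qed

lemma compact_Sph: "compact (Sph n)"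
proof -
  have "closed {x::nat => real. (\<Sum>i<n. (x i)\<^sup>2) = 1}"
    by (intro closed_Collect_eq continuous_intros continuous_on_coord)
  then have "closed (Sph n)"
    unfolding Sph_def Collect_conj_eq by (intro closed_Int closed_tail_zero)
  then have "compact ({y. \<forall>i. \<bar>y i\<bar> \<le> 1} \<inter> Sph n)"
    by (rule compact_Int_closed[OF compact_box_fun])
  moreover have "{y. \<forall>i. \<bar>y i\<bar> \<le> 1} \<inter> Sph n = Sph n"
    using Sph_abs_le by auto
  ultimately show ?thesis by simp
qed

lemma Sph_uminus: "x \<in> Sph n ==> (%i. - x i) \<in> Sph n"
  by (simp add: Sph_def)

lemma Sph_mono: "n \<le> m ==> x \<in> Sph n ==> x \<in> Sph m"
proof -
  assume a: "n \<le> m" "x \<in> Sph n"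
  have "(\<Sum>i<m. (x i)\<^sup>2) = (\<Sum>i<n. (x i)\<^sup>2)"
    by (rule sum.mono_neutral_right) (use a in \<open>auto simp: Sph_def\<close>)
  with a show ?thesis by (auto simp: Sph_def)
qed

text \<open>Radial projection to the sphere. Division by zero sends the zero vector to itself, so
  every use has to supply a nonvanishing coordinate.\<close>

definition nrm :: "nat => (nat => real) => nat => real" where
  "nrm m y = (%i. y i / sqrt (\<Sum>j<Suc m. (y j)\<^sup>2))"

lemma nrm_Sph:
  assumes "\<forall>i>m. y i = 0" "\<exists>i. y i \<noteq> 0" shows "nrm m y \<in> Sph (Suc m)"
proof -
  obtain i where i: "y i \<noteq> 0" using assms by auto
  then have "i \<in> {..<Suc m}" using assms(1) by (metis lessThan_iff not_less_eq)
  then have "(\<Sum>j<Suc m. (y j)\<^sup>2) > 0"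
    by (intro sum_pos2[of _ i]) (use i in auto)
  then show ?thesis using assms(1)
    by (simp add: Sph_def nrm_def power_divide Suc_le_eq add_divide_distrib[symmetric] flip: sum_divide_distrib)
qed

lemma nrm_id: "y \<in> Sph (Suc m) ==> nrm m y = y"
  by (simp add: Sph_def nrm_def)

lemma continuous_on_nrm:
  assumes "!!i. continuous_on T (%z. F z i)" "!!z. z \<in> T ==> \<forall>i>m. F z i = 0" "!!z. z \<in> T ==> \<exists>i. F z i \<noteq> 0"
  shows "continuous_on T (%z. nrm m (F z))"
proof (rule continuous_on_coordinatewise_then_product)
  fix i
  have "(\<Sum>j<Suc m. (F z j)\<^sup>2) > 0" if "z \<in> T" for z
  proof -
    obtain j where i: "F z j \<noteq> 0" using assms(3)[OF \<open>z \<in> T\<close>] by auto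
    then have "j \<in> {..<Suc m}" using assms(2)[OF that] by (metis lessThan_iff not_less_eq)
    then show ?thesis
      by (intro sum_pos2[of _ j]) (use i in auto)
  qed
  then show "continuous_on T (%z. nrm m (F z) i)"
    unfolding nrm_def
    by (intro continuous_on_divide continuous_on_real_sqrt continuous_on_sum continuous_on_power assms(1))
       (metis less_irrefl real_sqrt_eq_zero_cancel_iff)
qed

lemma degree_nrm_homotopy:
  fixes F :: "real => (nat => real) => nat => real"
  assumes cont: "!!i. continuous_on ({0..1} \<times> Sph (Suc m)) (%z. F (fst z) (snd z) i)"
    and tail: "!!t x. t \<in> {0..1} ==> x \<in> Sph (Suc m) ==> \<forall>i>m. F t x i = 0"
    and nz: "!!t x. t \<in> {0..1} ==> x \<in> Sph (Suc m) ==> \<exists>i. F t x i \<noteq> 0"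
  shows "Brouwer_degree2 m (%x. nrm m (F 0 x)) = Brouwer_degree2 m (%x. nrm m (F 1 x))"
proof (rule Brouwer_degree2_homotopic)
  define h where "h = (%z. nrm m (F (fst z) (snd z)))"
  have "continuous_on ({0..1} \<times> Sph (Suc m)) h" unfolding h_def
    by (intro continuous_on_nrm cont) (use tail nz in auto)
  moreover have "h ` ({0..1} \<times> Sph (Suc m)) \<subseteq> Sph (Suc m)" unfolding h_def
    using nrm_Sph tail nz by fastforce
  ultimately have "continuous_map (prod_topology (top_of_set {0..1}) (nsphere m)) (nsphere m) h"
    by (simp add: nsphere_eq_Sph image_subset_iff_funcset)
  then show "homotopic_with (%x. True) (nsphere m) (nsphere m) (%x. nrm m (F 0 x)) (%x. nrm m (F 1 x))"
    unfolding homotopic_with_def by (intro exI[of _ h]) (auto simp: h_def)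
qed

text \<open>Lipschitz functions on a compact set form an algebra that contains the coordinates, so
  Stone-Weierstrass applies to this algebra directly. The l1 distance is chosen because it is
  additive over coordinates.\<close>

lemma lipschitz_approx_Sph:
  fixes f :: "(nat => real) => real"
  assumes "continuous_on (Sph n) f" "e > 0"
  obtains g L where "continuous_on (Sph n) g" "L \<ge> 0" "!!x. x \<in> Sph n ==> \<bar>f x - g x\<bar> < e"
    "!!x y. x \<in> Sph n ==> y \<in> Sph n ==> \<bar>g x - g y\<bar> \<le> L * (\<Sum>j<n. \<bar>x j - y j\<bar>)"
proof -
  let ?D = "%x y. \<Sum>j<n. \<bar>x j - y j\<bar>"
  let ?R = "{g. continuous_on (Sph n) g \<and> (\<exists>L\<ge>0. \<forall>x\<in>Sph n. \<forall>y\<in>Sph n. \<bar>g x - g y\<bar> \<le> L * ?D x y)}"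
  interpret function_ring_on ?R "Sph n"
  proof
    show "compact (Sph n)" by (rule compact_Sph)
    show "continuous_on (Sph n) f" if "f \<in> ?R" for f using that by auto
    show "(%x. f x + g x) \<in> ?R" if fg: "f \<in> ?R" "g \<in> ?R" for f g
    proof -
      obtain L1 L2 where L: "L1 \<ge> 0" "L2 \<ge> 0" "\<forall>x\<in>Sph n. \<forall>y\<in>Sph n. \<bar>f x - f y\<bar> \<le> L1 * ?D x y"
        "\<forall>x\<in>Sph n. \<forall>y\<in>Sph n. \<bar>g x - g y\<bar> \<le> L2 * ?D x y"
        using fg by auto
      have "\<bar>(f x + g x) - (f y + g y)\<bar> \<le> (L1 + L2) * ?D x y" if "x \<in> Sph n" "y \<in> Sph n" for x y
        using L(3,4) that by (fastforce simp: algebra_simps abs_le_iff)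
      then show ?thesis using fg L(1,2)
        by (auto intro!: continuous_on_add exI[of _ "L1 + L2"])
    qed
    show "(%x. f x * g x) \<in> ?R" if fg: "f \<in> ?R" "g \<in> ?R" for f g
    proof -
      obtain L1 L2 where L: "L1 \<ge> 0" "L2 \<ge> 0" "\<forall>x\<in>Sph n. \<forall>y\<in>Sph n. \<bar>f x - f y\<bar> \<le> L1 * ?D x y"
        "\<forall>x\<in>Sph n. \<forall>y\<in>Sph n. \<bar>g x - g y\<bar> \<le> L2 * ?D x y"
        using fg by auto
      have "bounded (f ` Sph n)" "bounded (g ` Sph n)"
        using fg compact_Sph compact_continuous_image compact_imp_bounded by blast+
      then obtain B1 B2 where B: "\<forall>x\<in>Sph n. \<bar>f x\<bar> \<le> B1" "\<forall>x\<in>Sph n. \<bar>g x\<bar> \<le> B2"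
        unfolding bounded_iff by auto
      have "\<bar>f x * g x - f y * g y\<bar> \<le> (\<bar>B1\<bar> * L2 + \<bar>B2\<bar> * L1) * ?D x y" if "x \<in> Sph n" "y \<in> Sph n" for x y
      proof -
        have "f x * g x - f y * g y = f x * (g x - g y) + g y * (f x - f y)" by (simp add: algebra_simps)
        also have "\<bar>\<dots>\<bar> \<le> \<bar>f x\<bar> * \<bar>g x - g y\<bar> + \<bar>g y\<bar> * \<bar>f x - f y\<bar>"
          by (metis abs_mult abs_triangle_ineq)
        also have "\<dots> \<le> \<bar>B1\<bar> * (L2 * ?D x y) + \<bar>B2\<bar> * (L1 * ?D x y)"
          using L(3,4) B that by (intro add_mono mult_mono) (auto intro: order_trans[OF _ abs_ge_self])
        finally show ?thesis by (simp add: algebra_simps)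
      qed
      then show ?thesis using fg L(1,2)
        by (auto intro!: continuous_on_mult exI[of _ "\<bar>B1\<bar> * L2 + \<bar>B2\<bar> * L1"])
    qed
    show "(%_. c) \<in> ?R" for c by (auto intro!: exI[of _ 0])
    show "\<exists>f\<in>?R. f x \<noteq> f y" if xy: "x \<in> Sph n" "y \<in> Sph n" "x \<noteq> y" for x y
    proof -
      obtain i where i: "x i \<noteq> y i" using xy by auto
      then have "i < n" using xy by (metis (mono_tags, lifting) Sph_def linorder_not_less mem_Collect_eq)
      have "\<bar>u i - v i\<bar> \<le> 1 * (\<Sum>j<n. \<bar>u j - v j\<bar>)" for u v :: "nat => real"
        using member_le_sum[of i "{..<n}" "%j. \<bar>u j - v j\<bar>"] \<open>i < n\<close> by auto
      then have "(%x. x i) \<in> ?R" by (auto intro!: continuous_on_coord exI[of _ 1])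
      with i show ?thesis by (intro bexI[of _ "%x. x i"])
    qed
  qed
  obtain g where "g \<in> ?R" "\<forall>x\<in>Sph n. \<bar>f x - g x\<bar> < e"
    using Stone_Weierstrass_basic[OF assms] by auto
  then show thesis by (auto intro!: that)
qed

text \<open>A Lipschitz image of the (M-1)-sphere is met by fewer than all lines of M-dimensional projective
  space: compare the number of grid points with the number of grid cells meeting the sphere.\<close>

lemma lipschitz_Sph_misses_line:
  fixes G :: "(nat => real) => nat => real"
  assumes M: "M \<ge> 1" and L: "L \<ge> 0" and c: "c > 0"
    and lip: "!!x y i. x \<in> Sph M ==> y \<in> Sph M ==> i \<le> M ==> \<bar>G x i - G y i\<bar> \<le> L * (\<Sum>j<M. \<bar>x j - y j\<bar>)"
    and nz: "!!x. x \<in> Sph M ==> \<exists>i\<le>M. \<bar>G x i\<bar> \<ge> c"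
  shows "\<exists>z::nat => real. \<forall>x\<in>Sph M. \<exists>i<M. G x i \<noteq> z i * G x M"
proof (rule ccontr)
  assume "\<not> ?thesis"
  then have "\<forall>z::nat => real. \<exists>x\<in>Sph M. \<forall>i<M. G x i = z i * G x M" by blast
  then obtain X0 where X0: "!!z::nat => real. X0 z \<in> Sph M" "!!z i. i < M ==> G (X0 z) i = z i * G (X0 z) M"
    by metis
  \<comment> \<open>Lines are sampled with slopes \<open>w i / k\<close>, sphere points are recorded
    on a mesh of width 1/K with K = a k. The ratio a is fixed by L, c and M so that two points with
    the same code have slopes less than 1/k apart. Afterwards k is taken so large that k^M slopes
    outnumber the codes, which grow only like k^(M - 1).\<close>
  obtain a0 :: nat where a0: "real a0 > 4 * L * (real M)\<^sup>2 / c"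
    using reals_Archimedean2 by blast
  define a where "a = Suc a0"
  have a: "real a > 4 * L * (real M)\<^sup>2 / c" "a \<ge> 1" using a0 by (auto simp: a_def)
  define k :: nat where "k = 2 * M * (3 * a) ^ M + 1"
  define K :: nat where "K = a * k"
  have k: "k \<ge> 1" and K: "K \<ge> 1" using a by (auto simp: k_def K_def)
  define W where "W = PiE {..<M} (%_. {..<k})"
  define X where "X w = X0 (%i. real (w i) / real k)" for w
  define top where "top x = (SOME i. i < M \<and> \<bar>x i\<bar> \<ge> 1 / real M)" for x :: "nat => real"
  have top: "top x < M \<and> \<bar>x (top x)\<bar> \<ge> 1 / real M" if "x \<in> Sph M" for x
    unfolding top_def
  proof (rule someI_ex, rule ccontr)
    assume "\<nexists>i. i < M \<and> \<bar>x i\<bar> \<ge> 1 / real M"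
    then have *: "\<bar>x i\<bar> < 1 / real M" if "i < M" for i using that by (meson not_less)
    have "(x i)\<^sup>2 < 1 / real M" if "i < M" for i
    proof -
      have "(x i)\<^sup>2 \<le> \<bar>x i\<bar>" using Sph_abs_le[OF \<open>x \<in> Sph M\<close>, of i]
        by (metis abs_ge_zero mult_left_le power2_abs power2_eq_square)
      with *[OF that] show ?thesis by simp
    qed
    then have "(\<Sum>i<M. (x i)\<^sup>2) < (\<Sum>i<M. 1 / real M)"
      by (intro sum_strict_mono) (use M in \<open>auto simp: lessThan_empty_iff\<close>)
    with \<open>x \<in> Sph M\<close> M show False by (simp add: Sph_def)
  qed
  \<comment> \<open>One coordinate of modulus at least 1/M is left unrecorded, because the sphere
    equation recovers it up to the sign stored in \<open>code\<close>. This is what lowers the count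
    of codes to an (M - 1)-st power; the default 0 keeps that slot a singleton.\<close>
  define fl where "fl x = (\<lambda>j\<in>{..<M}. if j = top x then 0 else \<lfloor>real K * x j\<rfloor>)" for x :: "nat => real"
  define code where "code x = (top x, x (top x) > 0, fl x)" for x :: "nat => real"
  define C where "C = (SIGMA i:{..<M}. (UNIV::bool set) \<times> PiE {..<M} (%j. if j = i then {0::int} else {- int K..int K}))"
  have code_C: "code x \<in> C" if "x \<in> Sph M" for x
  proof -
    have "\<lfloor>real K * x j\<rfloor> \<in> {- int K..int K}" for j
    proof -
      have "- 1 \<le> x j" "x j \<le> 1" using Sph_abs_le[OF that, of j] by auto
      then have "- real K \<le> real K * x j" "real K * x j \<le> real K"
        by (metis mult.commute mult_left_mono mult_minus1 of_nat_0_le_iff mult.right_neutral)+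
      then show ?thesis by (simp add: le_floor_iff floor_le_iff)
    qed
    then show ?thesis using top[OF that] by (auto simp: C_def code_def fl_def)
  qed
  have inj: "inj_on (%w. code (X w)) W"
  proof (rule inj_onI)
    fix w w' assume w: "w \<in> W" "w' \<in> W" and eq: "code (X w) = code (X w')"
    let ?x = "X w" and ?y = "X w'"
    have S: "?x \<in> Sph M" "?y \<in> Sph M" unfolding X_def by (rule X0)+
    define i0 where "i0 = top ?x"
    have i0: "top ?y = i0" "i0 < M" "\<bar>?x i0\<bar> \<ge> 1 / real M" "\<bar>?y i0\<bar> \<ge> 1 / real M" "(?x i0 > 0) = (?y i0 > 0)"
      using eq top[OF S(1)] top[OF S(2)] by (auto simp: code_def i0_def)
    have near: "\<bar>?x j - ?y j\<bar> \<le> 1 / real K" if "j < M" "j \<noteq> i0" for j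
    proof -
      have "\<lfloor>real K * ?x j\<rfloor> = \<lfloor>real K * ?y j\<rfloor>"
        using eq that i0 by (auto simp: code_def fl_def i0_def fun_eq_iff split: if_splits)
      then have "\<bar>real K * ?x j - real K * ?y j\<bar> \<le> 1" by linarith
      then have "real K * \<bar>?x j - ?y j\<bar> \<le> 1" by (simp add: abs_mult flip: right_diff_distrib)
      then show ?thesis using K by (simp add: field_simps)
    qed
    \<comment> \<open>Both omitted coordinates have the same sign and modulus at least 1/M, so their
      sum is bounded away from zero and the difference of squares, known from the sphere equation,
      controls the difference.\<close>
    have near2: "\<bar>?x i0 - ?y i0\<bar> \<le> (real M)\<^sup>2 / real K"
    proof -
      have e1: "(\<Sum>j<M. (u j)\<^sup>2) = (u i0)\<^sup>2 + (\<Sum>j\<in>{..<M} - {i0}. (u j)\<^sup>2)" for u :: "nat => real"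
        using i0 by (simp add: sum.remove)
      have "(?x i0)\<^sup>2 - (?y i0)\<^sup>2 = (\<Sum>j\<in>{..<M} - {i0}. (?y j)\<^sup>2 - (?x j)\<^sup>2)"
        using S e1[of ?x] e1[of ?y] by (simp add: Sph_def sum_subtractf)
      also have "\<bar>\<dots>\<bar> \<le> (\<Sum>j\<in>{..<M} - {i0}. 2 / real K)"
      proof (rule order_trans[OF sum_abs sum_mono])
        fix j assume j: "j \<in> {..<M} - {i0}"
        have "(?y j)\<^sup>2 - (?x j)\<^sup>2 = (?y j - ?x j) * (?y j + ?x j)" by (simp add: power2_eq_square algebra_simps)
        moreover have "\<bar>?y j + ?x j\<bar> \<le> 2" using Sph_abs_le[OF S(1), of j] Sph_abs_le[OF S(2), of j] by linarith
        ultimately have "\<bar>(?y j)\<^sup>2 - (?x j)\<^sup>2\<bar> \<le> (1 / real K) * 2"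
          using near[of j] j by (simp only: abs_mult) (intro mult_mono, auto simp: abs_minus_commute)
        then show "\<bar>(?y j)\<^sup>2 - (?x j)\<^sup>2\<bar> \<le> 2 / real K" by simp
      qed
      also have "\<dots> \<le> 2 * real M / real K" using i0(2) by (simp add: divide_right_mono)
      finally have A: "\<bar>(?x i0)\<^sup>2 - (?y i0)\<^sup>2\<bar> \<le> 2 * real M / real K" .
      have "\<bar>?x i0 + ?y i0\<bar> \<ge> 2 / real M" using i0(3-5) by (auto simp: abs_if split: if_splits)
      then have "\<bar>?x i0 - ?y i0\<bar> * (2 / real M) \<le> \<bar>?x i0 - ?y i0\<bar> * \<bar>?x i0 + ?y i0\<bar>"
        by (intro mult_left_mono) auto
      also have "\<dots> = \<bar>(?x i0)\<^sup>2 - (?y i0)\<^sup>2\<bar>" by (simp add: power2_eq_square algebra_simps flip: abs_mult)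
      finally have "\<bar>?x i0 - ?y i0\<bar> * (2 / real M) \<le> 2 * real M / real K" using A by linarith
      then show ?thesis using M K by (simp add: field_simps power2_eq_square)
    qed
    have "(\<Sum>j<M. \<bar>?x j - ?y j\<bar>) = \<bar>?x i0 - ?y i0\<bar> + (\<Sum>j\<in>{..<M} - {i0}. \<bar>?x j - ?y j\<bar>)"
      using i0 by (simp add: sum.remove)
    also have "\<dots> \<le> (real M)\<^sup>2 / real K + (\<Sum>j\<in>{..<M} - {i0}. 1 / real K)"
      by (intro add_mono near2 sum_mono near) auto
    also have "\<dots> \<le> (real M)\<^sup>2 / real K + (real M)\<^sup>2 / real K"
    proof -
      have "real (card ({..<M} - {i0})) \<le> real M" by (metis card_Diff1_le card_lessThan of_nat_mono)
      also have "real M \<le> (real M)\<^sup>2" using M by (simp add: power2_eq_square)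
      finally show ?thesis using divide_right_mono[of "real (card ({..<M} - {i0}))" "(real M)\<^sup>2" "real K"] by simp
    qed
    finally have dist: "(\<Sum>j<M. \<bar>?x j - ?y j\<bar>) \<le> 2 * (real M)\<^sup>2 / real K" by simp
    define \<eta> where "\<eta> = L * (2 * (real M)\<^sup>2 / real K)"
    have Gn: "\<bar>G ?x i - G ?y i\<bar> \<le> \<eta>" if "i \<le> M" for i
      using lip[OF S that] dist L unfolding \<eta>_def by (meson mult_left_mono order_trans)
    have small: "2 * \<eta> / c < 1 / real k"
    proof -
      have "2 * \<eta> / c = (4 * L * (real M)\<^sup>2 / c) / real K" by (simp add: \<eta>_def mult.commute)
      also have "\<dots> < real a / real K" using a K by (intro divide_strict_right_mono) auto
      also have "\<dots> = 1 / real k" using a by (simp add: K_def)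
      finally show ?thesis .
    qed
    have Gx: "G ?x i = real (w i) / real k * G ?x M" and Gy: "G ?y i = real (w' i) / real k * G ?y M" if "i < M" for i
      unfolding X_def using X0(2)[OF that] by auto
    have w01: "real (v i) / real k \<le> 1" if "v \<in> W" "i < M" for v i
      using that k by (fastforce simp: W_def PiE_def Pi_def)
    \<comment> \<open>All sampled slopes lie in [0, 1], so the last coordinate of G dominates the
      others and inherits the lower bound c.\<close>
    have GM: "\<bar>G ?x M\<bar> \<ge> c"
    proof -
      obtain i where i: "i \<le> M" "\<bar>G ?x i\<bar> \<ge> c" using nz[OF S(1)] by auto
      show ?thesis
      proof (cases "i = M")
        case False
        then have "\<bar>G ?x i\<bar> = real (w i) / real k * \<bar>G ?x M\<bar>" using Gx[of i] i by (simp add: abs_mult)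
        also have "\<dots> \<le> 1 * \<bar>G ?x M\<bar>" using w01[OF w(1), of i] i False by (intro mult_right_mono) auto
        finally show ?thesis using i by simp
      qed (use i in auto)
    qed
    have "w i = w' i" if "i < M" for i
    proof -
      let ?z = "real (w i) / real k" and ?z' = "real (w' i) / real k"
      have eq: "(?z - ?z') * G ?x M = (G ?x i - G ?y i) - ?z' * (G ?x M - G ?y M)"
        using Gx[OF that] Gy[OF that] by (simp add: algebra_simps)
      have "\<bar>(?z - ?z') * G ?x M\<bar> \<le> \<bar>G ?x i - G ?y i\<bar> + ?z' * \<bar>G ?x M - G ?y M\<bar>"
        unfolding eq by (rule order_trans[OF abs_triangle_ineq4]) (simp add: abs_mult)
      also have "\<dots> \<le> \<eta> + 1 * \<eta>"
        using that w01[OF w(2) that] by (intro add_mono mult_mono Gn) auto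
      finally have "\<bar>?z - ?z'\<bar> * \<bar>G ?x M\<bar> \<le> 2 * \<eta>" by (simp add: abs_mult)
      moreover have "\<bar>?z - ?z'\<bar> * c \<le> \<bar>?z - ?z'\<bar> * \<bar>G ?x M\<bar>" using GM by (intro mult_left_mono) auto
      ultimately have "\<bar>?z - ?z'\<bar> * c \<le> 2 * \<eta>" by linarith
      then have "\<bar>?z - ?z'\<bar> \<le> 2 * \<eta> / c" using c by (simp add: field_simps)
      then have "\<bar>?z - ?z'\<bar> < 1 / real k" using small by linarith
      then have "\<bar>real (w i) - real (w' i)\<bar> / real k < 1 / real k"
        by (simp flip: diff_divide_distrib)
      then have "\<bar>real (w i) - real (w' i)\<bar> < 1" using k by (simp add: divide_less_cancel)
      then show ?thesis by linarith
    qed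
    then show "w = w'" using w unfolding W_def by (intro PiE_ext) auto
  qed
  have finC: "finite C" unfolding C_def by (intro finite_SigmaI finite_cartesian_product finite_PiE) auto
  \<comment> \<open>Injectivity of the code gives k^M \<le> 2 M (2 K + 1)^(M - 1), which is
    impossible for the chosen k.\<close>
  have "card W \<le> card C"
    by (rule card_inj_on_le[OF inj _ finC]) (use code_C X0(1) in \<open>auto simp: X_def\<close>)
  also have "card W = k ^ M" by (simp add: W_def card_PiE)
  also have "card C = (\<Sum>i<M. 2 * (2 * K + 1) ^ (M - 1))"
    unfolding C_def
  proof (subst card_SigmaI)
    show "(\<Sum>a<M. card ((UNIV::bool set) \<times> PiE {..<M} (%j. if j = a then {0::int} else {- int K..int K}))) =
      (\<Sum>i<M. 2 * (2 * K + 1) ^ (M - 1))"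
    proof (rule sum.cong[OF refl])
      fix a assume a: "a \<in> {..<M}"
      have "card (PiE {..<M} (%j. if j = a then {0::int} else {- int K..int K}))
        = (\<Prod>j<M. if j = a then 1 else 2 * K + 1)"
        by (subst card_PiE) (auto intro!: prod.cong)
      also have "\<dots> = (\<Prod>j\<in>{..<M} - {a}. 2 * K + 1)"
        using a by (subst prod.remove[of _ a]) (auto intro!: prod.cong)
      also have "\<dots> = (2 * K + 1) ^ (M - 1)" using a by simp
      finally show "card ((UNIV::bool set) \<times> PiE {..<M} (%j. if j = a then {0::int} else {- int K..int K})) = 2 * (2 * K + 1) ^ (M - 1)"
        by (simp add: card_cartesian_product)
    qed
  qed (auto intro!: finite_cartesian_product finite_PiE)
  also have "\<dots> = 2 * M * (2 * K + 1) ^ (M - 1)" by simp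
  also have "\<dots> \<le> 2 * M * (3 * a * k) ^ (M - 1)"
    using K by (intro mult_left_mono power_mono) (auto simp: K_def)
  also have "\<dots> = 2 * M * (3 * a) ^ (M - 1) * k ^ (M - 1)" by (simp add: power_mult_distrib)
  finally have "k * k ^ (M - 1) \<le> 2 * M * (3 * a) ^ (M - 1) * k ^ (M - 1)"
    using M by (metis power_eq_if not_one_le_zero)
  then have "k \<le> 2 * M * (3 * a) ^ (M - 1)" using k by simp
  also have "\<dots> \<le> 2 * M * (3 * a) ^ M" using a by (intro mult_left_mono power_increasing) auto
  finally show False by (simp add: k_def)
qed

lemma Sph_big_coord: assumes "x \<in> Sph n" shows "\<exists>i<n. \<bar>x i\<bar> \<ge> 1 / real n"
proof (rule ccontr)
  assume "\<not> ?thesis"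
  then have *: "\<bar>x i\<bar> < 1 / real n" if "i < n" for i using that by (meson not_less)
  have n: "n > 0" using assms by (cases n) (auto simp: Sph_def)
  have "(x i)\<^sup>2 < 1 / real n" if "i < n" for i
  proof -
    have "(x i)\<^sup>2 \<le> \<bar>x i\<bar>" using Sph_abs_le[OF assms, of i]
      by (metis abs_ge_zero mult_left_le power2_abs power2_eq_square)
    with *[OF that] show ?thesis by simp
  qed
  then have "(\<Sum>i<n. (x i)\<^sup>2) < (\<Sum>i<n. 1 / real n)"
    by (intro sum_strict_mono) (use n in \<open>auto simp: lessThan_empty_iff\<close>)
  with assms n show False by (simp add: Sph_def)
qed

lemma continuous_on_neg_fun: "continuous_on S (%x::nat => real. %i. - x i)"
  by (intro continuous_on_coordinatewise_then_product continuous_on_minus continuous_on_coord)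

lemma continuous_on_compose_snd:
  assumes "continuous_on S g" shows "continuous_on (T \<times> S) (%z. g (snd z))"
  by (rule continuous_on_compose2[OF assms continuous_on_snd[OF continuous_on_id]]) auto

text \<open>A Lipschitz approximation of f restricted to the equator misses a line; shearing that
  line to the last axis and then contracting the last coordinate near the equator makes f preserve
  the equator without changing its degree.\<close>

theorem odd_map_odd_degree:
  assumes "continuous_on (Sph (Suc m)) f" "f ` Sph (Suc m) \<subseteq> Sph (Suc m)"
    "!!x i. x \<in> Sph (Suc m) ==> f (%i. - x i) i = - f x i"
  shows "odd (Brouwer_degree2 m f)"
  using assms
proof (induction m arbitrary: f)
  case 0
  define e where "e = (%i::nat. if i = 0 then 1 else (0::real))"
  have Sph1: "x = e \<or> x = (%i. - e i)" if "x \<in> Sph (Suc 0)" for x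
    using that by (auto simp: Sph_def e_def fun_eq_iff power2_eq_1_iff)
  have e: "e \<in> Sph (Suc 0)" by (simp add: Sph_def e_def)
  then consider "f e = e" | "f e = (%i. - e i)" using 0(2) Sph1 by blast
  then show ?case
  proof cases
    case 1
    have "f x = id x" if "x \<in> Sph (Suc 0)" for x
      using Sph1[OF that] 1 0(3)[OF e] by (metis (no_types, lifting) ext id_apply)
    then have "Brouwer_degree2 0 f = Brouwer_degree2 0 id"
      by (intro Brouwer_degree2_eq) (auto simp: topspace_nsphere_Sph)
    then show ?thesis by simp
  next
    case 2
    have "f x = (%i. if i = 0 then - x i else x i)" if "x \<in> Sph (Suc 0)" for x
    proof -
      from Sph1[OF that] show ?thesis
      proof
        assume "x = (%i. - e i)"
        then show ?thesis using 0(3)[OF e] 2 by (intro ext) (simp add: e_def)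
      qed (use 2 in \<open>auto simp: e_def\<close>)
    qed
    then have "Brouwer_degree2 0 f = Brouwer_degree2 0 (%x i. if i = 0 then - x i else x i)"
      by (intro Brouwer_degree2_eq) (auto simp: topspace_nsphere_Sph)
    then show ?thesis by (simp add: Brouwer_degree2_reflection)
  qed
next
  case (Suc m)
  define M where "M = Suc m"
  let ?S = "Sph (Suc M)"
  have f: "continuous_on ?S f" "!!x. x \<in> ?S ==> f x \<in> ?S" "!!x i. x \<in> ?S ==> f (%i. - x i) i = - f x i"
    using Suc.prems by (auto simp: M_def)
  have fc: "continuous_on ?S (%x. f x i)" for i
    using continuous_on_product_then_coordinatewise[OF f(1)] .
  \<comment> \<open>A point of the sphere in M + 1 coordinates has a coordinate of modulus at least
    1/(M + 1) = 2 e, so no perturbation of size e reaches the origin.\<close>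
  define e where "e = 1 / (2 * real (Suc M))"
  have e: "e > 0" by (simp add: e_def)
  define P where "P i g L \<longleftrightarrow> continuous_on ?S g \<and> L \<ge> 0 \<and> (\<forall>x\<in>?S. \<bar>f x i - g x\<bar> < e) \<and>
    (\<forall>x\<in>?S. \<forall>y\<in>?S. \<bar>g x - g y\<bar> \<le> L * (\<Sum>j<Suc M. \<bar>x j - y j\<bar>))" for i g L
  have "\<forall>i. \<exists>g L. P i g L"
  proof
    fix i show "\<exists>g L. P i g L" unfolding P_def
      by (rule lipschitz_approx_Sph[OF fc[of i] e]) metis
  qed
  then obtain g L where P: "!!i. P i (g i) (L i)" by metis
  have g: "!!i. continuous_on ?S (g i)" "!!i. L i \<ge> 0"
    "!!i x. x \<in> ?S ==> \<bar>f x i - g i x\<bar> < e"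
    "!!i x y. x \<in> ?S ==> y \<in> ?S ==> \<bar>g i x - g i y\<bar> \<le> L i * (\<Sum>j<Suc M. \<bar>x j - y j\<bar>)"
    using P unfolding P_def by blast+
  \<comment> \<open>The odd part of the Lipschitz approximation: it is as close to the odd map f as
    the approximation itself, and oddness holds exactly.\<close>
  define G where "G x i = (if i \<le> M then (g i x - g i (%i. - x i)) / 2 else 0)" for x i
  have Gc: "continuous_on ?S (%x. G x i)" for i
  proof -
    have "continuous_on ?S (%x. g i (%i. - x i))"
      by (rule continuous_on_compose2[OF g(1) continuous_on_neg_fun]) (auto intro: Sph_uminus)
    then show ?thesis unfolding G_def
      by (cases "i \<le> M"; simp; intro continuous_intros g(1)) auto
  qed
  have aux: "\<bar>c - (a - b) / 2\<bar> < e" if "\<bar>c - a\<bar> < e" "\<bar>- c - b\<bar> < e" for a b c :: real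
  proof -
    have "c - a < e" "a - c < e" "- c - b < e" "c + b < e" using that by (auto simp: abs_less_iff)
    then show ?thesis unfolding abs_less_iff by (intro conjI; simp add: field_simps)
  qed
  have Gf: "\<bar>f x i - G x i\<bar> < e" if x: "x \<in> ?S" "i \<le> M" for x i
    using g(3)[OF x(1), of i] g(3)[OF Sph_uminus[OF x(1)], of i] f(3)[OF x(1), of i] x(2)
    by (simp add: G_def aux)
  have Godd: "G (%i. - x i) i = - G x i" for x i by (simp add: G_def minus_divide_left)
  have fbig: "\<exists>i\<le>M. \<bar>f x i\<bar> \<ge> 2 * e" if "x \<in> ?S" for x
  proof -
    have "2 * e = 1 / real (Suc M)" by (simp add: e_def field_simps)
    then show ?thesis using Sph_big_coord[OF f(2)[OF that]] by (auto simp: less_Suc_eq_le)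
  qed
  have Gbig: "\<exists>i\<le>M. \<bar>G x i\<bar> \<ge> e" if "x \<in> ?S" for x
  proof -
    obtain i where "i \<le> M" "\<bar>f x i\<bar> \<ge> 2 * e" using fbig[OF \<open>x \<in> ?S\<close>] by auto
    with Gf[OF \<open>x \<in> ?S\<close> this(1)] show ?thesis by (intro exI[of _ i]) linarith
  qed
  have eqS: "x \<in> ?S" if "x \<in> Sph M" for x using Sph_mono[OF _ that] by simp
  have "\<exists>z::nat => real. \<forall>x\<in>Sph M. \<exists>i<M. G x i \<noteq> z i * G x M"
  proof (rule lipschitz_Sph_misses_line[where L = "\<Sum>i\<le>M. L i" and c = e])
    fix x y i assume xy: "x \<in> Sph M" "y \<in> Sph M" "i \<le> M"
    let ?d = "\<Sum>j<M. \<bar>x j - y j\<bar>"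
    have d: "(\<Sum>j<Suc M. \<bar>u j - v j\<bar>) = (\<Sum>j<M. \<bar>u j - v j\<bar>)" if "u \<in> Sph M" "v \<in> Sph M" for u v
      using that by (simp add: Sph_def)
    have "\<bar>G x i - G y i\<bar> \<le> (\<bar>g i x - g i y\<bar> + \<bar>g i (%i. - x i) - g i (%i. - y i)\<bar>) / 2"
    proof -
      have "G x i = (g i x - g i (%i. - x i)) / 2" "G y i = (g i y - g i (%i. - y i)) / 2"
        using xy(3) by (simp_all add: G_def)
      then have "\<bar>G x i - G y i\<bar> = \<bar>((g i x - g i y) - (g i (%i. - x i) - g i (%i. - y i))) / 2\<bar>" by (simp add: diff_divide_distrib)
      then show ?thesis
        using abs_triangle_ineq4[of "g i x - g i y" "g i (%i. - x i) - g i (%i. - y i)"] by (simp only: abs_divide) simp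
    qed
    also have "\<dots> \<le> (L i * ?d + L i * ?d) / 2"
    proof -
      have "(\<Sum>j<Suc M. \<bar>- x j - - y j\<bar>) = ?d"
        using d[OF Sph_uminus Sph_uminus, OF xy(1,2)] by (simp add: abs_minus_commute)
      then show ?thesis
        using g(4)[OF eqS eqS, OF xy(1,2), of i] g(4)[OF eqS[OF Sph_uminus] eqS[OF Sph_uminus], OF xy(1,2), of i]
        unfolding d[OF xy(1,2)] by (intro divide_right_mono add_mono) simp_all
    qed
    also have "\<dots> = L i * ?d" by simp
    also have "\<dots> \<le> (\<Sum>i\<le>M. L i) * ?d"
      using xy(3) g(2) by (intro mult_right_mono member_le_sum sum_nonneg) auto
    finally show "\<bar>G x i - G y i\<bar> \<le> (\<Sum>i\<le>M. L i) * ?d" .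
  qed (use Gbig eqS e g(2) in \<open>auto simp: M_def intro!: add_nonneg_nonneg sum_nonneg\<close>)
  then obtain z :: "nat => real" where z: "!!x. x \<in> Sph M ==> \<exists>i<M. G x i \<noteq> z i * G x M" by blast
  define F1 where "F1 t x = (%i. (1 - t) * f x i + t * G x i)" for t x
  define F2 where "F2 t x = (%i. G x i - t * (if i < M then z i * G x M else 0))" for t x
  \<comment> \<open>The factor \<open>\<bar>x M\<bar>\<close> is even, so the end map stays odd, and
    it vanishes only on the equator. There the sheared coordinates below M do not all vanish, by the
    choice of z, so the homotopy never meets the origin.\<close>
  define F3 where "F3 t x = (%i. if i = M then (1 - t + t * \<bar>x M\<bar>) * G x M else F2 1 x i)" for t x
  have c1: "continuous_on ({0..1} \<times> ?S) (%z. F1 (fst z) (snd z) i)" for i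
    unfolding F1_def by (intro continuous_intros continuous_on_compose_snd fc Gc)
  have c2: "continuous_on (T \<times> ?S) (%z. F2 (fst z) (snd z) i)" for T i
    unfolding F2_def by (cases "i < M"; simp; intro continuous_intros continuous_on_compose_snd Gc)
  have c2': "continuous_on (T \<times> ?S) (%z. F2 1 (snd z) i)" for T :: "real set" and i
    unfolding F2_def by (cases "i < M"; simp; intro continuous_intros continuous_on_compose_snd Gc)
  have c3: "continuous_on ({0..1} \<times> ?S) (%z. F3 (fst z) (snd z) i)" for i
    unfolding F3_def
    by (cases "i = M"; simp add: c2'; intro continuous_intros continuous_on_compose_snd Gc continuous_on_coord)
  have f0: "f x i = 0" if "x \<in> ?S" "i > M" for x i using f(2)[OF that(1)] that(2) by (simp add: Sph_def)
  have t1: "\<forall>i>M. F1 t x i = 0" if "x \<in> ?S" for t x using f0[OF that] by (simp add: F1_def G_def)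
  have t2: "\<forall>i>M. F2 t x i = 0" for t x by (simp add: F2_def G_def)
  have t3: "\<forall>i>M. F3 t x i = 0" for t x using t2 by (simp add: F3_def)
  have n1: "\<exists>i. F1 t x i \<noteq> 0" if t: "t \<in> {0..1}" and x: "x \<in> ?S" for t x
  proof -
    obtain i where i: "i \<le> M" "\<bar>f x i\<bar> \<ge> 2 * e" using fbig[OF x] by auto
    have "F1 t x i = f x i - t * (f x i - G x i)" by (simp add: F1_def algebra_simps)
    moreover have "\<bar>t * (f x i - G x i)\<bar> \<le> 1 * e"
      using t Gf[OF x i(1)] unfolding abs_mult by (intro mult_mono) auto
    ultimately show ?thesis using i e by (intro exI[of _ i]) linarith
  qed
  have n2: "\<exists>i. F2 t x i \<noteq> 0" if x: "x \<in> ?S" for t x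
  proof (rule ccontr)
    assume "\<not> ?thesis"
    then have 0: "F2 t x i = 0" for i by blast
    from 0[of M] have "G x M = 0" by (simp add: F2_def)
    then have "G x i = 0" for i using 0[of i] by (auto simp: F2_def)
    with Gbig[OF x] e show False by auto
  qed
  have n3: "\<exists>i. F3 t x i \<noteq> 0" if t: "t \<in> {0..1}" and x: "x \<in> ?S" for t x
  proof (cases "x M = 0")
    case True
    then have "x \<in> Sph M" using x unfolding Sph_def by (auto simp: le_Suc_eq not_less_eq_eq Suc_le_eq) (metis le_neq_implies_less)
    then obtain i where "i < M" "G x i \<noteq> z i * G x M" using z by blast
    then show ?thesis by (intro exI[of _ i]) (auto simp: F3_def F2_def)
  next
    case False
    obtain i where i: "F2 1 x i \<noteq> 0" using n2[OF x] by blast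
    have pos: "1 - t + t * \<bar>x M\<bar> > 0"
    proof (cases "t = 1")
      case False2: False
      then have "1 - t > 0" "t * \<bar>x M\<bar> \<ge> 0" using t by auto
      then show ?thesis by linarith
    qed (use False in auto)
    show ?thesis
    proof (cases "i = M")
      case True
      then have "G x M \<noteq> 0" using i by (simp add: F2_def)
      then show ?thesis using pos by (intro exI[of _ M]) (auto simp: F3_def)
    qed (use i in \<open>auto simp: F3_def intro!: exI[of _ i]\<close>)
  qed
  have d1: "Brouwer_degree2 M (%x. nrm M (F1 0 x)) = Brouwer_degree2 M (%x. nrm M (F1 1 x))"
    by (rule degree_nrm_homotopy) (use c1 t1 n1 in auto)
  have d2: "Brouwer_degree2 M (%x. nrm M (F2 0 x)) = Brouwer_degree2 M (%x. nrm M (F2 1 x))"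
    by (rule degree_nrm_homotopy) (use c2 t2 n2 in auto)
  have d3: "Brouwer_degree2 M (%x. nrm M (F3 0 x)) = Brouwer_degree2 M (%x. nrm M (F3 1 x))"
    by (rule degree_nrm_homotopy) (use c3 t3 n3 in auto)
  have e1: "F1 1 x = F2 0 x" for x by (simp add: F1_def F2_def)
  have e2: "F3 0 x = F2 1 x" for x by (auto simp: F3_def F2_def fun_eq_iff)
  have d0: "Brouwer_degree2 M (%x. nrm M (F1 0 x)) = Brouwer_degree2 M f"
    by (rule Brouwer_degree2_eq) (use f(2) nrm_id in \<open>auto simp: topspace_nsphere_Sph F1_def\<close>)
  define h where "h x = nrm M (F3 1 x)" for x
  have hdeg: "Brouwer_degree2 M h = Brouwer_degree2 M f"
    using d0 d1 d2 d3 by (simp add: e1 e2 h_def[abs_def])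
  have hc: "continuous_on ?S h" unfolding h_def
  proof (rule continuous_on_nrm)
    show "continuous_on ?S (%x. F3 1 x i)" for i
    proof -
      have "continuous_on ?S (%x. (1::real, x))" by (intro continuous_intros)
      from continuous_on_compose2[OF c3[of i] this] show ?thesis by (auto simp: image_subset_iff)
    qed
  qed (use t3 n3 in auto)
  have hS: "h x \<in> ?S" if "x \<in> ?S" for x
    unfolding h_def by (rule nrm_Sph) (use t3 n3 that in auto)
  have hodd: "h (%i. - x i) i = - h x i" if "x \<in> ?S" for x i
  proof -
    have "F3 1 (%i. - x i) i = - F3 1 x i" for i
      by (simp add: F3_def F2_def Godd algebra_simps)
    then show ?thesis by (simp add: h_def nrm_def)
  qed
  have heq: "h x \<in> Sph M" if x: "x \<in> Sph M" for x
  proof -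
    have "x M = 0" using x by (simp add: Sph_def)
    then have 0: "h x M = 0" by (simp add: h_def nrm_def F3_def)
    with hS[OF eqS[OF x]] show ?thesis
      unfolding Sph_def by (auto simp: not_less_eq_eq Suc_le_eq) (metis le_neq_implies_less)
  qed
  \<comment> \<open>Once h is odd and preserves the equator, its degree has the parity of the degree
    of its restriction to the equator; the induction hypothesis applies to that restriction.\<close>
  have "even (Brouwer_degree2 M h - Brouwer_degree2 (M - Suc 0) h)"
  proof (rule Borsuk_odd_mapping_degree_step)
    show "continuous_map (nsphere M) (nsphere M) h"
      using hc hS by (auto simp: nsphere_eq_Sph)
    show "(h \<circ> (%x i. - x i)) u = ((%x i. - x i) \<circ> h) u" if "u \<in> topspace (nsphere M)" for u
      using hodd that by (auto simp: topspace_nsphere_Sph)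
    show "h \<in> topspace (nsphere (M - Suc 0)) \<rightarrow> topspace (nsphere (M - Suc 0))"
      using heq by (auto simp: topspace_nsphere_Sph M_def)
  qed
  moreover have "odd (Brouwer_degree2 m h)"
  proof (rule Suc.IH)
    show "continuous_on (Sph (Suc m)) h" by (rule continuous_on_subset[OF hc]) (use eqS in \<open>auto simp: M_def\<close>)
    show "h ` Sph (Suc m) \<subseteq> Sph (Suc m)" using heq by (auto simp: M_def)
    show "h (%i. - x i) i = - h x i" if "x \<in> Sph (Suc m)" for x i
      by (rule hodd) (use eqS that in \<open>auto simp: M_def\<close>)
  qed
  ultimately show ?case using hdeg by (auto simp: M_def)
qed

text \<open>Without a common zero the family normalises to an odd map into the equator. Its degree
  is odd because the map is odd, and zero because the pole is missed.\<close>

theorem Borsuk_Ulam: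
  assumes cont: "!!i. i < n ==> continuous_on (Sph (Suc n)) (%x. f x i)"
    and odd: "!!x i. x \<in> Sph (Suc n) ==> i < n ==> f (%i. - x i) i = - f x i"
  shows "\<exists>x\<in>Sph (Suc n). \<forall>i<n. f x i = (0::real)"
proof (rule ccontr)
  assume neg: "\<not> ?thesis"
  let ?F = "%x i. if i < n then f x i else 0"
  define h where "h x = nrm n (?F x)" for x
  have nz: "\<exists>i. ?F x i \<noteq> 0" if "x \<in> Sph (Suc n)" for x using neg that by auto
  have hc: "continuous_on (Sph (Suc n)) h" unfolding h_def
  proof (rule continuous_on_nrm)
    show "continuous_on (Sph (Suc n)) (%x. ?F x i)" for i
      by (cases "i < n") (simp_all add: cont)
  qed (use nz in auto)
  have hS: "h x \<in> Sph (Suc n)" if "x \<in> Sph (Suc n)" for x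
    unfolding h_def by (rule nrm_Sph) (use nz that in auto)
  have hodd: "h (%i. - x i) i = - h x i" if "x \<in> Sph (Suc n)" for x i
    using odd[OF that] by (simp add: h_def nrm_def)
  have "odd (Brouwer_degree2 n h)"
    by (rule odd_map_odd_degree) (use hc hS hodd in auto)
  moreover have "Brouwer_degree2 n h = 0"
  proof (rule Brouwer_degree2_nonsurjective)
    show "continuous_map (nsphere n) (nsphere n) h"
      using hc hS by (auto simp: nsphere_eq_Sph)
    let ?e = "%i. if i = n then 1 else (0::real)"
    have "?e \<in> Sph (Suc n)" by (simp add: Sph_def)
    moreover have "h x \<noteq> ?e" for x by (auto simp: h_def nrm_def fun_eq_iff intro!: exI[of _ n])
    ultimately show "h ` topspace (nsphere n) \<noteq> topspace (nsphere n)"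
      unfolding topspace_nsphere_Sph by (metis image_iff)
  qed
  ultimately show False by simp
qed

section \<open>A finite-dimensional minimax principle\<close>

text \<open>Were there no critical value in [a,b], an iterated Euler step of gradient ascent would push
  the set {g >= a} above level b by an odd map; Borsuk-Ulam then produces a point of the first k-dimensional
  coordinate subspace above level b.\<close>

theorem finite_dim_critical_point:
  fixes g :: "(nat => real) => real" and D :: "(nat => real) => nat => real"
    and lam :: "nat => (nat => real) => real"
  defines "V n \<equiv> {y::nat => real. \<forall>i\<ge>n. y i = 0}"
  assumes k: "1 \<le> k" "k \<le> n" and ab: "a \<le> b"
    and even: "!!y. y \<in> V n ==> g (%i. - y i) = g y"
    and contg: "continuous_on (V n) g"
    and contD: "!!i. i < n ==> continuous_on (V n) (%y. D y i)"
    and deriv: "!!y v s. y \<in> V n ==> v \<in> V n ==>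
      ((%s. g (%i. y i + s * v i)) has_real_derivative (\<Sum>i<n. v i * D (%i. y i + s * v i) i)) (at s)"
    and bnd: "!!y i. y \<in> V n ==> a \<le> g y ==> \<bar>y i\<bar> \<le> R"
    and up: "!!y. y \<in> V k ==> g y \<le> b"
    and \<sigma>: "continuous_on (Sph n) \<sigma>" "!!x. x \<in> Sph n ==> \<sigma> x \<in> V n"
      "!!x. x \<in> Sph n ==> \<sigma> (%i. - x i) = (%i. - \<sigma> x i)"
    and lam: "!!j. j < k - 1 ==> continuous_on (Sph n) (lam j)"
      "!!j x. j < k - 1 ==> x \<in> Sph n ==> lam j (%i. - x i) = - lam j x"
    and low: "!!x. x \<in> Sph n ==> (\<forall>j<k - 1. lam j x = 0) ==> a \<le> g (\<sigma> x)"
  shows "\<exists>y\<in>V n. a \<le> g y \<and> g y \<le> b \<and> (\<forall>i<n. D y i = 0)"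
proof (rule ccontr)
  assume neg: "\<not> ?thesis"
  define D0 where "D0 y = (%i. if i < n then D y i else 0)" for y
  have D0V: "D0 y \<in> V n" for y by (simp add: D0_def V_def)
  have line_V: "(%i. y i + s * v i) \<in> V n" if "y \<in> V n" "v \<in> V n" for y v s using that by (simp add: V_def)
  have neg_V: "(%i. - y i) \<in> V n" if "y \<in> V n" for y using that by (simp add: V_def)
  \<comment> \<open>Evenness of g determines the parity of its gradient: the derivatives along the
    coordinate lines through y and through -y are compared by uniqueness.\<close>
  have Dodd: "D0 (%i. - y i) = (%i. - D0 y i)" if y: "y \<in> V n" for y
  proof
    fix i
    show "D0 (%i. - y i) i = - D0 y i"
    proof (cases "i < n")
      case True
      define v where "v = (%j. if j = i then 1 else (0::real))"
      have v: "v \<in> V n" using True by (auto simp: V_def v_def)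
      have sv: "(\<Sum>j<n. v j * E j) = E i" for E :: "nat => real"
        using True by (simp add: v_def if_distrib[of "%x. x * _"] sum.delta cong: if_cong)
      have 1: "((%s. g (%i. y i + s * v i)) has_real_derivative D y i) (at 0)"
        using deriv[OF y v, of 0] by (simp add: sv)
      have 2: "((%s. g (%i. - y i + s * v i)) has_real_derivative D (%i. - y i) i) (at 0)"
        using deriv[OF neg_V[OF y] v, of 0] by (simp add: sv)
      have "g (%i. - y i + s * v i) = g (%i. y i + (- s) * v i)" for s
        using even[OF line_V[OF y v], of "- s"] by (simp add: algebra_simps)
      then have 3: "((%s. g (%i. y i + (- s) * v i)) has_real_derivative D (%i. - y i) i) (at 0)"
        using 2 by simp
      have "((%s. g (%i. y i + (- s) * v i)) has_real_derivative D y i * (- 1)) (at 0)"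
        by (rule DERIV_chain'[where f = "%s::real. - s" and g = "%s. g (%i. y i + s * v i)"])
           (use 1 in \<open>auto intro!: derivative_eq_intros\<close>)
      from DERIV_unique[OF 3 this] show ?thesis using True by (simp add: D0_def)
    qed (simp add: D0_def)
  qed
  have closedV: "closed (V n)" unfolding V_def by (rule closed_tail_zero)
  define K where "K = {y \<in> V n. a \<le> g y}"
  have "closed K"
  proof -
    have "K = V n \<inter> g -` {a..}" by (auto simp: K_def)
    then show ?thesis using continuous_closed_preimage[OF contg closedV] by simp
  qed
  moreover have "K = {y. \<forall>i. \<bar>y i\<bar> \<le> R} \<inter> K" using bnd by (auto simp: K_def)
  ultimately have K: "compact K" by (metis compact_Int_closed[OF compact_box_fun])
  have KV: "K \<subseteq> V n" by (auto simp: K_def)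
  have D0c: "continuous_on (V n) (%y. D0 y i)" for i
    unfolding D0_def by (cases "i < n") (simp_all add: contD)
  define q where "q y = (\<Sum>i<n. (D y i)\<^sup>2)" for y
  have qc: "continuous_on K q" unfolding q_def
    by (intro continuous_intros continuous_on_subset[OF contD KV]) auto
  \<comment> \<open>Without critical points at levels in [a, b], every point of the compact set K
    either lies above b or has nonzero gradient. The sum of the two quantities is continuous and
    positive, hence bounded below.\<close>
  have "\<exists>m>0. \<forall>y\<in>K. m \<le> max (g y - b) 0 + q y"
  proof (cases "K = {}")
    case False
    have "continuous_on K (%y. max (g y - b) 0 + q y)"
      by (intro continuous_intros qc continuous_on_subset[OF contg KV])
    from continuous_attains_inf[OF K False this] obtain y0 where
      y0: "y0 \<in> K" "\<forall>y\<in>K. max (g y0 - b) 0 + q y0 \<le> max (g y - b) 0 + q y" by blast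
    have "q y0 \<ge> 0" by (simp add: q_def sum_nonneg)
    moreover have "q y0 > 0" if "g y0 \<le> b"
    proof -
      obtain i where "i < n" "D y0 i \<noteq> 0" using neg \<open>g y0 \<le> b\<close> y0(1) unfolding K_def by blast
      then show ?thesis unfolding q_def by (intro sum_pos2[of _ i]) auto
    qed
    ultimately have "max (g y0 - b) 0 + q y0 > 0" by (auto simp: max_def not_le)
    then show ?thesis using y0(2) by blast
  qed (auto intro: exI[of _ 1])
  then obtain m where m: "m > 0" "!!y. y \<in> K ==> m \<le> max (g y - b) 0 + q y" by blast
  \<comment> \<open>\<open>W (y, t)\<close> is the derivative of g along the direction
    \<open>D0 y\<close>, taken at the point reached after time t. At t = 0 it is the squared length
    of the gradient.\<close>
  define W where "W z = (\<Sum>i<n. D0 (fst z) i * D0 (%i. fst z i + snd z * D0 (fst z) i) i)" for z :: "(nat => real) \<times> real"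
  have Wc: "continuous_on (K \<times> {0..1}) W"
  proof -
    have f: "continuous_on (K \<times> {0..1::real}) (%z. D0 (fst z) i)" for i
      by (rule continuous_on_compose2[OF D0c continuous_on_fst[OF continuous_on_id]]) (use KV in auto)
    have fi: "continuous_on (K \<times> {0..1::real}) (%z. fst z i)" for i
      by (rule continuous_on_compose2[OF continuous_on_coord[of UNIV] continuous_on_fst[OF continuous_on_id]]) auto
    have s: "continuous_on (K \<times> {0..1}) (%z. (%i. fst z i + snd z * D0 (fst z) i))"
      by (intro continuous_on_coordinatewise_then_product continuous_intros f fi)
    have "continuous_on (K \<times> {0..1}) (%z. D0 (%i. fst z i + snd z * D0 (fst z) i) i)" for i
      by (rule continuous_on_compose2[OF D0c s]) (use KV line_V D0V in auto)
    then show ?thesis unfolding W_def by (intro continuous_intros f)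
  qed
  have Kc: "compact (K \<times> {0..1::real})" by (intro compact_Times K) simp
  have "bounded (W ` (K \<times> {0..1}))" by (rule compact_imp_bounded[OF compact_continuous_image[OF Wc Kc]])
  then obtain B where B: "B > 0" "!!y t. y \<in> K ==> 0 \<le> t ==> t \<le> 1 ==> \<bar>W (y, t)\<bar> \<le> B"
    unfolding bounded_pos by force
  obtain d where d: "d > 0" "!!z z'. z \<in> K \<times> {0..1} ==> z' \<in> K \<times> {0..1} ==> dist z' z < d ==> dist (W z') (W z) < m / 4"
    using compact_uniformly_continuous[OF Wc Kc] m(1) unfolding uniformly_continuous_on_def
    by (metis divide_pos_pos zero_less_numeral)
  \<comment> \<open>Three demands on the Euler step: it stays in the unit interval on which W is
    bounded, it is short enough for W to change by less than m/4, and it never lowers g by more than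
    m/2.\<close>
  define s where "s = min (min 1 (d / 2)) (m / (2 * B))"
  have s: "s > 0" "s \<le> 1" "s < d" "s * B \<le> m / 2"
  proof -
    show "s > 0" "s \<le> 1" using d(1) m(1) B(1) by (auto simp: s_def)
    have "s \<le> d / 2" by (simp add: s_def)
    then show "s < d" using d(1) by simp
    have "s \<le> m / (2 * B)" by (simp add: s_def)
    then show "s * B \<le> m / 2" using B(1) by (simp add: field_simps)
  qed
  define h where "h y = (%i. y i + s * D0 y i)" for y
  have hV: "h y \<in> V n" if "y \<in> V n" for y unfolding h_def by (rule line_V[OF that D0V])
  have hodd: "h (%i. - y i) = (%i. - h y i)" if "y \<in> V n" for y by (simp add: h_def Dodd[OF that])
  have hc: "continuous_on (V n) h" unfolding h_def
    by (intro continuous_on_coordinatewise_then_product continuous_intros D0c continuous_on_coord)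
  have gain: "\<exists>t. 0 < t \<and> t < s \<and> g (h y) - g y = s * W (y, t)" if y: "y \<in> V n" for y
  proof -
    have "\<exists>z>0. z < s \<and> g (%i. y i + s * D0 y i) - g (%i. y i + 0 * D0 y i)
        = (s - 0) * (\<Sum>i<n. D0 y i * D (%i. y i + z * D0 y i) i)"
      by (rule MVT2[OF s(1)]) (rule deriv[OF y D0V])
    then obtain z where z: "z > 0" "z < s" "g (%i. y i + s * D0 y i) - g (%i. y i + 0 * D0 y i)
        = (s - 0) * (\<Sum>i<n. D0 y i * D (%i. y i + z * D0 y i) i)" by blast
    have "W (y, z) = (\<Sum>i<n. D0 y i * D (%i. y i + z * D0 y i) i)"
      unfolding W_def fst_conv snd_conv by (intro sum.cong) (auto simp: D0_def)
    then show ?thesis using z by (intro exI[of _ z]) (simp add: h_def)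
  qed
  \<comment> \<open>Up to level b + m/2 the gradient term supplies at least m/2, so the step gains
    height. Above that level it may lose height, but not enough to fall back to b.\<close>
  have step: "(b < g y --> b < g (h y)) \<and> (g y \<le> b --> g y + s * (m / 4) \<le> g (h y))" if y: "y \<in> K" for y
  proof -
    obtain t where t: "0 < t" "t < s" "g (h y) - g y = s * W (y, t)" using gain y KV by blast
    have W0: "W (y, 0) = q y" by (simp add: W_def q_def D0_def power2_eq_square)
    have "dist (W (y, t)) (W (y, 0)) < m / 4"
      by (rule d(2)) (use y t s in \<open>auto simp: dist_Pair_Pair\<close>)
    then have Wq: "W (y, t) > q y - m / 4" using W0 using abs_ge_minus_self[of "W (y, t) - q y"] unfolding dist_real_def by linarith
    show ?thesis
    proof (cases "g y \<le> b + m / 2")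
      case True
      have "max (g y - b) 0 \<le> m / 2" using True m(1) by (simp add: max_def)
      then have "q y \<ge> m / 2" using m(2)[OF y] by linarith
      then have "W (y, t) \<ge> m / 4" using Wq by linarith
      then have "s * W (y, t) \<ge> s * (m / 4)" using s(1) by (intro mult_left_mono) auto
      moreover have "s * (m / 4) > 0" using s(1) m(1) by simp
      ultimately show ?thesis using t(3) by linarith
    next
      case False
      have "\<bar>W (y, t)\<bar> \<le> B" by (rule B(2)[OF y]) (use t s in auto)
      then have "s * W (y, t) \<ge> - (s * B)" using s(1) by (metis abs_le_D2 minus_le_iff mult_left_mono mult_minus_right less_imp_le)
      then show ?thesis using t(3) s(4) False m(1) by linarith
    qed
  qed
  have iter: "(h ^^ j) y \<in> K \<and> (b < g ((h ^^ j) y) \<or> a + real j * (s * (m / 4)) \<le> g ((h ^^ j) y))" if y: "y \<in> K" for j y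
  proof (induction j)
    case (Suc j)
    let ?y = "(h ^^ j) y"
    have yK: "?y \<in> K" using Suc.IH by blast
    have pos: "s * (m / 4) > 0" using s(1) m(1) by simp
    have "h ?y \<in> V n" using hV yK KV by blast
    show ?case
    proof (cases "b < g ?y")
      case True
      then have "b < g (h ?y)" using step[OF yK] by blast
      then show ?thesis using \<open>h ?y \<in> V n\<close> ab by (auto simp: K_def)
    next
      case False
      then have "g ?y + s * (m / 4) \<le> g (h ?y)" using step[OF yK] by auto
      moreover have "a + real j * (s * (m / 4)) \<le> g ?y" using Suc.IH False by blast
      ultimately have 1: "a + real (Suc j) * (s * (m / 4)) \<le> g (h ?y)" by (simp add: field_simps)
      have "a \<le> a + real (Suc j) * (s * (m / 4))" using pos by simp
      then have "a \<le> g (h ?y)" using 1 by linarith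
      then show ?thesis using 1 \<open>h ?y \<in> V n\<close> by (auto simp: K_def)
    qed
  qed (use y in \<open>auto simp: K_def\<close>)
  obtain j :: nat where j: "real j * (s * (m / 4)) > b - a"
    using reals_Archimedean3[of "s * (m / 4)"] s(1) m(1) by (metis divide_pos_pos mult_pos_pos zero_less_numeral)
  have high: "b < g ((h ^^ j) y)" if "y \<in> K" for y
    using iter[OF that, of j] j by linarith
  have jV: "(h ^^ i) y \<in> V n" if "y \<in> V n" for i y by (induction i) (use that hV in auto)
  have jodd: "(h ^^ i) (%i. - y i) = (%l. - (h ^^ i) y l)" if "y \<in> V n" for i y
    by (induction i) (use that hodd jV in auto)
  have jc: "continuous_on (Sph n) (%x. (h ^^ i) (\<sigma> x))" for i
  proof (induction i)
    case (Suc i)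
    have "continuous_on (Sph n) (%x. h ((h ^^ i) (\<sigma> x)))"
      by (rule continuous_on_compose2[OF hc Suc]) (use jV \<sigma>(2) in auto)
    then show ?case by simp
  qed (use \<sigma>(1) in simp)
  \<comment> \<open>The n - 1 odd functions are the k - 1 constraints followed by the coordinates k,
    ..., n - 1 of the flowed point; the shift \<open>Suc i\<close> starts the latter at k when i = k
    - 1. A common zero satisfies the constraints and flows into \<open>V k\<close>.\<close>
  let ?G = "%i x. if i < k - 1 then lam i x else (h ^^ j) (\<sigma> x) (Suc i)"
  have n1: "Suc (n - 1) = n" using k by simp
  have "\<exists>x\<in>Sph (Suc (n - 1)). \<forall>i<n - 1. ?G i x = 0"
  proof (rule Borsuk_Ulam)
    show "continuous_on (Sph (Suc (n - 1))) (%x. if i < k - 1 then lam i x else (h ^^ j) (\<sigma> x) (Suc i))" for i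
      unfolding n1 using lam(1)[of i] continuous_on_product_then_coordinatewise[OF jc, of j "Suc i"] by (cases "i < k - 1") simp_all
    show "(if i < k - 1 then lam i (%i. - x i) else (h ^^ j) (\<sigma> (%i. - x i)) (Suc i))
        = - ?G i x" if "x \<in> Sph (Suc (n - 1))" for x i
      using that[unfolded n1] lam(2)[of i x] \<sigma>(2,3) jodd by simp
  qed
  then obtain x where x: "x \<in> Sph n" "!!i. i < n - 1 ==> ?G i x = 0"
    unfolding n1 by blast
  have "lam i x = 0" if "i < k - 1" for i
    using x(2)[of i] that k by simp
  then have "\<sigma> x \<in> K" using low[OF x(1)] \<sigma>(2)[OF x(1)] by (simp add: K_def)
  then have "b < g ((h ^^ j) (\<sigma> x))" by (rule high)
  moreover have "(h ^^ j) (\<sigma> x) \<in> V k"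
  proof -
    have "(h ^^ j) (\<sigma> x) i = 0" if "i \<ge> k" for i
    proof (cases "i < n")
      case True
      then have "i - 1 < n - 1" "\<not> i - 1 < k - 1" "Suc (i - 1) = i" using \<open>k \<le> i\<close> k by linarith+
      then show ?thesis using x(2)[of "i - 1"] by metis
    next
      case False
      then show ?thesis using jV[OF \<sigma>(2)[OF x(1)], of j] by (simp add: V_def)
    qed
    then show ?thesis by (simp add: V_def)
  qed
  ultimately show False using up by (meson not_less)
qed

section \<open>Modular spaces with variable exponent\<close>

text \<open>Borel-Cantelli in integral form: summable integrals give an almost everywhere finite
  sum, hence almost everywhere convergence of the quantities summed.\<close>

lemma nn_integral_suminf_bounded:
  fixes h :: "nat => 'x => real"
  assumes h [measurable]: "!!k. h k \<in> borel_measurable M"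
    and b: "!!k. (\<integral>\<^sup>+ x. ennreal (h k x) \<partial>M) \<le> ennreal (c k)" and c: "!!k. 0 \<le> c k" "summable c"
  shows "(\<integral>\<^sup>+ x. (suminf (%k. ennreal (h k x))) \<partial>M) \<le> ennreal (suminf c)" (is ?b)
    and "AE x in M. (suminf (%k. ennreal (h k x))) \<noteq> top"
proof -
  have "(\<integral>\<^sup>+ x. (suminf (%k. ennreal (h k x))) \<partial>M) = (suminf (%k. \<integral>\<^sup>+ x. ennreal (h k x) \<partial>M))" by (rule nn_integral_suminf) simp
  also have "\<dots> \<le> (suminf (%k. ennreal (c k)))" by (intro suminf_le b) auto
  also have "\<dots> = ennreal (suminf c)" by (rule suminf_ennreal2[OF c])
  finally show ?b .
  then have "(\<integral>\<^sup>+ x. (suminf (%k. ennreal (h k x))) \<partial>M) \<noteq> \<infinity>" by (auto simp: top_unique)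
  from nn_integral_PInf_AE[OF _ this] show "AE x in M. (suminf (%k. ennreal (h k x))) \<noteq> top" by simp
qed

lemma powr_add_le:
  fixes a b p P :: real
  assumes "0 \<le> a" "0 \<le> b" "0 \<le> p" "p \<le> P"
  shows "(a + b) powr p \<le> 2 powr P * (a powr p + b powr p)"
proof -
  have "(a + b) powr p \<le> (2 * max a b) powr p"
    using assms by (intro powr_mono2) auto
  also have "\<dots> = 2 powr p * (max a b) powr p" using assms by (simp add: powr_mult)
  also have "\<dots> \<le> 2 powr P * (a powr p + b powr p)"
    using assms by (intro mult_mono powr_mono) (auto simp: max_def)
  finally show ?thesis .
qed

text \<open>Young's inequality with a small parameter, proved by comparing v with e s. The constant
  depends only on the upper bound A of the exponents, so the inequality can be integrated with a
  variable exponent.\<close>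

lemma young_split:
  fixes s v a A e :: real
  assumes "0 \<le> s" "0 \<le> v" "1 \<le> a" "a \<le> A" "0 < e" "e \<le> 1"
  shows "s powr (a - 1) * v \<le> e * s powr a + e powr (1 - A) * v powr a"
proof (cases "v \<le> e * s")
  case True
  have "s powr (a - 1) * v \<le> s powr (a - 1) * (e * s)" using True by (intro mult_left_mono) auto
  also have "\<dots> = e * s powr a"
    using assms by (cases "s = 0") (auto simp: powr_diff)
  finally show ?thesis by (simp add: add_increasing2)
next
  case False
  have "0 \<le> e * s" using assms by simp
  with False have "v > 0" by linarith
  moreover have "s \<le> v / e" using False assms by (simp add: field_simps)
  ultimately have sv: "s \<le> v / e" "v > 0" by auto
  have "s powr (a - 1) * v \<le> (v / e) powr (a - 1) * v"
    using assms sv by (intro mult_right_mono powr_mono2) auto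
  also have "\<dots> = e powr (1 - a) * v powr a"
    using assms sv by (simp add: powr_divide powr_diff field_simps)
  also have "\<dots> \<le> e powr (1 - A) * v powr a"
    using assms by (intro mult_right_mono powr_mono') auto
  finally show ?thesis using assms by (simp add: add_increasing)
qed

text \<open>Splitting at the level l bounds a function by a constant plus its p-th power. With p
  depending on the point, this takes the place of Hoelder's inequality throughout.\<close>

lemma le_split_powr:
  fixes x l p P :: real
  assumes "0 \<le> x" "0 < l" "1 \<le> p"
  shows "x \<le> l + l powr (1 - p) * x powr p"
proof (cases "x \<le> l")
  case False
  then have "x = x powr (1 - p) * x powr p" using assms by (simp flip: powr_add)
  also have "\<dots> \<le> l powr (1 - p) * x powr p"
    using False assms by (intro mult_right_mono powr_mono2') auto
  finally show ?thesis using assms by linarith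
qed (simp add: add_increasing2)

lemma powr_tangent_strict:
  fixes y p :: real
  assumes p: "1 < p" and y: "0 \<le> y" "y \<noteq> 1"
  shows "1 + p * (y - 1) < y powr p"
proof -
  have der: "((%y. y powr p - p * y) has_real_derivative p * (z powr (p - 1) - 1)) (at z)" if "z > 0" for z
    using that by (auto intro!: derivative_eq_intros simp: algebra_simps)
  consider "y = 0" | "0 < y" "y < 1" | "y > 1" using y by linarith
  then show ?thesis
  proof cases
    case 1 then show ?thesis using p by simp
  next
    case 2
    obtain z where z: "y < z" "z < 1" "(1 powr p - p * 1) - (y powr p - p * y) = (1 - y) * (p * (z powr (p - 1) - 1))"
      using MVT2[of y 1 "%y. y powr p - p * y" "%z. p * (z powr (p - 1) - 1)"] der 2 by auto
    have "z powr (p - 1) < 1" using z 2 p by (metis diff_gt_0_iff_gt less_trans powr_less_mono2 powr_one_eq_one less_imp_le)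
    then have "(1 - y) * (p * (z powr (p - 1) - 1)) < 0" using 2 p by (intro mult_pos_neg) auto
    then show ?thesis using z(3) by (simp add: algebra_simps)
  next
    case 3
    obtain z where z: "1 < z" "z < y" "(y powr p - p * y) - (1 powr p - p * 1) = (y - 1) * (p * (z powr (p - 1) - 1))"
      using MVT2[of 1 y "%y. y powr p - p * y" "%z. p * (z powr (p - 1) - 1)"] der 3 by auto
    have "z powr (p - 1) > 1" using z p using powr_less_mono2[of "p - 1" 1 z] by simp
    then have "(y - 1) * (p * (z powr (p - 1) - 1)) > 0" using 3 p by simp
    then show ?thesis using z(3) by (simp add: algebra_simps)
  qed
qed

lemma powr_midpoint_strict:
  fixes s t p :: real
  assumes p: "1 < p" and st: "0 \<le> s" "0 \<le> t" "s \<noteq> t"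
  shows "((s + t) / 2) powr p < (s powr p + t powr p) / 2"
proof -
  define m where "m = (s + t) / 2"
  have m: "m > 0" using st by (auto simp: m_def)
  have "1 + p * (s / m - 1) < (s / m) powr p" "1 + p * (t / m - 1) < (t / m) powr p"
    using st m by (intro powr_tangent_strict p; auto simp: m_def field_simps)+
  then have "2 + p * ((s + t) / m - 2) < (s powr p + t powr p) / m powr p"
    using st m by (simp add: powr_divide algebra_simps add_divide_distrib)
  moreover have "(s + t) / m = 2" using m by (simp add: m_def field_simps)
  ultimately have "2 < (s powr p + t powr p) / m powr p" by simp
  then show ?thesis using m by (simp add: field_simps flip: m_def)
qed

text \<open>For different norms the strictness comes from the scalar power; for equal norms it comes
  from the parallelogram law, which shortens the midpoint.\<close>

lemma norm_powr_midpoint_strict: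
  fixes a b :: "'b::real_inner"
  assumes p: "1 < p" and ab: "a \<noteq> b"
  shows "norm ((1/2) *\<^sub>R (a + b)) powr p < (norm a powr p + norm b powr p) / 2"
proof (cases "norm a = norm b")
  case True
  have "(norm (a + b))\<^sup>2 + (norm (a - b))\<^sup>2 = 2 * (norm a)\<^sup>2 + 2 * (norm b)\<^sup>2"
    by (simp add: power2_norm_eq_inner inner_simps inner_commute)
  moreover have "(norm (a - b))\<^sup>2 > 0" using ab by simp
  moreover have "(2 * norm a)\<^sup>2 = 2 * (norm a)\<^sup>2 + 2 * (norm b)\<^sup>2" using True by (simp add: power_mult_distrib)
  ultimately have "(norm (a + b))\<^sup>2 < (2 * norm a)\<^sup>2" by linarith
  then have "norm (a + b) < 2 * norm a" by (rule power_less_imp_less_base) simp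
  then have "norm ((1/2) *\<^sub>R (a + b)) powr p < norm a powr p"
    using p by (intro powr_less_mono2) auto
  then show ?thesis using True by simp
next
  case False
  have "norm ((1/2) *\<^sub>R (a + b)) powr p \<le> ((norm a + norm b) / 2) powr p"
    using p norm_triangle_ineq[of a b] by (intro powr_mono2) auto
  also have "\<dots> < (norm a powr p + norm b powr p) / 2"
    by (rule powr_midpoint_strict) (use p False in auto)
  finally show ?thesis .
qed

lemma norm_powr_midpoint:
  fixes a b :: "'b::real_inner"
  assumes "1 < p"
  shows "norm ((1/2) *\<^sub>R (a + b)) powr p \<le> (norm a powr p + norm b powr p) / 2"
proof (cases "a = b")
  case True
  then have "(1/2) *\<^sub>R (a + b) = a" by (simp add: scaleR_2[symmetric])
  then show ?thesis using True by simp
qed (use norm_powr_midpoint_strict[OF assms] in \<open>auto intro: less_imp_le\<close>)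

text \<open>Compactness of the normalized triples (a, b, p) makes the strict convexity uniform.\<close>

lemma norm_powr_uniformly_convex:
  fixes p0 P e :: real
  assumes p0: "1 < p0" "p0 \<le> P" and e: "0 < e"
  obtains C where "C \<ge> 0" "!!(a::'b::euclidean_space) b p. p0 \<le> p ==> p \<le> P ==>
    norm (a - b) powr p \<le> e * (norm a powr p + norm b powr p)
      + C * ((norm a powr p + norm b powr p) / 2 - norm ((1/2) *\<^sub>R (a + b)) powr p)"
proof -
  \<comment> \<open>With the cap at 1, a difference shorter than e' satisfies |a - b|^p \<le> |a -
    b| \<le> e, and e is covered by the first term on the right because the larger of the two norms
    is 1.\<close>
  define e' where "e' = min e 1"
  define \<Delta> where "\<Delta> z = (case z of (a::'b, b::'b, p) => (norm a powr p + norm b powr p) / 2 - norm ((1/2) *\<^sub>R (a + b)) powr p)" for z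
  define K where "K = {(a::'b, b::'b, p). max (norm a) (norm b) = 1 \<and> e' \<le> norm (a - b) \<and> p \<in> {p0..P}}"
  have Keq: "K = (cball 0 1 \<times> cball 0 1 \<times> {p0..P}) \<inter> {z. max (norm (fst z)) (norm (fst (snd z))) = 1}
      \<inter> {z. e' \<le> norm (fst z - fst (snd z))}"
    by (auto simp: K_def)
  have "compact K" unfolding Keq
    by (intro compact_Int_closed compact_Times closed_Collect_eq closed_Collect_le continuous_intros) auto
  have dc: "continuous_on K \<Delta>" unfolding \<Delta>_def case_prod_beta
    by (intro continuous_intros continuous_on_powr') (use p0 in \<open>auto simp: K_def\<close>)
  have pos: "\<Delta> z > 0" if "z \<in> K" for z
  proof -
    obtain a b p where z: "z = (a, b, p)" by (cases z)
    have "a \<noteq> b" using that e by (auto simp: K_def z e'_def)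
    then show ?thesis using norm_powr_midpoint_strict[of p a b] that p0 by (auto simp: \<Delta>_def z K_def)
  qed
  have "\<exists>d>0. \<forall>z\<in>K. d \<le> \<Delta> z"
  proof (cases "K = {}")
    case False
    from continuous_attains_inf[OF \<open>compact K\<close> False dc] show ?thesis using pos by metis
  qed (auto intro: exI[of _ 1])
  then obtain d where d: "d > 0" "!!z. z \<in> K ==> d \<le> \<Delta> z" by blast
  \<comment> \<open>On K the left side is at most 2^P while the convexity deficit is at least d, so
    this C lets the deficit alone cover it.\<close>
  define C where "C = 2 powr P / d"
  have C: "C \<ge> 0" using d by (simp add: C_def)
  have norm1: "norm (a - b) powr p \<le> e * (norm a powr p + norm b powr p) + C * \<Delta> (a, b, p)"
    if ab: "max (norm a) (norm b) = 1" and p: "p0 \<le> p" "p \<le> P" for a b :: 'b and p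
  proof (cases "e' \<le> norm (a - b)")
    case True
    then have "d \<le> \<Delta> (a, b, p)" using ab p by (intro d(2)) (auto simp: K_def)
    then have 1: "2 powr P \<le> C * \<Delta> (a, b, p)" using d(1) by (simp add: C_def field_simps)
    have "norm (a - b) \<le> 2" using norm_triangle_ineq4[of a b] ab by (simp add: max_def split: if_splits)
    then have "norm (a - b) powr p \<le> 2 powr p" using p p0 by (intro powr_mono2) auto
    also have "\<dots> \<le> 2 powr P" using p by (intro powr_mono) auto
    finally have "norm (a - b) powr p \<le> C * \<Delta> (a, b, p)" using 1 by linarith
    moreover have "e * (norm a powr p + norm b powr p) \<ge> 0" using e by simp
    ultimately show ?thesis by linarith
  next
    case False
    have s1: "norm a powr p + norm b powr p \<ge> 1"
      using ab by (auto simp: max_def split: if_splits)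
    have "norm (a - b) powr p \<le> norm (a - b) powr 1"
      using False p p0 by (intro powr_mono') (auto simp: e'_def)
    also have "\<dots> \<le> e" using False by (auto simp: e'_def)
    also have "\<dots> \<le> e * (norm a powr p + norm b powr p)" using s1 e by simp
    finally have 1: "norm (a - b) powr p \<le> e * (norm a powr p + norm b powr p)" .
    have "\<Delta> (a, b, p) \<ge> 0" using norm_powr_midpoint[of p a b] p p0 by (simp add: \<Delta>_def)
    then show ?thesis using 1 C by (simp add: add_increasing2)
  qed
  show thesis
  proof (rule that[OF C])
    fix a b :: 'b and p assume p: "p0 \<le> p" "p \<le> P"
    let ?t = "max (norm a) (norm b)"
    show "norm (a - b) powr p \<le> e * (norm a powr p + norm b powr p)
      + C * ((norm a powr p + norm b powr p) / 2 - norm ((1/2) *\<^sub>R (a + b)) powr p)"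
    proof (cases "?t = 0")
      case True
      then have "a = 0" "b = 0" by (auto simp: max_def split: if_splits)
      then show ?thesis by simp
    next
      case False
      then have t: "?t > 0" by (metis max.coboundedI1 norm_ge_zero less_eq_real_def)
      let ?a = "(1 / ?t) *\<^sub>R a" and ?b = "(1 / ?t) *\<^sub>R b"
      have "max (norm ?a) (norm ?b) = 1"
        using t by (auto simp: max_def field_simps)
      from norm1[OF this p] have N: "norm (?a - ?b) powr p \<le> e * (norm ?a powr p + norm ?b powr p) + C * \<Delta> (?a, ?b, p)" .
      have S: "norm ((1 / ?t) *\<^sub>R v) powr p = norm v powr p / ?t powr p" for v :: 'b
        using t by (simp add: powr_divide abs_of_pos)
      have E: "?a - ?b = (1 / ?t) *\<^sub>R (a - b)" "(1/2) *\<^sub>R (?a + ?b) = (1 / ?t) *\<^sub>R ((1/2) *\<^sub>R (a + b))"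
        by (simp_all add: scaleR_diff_right scaleR_add_right mult.commute)
      have "norm (a - b) powr p / ?t powr p \<le> (e * (norm a powr p + norm b powr p)
         + C * ((norm a powr p + norm b powr p) / 2 - norm ((1/2) *\<^sub>R (a + b)) powr p)) / ?t powr p"
        using N unfolding \<Delta>_def case_prod_conv E S
        by (simp add: add_divide_distrib diff_divide_distrib distrib_left right_diff_distrib)
      then show ?thesis using t by (simp add: divide_le_cancel)
    qed
  qed
qed

text \<open>Differentiation under the integral: the mean value estimate bounds all difference
  quotients with increments at most 1 by the same integrable B.\<close>

lemma has_real_derivative_integral:
  fixes h h' :: "real => 'x => real"
  assumes int: "!!s. \<bar>s\<bar> \<le> 1 ==> integrable M (h s)"
    and der: "AE x in M. \<forall>s. \<bar>s\<bar> \<le> 1 --> ((%s. h s x) has_real_derivative h' s x) (at s)"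
    and bnd: "AE x in M. \<forall>s. \<bar>s\<bar> \<le> 1 --> \<bar>h' s x\<bar> \<le> B x"
    and B: "integrable M B" and meas: "h' 0 \<in> borel_measurable M"
  shows "((%s. \<integral>x. h s x \<partial>M) has_real_derivative (\<integral>x. h' 0 x \<partial>M)) (at 0)"
  unfolding has_field_derivative_iff
proof (subst tendsto_at_iff_sequentially, intro allI impI)
  fix X :: "nat => real" assume X0: "\<forall>i. X i \<in> UNIV - {0}" and X: "X \<longlonglongrightarrow> 0"
  let ?q = "%s x. (h s x - h 0 x) / (s - 0)"
  from X obtain N where N: "!!i. i \<ge> N ==> \<bar>X i\<bar> \<le> 1"
    by (metis LIMSEQ_D dist_0_norm diff_zero less_imp_le real_norm_def zero_less_one)
  have "(%i. \<integral>x. ?q (X (i + N)) x \<partial>M) \<longlonglongrightarrow> (\<integral>x. h' 0 x \<partial>M)"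
  proof (rule integral_dominated_convergence[where w = B])
    show "?q (X (i + N)) \<in> borel_measurable M" for i
      using borel_measurable_integrable[OF int[of 0]] borel_measurable_integrable[OF int[OF N[of "i + N"]]] by simp
    show "AE x in M. (%i. ?q (X (i + N)) x) \<longlonglongrightarrow> h' 0 x"
      using der
    proof eventually_elim
      case (elim x)
      then have "((%s. h s x) has_real_derivative h' 0 x) (at 0)" by simp
      then have "((%s. ?q s x) \<longlongrightarrow> h' 0 x) (at 0)" unfolding has_field_derivative_iff .
      from this[unfolded tendsto_at_iff_sequentially, rule_format, of X] X0 X
      have "(%i. ?q (X i) x) \<longlonglongrightarrow> h' 0 x" by (simp add: o_def)
      then show ?case by (rule LIMSEQ_ignore_initial_segment)
    qed
    show "AE x in M. norm (?q (X (i + N)) x) \<le> B x" for i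
      using der bnd
    proof eventually_elim
      case (elim x)
      let ?s = "X (i + N)"
      have s: "?s \<noteq> 0" "\<bar>?s\<bar> \<le> 1" using X0 N[of "i + N"] by auto
      have "norm (h ?s x - h 0 x) \<le> B x * norm (?s - 0)"
      proof (rule field_differentiable_bound[where S = "{-1..1}" and f = "%s. h s x" and f' = "%s. h' s x"])
        show "((%s. h s x) has_field_derivative h' z x) (at z within {- 1..1})" if "z \<in> {-1..1}" for z
        proof -
          have "((%s. h s x) has_real_derivative h' z x) (at z)" using elim(1) that by (auto simp: abs_le_iff)
          then show ?thesis by (rule has_field_derivative_at_within)
        qed
        show "norm (h' z x) \<le> B x" if "z \<in> {-1..1}" for z using elim(2) that by (auto simp: abs_le_iff)
      qed (use s in auto)
      then show ?case using s by (simp add: field_simps)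
    qed
  qed (use B meas in auto)
  moreover have eq: "(\<integral>x. ?q (X (i + N)) x \<partial>M) = ((\<integral>x. h (X (i + N)) x \<partial>M) - (\<integral>x. h 0 x \<partial>M)) / (X (i + N) - 0)" for i
    using int[of 0] int[OF N[of "i + N"]] by simp
  ultimately have "(%i. ((\<integral>x. h (X (i + N)) x \<partial>M) - (\<integral>x. h 0 x \<partial>M)) / (X (i + N) - 0)) \<longlonglongrightarrow> (\<integral>x. h' 0 x \<partial>M)"
    unfolding eq by blast
  then show "((%s. ((\<integral>x. h s x \<partial>M) - (\<integral>x. h 0 x \<partial>M)) / (s - 0)) \<circ> X) \<longlonglongrightarrow> (\<integral>x. h' 0 x \<partial>M)"
    unfolding o_def by (rule LIMSEQ_offset)
qed

section \<open>Modulars: convergence, domination and completeness\<close>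

definition rho :: "'x measure => ('x => real) => ('x => 'b::euclidean_space) => ennreal" where
  "rho M p u = (\<integral>\<^sup>+ x. ennreal (norm (u x) powr p x) \<partial>M)"

lemma ennreal_pos_below:
  fixes e :: ennreal
  assumes "0 < e" obtains z where "0 < z" "ennreal z < e"
proof -
  obtain y where y: "0 < y" "y < e" using dense[OF assms] by blast
  then have "y < top" using top.not_eq_extremum by fastforce
  then show ?thesis using that[of "enn2real y"] y by (simp add: enn2real_positive_iff)
qed

locale exponent = finite_measure M for M :: "'x measure" +
  fixes p :: "'x => real" and P :: real
  assumes p_meas [measurable]: "p \<in> borel_measurable M"
    and p_ge: "!!x. x \<in> space M ==> 1 \<le> p x" and p_le: "!!x. x \<in> space M ==> p x \<le> P"
    and P_ge: "1 \<le> P"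
begin

abbreviation \<rho> :: "('x => 'b::euclidean_space) => ennreal" where "\<rho> \<equiv> rho M p"

abbreviation mconv :: "(nat => 'x => 'b::euclidean_space) => ('x => 'b) => bool" where
  "mconv u w \<equiv> (%n. \<rho> (%x. u n x - w x)) \<longlonglongrightarrow> 0"

lemma rho_add:
  assumes [measurable]: "u \<in> borel_measurable M" "v \<in> borel_measurable M"
  shows "\<rho> (%x. u x + v x) \<le> ennreal (2 powr P) * (\<rho> u + \<rho> v)"
proof -
  have "\<rho> (%x. u x + v x) \<le> (\<integral>\<^sup>+ x. ennreal (2 powr P) * (ennreal (norm (u x) powr p x) + ennreal (norm (v x) powr p x)) \<partial>M)"
    unfolding rho_def
  proof (rule nn_integral_mono)
    fix x assume x: "x \<in> space M"
    have "norm (u x + v x) powr p x \<le> (norm (u x) + norm (v x)) powr p x"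
      using p_ge[OF x] by (intro powr_mono2 norm_triangle_ineq) auto
    also have "\<dots> \<le> 2 powr P * (norm (u x) powr p x + norm (v x) powr p x)"
      using p_ge[OF x] p_le[OF x] by (intro powr_add_le) auto
    finally show "ennreal (norm (u x + v x) powr p x) \<le> ennreal (2 powr P) * (ennreal (norm (u x) powr p x) + ennreal (norm (v x) powr p x))"
      by (simp add: ennreal_leI flip: ennreal_mult ennreal_plus)
  qed
  also have "\<dots> = ennreal (2 powr P) * (\<rho> u + \<rho> v)"
    unfolding rho_def by (simp add: nn_integral_cmult nn_integral_add)
  finally show ?thesis .
qed

lemma rho_diff_commute: "\<rho> (%x. u x - v x) = \<rho> (%x. v x - u x)"
  by (simp add: rho_def norm_minus_commute)

lemma rho_scale:
  assumes [measurable]: "u \<in> borel_measurable M"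
  shows "\<rho> (%x. c *\<^sub>R u x) \<le> ennreal (max 1 \<bar>c\<bar> powr P) * \<rho> u"
proof -
  have "\<rho> (%x. c *\<^sub>R u x) \<le> (\<integral>\<^sup>+ x. ennreal (max 1 \<bar>c\<bar> powr P) * ennreal (norm (u x) powr p x) \<partial>M)"
    unfolding rho_def
  proof (rule nn_integral_mono)
    fix x assume x: "x \<in> space M"
    have "norm (c *\<^sub>R u x) powr p x \<le> (max 1 \<bar>c\<bar> * norm (u x)) powr p x"
      using p_ge[OF x] by (intro powr_mono2) (auto intro: mult_right_mono)
    also have "\<dots> = max 1 \<bar>c\<bar> powr p x * norm (u x) powr p x" by (simp add: powr_mult)
    also have "\<dots> \<le> max 1 \<bar>c\<bar> powr P * norm (u x) powr p x"
      using p_le[OF x] by (intro mult_right_mono powr_mono) auto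
    finally show "ennreal (norm (c *\<^sub>R u x) powr p x) \<le> ennreal (max 1 \<bar>c\<bar> powr P) * ennreal (norm (u x) powr p x)"
      by (simp add: ennreal_leI flip: ennreal_mult)
  qed
  also have "\<dots> = ennreal (max 1 \<bar>c\<bar> powr P) * \<rho> u"
    unfolding rho_def by (simp add: nn_integral_cmult)
  finally show ?thesis .
qed

lemma integrable_powr_iff:
  assumes [measurable]: "u \<in> borel_measurable M"
  shows "integrable M (%x. norm (u x) powr p x) \<longleftrightarrow> \<rho> u < top"
  unfolding rho_def by (subst integrable_iff_bounded) simp

lemma rho_eq_integral:
  assumes "integrable M (%x. norm (u x) powr p x)"
  shows "\<rho> u = ennreal (\<integral>x. norm (u x) powr p x \<partial>M)"
  unfolding rho_def by (rule nn_integral_eq_integral[OF assms]) simp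

lemma rho_tendsto_add:
  assumes m: "!!n. u n \<in> borel_measurable M" "!!n. v n \<in> borel_measurable M"
    and "(%n. \<rho> (u n)) \<longlonglongrightarrow> 0" "(%n. \<rho> (v n)) \<longlonglongrightarrow> 0"
  shows "(%n. \<rho> (%x. u n x + v n x)) \<longlonglongrightarrow> 0"
proof (rule tendsto_sandwich[of "%_. 0" _ _ "%n. ennreal (2 powr P) * (\<rho> (u n) + \<rho> (v n))"])
  have "(%n. ennreal (2 powr P) * (\<rho> (u n) + \<rho> (v n))) \<longlonglongrightarrow> ennreal (2 powr P) * (0 + 0)"
    by (intro ennreal_tendsto_cmult tendsto_add assms) simp
  then show "(%n. ennreal (2 powr P) * (\<rho> (u n) + \<rho> (v n))) \<longlonglongrightarrow> 0" by simp
qed (use rho_add[OF m] in auto)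

lemma rho_tendsto_scale:
  assumes m: "!!n. u n \<in> borel_measurable M"
    and "(%n. \<rho> (u n)) \<longlonglongrightarrow> 0"
  shows "(%n. \<rho> (%x. c *\<^sub>R u n x)) \<longlonglongrightarrow> 0"
proof (rule tendsto_sandwich[of "%_. 0" _ _ "%n. ennreal (max 1 \<bar>c\<bar> powr P) * \<rho> (u n)"])
  have "(%n. ennreal (max 1 \<bar>c\<bar> powr P) * \<rho> (u n)) \<longlonglongrightarrow> ennreal (max 1 \<bar>c\<bar> powr P) * 0"
    by (intro ennreal_tendsto_cmult assms) simp
  then show "(%n. ennreal (max 1 \<bar>c\<bar> powr P) * \<rho> (u n)) \<longlonglongrightarrow> 0" by simp
qed (use rho_scale[OF m] in auto)

text \<open>Along a subsequence with modulars below 2^-k, the sum of all the powers is integrable.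
  This sum is the dominating function, and its finiteness forces the terms to zero.\<close>

lemma rho_subseq_dominated:
  fixes u :: "nat => 'x => 'b::euclidean_space"
  assumes [measurable]: "!!n. u n \<in> borel_measurable M" and lim: "(%n. \<rho> (u n)) \<longlonglongrightarrow> 0"
  obtains r S where "strict_mono r" "integrable M S" "AE x in M. (%k. u (r k) x) \<longlonglongrightarrow> 0"
    "AE x in M. \<forall>k. norm (u (r k) x) powr p x \<le> S x"
proof -
  have ev: "\<exists>N. \<forall>n\<ge>N. \<rho> (u n) < ennreal ((1/2) ^ k)" for k
    using order_tendstoD(2)[OF lim, of "ennreal ((1/2) ^ k)"] by (simp add: eventually_sequentially)
  have "\<exists>r::nat => nat. strict_mono r \<and> (\<forall>k. \<rho> (u (r k)) < ennreal ((1/2) ^ k))"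
  proof -
    have "\<exists>r. \<forall>k. \<rho> (u (r k)) < ennreal ((1/2) ^ k) \<and> r k < r (Suc k)"
    proof (rule dependent_nat_choice)
      show "\<exists>x. \<rho> (u x) < ennreal ((1/2) ^ 0)" using ev[of 0] by auto
      fix x k
      obtain N where "\<forall>n\<ge>N. \<rho> (u n) < ennreal ((1/2) ^ Suc k)" using ev by blast
      then show "\<exists>y. \<rho> (u y) < ennreal ((1/2) ^ Suc k) \<and> x < y"
        by (intro exI[of _ "max N (Suc x)"]) auto
    qed
    then show ?thesis by (auto simp: strict_mono_Suc_iff)
  qed
  then obtain r where r: "strict_mono r" "!!k. \<rho> (u (r k)) < ennreal ((1/2) ^ k)" by blast
  define T where "T x = (suminf (%k. ennreal (norm (u (r k) x) powr p x)))" for x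
  have Tm [measurable]: "T \<in> borel_measurable M" unfolding T_def by measurable
  have TI: "(\<integral>\<^sup>+ x. T x \<partial>M) \<le> ennreal (suminf ((^) (1/2)))" "AE x in M. T x \<noteq> top"
    unfolding T_def using r(2)
    by (intro nn_integral_suminf_bounded[where c = "(^) (1/2)"]; simp add: rho_def less_imp_le summable_geometric)+
  then have Tfin: "(\<integral>\<^sup>+ x. T x \<partial>M) < top" by (simp add: le_less_trans)
  have AET: "AE x in M. T x < top" using TI(2) by (simp add: less_top)
  have le: "ennreal (norm (u (r k) x) powr p x) \<le> T x" for k x
  proof -
    have "(\<Sum>j\<in>{k}. ennreal (norm (u (r j) x) powr p x)) \<le> T x"
      unfolding T_def by (rule sum_le_suminf) auto
    then show ?thesis by simp
  qed
  show thesis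
  proof (rule that[OF r(1)])
    show "integrable M (%x. enn2real (T x))"
    proof (rule integrableI_nonneg)
      have "(\<integral>\<^sup>+ x. ennreal (enn2real (T x)) \<partial>M) = (\<integral>\<^sup>+ x. T x \<partial>M)"
        by (rule nn_integral_cong_AE) (use AET in eventually_elim, auto)
      then show "(\<integral>\<^sup>+ x. ennreal (enn2real (T x)) \<partial>M) < \<infinity>" using Tfin by simp
    qed auto
    show "AE x in M. \<forall>k. norm (u (r k) x) powr p x \<le> enn2real (T x)"
      using AET
    proof eventually_elim
      case (elim x)
      then show ?case using le[of _ x] by (metis enn2real_ennreal enn2real_mono infinity_ennreal_def powr_ge_zero)
    qed
    show "AE x in M. (%k. u (r k) x) \<longlonglongrightarrow> 0"
      using AET AE_space
    proof eventually_elim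
      case (elim x)
      let ?a = "%k. norm (u (r k) x) powr p x"
      have "summable ?a"
        using elim(1) unfolding T_def by (intro summable_suminf_not_top) auto
      then have a0: "?a \<longlonglongrightarrow> 0" by (rule summable_LIMSEQ_zero)
      have p: "p x \<ge> 1" using p_ge elim(2) by blast
      have "(%k. norm (u (r k) x)) \<longlonglongrightarrow> 0"
      proof (rule LIMSEQ_I)
        fix e :: real assume e: "e > 0"
        then have "e powr p x > 0" by simp
        from LIMSEQ_D[OF a0 this] obtain N where N: "!!k. k \<ge> N ==> ?a k < e powr p x" by auto
        have "norm (u (r k) x) < e" if "k \<ge> N" for k
          using N[OF that] e p by (metis norm_ge_zero not_less powr_mono2 less_imp_le order_trans zero_le_one)
        then show "\<exists>no. \<forall>n\<ge>no. norm (norm (u (r n) x) - 0) < e" by auto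
      qed
      then show ?case by (rule tendsto_norm_zero_cancel)
    qed
  qed
qed

lemma LIMSEQ_by_subseqs:
  fixes a :: "nat => real"
  assumes "!!s. strict_mono s ==> \<exists>r. strict_mono (r::nat => nat) \<and> (%k. a (s (r k))) \<longlonglongrightarrow> l"
  shows "a \<longlonglongrightarrow> l"
proof (rule ccontr)
  assume "\<not> ?thesis"
  then obtain e where e: "e > 0" "\<forall>N. \<exists>n\<ge>N. \<not> dist (a n) l < e" unfolding lim_sequentially by blast
  have "infinite {n. \<not> dist (a n) l < e}"
    using e(2) by (simp add: infinite_nat_iff_unbounded_le)
  then obtain s :: "nat => nat" where s: "strict_mono s" "!!n. s n \<in> {n. \<not> dist (a n) l < e}" using infinite_enumerate by blast
  obtain r where r: "strict_mono (r::nat => nat)" "(%k. a (s (r k))) \<longlonglongrightarrow> l" using assms[OF s(1)] by blast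
  from r(2) e(1) obtain N where "\<forall>k\<ge>N. dist (a (s (r k))) l < e" unfolding lim_sequentially by blast
  then show False using s(2)[of "r N"] by auto
qed

lemma nemytskii_integrable:
  fixes v :: "'x => 'b::euclidean_space"
  assumes [measurable]: "v \<in> borel_measurable M" and hm: "(%x. h x (v x)) \<in> borel_measurable M"
    and "\<rho> v < top" and D: "integrable M D"
    and bnd: "AE x in M. \<forall>\<xi>. \<bar>h x \<xi>\<bar> \<le> D x + C * norm \<xi> powr p x"
  shows "integrable M (%x. h x (v x) :: real)"
proof (rule integrable_bound)
  show "integrable M (%x. D x + C * norm (v x) powr p x)"
    using assms integrable_powr_iff[of v] by auto
  show "AE x in M. norm (h x (v x)) \<le> norm (D x + C * norm (v x) powr p x)"
    using bnd by eventually_elim (auto intro: order_trans[OF _ abs_ge_self])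
qed fact

text \<open>Every subsequence has a further one converging almost everywhere under a common
  dominating function, so dominated convergence applies. Both energy terms, their derivatives and
  the potential obtain their continuity from this one statement.\<close>

lemma nemytskii_continuous:
  fixes v :: "nat => 'x => 'b::euclidean_space" and h :: "'x => 'b => real"
  assumes vm [measurable]: "!!n. v n \<in> borel_measurable M" "w \<in> borel_measurable M"
    and hm: "!!v. v \<in> borel_measurable M ==> (%x. h x (v x)) \<in> borel_measurable M"
    and cont: "AE x in M. continuous_on UNIV (h x)"
    and D: "integrable M D" and C: "C \<ge> 0"
    and bnd: "AE x in M. \<forall>\<xi>. \<bar>h x \<xi>\<bar> \<le> D x + C * norm \<xi> powr p x"
    and lim: "mconv v w" and w: "\<rho> w < top"
  shows "(%n. \<integral>x. h x (v n x) \<partial>M) \<longlonglongrightarrow> (\<integral>x. h x (w x) \<partial>M)"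
proof (rule LIMSEQ_by_subseqs)
  fix s :: "nat => nat" assume s: "strict_mono s"
  have "(%n. \<rho> (%x. v (s n) x - w x)) \<longlonglongrightarrow> 0"
    using LIMSEQ_subseq_LIMSEQ[OF lim s] by (simp add: o_def)
  then obtain r S where r: "strict_mono r" "integrable M S" "AE x in M. (%k. v (s (r k)) x - w x) \<longlonglongrightarrow> 0"
    "AE x in M. \<forall>k. norm (v (s (r k)) x - w x) powr p x \<le> S x"
    by (rule rho_subseq_dominated[rotated]) auto
  have wi: "integrable M (%x. norm (w x) powr p x)" using w integrable_powr_iff[OF vm(2)] by simp
  have "(%k. \<integral>x. h x (v (s (r k)) x) \<partial>M) \<longlonglongrightarrow> (\<integral>x. h x (w x) \<partial>M)"
  proof (rule integral_dominated_convergence[where w = "%x. D x + C * (2 powr P * (S x + norm (w x) powr p x))"])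
    show "AE x in M. (%k. h x (v (s (r k)) x)) \<longlonglongrightarrow> h x (w x)"
      using r(3) cont
    proof eventually_elim
      case (elim x)
      then have "(%k. v (s (r k)) x) \<longlonglongrightarrow> w x" by (simp add: LIM_zero_iff)
      then show ?case by (intro continuous_on_tendsto_compose[OF elim(2)]) auto
    qed
    show "AE x in M. norm (h x (v (s (r k)) x)) \<le> D x + C * (2 powr P * (S x + norm (w x) powr p x))" for k
      using bnd r(4) AE_space
    proof eventually_elim
      case (elim x)
      have "norm (v (s (r k)) x) powr p x \<le> (norm (v (s (r k)) x - w x) + norm (w x)) powr p x"
        using p_ge[OF elim(3)] norm_triangle_sub[of "v (s (r k)) x" "w x"] by (intro powr_mono2) auto
      also have "\<dots> \<le> 2 powr P * (norm (v (s (r k)) x - w x) powr p x + norm (w x) powr p x)"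
        using p_ge[OF elim(3)] p_le[OF elim(3)] by (intro powr_add_le) auto
      also have "\<dots> \<le> 2 powr P * (S x + norm (w x) powr p x)" using elim(2) by (intro mult_left_mono add_right_mono) auto
      finally have "C * norm (v (s (r k)) x) powr p x \<le> C * (2 powr P * (S x + norm (w x) powr p x))"
        using C by (rule mult_left_mono)
      then show ?case using elim(1) by (metis add_left_mono order_trans real_norm_def)
    qed
  qed (use hm r(2) D wi in auto)
  then show "\<exists>r. strict_mono (r::nat => nat) \<and> (%k. \<integral>x. h x (v (s (r k)) x) \<partial>M) \<longlonglongrightarrow> (\<integral>x. h x (w x) \<partial>M)"
    using r(1) by blast
qed

lemma rho_small_scale:
  assumes [measurable]: "u \<in> borel_measurable M" and c: "\<bar>c\<bar> \<le> 1"
  shows "\<rho> (%x. c *\<^sub>R u x) \<le> ennreal \<bar>c\<bar> * \<rho> u"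
proof -
  have "\<rho> (%x. c *\<^sub>R u x) \<le> (\<integral>\<^sup>+ x. ennreal \<bar>c\<bar> * ennreal (norm (u x) powr p x) \<partial>M)"
    unfolding rho_def
  proof (rule nn_integral_mono)
    fix x assume x: "x \<in> space M"
    have "\<bar>c\<bar> powr p x \<le> \<bar>c\<bar> powr 1" using c p_ge[OF x] by (intro powr_mono') auto
    then have "norm (c *\<^sub>R u x) powr p x \<le> \<bar>c\<bar> * norm (u x) powr p x" by (simp add: powr_mult mult_right_mono)
    then show "ennreal (norm (c *\<^sub>R u x) powr p x) \<le> ennreal \<bar>c\<bar> * ennreal (norm (u x) powr p x)"
      by (simp add: ennreal_leI flip: ennreal_mult)
  qed
  also have "\<dots> = ennreal \<bar>c\<bar> * \<rho> u" unfolding rho_def by (rule nn_integral_cmult) measurable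
  finally show ?thesis .
qed

definition Lp :: "('x => 'b::euclidean_space) => bool" where
  "Lp g \<longleftrightarrow> g \<in> borel_measurable M \<and> \<rho> g < top"

lemma Lp_meas: "Lp g ==> g \<in> borel_measurable M" by (simp add: Lp_def)

lemma Lp_integrable: "Lp g ==> integrable M (%x. norm (g x) powr p x)"
  using integrable_powr_iff[of g] by (auto simp: Lp_def)

lemma Lp_scale: assumes "Lp g" shows "Lp (%x. c *\<^sub>R g x)"
proof -
  note [measurable] = Lp_meas[OF assms]
  have "\<rho> (%x. c *\<^sub>R g x) \<le> ennreal (max 1 \<bar>c\<bar> powr P) * \<rho> g" by (rule rho_scale) measurable
  also have "\<dots> < top" using assms by (simp add: Lp_def ennreal_mult_less_top)
  finally show ?thesis by (simp add: Lp_def)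
qed

lemma Lp_add: assumes "Lp g" "Lp h" shows "Lp (%x. g x + h x)"
proof -
  note [measurable] = Lp_meas[OF assms(1)] Lp_meas[OF assms(2)]
  have "\<rho> (%x. g x + h x) \<le> ennreal (2 powr P) * (\<rho> g + \<rho> h)" by (rule rho_add) measurable
  also have "\<dots> < top" using assms by (simp add: Lp_def ennreal_mult_less_top)
  finally show ?thesis by (simp add: Lp_def)
qed

lemma Lp_uminus: "Lp g ==> Lp (%x. - g x)" using Lp_scale[of g "-1"] by simp

lemma Lp_diff: "Lp g ==> Lp h ==> Lp (%x. g x - h x)"
  using Lp_add[OF _ Lp_uminus, of g h] by simp

lemma Lp_limit:
  fixes u :: "nat => 'x => 'b::euclidean_space"
  assumes u: "!!n. Lp (u n)" and w: "w \<in> borel_measurable M" and lim: "mconv u w"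
  shows "Lp w"
proof -
  have "\<forall>\<^sub>F n in sequentially. \<rho> (%x. u n x - w x) < top" using order_tendstoD(2)[OF lim, of top] by simp
  then obtain n where n: "\<rho> (%x. u n x - w x) < top" by (auto simp: eventually_sequentially)
  have "Lp (%x. u n x - w x)" using n w Lp_meas[OF u[of n]] by (simp add: Lp_def)
  from Lp_diff[OF u[of n] this] show ?thesis by simp
qed

text \<open>As in the Riesz-Fischer theorem: a fast subsequence has increments summable in L1, hence
  converges almost everywhere, and Fatou's lemma carries the Cauchy estimate over to the
  limit.\<close>

lemma rho_complete:
  fixes u :: "nat => 'x => 'b::euclidean_space"
  assumes [measurable]: "!!n. u n \<in> borel_measurable M"
    and cau: "!!e. e > 0 ==> \<exists>N. \<forall>m\<ge>N. \<forall>n\<ge>N. \<rho> (%x. u n x - u m x) < ennreal e"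
  obtains w where "w \<in> borel_measurable M" "mconv u w"
proof -
  \<comment> \<open>The second factor cancels l^(1 - P) for l = 2^-k, the constant produced when
    \<open>le_split_powr\<close> turns a modular into an L1 bound at level l. What remains is 2^-k,
    which is summable.\<close>
  define c where "c k = (1/2) ^ k * (1/2 :: real) powr (real k * (P - 1))" for k
  have c: "c k > 0" for k by (simp add: c_def)
  have "\<exists>r. \<forall>k. (\<forall>m\<ge>r k. \<forall>n\<ge>r k. \<rho> (%x. u n x - u m x) < ennreal (c k)) \<and> r k < r (Suc k)"
  proof (rule dependent_nat_choice)
    show "\<exists>N. \<forall>m\<ge>N. \<forall>n\<ge>N. \<rho> (%x. u n x - u m x) < ennreal (c 0)" using cau[OF c] by blast
    fix x k
    obtain N where "\<forall>m\<ge>N. \<forall>n\<ge>N. \<rho> (%x. u n x - u m x) < ennreal (c (Suc k))" using cau[OF c] by blast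
    then show "\<exists>y. (\<forall>m\<ge>y. \<forall>n\<ge>y. \<rho> (%x. u n x - u m x) < ennreal (c (Suc k))) \<and> x < y"
      by (intro exI[of _ "max N (Suc x)"]) auto
  qed
  then obtain r where r: "!!k m n. m \<ge> r k ==> n \<ge> r k ==> \<rho> (%x. u n x - u m x) < ennreal (c k)"
    "!!k. r k < r (Suc k)" by blast
  have rm: "strict_mono r" using r(2) by (simp add: strict_mono_Suc_iff)
  define d where "d k x = u (r (Suc k)) x - u (r k) x" for k x
  have dm [measurable]: "d k \<in> borel_measurable M" for k unfolding d_def by measurable
  have dint: "(\<integral>\<^sup>+ x. ennreal (norm (d k x)) \<partial>M) \<le> ennreal ((1/2) ^ k * (measure M (space M) + 1))" for k
  proof -
    define l :: real where "l = (1/2) ^ k"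
    have l: "0 < l" "l \<le> 1" by (auto simp: l_def power_le_one)
    have "(\<integral>\<^sup>+ x. ennreal (norm (d k x)) \<partial>M) \<le> (\<integral>\<^sup>+ x. ennreal l + ennreal (l powr (1 - P)) * ennreal (norm (d k x) powr p x) \<partial>M)"
    proof (rule nn_integral_mono)
      fix x assume x: "x \<in> space M"
      have "norm (d k x) \<le> l + l powr (1 - p x) * norm (d k x) powr p x"
        by (rule le_split_powr) (use l p_ge[OF x] in auto)
      also have "\<dots> \<le> l + l powr (1 - P) * norm (d k x) powr p x"
        using l p_le[OF x] by (intro add_left_mono mult_right_mono powr_mono') auto
      finally show "ennreal (norm (d k x)) \<le> ennreal l + ennreal (l powr (1 - P)) * ennreal (norm (d k x) powr p x)"
        using l by (simp add: ennreal_leI flip: ennreal_mult ennreal_plus)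
    qed
    also have "\<dots> = ennreal l * emeasure M (space M) + ennreal (l powr (1 - P)) * \<rho> (d k)"
      unfolding rho_def by (simp add: nn_integral_add nn_integral_cmult)
    also have "\<dots> \<le> ennreal l * emeasure M (space M) + ennreal (l powr (1 - P)) * ennreal (c k)"
      unfolding d_def using r(1)[of k "r k" "r (Suc k)"] r(2)[of k]
      by (intro add_left_mono mult_left_mono) (auto intro: less_imp_le)
    also have "ennreal l * emeasure M (space M) + ennreal (l powr (1 - P)) * ennreal (c k) = ennreal (l * measure M (space M) + l powr (1 - P) * c k)"
      using l c[of k] by (simp add: emeasure_eq_measure ennreal_mult ennreal_plus less_imp_le)
    also have "l powr (1 - P) * c k = l"
    proof -
      have "l = (1/2) powr real k" by (simp add: l_def powr_realpow)
      then have "l powr (1 - P) * (1/2) powr (real k * (P - 1)) = 1" by (simp add: powr_powr flip: powr_add) (simp add: algebra_simps)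
      then show ?thesis by (simp add: c_def l_def)
    qed
    finally show ?thesis by (simp add: l_def algebra_simps)
  qed
  define T where "T x = (suminf (%k. ennreal (norm (d k x))))" for x
  have AET: "AE x in M. T x \<noteq> top"
    unfolding T_def using dint
    by (intro nn_integral_suminf_bounded(2)) (auto intro!: summable_mult2 simp: summable_geometric)
  define w where "w x = lim (%k. u (r k) x)" for x
  have wm [measurable]: "w \<in> borel_measurable M" unfolding w_def by measurable
  have conv: "AE x in M. (%k. u (r k) x) \<longlonglongrightarrow> w x"
    using AET
  proof eventually_elim
    case (elim x)
    have "summable (%k. norm (d k x))"
      using elim unfolding T_def by (intro summable_suminf_not_top) auto
    then have "summable (%k. d k x)" by (rule summable_norm_cancel)
    then have "convergent (%n. \<Sum>k<n. d k x)" by (simp add: summable_iff_convergent)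
    moreover have "(\<Sum>k<n. d k x) = u (r n) x - u (r 0) x" for n
      unfolding d_def by (rule sum_lessThan_telescope)
    ultimately have "convergent (%n. u (r n) x)" by (simp add: convergent_diff_const_right_iff)
    then show ?case unfolding w_def by (simp add: convergent_LIMSEQ_iff)
  qed
  show thesis
  proof (rule that[OF wm])
    show "mconv u w"
    proof (rule order_tendstoI)
      fix e :: ennreal assume "0 < e"
      then obtain e' where e': "0 < e'" "ennreal e' < e" by (rule ennreal_pos_below)
      obtain N where N: "!!m n. m \<ge> N ==> n \<ge> N ==> \<rho> (%x. u n x - u m x) < ennreal e'" using cau[OF e'(1)] by blast
      have "\<rho> (%x. u n x - w x) < e" if n: "n \<ge> N" for n
      proof -
        have "\<rho> (%x. u n x - w x) = (\<integral>\<^sup>+ x. liminf (%k. ennreal (norm (u n x - u (r k) x) powr p x)) \<partial>M)"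
          unfolding rho_def
        proof (rule nn_integral_cong_AE)
          show "AE x in M. ennreal (norm (u n x - w x) powr p x) = liminf (%k. ennreal (norm (u n x - u (r k) x) powr p x))"
            using conv AE_space
          proof eventually_elim
            case (elim x)
            have "(%k. ennreal (norm (u n x - u (r k) x) powr p x)) \<longlonglongrightarrow> ennreal (norm (u n x - w x) powr p x)"
              using elim(1) p_ge[OF elim(2)] by (intro tendsto_ennrealI tendsto_powr' tendsto_intros) auto
            then show ?case by (intro lim_imp_Liminf[symmetric]) auto
          qed
        qed
        also have "\<dots> \<le> liminf (%k. \<rho> (%x. u n x - u (r k) x))"
          unfolding rho_def by (rule nn_integral_liminf) simp
        also have "\<dots> \<le> ennreal e'"
        proof (rule Liminf_le)
          have "eventually (%k. N \<le> r k) sequentially"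
            using rm by (metis eventually_sequentiallyI le_trans seq_suble)
          then show "\<forall>\<^sub>F k in sequentially. \<rho> (%x. u n x - u (r k) x) \<le> ennreal e'"
            by eventually_elim (use N n in \<open>auto intro: less_imp_le\<close>)
        qed simp
        finally show ?thesis using e'(2) by simp
      qed
      then show "\<forall>\<^sub>F n in sequentially. \<rho> (%x. u n x - w x) < e" by (auto simp: eventually_sequentially)
    qed auto
  qed
qed

end

section \<open>Test functions\<close>

text \<open>The negative power makes the family closed under differentiation: the derivative of
  \<open>zeta m\<close> is a combination of \<open>zeta (m + 1)\<close> and
  \<open>zeta (m + 2)\<close>.\<close>

definition zeta :: "nat => real => real" where
  "zeta m t = (if t > 0 then exp (- (1 / t)) / t ^ m else 0)"

text \<open>The k-th power of exp y \<ge> y at y = 1/(k t) with k = m + 2 leaves two powers of t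
  after division by t^m. Quadratic decay is what differentiability at 0 needs.\<close>

lemma zeta_le: "\<bar>zeta m t\<bar> \<le> real (m + 2) ^ (m + 2) * t\<^sup>2"
proof (cases "t > 0")
  case True
  define k where "k = m + 2"
  have k: "real k > 0" by (simp add: k_def)
  have "(1 / (real k * t)) ^ k \<le> (exp (1 / (real k * t))) ^ k"
  proof (rule power_mono)
    show "1 / (real k * t) \<le> exp (1 / (real k * t))" using exp_ge_add_one_self[of "1 / (real k * t)"] by linarith
  qed (use True k in auto)
  also have "\<dots> = exp (1 / t)" using k by (simp flip: exp_of_nat_mult)
  finally have "exp (- (1 / t)) \<le> (real k * t) ^ k"
    using True k by (simp add: exp_minus power_one_over field_simps)
  then have "zeta m t \<le> (real k * t) ^ k / t ^ m" using True by (simp add: zeta_def divide_right_mono)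
  also have "\<dots> = real k ^ k * t\<^sup>2" using True by (simp add: k_def power_mult_distrib power_add power2_eq_square)
  finally show ?thesis using True by (simp add: zeta_def k_def)
qed (simp add: zeta_def)

lemma zeta_deriv: "(zeta m has_real_derivative (- real m * zeta (m + 1) t + zeta (m + 2) t)) (at t)"
proof -
  consider "t > 0" | "t < 0" | "t = 0" by linarith
  then show ?thesis
  proof cases
    case 1
    have "((%t. exp (- (1 / t)) / t ^ m) has_real_derivative (- real m * zeta (m + 1) t + zeta (m + 2) t)) (at t)"
    proof (cases m)
      case 0
      then show ?thesis using 1 by (auto intro!: derivative_eq_intros simp: zeta_def power2_eq_square)
    next
      case (Suc k)
      then show ?thesis using 1
        by (auto intro!: derivative_eq_intros simp: zeta_def field_simps power2_eq_square) (cases k; simp)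
    qed
    then show ?thesis
      by (rule has_field_derivative_transform_within_open[where S = "{0<..}"]) (use 1 in \<open>auto simp: zeta_def\<close>)
  next
    case 2
    have "((%t. 0) has_real_derivative (- real m * zeta (m + 1) t + zeta (m + 2) t)) (at t)"
      using 2 by (simp add: zeta_def)
    then show ?thesis
      by (rule has_field_derivative_transform_within_open[where S = "{..<0}"]) (use 2 in \<open>auto simp: zeta_def\<close>)
  next
    case 3
    let ?C = "real (m + 2) ^ (m + 2)"
    have "((%h. zeta m h / h) \<longlongrightarrow> 0) (at 0)"
    proof (rule Lim_null_comparison[where g = "%h. ?C * \<bar>h\<bar>"])
      have "\<bar>zeta m h / h\<bar> \<le> ?C * \<bar>h\<bar>" if "h \<noteq> 0" for h
        using zeta_le[of m h] that by (simp add: abs_divide divide_le_eq power2_eq_square abs_mult_self_eq mult.assoc)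
      then show "\<forall>\<^sub>F h in at 0. norm (zeta m h / h) \<le> ?C * \<bar>h\<bar>"
        by (auto simp: eventually_at intro!: exI[of _ 1])
      have "((%h. ?C * \<bar>h\<bar>) \<longlongrightarrow> ?C * \<bar>0::real\<bar>) (at 0)" by (intro tendsto_intros)
      then show "((%h. ?C * \<bar>h\<bar>) \<longlongrightarrow> 0) (at (0::real))" by simp
    qed
    then show ?thesis using 3 by (simp add: has_field_derivative_iff zeta_def)
  qed
qed

text \<open>A class stable under directional derivatives, so that membership alone yields all orders
  of differentiability by induction.\<close>

inductive bumplike :: "('a::euclidean_space => real) => bool" where
  const: "bumplike (%x. c)"
| zeta: "bumplike (%x. zeta m (c * (x \<bullet> b) + d))"
| add: "bumplike f ==> bumplike g ==> bumplike (%x. f x + g x)"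
| mult: "bumplike f ==> bumplike g ==> bumplike (%x. f x * g x)"

lemma bumplike_deriv:
  "bumplike f ==> \<exists>D. (\<forall>x. (f has_derivative (%v. D v x)) (at x)) \<and> (\<forall>v. bumplike (D v))"
proof (induction rule: bumplike.induct)
  case (const c)
  then show ?case by (intro exI[of _ "%v x. 0"]) (auto intro: bumplike.const)
next
  case (zeta m c b d)
  let ?D = "%v x. (- real m * zeta (m + 1) (c * (x \<bullet> b) + d) + zeta (m + 2) (c * (x \<bullet> b) + d)) * (c * (v \<bullet> b))"
  have "((%x. zeta m (c * (x \<bullet> b) + d)) has_derivative (%v. ?D v x)) (at x)" for x
  proof -
    have 1: "((%x. c * (x \<bullet> b) + d) has_derivative (%v. c * (v \<bullet> b))) (at x)"
      by (auto intro!: derivative_eq_intros)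
    have "(zeta m has_derivative (%t. (- real m * zeta (m + 1) (c * (x \<bullet> b) + d) + zeta (m + 2) (c * (x \<bullet> b) + d)) * t)) (at (c * (x \<bullet> b) + d))"
      using zeta_deriv[of m "c * (x \<bullet> b) + d"] by (simp add: has_field_derivative_def)
    from has_derivative_compose[OF 1 this] show ?thesis by simp
  qed
  moreover have "bumplike (?D v)" for v
    by (intro bumplike.intros)
  ultimately show ?case by (intro exI[of _ ?D]) auto
next
  case (add f g)
  then obtain D E where "\<forall>x. (f has_derivative (%v. D v x)) (at x)" "\<forall>v. bumplike (D v)"
    "\<forall>x. (g has_derivative (%v. E v x)) (at x)" "\<forall>v. bumplike (E v)" by blast
  then show ?case
    by (intro exI[of _ "%v x. D v x + E v x"]) (auto intro!: has_derivative_add bumplike.add)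
next
  case (mult f g)
  then obtain D E where "\<forall>x. (f has_derivative (%v. D v x)) (at x)" "\<forall>v. bumplike (D v)"
    "\<forall>x. (g has_derivative (%v. E v x)) (at x)" "\<forall>v. bumplike (E v)" by blast
  then show ?case using mult
    by (intro exI[of _ "%v x. f x * E v x + D v x * g x"]) (auto intro!: has_derivative_mult bumplike.intros)
qed

lemma bumplike_Ck: "bumplike f ==> Ck_on k UNIV f"
proof (induction k arbitrary: f)
  case 0
  then obtain D where "\<forall>x. (f has_derivative (%v. D v x)) (at x)" using bumplike_deriv by blast
  then show ?case by (auto intro!: has_derivative_continuous_on intro: has_derivative_at_withinI)
next
  case (Suc k)
  obtain D where D: "!!x. (f has_derivative (%v. D v x)) (at x)" "!!v. bumplike (D v)"
    using bumplike_deriv[OF Suc.prems] by blast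
  have "frechet_derivative f (at x) = (%v. D v x)" for x using frechet_derivative_at[OF D(1)] by simp
  then show ?case using D Suc.IH by (auto simp: differentiable_def)
qed

lemma bumplike_prod: "finite A ==> (!!i. i \<in> A ==> bumplike (f i)) ==> bumplike (%x. \<Prod>i\<in>A. f i x)"
  by (induction A rule: finite_induct) (auto intro: bumplike.intros)

text \<open>Positive exactly on the open box. Each factor tends to 1 as n grows, so the bumps tend
  pointwise to the indicator of the box while staying below 1.\<close>

definition bump :: "real => 'a::euclidean_space => 'a => 'a => real" where
  "bump n a b x = (\<Prod>i\<in>Basis. zeta 0 (n * (x \<bullet> i) + - n * (a \<bullet> i)) * zeta 0 (- n * (x \<bullet> i) + n * (b \<bullet> i)))"

lemma zeta0_range: "0 \<le> zeta 0 t" "zeta 0 t \<le> 1" by (auto simp: zeta_def)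

lemma bump_range: "0 \<le> bump n a b x" "bump n a b x \<le> 1"
  unfolding bump_def by (auto intro!: prod_nonneg prod_le_1 mult_nonneg_nonneg mult_le_one zeta0_range)

lemma bump_pos_iff: assumes "n > 0" shows "bump n a b x \<noteq> 0 \<longleftrightarrow> x \<in> box a b"
proof -
  have "zeta 0 (n * (x \<bullet> i) + - n * (a \<bullet> i)) \<noteq> 0 \<longleftrightarrow> a \<bullet> i < x \<bullet> i" for i
    using assms by (auto simp: zeta_def)
  moreover have "zeta 0 (- n * (x \<bullet> i) + n * (b \<bullet> i)) \<noteq> 0 \<longleftrightarrow> x \<bullet> i < b \<bullet> i" for i
    using assms by (auto simp: zeta_def)
  ultimately show ?thesis by (simp add: bump_def box_def)
qed

lemma bump_test_fns:
  assumes "n > 0" "cbox a b \<subseteq> \<Omega>" shows "bump n a b \<in> test_fns \<Omega>"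
proof -
  have "bumplike (bump n a b)" unfolding bump_def[abs_def]
    by (intro bumplike_prod bumplike.mult bumplike.zeta) auto
  then have "smooth_on UNIV (bump n a b)" by (simp add: smooth_on_def bumplike_Ck)
  moreover have sub: "closure {x. bump n a b x \<noteq> 0} \<subseteq> cbox a b"
    by (intro closure_minimal) (auto simp: bump_pos_iff[OF assms(1)] intro: box_subset_cbox[THEN subsetD])
  moreover have "compact (closure {x. bump n a b x \<noteq> 0})"
    using sub by (meson bounded_subset bounded_cbox closed_closure compact_eq_bounded_closed)
  ultimately show ?thesis using assms(2) by (auto simp: test_fns_def)
qed

lemma bump_tendsto: "(%n. bump (real (Suc n)) a b x) \<longlonglongrightarrow> indicat_real (box a b) x"
proof (cases "x \<in> box a b")
  case True
  have z: "(%n. zeta 0 (real (Suc n) * c)) \<longlonglongrightarrow> 1" if "c > 0" for c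
  proof -
    have "(%n. exp (- (inverse (real (Suc n)) * (1 / c)))) \<longlonglongrightarrow> exp (- (0 * (1 / c)))"
      by (intro tendsto_intros LIMSEQ_inverse_real_of_nat)
    moreover have "0 < c + c * real n" for n using that by (intro add_pos_nonneg) auto
    ultimately show ?thesis using that by (simp add: zeta_def field_simps)
  qed
  have "(%n. \<Prod>i\<in>Basis. zeta 0 (real (Suc n) * (x \<bullet> i - a \<bullet> i)) * zeta 0 (real (Suc n) * (b \<bullet> i - x \<bullet> i)))
      \<longlonglongrightarrow> (\<Prod>i\<in>(Basis::'a set). 1 * 1)"
    using True by (intro tendsto_prod tendsto_mult z) (auto simp: box_def)
  then show ?thesis using True by (simp add: bump_def algebra_simps)
next
  case False
  then have "bump (real (Suc n)) a b x = 0" for n using bump_pos_iff[of "real (Suc n)" a b x] by simp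
  then show ?thesis using False by simp
qed

definition grad :: "('a::euclidean_space => real) => 'a => 'a" where
  "grad \<phi> x = (\<Sum>i\<in>Basis. frechet_derivative \<phi> (at x) i *\<^sub>R i)"

lemma grad_eqI:
  assumes "(\<phi> has_derivative (%v. w \<bullet> v)) (at x)" shows "grad \<phi> x = w"
  unfolding grad_def using frechet_derivative_at[OF assms, symmetric] by (simp add: euclidean_representation)

lemma test_fns_Ck: "\<phi> \<in> test_fns \<Omega> ==> Ck_on k UNIV \<phi>"
  by (simp add: test_fns_def smooth_on_def)

lemma test_fns_has_derivative:
  assumes "\<phi> \<in> test_fns \<Omega>" shows "(\<phi> has_derivative (%v. grad \<phi> x \<bullet> v)) (at x)"
proof -
  have "\<phi> differentiable (at x)" using test_fns_Ck[OF assms, of 1] by simp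
  then have d: "(\<phi> has_derivative frechet_derivative \<phi> (at x)) (at x)" by (simp add: frechet_derivative_works)
  then interpret bounded_linear "frechet_derivative \<phi> (at x)" by (rule has_derivative_bounded_linear)
  have "frechet_derivative \<phi> (at x) v = grad \<phi> x \<bullet> v" for v
  proof -
    have "frechet_derivative \<phi> (at x) v = frechet_derivative \<phi> (at x) (\<Sum>i\<in>Basis. (v \<bullet> i) *\<^sub>R i)"
      by (simp add: euclidean_representation)
    also have "\<dots> = grad \<phi> x \<bullet> v"
      by (simp add: sum scaleR grad_def inner_sum_left, intro sum.cong) (auto simp: inner_commute mult.commute)
    finally show ?thesis .
  qed
  then show ?thesis using d by presburger
qed

lemma test_fns_grad_inner:
  assumes "i \<in> Basis" shows "grad \<phi> x \<bullet> i = frechet_derivative \<phi> (at x) i"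
  using assms by (simp add: grad_def inner_sum_left inner_Basis if_distrib sum.delta cong: if_cong)

lemma test_fns_continuous: "\<phi> \<in> test_fns \<Omega> ==> continuous_on S \<phi>"
  using test_fns_Ck[of \<phi> \<Omega> 0] by (auto intro: continuous_on_subset)

lemma test_fns_grad_continuous: assumes "\<phi> \<in> test_fns \<Omega>" shows "continuous_on S (grad \<phi>)"
proof -
  have "continuous_on UNIV (%x. frechet_derivative \<phi> (at x) i)" if "i \<in> Basis" for i
    using test_fns_Ck[OF assms, of 1] that by simp
  then have "continuous_on UNIV (grad \<phi>)" unfolding grad_def by (intro continuous_intros) auto
  then show ?thesis by (auto intro: continuous_on_subset)
qed

lemma test_fns_support:
  assumes "\<phi> \<in> test_fns \<Omega>"
  obtains K where "compact K" "K \<subseteq> \<Omega>" "!!x. x \<notin> K ==> \<phi> x = 0" "!!x. x \<notin> K ==> grad \<phi> x = 0"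
proof
  let ?K = "closure {x. \<phi> x \<noteq> 0}"
  show "compact ?K" "?K \<subseteq> \<Omega>" using assms by (auto simp: test_fns_def)
  show 0: "\<phi> x = 0" if "x \<notin> ?K" for x using that closure_subset[of "{x. \<phi> x \<noteq> 0}"] by auto
  show "grad \<phi> x = 0" if "x \<notin> ?K" for x
  proof (rule grad_eqI)
    have "((%x. 0) has_derivative (%v. 0 \<bullet> v)) (at x)" by simp
    then show "(\<phi> has_derivative (%v. 0 \<bullet> v)) (at x)"
    proof (rule has_derivative_transform_within_open[where s = "- ?K"])
      show "0 = \<phi> y" if "y \<in> - ?K" for y using 0[of y] that by simp
    qed (use \<open>x \<notin> ?K\<close> in \<open>simp_all add: open_Compl\<close>)
  qed
qed

lemma test_fns_zero_outside: "\<phi> \<in> test_fns \<Omega> ==> x \<notin> \<Omega> ==> \<phi> x = 0 \<and> grad \<phi> x = 0"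
  by (metis test_fns_support subsetD)

lemma test_fns_bounded:
  assumes "\<phi> \<in> test_fns \<Omega>" obtains B where "B \<ge> 0" "!!x. \<bar>\<phi> x\<bar> \<le> B" "!!x. norm (grad \<phi> x) \<le> B"
proof -
  obtain K where K: "compact K" "!!x. x \<notin> K ==> \<phi> x = 0" "!!x. x \<notin> K ==> grad \<phi> x = 0"
    using test_fns_support[OF assms] by metis
  have "bounded (\<phi> ` K)" "bounded (grad \<phi> ` K)"
    using K(1) test_fns_continuous[OF assms] test_fns_grad_continuous[OF assms]
    by (auto intro: compact_imp_bounded compact_continuous_image)
  then obtain B1 B2 where B: "!!x. x \<in> K ==> \<bar>\<phi> x\<bar> \<le> B1" "!!x. x \<in> K ==> norm (grad \<phi> x) \<le> B2"
    unfolding bounded_iff by auto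
  show thesis
  proof (rule that[of "max 0 (max B1 B2)"])
    show "\<bar>\<phi> x\<bar> \<le> max 0 (max B1 B2)" for x using B(1)[of x] K(2)[of x] by (cases "x \<in> K") auto
    show "norm (grad \<phi> x) \<le> max 0 (max B1 B2)" for x using B(2)[of x] K(3)[of x] by (cases "x \<in> K") auto
  qed simp
qed

lemma Ck_on_lincomb:
  "Ck_on k UNIV f ==> Ck_on k UNIV g ==> Ck_on k UNIV (%x. c * f x + d * g x)"
proof (induction k arbitrary: f g)
  case 0
  then show ?case by (auto intro!: continuous_intros)
next
  case (Suc k)
  have D: "((%x. c * f x + d * g x) has_derivative (%v. c * frechet_derivative f (at x) v + d * frechet_derivative g (at x) v)) (at x)" for x
  proof -
    have "(f has_derivative frechet_derivative f (at x)) (at x)" "(g has_derivative frechet_derivative g (at x)) (at x)"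
      using Suc.prems by (simp_all add: frechet_derivative_works[symmetric])
    then show ?thesis by (auto intro!: derivative_eq_intros)
  qed
  have "frechet_derivative (%x. c * f x + d * g x) (at x) = (%v. c * frechet_derivative f (at x) v + d * frechet_derivative g (at x) v)" for x
    using frechet_derivative_at[OF D] by simp
  then show ?case using D Suc by (auto simp: differentiable_def)
qed

lemma test_fns_lincomb:
  assumes "\<phi> \<in> test_fns \<Omega>" "\<psi> \<in> test_fns \<Omega>" shows "(%x. c * \<phi> x + d * \<psi> x) \<in> test_fns \<Omega>"
proof -
  have "closure {x. c * \<phi> x + d * \<psi> x \<noteq> 0} \<subseteq> closure ({x. \<phi> x \<noteq> 0} \<union> {x. \<psi> x \<noteq> 0})"
    by (intro closure_mono) auto
  then have sub: "closure {x. c * \<phi> x + d * \<psi> x \<noteq> 0} \<subseteq> closure {x. \<phi> x \<noteq> 0} \<union> closure {x. \<psi> x \<noteq> 0}"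
    by (simp add: closure_Un)
  have "compact (closure {x. \<phi> x \<noteq> 0} \<union> closure {x. \<psi> x \<noteq> 0})"
    using assms by (intro compact_Un) (auto simp: test_fns_def)
  then have "compact (closure {x. c * \<phi> x + d * \<psi> x \<noteq> 0})"
    using compact_Int_closed[OF _ closed_closure[of "{x. c * \<phi> x + d * \<psi> x \<noteq> 0}"]] Int_absorb1[OF sub] by fastforce
  then show ?thesis using sub assms by (auto simp: test_fns_def smooth_on_def intro!: Ck_on_lincomb)
qed

lemma grad_lincomb:
  assumes "\<phi> \<in> test_fns \<Omega>" "\<psi> \<in> test_fns \<Omega>" shows "grad (%x. c * \<phi> x + d * \<psi> x) x = c *\<^sub>R grad \<phi> x + d *\<^sub>R grad \<psi> x"
  by (rule grad_eqI) (use test_fns_has_derivative[OF assms(1)] test_fns_has_derivative[OF assms(2)] in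
    \<open>auto intro!: derivative_eq_intros simp: inner_add_left\<close>)

lemma integrable_compact_support:
  fixes f :: "'a::euclidean_space => 'b::euclidean_space"
  assumes "compact K" "continuous_on UNIV f" "!!x. x \<notin> K ==> f x = 0"
  shows "integrable lborel f"
proof -
  have "integrable lborel (%x. indicat_real K x *\<^sub>R f x)"
    by (rule borel_integrable_compact[OF assms(1) continuous_on_subset[OF assms(2)]]) simp
  moreover have "(%x. indicat_real K x *\<^sub>R f x) = f" using assms(3) by (auto simp: indicator_def fun_eq_iff)
  ultimately show ?thesis by simp
qed

lemma integral_lborel_translate:
  fixes f :: "'a::euclidean_space => real"
  assumes "f \<in> borel_measurable borel" shows "(\<integral>x. f (c + x) \<partial>lborel) = (\<integral>x. f x \<partial>lborel)"
proof -
  have "(\<integral>x. f x \<partial>distr lborel borel ((+) c)) = (\<integral>x. f (c + x) \<partial>lborel)"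
    by (rule integral_distr) (use assms in auto)
  then show ?thesis by (simp add: lborel_distr_plus)
qed

text \<open>The integral of a translate does not depend on the translation; differentiating it in
  direction i at 0 gives the integral of the partial derivative.\<close>

lemma integral_partial_derivative_zero:
  fixes h :: "'a::euclidean_space => real"
  assumes d: "!!x. (h has_derivative (%v. g x \<bullet> v)) (at x)" and gc: "continuous_on UNIV g"
    and K: "compact K" "!!x. x \<notin> K ==> h x = 0" "!!x. x \<notin> K ==> g x = 0" and i: "i \<in> Basis"
  shows "(\<integral>x. g x \<bullet> i \<partial>lborel) = 0"
proof -
  have hc: "continuous_on UNIV h" using d by (intro has_derivative_continuous_on[where f' = "%x v. g x \<bullet> v"]) auto
  obtain R where R0: "R > 0" "\<forall>x\<in>K. norm x \<le> R"
    using compact_imp_bounded[OF K(1)] unfolding bounded_pos by blast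
  then have R: "R > 0" "K \<subseteq> cball 0 R" by auto
  obtain B where B: "!!x. norm (g x) \<le> B" "B \<ge> 0"
  proof -
    have "bounded (g ` K)" using gc K(1) by (intro compact_imp_bounded compact_continuous_image) (auto intro: continuous_on_subset)
    then obtain B where "!!x. x \<in> K ==> norm (g x) \<le> B" unfolding bounded_iff by auto
    then show thesis using K(3) by (intro that[of "max B 0"]) (metis max.coboundedI1 max.coboundedI2 norm_zero order_refl, simp)
  qed
  have int: "integrable lborel h" by (rule integrable_compact_support[OF K(1) hc K(2)])
  have hs: "integrable lborel (%x. h (x + s *\<^sub>R i))" for s
  proof (rule integrable_compact_support[of "(%x. x - s *\<^sub>R i) ` K"])
    show "compact ((%x. x - s *\<^sub>R i) ` K)" by (intro compact_continuous_image K continuous_intros)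
    show "continuous_on UNIV (%x. h (x + s *\<^sub>R i))"
      by (rule continuous_on_compose2[OF hc]) (auto intro!: continuous_intros)
    show "h (x + s *\<^sub>R i) = 0" if "x \<notin> (%x. x - s *\<^sub>R i) ` K" for x
      using that K(2) by (metis add_diff_cancel_right' image_eqI)
  qed
  have "((%s. \<integral>x. h (x + s *\<^sub>R i) \<partial>lborel) has_real_derivative (\<integral>x. g (x + 0 *\<^sub>R i) \<bullet> i \<partial>lborel)) (at 0)"
  proof (rule has_real_derivative_integral[where B = "%x. indicat_real (cball 0 (R + 1)) x *\<^sub>R B" and h' = "%s x. g (x + s *\<^sub>R i) \<bullet> i"])
    show "AE x in lborel. \<forall>s. \<bar>s\<bar> \<le> 1 --> ((%s. h (x + s *\<^sub>R i)) has_real_derivative g (x + s *\<^sub>R i) \<bullet> i) (at s)"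
    proof (intro AE_I2 allI impI)
      fix x s
      have "((%s. x + s *\<^sub>R i) has_derivative (%t. t *\<^sub>R i)) (at s)" by (auto intro!: derivative_eq_intros)
      from has_derivative_compose[OF this d]
      show "((%s. h (x + s *\<^sub>R i)) has_real_derivative g (x + s *\<^sub>R i) \<bullet> i) (at s)"
        by (simp add: has_field_derivative_def mult.commute[of _ "g (x + s *\<^sub>R i) \<bullet> i"])
    qed
    show "AE x in lborel. \<forall>s. \<bar>s\<bar> \<le> 1 --> \<bar>g (x + s *\<^sub>R i) \<bullet> i\<bar> \<le> indicat_real (cball 0 (R + 1)) x *\<^sub>R B"
    proof (intro AE_I2 allI impI)
      fix x s assume s: "\<bar>s\<bar> \<le> (1::real)"
      show "\<bar>g (x + s *\<^sub>R i) \<bullet> i\<bar> \<le> indicat_real (cball 0 (R + 1)) x *\<^sub>R B"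
      proof (cases "x + s *\<^sub>R i \<in> K")
        case True
        have "norm x \<le> norm (x + s *\<^sub>R i) + norm (s *\<^sub>R i)" by (metis add_diff_cancel_right' norm_triangle_ineq4)
        also have "\<dots> \<le> R + 1" using R(2) True s i by (intro add_mono) auto
        finally have "x \<in> cball 0 (R + 1)" by simp
        moreover have "\<bar>g (x + s *\<^sub>R i) \<bullet> i\<bar> \<le> B"
          using Basis_le_norm[OF i, of "g (x + s *\<^sub>R i)"] B(1)[of "x + s *\<^sub>R i"] by linarith
        ultimately show ?thesis by simp
      qed (use K(3) B(2) in auto)
    qed
    show "integrable lborel (%x. indicat_real (cball 0 (R + 1)) x *\<^sub>R B :: real)"
      by (intro borel_integrable_compact) auto
    show "(%x. g (x + 0 *\<^sub>R i) \<bullet> i) \<in> borel_measurable lborel"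
      using borel_measurable_continuous_onI[OF gc] by simp
  qed (use hs in auto)
  moreover have "(\<integral>x. h (x + s *\<^sub>R i) \<partial>lborel) = (\<integral>x. h x \<partial>lborel)" for s
    using integral_lborel_translate[of h "s *\<^sub>R i"] borel_measurable_continuous_onI[OF hc] by (simp add: add.commute)
  ultimately have "((%s. \<integral>x. h x \<partial>lborel) has_real_derivative (\<integral>x. g x \<bullet> i \<partial>lborel)) (at (0::real))" by simp
  from DERIV_unique[OF this DERIV_const] show ?thesis .
qed

lemma integral_lebesgue_on_eq_lborel:
  fixes F :: "'a::euclidean_space => 'b::euclidean_space"
  assumes "F \<in> borel_measurable borel" "!!x. x \<notin> \<Omega> ==> F x = 0" "\<Omega> \<in> sets lebesgue"
  shows "(\<integral>x. F x \<partial>lebesgue_on \<Omega>) = (\<integral>x. F x \<partial>lborel)"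
proof -
  have "(\<integral>x. F x \<partial>lebesgue_on \<Omega>) = (\<integral>x. indicat_real \<Omega> x *\<^sub>R F x \<partial>lebesgue)"
    by (rule integral_restrict_space) (use assms in auto)
  also have "(%x. indicat_real \<Omega> x *\<^sub>R F x) = F" using assms(2) by (auto simp: indicator_def fun_eq_iff)
  finally show ?thesis using assms(1) by (simp add: integral_completion)
qed

lemma test_fns_integration_by_parts:
  assumes \<phi>: "\<phi> \<in> test_fns \<Omega>" and \<psi>: "\<psi> \<in> test_fns \<Omega>" and \<Omega>: "open \<Omega>" and i: "i \<in> Basis"
  shows "(\<integral>x. \<phi> x * (grad \<psi> x \<bullet> i) \<partial>lebesgue_on \<Omega>) = - (\<integral>x. (grad \<phi> x \<bullet> i) * \<psi> x \<partial>lebesgue_on \<Omega>)"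
proof -
  obtain K where K: "compact K" "!!x. x \<notin> K ==> \<phi> x = 0" "!!x. x \<notin> K ==> grad \<phi> x = 0"
    using test_fns_support[OF \<phi>] by metis
  note c = test_fns_continuous[OF \<phi>] test_fns_continuous[OF \<psi>] test_fns_grad_continuous[OF \<phi>] test_fns_grad_continuous[OF \<psi>]
  let ?g = "%x. \<phi> x *\<^sub>R grad \<psi> x + \<psi> x *\<^sub>R grad \<phi> x"
  have "(\<integral>x. ?g x \<bullet> i \<partial>lborel) = 0"
  proof (rule integral_partial_derivative_zero[of "%x. \<phi> x * \<psi> x"])
    show "((%x. \<phi> x * \<psi> x) has_derivative (%v. ?g x \<bullet> v)) (at x)" for x
      using test_fns_has_derivative[OF \<phi>, of x] test_fns_has_derivative[OF \<psi>, of x]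
      by (auto intro!: derivative_eq_intros simp: inner_add_left algebra_simps)
    show "continuous_on UNIV ?g" by (intro continuous_intros c)
  qed (use K i in auto)
  moreover have i1: "integrable lborel (%x. \<phi> x * (grad \<psi> x \<bullet> i))"
    by (rule integrable_compact_support[OF K(1)]) (auto intro!: continuous_intros c simp: K)
  moreover have i2: "integrable lborel (%x. (grad \<phi> x \<bullet> i) * \<psi> x)"
    by (rule integrable_compact_support[OF K(1)]) (auto intro!: continuous_intros c simp: K)
  ultimately have "(\<integral>x. \<phi> x * (grad \<psi> x \<bullet> i) \<partial>lborel) = - (\<integral>x. (grad \<phi> x \<bullet> i) * \<psi> x \<partial>lborel)"
    by (simp add: inner_add_left mult.commute)
  moreover have "\<Omega> \<in> sets lebesgue" by (rule sets_completionI_sets) (simp add: \<Omega>)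
  ultimately show ?thesis
    using test_fns_zero_outside[OF \<phi>] borel_measurable_integrable[OF i1] borel_measurable_integrable[OF i2]
    by (subst (1 2) integral_lebesgue_on_eq_lborel) auto
qed

lemma indicator_box_measurable: "indicat_real (box a b) \<in> borel_measurable lebesgue"
  by (intro borel_measurable_indicator sets_completionI_sets) simp

text \<open>Bumps approximate indicators of boxes, so g integrates to zero over every box inside the
  domain; Lebesgue differentiation along shrinking cubes then gives g = 0 almost everywhere.\<close>

lemma fundamental_lemma_variations:
  fixes g :: "'a::euclidean_space => real"
  assumes \<Omega>: "open \<Omega>" and g: "loc_integrable \<Omega> g"
    and zero: "!!\<phi>. \<phi> \<in> test_fns \<Omega> ==> (\<integral>x. g x * \<phi> x \<partial>lebesgue_on \<Omega>) = 0"
  shows "AE x in lebesgue_on \<Omega>. g x = 0"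
proof -
  have \<Omega>s: "\<Omega> \<in> sets lebesgue" by (rule sets_completionI_sets) (simp add: \<Omega>)
  have gi: "integrable lebesgue (%x. indicat_real (cbox a b) x * g x)" if "cbox a b \<subseteq> \<Omega>" for a b
  proof -
    have "integrable (lebesgue_on (cbox a b)) g" using g that compact_cbox unfolding loc_integrable_def by blast
    then show ?thesis by (subst (asm) integrable_restrict_space) auto
  qed
  have box0: "(\<integral>x. indicat_real (box a b) x * g x \<partial>lebesgue) = 0" if ab: "cbox a b \<subseteq> \<Omega>" for a b
  proof -
    have "(%n. \<integral>x. indicat_real (cbox a b) x * g x * bump (real (Suc n)) a b x \<partial>lebesgue) \<longlonglongrightarrow>
        (\<integral>x. indicat_real (cbox a b) x * g x * indicat_real (box a b) x \<partial>lebesgue)"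
    proof (rule integral_dominated_convergence[where w = "%x. \<bar>indicat_real (cbox a b) x * g x\<bar>"])
      show "(%x. indicat_real (cbox a b) x * g x * bump (real (Suc n)) a b x) \<in> borel_measurable lebesgue" for n
      proof -
        have "bump (real (Suc n)) a b \<in> borel_measurable lebesgue"
          using borel_measurable_continuous_onI[OF test_fns_continuous[OF bump_test_fns[OF _ ab]], of "real (Suc n)"]
          by (simp add: measurable_completion)
        then show ?thesis using borel_measurable_integrable[OF gi[OF ab]] by simp
      qed
      show "(%x. indicat_real (cbox a b) x * g x * indicat_real (box a b) x) \<in> borel_measurable lebesgue"
        by (rule borel_measurable_times[OF borel_measurable_integrable[OF gi[OF ab]] indicator_box_measurable])
      show "AE x in lebesgue. (%n. indicat_real (cbox a b) x * g x * bump (real (Suc n)) a b x) \<longlonglongrightarrow> indicat_real (cbox a b) x * g x * indicat_real (box a b) x"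
        by (intro AE_I2 tendsto_mult tendsto_const bump_tendsto)
      show "AE x in lebesgue. norm (indicat_real (cbox a b) x * g x * bump (real (Suc n)) a b x) \<le> \<bar>indicat_real (cbox a b) x * g x\<bar>" for n
        using bump_range[of "real (Suc n)" a b] by (auto simp: abs_mult intro!: mult_left_le mult_nonneg_nonneg)
      show "integrable lebesgue (%x. \<bar>indicat_real (cbox a b) x * g x\<bar>)" using gi[OF ab] by (rule integrable_abs)
    qed
    moreover have "(\<integral>x. indicat_real (cbox a b) x * g x * bump (real (Suc n)) a b x \<partial>lebesgue) = 0" for n
    proof -
      let ?b = "bump (real (Suc n)) a b"
      have "(\<integral>x. g x * ?b x \<partial>lebesgue_on \<Omega>) = (\<integral>x. indicat_real \<Omega> x *\<^sub>R (g x * ?b x) \<partial>lebesgue)"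
        by (rule integral_restrict_space) (use \<Omega>s in auto)
      moreover have e: "indicat_real \<Omega> x *\<^sub>R (g x * ?b x) = indicat_real (cbox a b) x * g x * ?b x" for x
      proof (cases "x \<in> cbox a b")
        case False
        then have "?b x = 0" using bump_pos_iff[of "real (Suc n)" a b x] box_subset_cbox by auto
        then show ?thesis by simp
      qed (use ab in auto)
      ultimately show ?thesis using zero[OF bump_test_fns[OF _ ab], of "real (Suc n)"] unfolding e by simp
    qed
    moreover have "indicat_real (cbox a b) x * g x * indicat_real (box a b) x = indicat_real (box a b) x * g x" for x
      using box_subset_cbox by (auto simp: indicator_def)
    ultimately show ?thesis by (simp add: LIMSEQ_const_iff)
  qed
  have cb0: "negligible {x \<in> cbox c d. g x \<noteq> 0}" if cd: "cbox c d \<subseteq> \<Omega>" for c d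
  proof -
    define f where "f x = indicat_real (cbox c d) x * g x" for x
    have fai: "f absolutely_integrable_on S" if "S \<in> sets lebesgue" for S
      unfolding set_integrable_def f_def[abs_def] by (rule integrable_mult_indicator[OF that gi[OF cd]])
    then have fi: "f integrable_on cbox a b" for a b by (rule set_lebesgue_integral_eq_integral(1)) simp
    \<comment> \<open>Lebesgue's differentiation theorem over cubes with lower corner x.\<close>
    obtain N where N: "negligible N" "!!x e. x \<notin> N ==> 0 < e ==> \<exists>\<delta>>0. \<forall>h. 0 < h \<and> h < \<delta> -->
        norm (integral (cbox x (x + h *\<^sub>R One)) f /\<^sub>R h ^ DIM('a) - f x) < e"
      using integrable_ccontinuous_explicit[OF fi] by metis
    have "g x = 0" if x: "x \<in> box c d" "x \<notin> N" for x
    proof (rule ccontr)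
      assume "g x \<noteq> 0"
      then have "f x \<noteq> 0" using x box_subset_cbox by (auto simp: f_def indicator_def)
      then obtain \<delta> where \<delta>: "\<delta> > 0" "!!h. 0 < h \<and> h < \<delta> ==> norm (integral (cbox x (x + h *\<^sub>R One)) f /\<^sub>R h ^ DIM('a) - f x) < norm (f x)"
        using N(2)[OF x(2), of "norm (f x)"] by auto
      have "((%h. x + h *\<^sub>R One) \<longlongrightarrow> x + 0 *\<^sub>R One) (at_right 0)" by (intro tendsto_intros)
      then have "\<forall>\<^sub>F h in at_right 0. x + h *\<^sub>R One \<in> box c d" using topological_tendstoD[OF _ open_box] x by fastforce
      from eventually_happens[OF eventually_conj[OF this eventually_at_right_real[OF \<delta>(1)]]]
      obtain h where h: "x + h *\<^sub>R One \<in> box c d" "0 < h" "h < \<delta>" by (auto simp: trivial_limit_at_right_real)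
      have sub: "cbox x (x + h *\<^sub>R One) \<subseteq> cbox c d"
        using x(1) h(1) box_subset_cbox[of c d] by (intro subset_box_imp) (auto simp: mem_box intro: less_imp_le)
      have "integral (cbox x (x + h *\<^sub>R One)) f = integral (box x (x + h *\<^sub>R One)) f" by (rule integral_open_interval[symmetric])
      also have "\<dots> = (\<integral>y. indicat_real (box x (x + h *\<^sub>R One)) y *\<^sub>R f y \<partial>lebesgue)"
        using set_lebesgue_integral_eq_integral(2)[OF fai, of "box x (x + h *\<^sub>R One)"] by (simp add: set_lebesgue_integral_def)
      also have "\<dots> = (\<integral>y. indicat_real (box x (x + h *\<^sub>R One)) y * g y \<partial>lebesgue)"
        using sub box_subset_cbox[of x "x + h *\<^sub>R One"] by (intro integral_cong) (auto simp: f_def indicator_def)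
      also have "\<dots> = 0" using box0 sub cd by blast
      finally show False using \<delta>(2)[of h] h by simp
    qed
    then have "{x \<in> cbox c d. g x \<noteq> 0} \<subseteq> N \<union> (cbox c d - box c d)" by auto
    then show ?thesis using N(1) negligible_frontier_interval negligible_Un negligible_subset by metis
  qed
  obtain \<D> where D: "countable \<D>" "\<D> \<subseteq> Pow \<Omega>" "!!X. X \<in> \<D> ==> \<exists>a b. X = cbox a b" "\<Union> \<D> = \<Omega>"
    using open_countable_Union_open_cbox[OF \<Omega>] by metis
  have "negligible (\<Union>X\<in>\<D>. {x \<in> X. g x \<noteq> 0})"
  proof (rule negligible_countable_Union)
    show "negligible S" if S: "S \<in> (%X. {x \<in> X. g x \<noteq> 0}) ` \<D>" for S
    proof -
      obtain X where X: "X \<in> \<D>" "S = {x \<in> X. g x \<noteq> 0}" using S by blast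
      obtain a b where "X = cbox a b" using D(3)[OF X(1)] by blast
      then show ?thesis using cb0[of a b] X D(2) by auto
    qed
  qed (use D(1) in auto)
  moreover have "{x. \<not> (x \<in> \<Omega> --> g x = 0)} \<subseteq> (\<Union>X\<in>\<D>. {x \<in> X. g x \<noteq> 0})" using D(4) by auto
  ultimately have "AE x in lebesgue. x \<in> \<Omega> --> g x = 0"
    unfolding eventually_ae_filter_negligible by blast
  then show ?thesis using \<Omega>s by (subst AE_restrict_space_iff) auto
qed

section \<open>Sobolev functions with zero boundary values\<close>

locale bdomain =
  fixes \<Omega> :: "'a::euclidean_space set"
  assumes open_dom: "open \<Omega>" and bounded_dom: "bounded \<Omega>"
begin

abbreviation "L \<equiv> lebesgue_on \<Omega>"

abbreviation "sint Q F \<equiv> (\<integral>x. indicat_real Q x * (F x :: real) \<partial>L)"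
abbreviation "bint Q F \<equiv> (\<integral>x. indicat_real Q x * (F x :: real) \<partial>lborel)"

lemma dom_sets: "\<Omega> \<in> sets lebesgue"
  by (rule sets_completionI_sets) (simp add: open_dom)

lemma dom_lmeasurable: "\<Omega> \<in> lmeasurable"
  by (rule lmeasurable_open[OF bounded_dom open_dom])

lemma finite_measure_dom: "finite_measure L"
  by (rule finite_measure_lebesgue_on[OF dom_lmeasurable])

lemma borel_imp_measurable_dom: "f \<in> borel_measurable borel ==> f \<in> borel_measurable L"
  by (intro measurable_restrict_space1 measurable_completion) simp

lemma test_fn_measurable: "\<phi> \<in> test_fns \<Omega> ==> \<phi> \<in> borel_measurable L"
  by (intro borel_imp_measurable_dom borel_measurable_continuous_onI test_fns_continuous)

lemma grad_measurable: "\<phi> \<in> test_fns \<Omega> ==> grad \<phi> \<in> borel_measurable L"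
  by (intro borel_imp_measurable_dom borel_measurable_continuous_onI test_fns_grad_continuous)

lemma loc_integrable_times_bounded:
  fixes g :: "'a => real"
  assumes g: "loc_integrable \<Omega> g" and K: "compact K" "K \<subseteq> \<Omega>" and \<psi>: "continuous_on UNIV \<psi>"
    "!!x. x \<notin> K ==> \<psi> x = 0" "!!x. \<bar>\<psi> x\<bar> \<le> B"
  shows "integrable L (%x. g x * \<psi> x)"
proof -
  let ?g = "%x. indicat_real K x * g x"
  have Ks: "K \<in> sets lebesgue" by (rule sets_completionI_sets) (simp add: K compact_imp_closed)
  have "integrable (lebesgue_on K) g" using g K by (auto simp: loc_integrable_def)
  then have 1: "integrable lebesgue (%x. indicat_real K x * g x)" using Ks by (subst (asm) integrable_restrict_space) auto
  have \<psi>m: "\<psi> \<in> borel_measurable lebesgue"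
    by (intro measurable_completion) (simp add: borel_measurable_continuous_onI[OF \<psi>(1)])
  have "integrable lebesgue (%x. ?g x * \<psi> x)"
  proof (rule integrable_bound[where f = "%x. B * ?g x"])
    show "integrable lebesgue (%x. B * ?g x)" using 1 by simp
    show "(%x. ?g x * \<psi> x) \<in> borel_measurable lebesgue"
      using borel_measurable_integrable[OF 1] \<psi>m by (rule borel_measurable_times)
    show "AE x in lebesgue. norm (?g x * \<psi> x) \<le> norm (B * ?g x)"
    proof (intro AE_I2)
      fix x
      have "\<bar>\<psi> x\<bar> \<le> \<bar>B\<bar>" using \<psi>(3)[of x] by linarith
      then have "\<bar>indicat_real K x * g x\<bar> * \<bar>\<psi> x\<bar> \<le> \<bar>indicat_real K x * g x\<bar> * \<bar>B\<bar>" by (intro mult_left_mono) auto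
      then show "norm (?g x * \<psi> x) \<le> norm (B * ?g x)"
        by (simp add: abs_mult mult.commute mult.left_commute)
    qed
  qed
  moreover have "?g x * \<psi> x = indicat_real \<Omega> x * (g x * \<psi> x)" for x
    using K(2) \<psi>(2)[of x] by (auto simp: indicator_def)
  ultimately show ?thesis using dom_sets by (subst integrable_restrict_space) auto
qed

lemma loc_integrable_times_test:
  assumes "loc_integrable \<Omega> g" "\<phi> \<in> test_fns \<Omega>"
  shows "integrable L (%x. g x * \<phi> x)"
    and "i \<in> Basis ==> integrable L (%x. g x * frechet_derivative \<phi> (at x) i)"
proof -
  obtain K where K: "compact K" "K \<subseteq> \<Omega>" "!!x. x \<notin> K ==> \<phi> x = 0" "!!x. x \<notin> K ==> grad \<phi> x = 0"
    using test_fns_support[OF assms(2)] by metis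
  obtain B where B: "!!x. \<bar>\<phi> x\<bar> \<le> B" "!!x. norm (grad \<phi> x) \<le> B" using test_fns_bounded[OF assms(2)] by metis
  show "integrable L (%x. g x * \<phi> x)"
    by (rule loc_integrable_times_bounded[OF assms(1) K(1,2) test_fns_continuous[OF assms(2)] K(3) B(1)])
  assume i: "i \<in> Basis"
  have "integrable L (%x. g x * (grad \<phi> x \<bullet> i))"
  proof (rule loc_integrable_times_bounded[OF assms(1) K(1,2), where B = B])
    show "continuous_on UNIV (%x. grad \<phi> x \<bullet> i)" by (intro continuous_intros test_fns_grad_continuous[OF assms(2)])
    show "\<bar>grad \<phi> x \<bullet> i\<bar> \<le> B" for x using Basis_le_norm[OF i, of "grad \<phi> x"] B(2)[of x] by linarith
  qed (simp add: K(4))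
  then show "integrable L (%x. g x * frechet_derivative \<phi> (at x) i)"
    using i by (simp add: test_fns_grad_inner)
qed

lemma loc_integrable_inner: "loc_integrable \<Omega> g ==> loc_integrable \<Omega> (%x. g x \<bullet> i)"
  by (auto simp: loc_integrable_def)

lemma loc_integrable_lincomb:
  fixes f g :: "'a => 'b::euclidean_space"
  shows "loc_integrable \<Omega> f ==> loc_integrable \<Omega> g ==> loc_integrable \<Omega> (%x. a *\<^sub>R f x + b *\<^sub>R g x)"
  by (auto simp: loc_integrable_def)

lemma loc_integrable_of_integrable:
  fixes f :: "'a => 'b::euclidean_space"
  assumes "integrable L f" shows "loc_integrable \<Omega> f"
  unfolding loc_integrable_def
proof (intro allI impI)
  fix K assume K: "compact K \<and> K \<subseteq> \<Omega>"
  have Ks: "K \<in> sets lebesgue" by (rule sets_completionI_sets) (use K in \<open>simp add: compact_imp_closed\<close>)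
  have "integrable lebesgue (%x. indicat_real \<Omega> x *\<^sub>R f x)"
    using assms dom_sets by (subst (asm) integrable_restrict_space) auto
  then have "integrable lebesgue (%x. indicat_real K x *\<^sub>R (indicat_real \<Omega> x *\<^sub>R f x))"
    by (rule integrable_mult_indicator[OF Ks])
  moreover have e: "indicat_real K x *\<^sub>R (indicat_real \<Omega> x *\<^sub>R f x) = indicat_real K x *\<^sub>R f x" for x
    using K by (auto simp: indicator_def)
  ultimately have "integrable lebesgue (%x. indicat_real K x *\<^sub>R f x)" by (simp only: e)
  then show "integrable (lebesgue_on K) f" using Ks by (subst integrable_restrict_space) auto
qed

lemma loc_integrable_measurable:
  fixes f :: "'a => 'b::euclidean_space"
  assumes "loc_integrable \<Omega> f" shows "f \<in> borel_measurable L"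
proof -
  obtain \<D> where D: "countable \<D>" "\<D> \<subseteq> Pow \<Omega>" "!!X. X \<in> \<D> ==> \<exists>a b. X = cbox a b" "\<Union> \<D> = \<Omega>"
    using open_countable_Union_open_cbox[OF open_dom] by metis
  have Xs: "X \<in> sets lebesgue" "X \<subseteq> \<Omega>" "compact X" if "X \<in> \<D>" for X
    using D(2) D(3)[OF that] that by (auto intro: sets_completionI_sets)
  show ?thesis
  proof (rule measurable_piecewise_restrict[OF D(1)])
    fix X assume X: "X \<in> \<D>"
    show "X \<inter> space L \<in> sets L"
      using Xs[OF X] dom_sets by (auto simp: sets_restrict_space image_iff intro!: bexI[of _ X])
    have "restrict_space L X = lebesgue_on (\<Omega> \<inter> X)"
      using Xs[OF X] dom_sets by (intro restrict_restrict_space) auto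
    also have "\<Omega> \<inter> X = X" using Xs[OF X] by auto
    finally show "f \<in> borel_measurable (restrict_space L X)"
      using assms Xs[OF X] by (auto simp: loc_integrable_def intro: borel_measurable_integrable)
  qed (use D(4) in auto)
qed

text \<open>Makes the choice in \<open>wgrad\<close> harmless: any two candidates differ on a null
  set only, so a convenient gradient may replace the chosen one under every integral.\<close>

lemma weak_gradient_unique:
  assumes g: "has_weak_gradient \<Omega> u g" and h: "has_weak_gradient \<Omega> u h"
  shows "AE x in L. g x = h x"
proof -
  have gl: "loc_integrable \<Omega> g" "loc_integrable \<Omega> h" using g h by (auto simp: has_weak_gradient_def)
  have "AE x in L. g x \<bullet> i + (- 1) * (h x \<bullet> i) = 0" if i: "i \<in> Basis" for i
  proof (rule fundamental_lemma_variations[OF open_dom])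
    have gi: "loc_integrable \<Omega> (%x. g x \<bullet> i)" "loc_integrable \<Omega> (%x. h x \<bullet> i)"
      using gl by (auto intro: loc_integrable_inner)
    show "loc_integrable \<Omega> (%x. g x \<bullet> i + (- 1) * (h x \<bullet> i))"
      using loc_integrable_lincomb[OF gi, of 1 "-1"] by simp
    fix \<phi> assume \<phi>: "\<phi> \<in> test_fns \<Omega>"
    have "(\<integral>x. (g x \<bullet> i) * \<phi> x \<partial>L) = (\<integral>x. (h x \<bullet> i) * \<phi> x \<partial>L)"
      using g h i \<phi> by (auto simp: has_weak_gradient_def)
    then show "(\<integral>x. (g x \<bullet> i + (- 1) * (h x \<bullet> i)) * \<phi> x \<partial>L) = 0"
      using loc_integrable_times_test(1)[OF gi(1) \<phi>] loc_integrable_times_test(1)[OF gi(2) \<phi>]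
      by (simp add: left_diff_distrib)
  qed
  then have "AE x in L. \<forall>i\<in>Basis. g x \<bullet> i + (- 1) * (h x \<bullet> i) = 0"
    by (intro AE_finite_allI) auto
  then show ?thesis by eventually_elim (auto intro: euclidean_eqI)
qed

lemma weak_gradient_lincomb:
  assumes g: "has_weak_gradient \<Omega> u g" and h: "has_weak_gradient \<Omega> v h"
  shows "has_weak_gradient \<Omega> (%x. a * u x + b * v x) (%x. a *\<^sub>R g x + b *\<^sub>R h x)"
  unfolding has_weak_gradient_def
proof (intro conjI ballI)
  have l: "loc_integrable \<Omega> u" "loc_integrable \<Omega> v" "loc_integrable \<Omega> g" "loc_integrable \<Omega> h"
    using g h by (auto simp: has_weak_gradient_def)
  show "loc_integrable \<Omega> (%x. a * u x + b * v x)" using loc_integrable_lincomb[OF l(1,2), of a b] by simp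
  show "loc_integrable \<Omega> (%x. a *\<^sub>R g x + b *\<^sub>R h x)" by (rule loc_integrable_lincomb[OF l(3,4)])
  fix i \<phi> assume i: "i \<in> (Basis :: 'a set)" and \<phi>: "\<phi> \<in> test_fns \<Omega>"
  note T = loc_integrable_times_test(2)[OF l(1) \<phi> i] loc_integrable_times_test(2)[OF l(2) \<phi> i]
    loc_integrable_times_test(1)[OF loc_integrable_inner[OF l(3), of i] \<phi>] loc_integrable_times_test(1)[OF loc_integrable_inner[OF l(4), of i] \<phi>]
  have "(\<integral>x. (a * u x + b * v x) * frechet_derivative \<phi> (at x) i \<partial>L)
      = (\<integral>x. a * (u x * frechet_derivative \<phi> (at x) i) + b * (v x * frechet_derivative \<phi> (at x) i) \<partial>L)"
    by (simp add: algebra_simps)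
  also have "\<dots> = a * (\<integral>x. u x * frechet_derivative \<phi> (at x) i \<partial>L) + b * (\<integral>x. v x * frechet_derivative \<phi> (at x) i \<partial>L)"
    using T by simp
  also have "\<dots> = - (a * (\<integral>x. (g x \<bullet> i) * \<phi> x \<partial>L) + b * (\<integral>x. (h x \<bullet> i) * \<phi> x \<partial>L))"
    using g h i \<phi> by (simp add: has_weak_gradient_def)
  also have "\<dots> = - (\<integral>x. a * ((g x \<bullet> i) * \<phi> x) + b * ((h x \<bullet> i) * \<phi> x) \<partial>L)"
    using T by simp
  also have "(\<integral>x. a * ((g x \<bullet> i) * \<phi> x) + b * ((h x \<bullet> i) * \<phi> x) \<partial>L) = (\<integral>x. ((a *\<^sub>R g x + b *\<^sub>R h x) \<bullet> i) * \<phi> x \<partial>L)"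
    by (simp add: inner_add_left algebra_simps)
  finally show "(\<integral>x. (a * u x + b * v x) * frechet_derivative \<phi> (at x) i \<partial>L)
      = - (\<integral>x. ((a *\<^sub>R g x + b *\<^sub>R h x) \<bullet> i) * \<phi> x \<partial>L)" .
qed

lemma integrable_continuous_bounded:
  fixes f :: "'a => 'b::euclidean_space"
  assumes "continuous_on UNIV f" "!!x. norm (f x) \<le> B"
  shows "integrable L f"
proof -
  interpret finite_measure L by (rule finite_measure_dom)
  show ?thesis
    by (rule integrable_const_bound[where B = B])
       (use assms in \<open>auto intro: borel_imp_measurable_dom borel_measurable_continuous_onI\<close>)
qed

lemma weak_gradient_test:
  assumes "\<phi> \<in> test_fns \<Omega>" shows "has_weak_gradient \<Omega> \<phi> (grad \<phi>)"
  unfolding has_weak_gradient_def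
proof (intro conjI ballI)
  obtain B where B: "!!x. \<bar>\<phi> x\<bar> \<le> B" "!!x. norm (grad \<phi> x) \<le> B" using test_fns_bounded[OF assms] by metis
  show "loc_integrable \<Omega> \<phi>"
    by (intro loc_integrable_of_integrable integrable_continuous_bounded[where B = B] test_fns_continuous[OF assms]) (simp add: B)
  show "loc_integrable \<Omega> (grad \<phi>)"
    by (intro loc_integrable_of_integrable integrable_continuous_bounded[where B = B] test_fns_grad_continuous[OF assms]) (simp add: B)
  fix i \<psi> assume "i \<in> (Basis :: 'a set)" "\<psi> \<in> test_fns \<Omega>"
  then show "(\<integral>x. \<phi> x * frechet_derivative \<psi> (at x) i \<partial>L) = - (\<integral>x. (grad \<phi> x \<bullet> i) * \<psi> x \<partial>L)"
    using test_fns_integration_by_parts[OF assms _ open_dom] by (simp add: test_fns_grad_inner)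
qed

lemma wgrad_weak: "has_weak_gradient \<Omega> u g ==> has_weak_gradient \<Omega> u (wgrad \<Omega> u)"
  unfolding wgrad_def by (rule someI[of "has_weak_gradient \<Omega> u"])

lemma wgrad_AE: "has_weak_gradient \<Omega> u g ==> AE x in L. wgrad \<Omega> u x = g x"
  by (rule weak_gradient_unique[OF wgrad_weak])

lemma integral_times_bounded_tendsto:
  fixes w :: "nat => 'a => real"
  assumes [measurable]: "!!n. w n \<in> borel_measurable L" "v \<in> borel_measurable L" "\<psi> \<in> borel_measurable L"
    and B: "!!x. \<bar>\<psi> x\<bar> \<le> B" and i: "!!n. integrable L (w n)" "integrable L v"
    and lim: "(%n. \<integral>x. \<bar>w n x - v x\<bar> \<partial>L) \<longlonglongrightarrow> 0"
  shows "(%n. \<integral>x. w n x * \<psi> x \<partial>L) \<longlonglongrightarrow> (\<integral>x. v x * \<psi> x \<partial>L)"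
proof -
  let ?W = "%n. \<integral>x. w n x * \<psi> x \<partial>L"
  let ?D = "%n. \<integral>x. \<bar>w n x - v x\<bar> \<partial>L"
  let ?V = "\<integral>x. v x * \<psi> x \<partial>L"
  have im: "integrable L (%x. f x * \<psi> x)" if "integrable L f" for f :: "'a => real"
  proof (rule integrable_bound[of _ "%x. B * f x"])
    show "AE x in L. norm (f x * \<psi> x) \<le> norm (B * f x)"
    proof (intro AE_I2)
      fix x
      have "\<bar>\<psi> x\<bar> \<le> \<bar>B\<bar>" using B[of x] by linarith
      then have "\<bar>f x\<bar> * \<bar>\<psi> x\<bar> \<le> \<bar>f x\<bar> * \<bar>B\<bar>" by (intro mult_left_mono) auto
      then show "norm (f x * \<psi> x) \<le> norm (B * f x)" by (simp add: abs_mult mult.commute)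
    qed
    show "(%x. f x * \<psi> x) \<in> borel_measurable L" using borel_measurable_integrable[OF that] by simp
  qed (use that in simp)
  have "(%n. ?W n - ?V) \<longlonglongrightarrow> 0"
  proof (rule Lim_null_comparison[where g = "%n. B * ?D n"])
    show "\<forall>\<^sub>F n in sequentially. norm (?W n - ?V) \<le> B * ?D n"
    proof (intro always_eventually allI)
      fix n
      have "?W n - ?V = (\<integral>x. (w n x - v x) * \<psi> x \<partial>L)"
        using im[OF i(1)[of n]] im[OF i(2)] by (simp add: left_diff_distrib)
      also have "norm \<dots> \<le> (\<integral>x. \<bar>(w n x - v x) * \<psi> x\<bar> \<partial>L)" by (simp add: integral_abs_bound)
      also have "\<dots> \<le> (\<integral>x. B * \<bar>w n x - v x\<bar> \<partial>L)"
      proof (rule integral_mono)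
        have d: "integrable L (%x. w n x - v x)" using i by simp
        show "integrable L (%x. \<bar>(w n x - v x) * \<psi> x\<bar>)" by (rule integrable_abs[OF im[OF d]])
        show "integrable L (%x. B * \<bar>w n x - v x\<bar>)" using d by simp
        show "\<bar>(w n x - v x) * \<psi> x\<bar> \<le> B * \<bar>w n x - v x\<bar>" for x
          using mult_right_mono[OF B[of x], of "\<bar>w n x - v x\<bar>"] by (simp add: abs_mult mult.commute)
      qed
      finally show "norm (?W n - ?V) \<le> B * ?D n" by simp
    qed
    show "(%n. B * ?D n) \<longlonglongrightarrow> 0" using tendsto_mult_right_zero[OF lim] by simp
  qed
  then show ?thesis by (simp add: LIM_zero_iff)
qed

end

section \<open>Sobolev functions with zero boundary values through modular approximation\<close>

locale sobolev = bdomain \<Omega> + exponent "lebesgue_on \<Omega>" p P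
  for \<Omega> :: "'a::euclidean_space set" and p :: "'a => real" and P :: real
begin

lemma Lp_L1:
  fixes u :: "'a => 'b::euclidean_space"
  assumes u: "Lp u" shows "integrable L u"
proof (rule integrable_bound)
  show "integrable L (%x. 1 + norm (u x) powr p x)" using Lp_integrable[OF u] by auto
  show "AE x in L. norm (u x) \<le> norm (1 + norm (u x) powr p x)"
  proof (rule AE_I2)
    fix x assume "x \<in> space L"
    from le_split_powr[of "norm (u x)" 1 "p x"] p_ge[OF this] show "norm (u x) \<le> norm (1 + norm (u x) powr p x)" by simp
  qed
qed (rule Lp_meas[OF u])

lemma mconv_L1:
  fixes w :: "nat => 'a => 'b::euclidean_space"
  assumes w: "!!n. Lp (w n)" "Lp v" and lim: "mconv w v"
  shows "(%n. \<integral>x. norm (w n x - v x) \<partial>L) \<longlonglongrightarrow> 0"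
proof -
  have "(%n. \<integral>x. norm (w n x - v x) \<partial>L) \<longlonglongrightarrow> (\<integral>x. norm ((%x. 0::'b) x) \<partial>L)"
  proof (rule nemytskii_continuous[where h = "%x \<xi>. norm \<xi>" and v = "%n x. w n x - v x" and w = "%x. 0" and D = "%_. 1" and C = 1])
    show "AE x in L. \<forall>\<xi>. \<bar>norm \<xi>\<bar> \<le> 1 + 1 * norm (\<xi>::'b) powr p x"
    proof (intro AE_I2 allI)
      fix x and \<xi> :: 'b assume "x \<in> space L"
      from le_split_powr[of "norm \<xi>" 1 "p x"] p_ge[OF this] show "\<bar>norm \<xi>\<bar> \<le> 1 + 1 * norm \<xi> powr p x" by simp
    qed
  qed (use lim Lp_meas[OF w(1)] Lp_meas[OF w(2)] in \<open>auto simp: rho_def intro: continuous_intros\<close>)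
  then show ?thesis by simp
qed

text \<open>Its infimum is the Luxemburg norm, for scalar functions and for lengths of vector fields
  alike.\<close>

definition lset :: "('a => 'b::euclidean_space) => real set" where
  "lset u = {c. c > 0 \<and> \<rho> (%x. (1 / c) *\<^sub>R u x) \<le> 1}"

lemma lux_norm_eq: "lux_norm \<Omega> p (%x. norm (u x)) = Inf (lset u)" "lux_norm \<Omega> p v = Inf (lset v)"
  unfolding lux_norm_def lset_def modular_def rho_def by (simp_all add: abs_mult[symmetric] cong: conj_cong)

lemma lset_bdd: "bdd_below (lset u)" by (auto simp: lset_def intro!: bdd_belowI[of _ 0])

lemma rho_le_lset:
  assumes u: "u \<in> borel_measurable L" and c: "0 < c" "c \<le> 1" and le: "\<rho> u \<le> ennreal (c powr P)"
  shows "c \<in> lset u"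
proof -
  let ?m = "max 1 \<bar>1 / c\<bar> powr P"
  have "\<rho> (%x. (1 / c) *\<^sub>R u x) \<le> ennreal ?m * \<rho> u" by (rule rho_scale[OF u])
  also have "\<dots> \<le> ennreal ?m * ennreal (c powr P)" by (intro mult_left_mono le) auto
  also have "\<dots> = ennreal (?m * c powr P)" by (simp add: ennreal_mult)
  also have "?m * c powr P = 1" using c by (simp add: max_def powr_divide field_simps)
  finally show ?thesis using c by (simp add: lset_def)
qed

lemma lset_rho_le:
  assumes u: "u \<in> borel_measurable L" and c: "c \<in> lset u" "c \<le> 1"
  shows "\<rho> u \<le> ennreal c"
proof -
  have c0: "c > 0" "\<rho> (%x. (1 / c) *\<^sub>R u x) \<le> 1" using c by (auto simp: lset_def)
  have "\<rho> (%x. c *\<^sub>R ((1 / c) *\<^sub>R u x)) \<le> ennreal \<bar>c\<bar> * \<rho> (%x. (1 / c) *\<^sub>R u x)"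
    by (rule rho_small_scale) (use u c c0 in auto)
  also have "\<dots> \<le> ennreal \<bar>c\<bar> * 1" using c0 by (intro mult_left_mono) auto
  finally show ?thesis using c0 by simp
qed

lemma lset_nonempty: assumes u: "Lp u" shows "lset u \<noteq> {}"
proof -
  define c where "c = max 1 (enn2real (\<rho> u))"
  have c: "c \<ge> 1" by (simp add: c_def)
  have "\<rho> u = ennreal (enn2real (\<rho> u))" using u by (simp add: Lp_def)
  also have "\<dots> \<le> ennreal c" by (intro ennreal_leI) (simp add: c_def)
  finally have le: "\<rho> u \<le> ennreal c" .
  have "\<rho> (%x. (1 / c) *\<^sub>R u x) \<le> ennreal \<bar>1 / c\<bar> * \<rho> u" by (rule rho_small_scale[OF Lp_meas[OF u]]) (use c in simp)
  also have "\<dots> \<le> ennreal \<bar>1 / c\<bar> * ennreal c" by (intro mult_left_mono le) auto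
  also have "\<dots> = 1" using c by (simp flip: ennreal_mult)
  finally have "c \<in> lset u" using c by (simp add: lset_def)
  then show ?thesis by blast
qed

lemma lset_nonneg: "Lp u ==> 0 \<le> Inf (lset u)"
  by (intro cInf_greatest lset_nonempty) (auto simp: lset_def)

text \<open>For a bounded exponent and c \<le> 1, a modular below c^P gives norm at most c, and c in
  the set gives modular at most c. Norm convergence to zero can therefore be replaced by modular
  convergence from here on.\<close>

lemma Inf_lset_tendsto_iff:
  fixes u :: "nat => 'a => 'b::euclidean_space"
  assumes u: "!!n. Lp (u n)"
  shows "(%n. Inf (lset (u n))) \<longlonglongrightarrow> 0 \<longleftrightarrow> (%n. \<rho> (u n)) \<longlonglongrightarrow> 0"
proof
  assume lim: "(%n. Inf (lset (u n))) \<longlonglongrightarrow> 0"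
  show "(%n. \<rho> (u n)) \<longlonglongrightarrow> 0"
  proof (rule order_tendstoI)
    fix e :: ennreal assume "0 < e"
    then obtain z where z: "0 < z" "ennreal z < e" by (rule ennreal_pos_below)
    from order_tendstoD(2)[OF lim, of "min 1 z"] z(1) have "\<forall>\<^sub>F n in sequentially. Inf (lset (u n)) < min 1 z" by simp
    then show "\<forall>\<^sub>F n in sequentially. \<rho> (u n) < e"
    proof eventually_elim
      case (elim n)
      obtain c where c: "c \<in> lset (u n)" "c < min 1 z" using cInf_lessD[OF lset_nonempty[OF u] elim] by blast
      then have "\<rho> (u n) \<le> ennreal c" by (intro lset_rho_le Lp_meas u) auto
      also have "\<dots> \<le> ennreal z" using c(2) by (intro ennreal_leI) simp
      finally show ?case using z by simp
    qed
  qed auto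
next
  assume R: "(%n. \<rho> (u n)) \<longlonglongrightarrow> 0"
  show "(%n. Inf (lset (u n))) \<longlonglongrightarrow> 0"
  proof (rule order_tendstoI)
    fix a :: real assume "a < 0"
    then show "\<forall>\<^sub>F n in sequentially. a < Inf (lset (u n))"
      using lset_nonneg[OF u] by (intro always_eventually) (auto intro: less_le_trans)
  next
    fix a :: real assume a: "0 < a"
    define c where "c = min 1 (a / 2)"
    have c: "0 < c" "c \<le> 1" "c < a" using a by (auto simp: c_def)
    have "0 < ennreal (c powr P)" using c by (simp add: ennreal_less_zero_iff)
    from order_tendstoD(2)[OF R this] show "\<forall>\<^sub>F n in sequentially. Inf (lset (u n)) < a"
    proof eventually_elim
      case (elim n)
      have "c \<in> lset (u n)" using elim by (intro rho_le_lset Lp_meas u c) simp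
      then have "Inf (lset (u n)) \<le> c" by (intro cInf_lower lset_bdd)
      then show ?case using c by simp
    qed
  qed
qed

lemma in_Lp_iff: "in_Lp \<Omega> p u \<longleftrightarrow> Lp u"
proof -
  have e: "modular \<Omega> p (%x. u x / c) = \<rho> (%x. (1 / c) *\<^sub>R u x)" for c by (simp add: modular_def rho_def)
  show ?thesis
  proof
    assume "in_Lp \<Omega> p u"
    then obtain c where c: "c > 0" "Lp (%x. (1 / c) *\<^sub>R u x)" by (auto simp: in_Lp_def e Lp_def)
    from Lp_scale[OF c(2), of c] show "Lp u" using c(1) by simp
  next
    assume "Lp u"
    then show "in_Lp \<Omega> p u" by (auto simp: in_Lp_def e Lp_def intro!: exI[of _ 1])
  qed
qed

lemma Lp_norm: "u \<in> borel_measurable L ==> Lp (%x. norm (u x)) \<longleftrightarrow> Lp u"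
  by (simp add: Lp_def rho_def)

text \<open>Membership in W0 with the gradient g carried explicitly, so that sums, multiples and
  limits do not have to pass through the choice in \<open>wgrad\<close>.\<close>

definition approximable :: "('a => real) => ('a => 'a) => bool" where
  "approximable u g \<longleftrightarrow> Lp u \<and> Lp g \<and> (\<exists>\<phi>. (\<forall>k. \<phi> k \<in> test_fns \<Omega>) \<and> mconv \<phi> u \<and> mconv (%k. grad (\<phi> k)) g)"

lemma bounded_Lp:
  fixes f :: "'a => 'b::euclidean_space"
  assumes [measurable]: "f \<in> borel_measurable L" and "!!x. norm (f x) \<le> B"
  shows "Lp f"
proof -
  have "norm (f x) powr p x \<le> max 1 B powr P" if "x \<in> space L" for x
  proof -
    have "norm (f x) powr p x \<le> max 1 B powr p x" using assms(2)[of x] p_ge[OF that] by (intro powr_mono2) auto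
    also have "\<dots> \<le> max 1 B powr P" using p_le[OF that] by (intro powr_mono) auto
    finally show ?thesis .
  qed
  then have "\<rho> f \<le> (\<integral>\<^sup>+ x. ennreal (max 1 B powr P) \<partial>L)"
    unfolding rho_def by (intro nn_integral_mono ennreal_leI) auto
  also have "\<dots> < top" by (simp add: emeasure_eq_measure ennreal_mult_less_top)
  finally show ?thesis by (simp add: Lp_def)
qed

lemma test_fn_Lp: assumes "\<phi> \<in> test_fns \<Omega>" shows "Lp \<phi>" "Lp (grad \<phi>)"
proof -
  obtain B where B: "!!x. \<bar>\<phi> x\<bar> \<le> B" "!!x. norm (grad \<phi> x) \<le> B" using test_fns_bounded[OF assms] by metis
  show "Lp \<phi>" by (rule bounded_Lp[OF test_fn_measurable[OF assms], of B]) (simp add: B)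
  show "Lp (grad \<phi>)" by (rule bounded_Lp[OF grad_measurable[OF assms]]) (rule B)
qed

lemma rho_cong_AE: "AE x in L. g x = h x ==> \<rho> g = \<rho> h"
  unfolding rho_def by (intro nn_integral_cong_AE) auto

lemma approximable_L1:
  assumes "approximable u g"
  obtains \<phi> where "!!k. \<phi> k \<in> test_fns \<Omega>" "integrable L u" "integrable L g" "(%k. \<integral>x. \<bar>\<phi> k x - u x\<bar> \<partial>L) \<longlonglongrightarrow> 0"
    "(%k. \<integral>x. norm (grad (\<phi> k) x - g x) \<partial>L) \<longlonglongrightarrow> 0"
proof -
  obtain \<phi> where \<phi>: "Lp u" "Lp g" "!!k. \<phi> k \<in> test_fns \<Omega>" "mconv \<phi> u" "mconv (%k. grad (\<phi> k)) g" using assms unfolding approximable_def by blast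
  show thesis
    using that[OF \<phi>(3) Lp_L1[OF \<phi>(1)] Lp_L1[OF \<phi>(2)]] mconv_L1[OF test_fn_Lp(1)[OF \<phi>(3)] \<phi>(1,4)] mconv_L1[OF test_fn_Lp(2)[OF \<phi>(3)] \<phi>(2,5)] by simp
qed

text \<open>Modular convergence implies L1 convergence, so integration by parts for test functions
  survives the limit.\<close>

lemma approximable_weak_gradient:
  assumes a: "approximable u g" shows "has_weak_gradient \<Omega> u g"
  unfolding has_weak_gradient_def
proof (intro conjI ballI)
  obtain \<phi> where \<phi>: "!!k. \<phi> k \<in> test_fns \<Omega>" "integrable L u" "integrable L g" "(%k. \<integral>x. \<bar>\<phi> k x - u x\<bar> \<partial>L) \<longlonglongrightarrow> 0"
    "(%k. \<integral>x. norm (grad (\<phi> k) x - g x) \<partial>L) \<longlonglongrightarrow> 0" using approximable_L1[OF a] by blast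
  then show "loc_integrable \<Omega> u" "loc_integrable \<Omega> g" by (auto intro: loc_integrable_of_integrable)
  fix i \<psi> assume i: "i \<in> (Basis :: 'a set)" and \<psi>: "\<psi> \<in> test_fns \<Omega>"
  note \<phi>i = Lp_L1[OF test_fn_Lp(1)[OF \<phi>(1)]] Lp_L1[OF test_fn_Lp(2)[OF \<phi>(1)]]
  obtain B where B: "!!x. \<bar>\<psi> x\<bar> \<le> B" "!!x. norm (grad \<psi> x) \<le> B" using test_fns_bounded[OF \<psi>] by metis
  have "(%k. \<integral>x. \<bar>grad (\<phi> k) x \<bullet> i - g x \<bullet> i\<bar> \<partial>L) \<longlonglongrightarrow> 0"
  proof (rule Lim_null_comparison[OF _ \<phi>(5)], intro always_eventually allI)
    fix k
    have "(\<integral>x. \<bar>grad (\<phi> k) x \<bullet> i - g x \<bullet> i\<bar> \<partial>L) \<le> (\<integral>x. norm (grad (\<phi> k) x - g x) \<partial>L)"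
      using Basis_le_norm[OF i] \<phi>(3) \<phi>i by (intro integral_mono) (auto simp flip: inner_diff_left)
    then show "norm (\<integral>x. \<bar>grad (\<phi> k) x \<bullet> i - g x \<bullet> i\<bar> \<partial>L) \<le> (\<integral>x. norm (grad (\<phi> k) x - g x) \<partial>L)" by simp
  qed
  then have 1: "(%k. \<integral>x. (grad (\<phi> k) x \<bullet> i) * \<psi> x \<partial>L) \<longlonglongrightarrow> (\<integral>x. (g x \<bullet> i) * \<psi> x \<partial>L)"
    by (intro integral_times_bounded_tendsto[where B = B])
       (use \<phi>(3) \<phi>i B test_fn_measurable[OF \<psi>] in \<open>auto intro: borel_measurable_integrable\<close>)
  have "\<bar>grad \<psi> x \<bullet> i\<bar> \<le> B" for x using Basis_le_norm[OF i, of "grad \<psi> x"] B(2)[of x] by simp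
  moreover have "(%x. grad \<psi> x \<bullet> i) \<in> borel_measurable L" using grad_measurable[OF \<psi>] by simp
  ultimately have 2: "(%k. \<integral>x. \<phi> k x * (grad \<psi> x \<bullet> i) \<partial>L) \<longlonglongrightarrow> (\<integral>x. u x * (grad \<psi> x \<bullet> i) \<partial>L)"
    by (intro integral_times_bounded_tendsto[where B = B]) (use \<phi>i \<phi>(2,4) in \<open>auto intro: borel_measurable_integrable\<close>)
  have "(%k. \<integral>x. \<phi> k x * (grad \<psi> x \<bullet> i) \<partial>L) \<longlonglongrightarrow> - (\<integral>x. (g x \<bullet> i) * \<psi> x \<partial>L)"
    using tendsto_minus[OF 1] by (simp add: test_fns_integration_by_parts[OF \<phi>(1) \<psi> open_dom i])
  from LIMSEQ_unique[OF 2 this]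
  show "(\<integral>x. u x * frechet_derivative \<psi> (at x) i \<partial>L) = - (\<integral>x. (g x \<bullet> i) * \<psi> x \<partial>L)" by (simp add: test_fns_grad_inner[OF i])
qed

lemma W_norm_tendsto_iff:
  assumes \<phi>: "!!k. \<phi> k \<in> test_fns \<Omega>" and w: "has_weak_gradient \<Omega> u g" and u: "Lp u" "Lp g"
  shows "(%k. W_norm \<Omega> p (%x. \<phi> k x - u x)) \<longlonglongrightarrow> 0 \<longleftrightarrow> mconv \<phi> u \<and> mconv (%k. grad (\<phi> k)) g"
proof -
  let ?u = "%k x. \<phi> k x - u x" and ?g = "%k x. grad (\<phi> k) x - g x"
  let ?U = "%k. Inf (lset (?u k))" and ?G = "%k. Inf (lset (?g k))"
  have l: "Lp (?u k)" "Lp (?g k)" for k by (intro Lp_diff u test_fn_Lp \<phi>)+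
  have wg: "AE x in L. wgrad \<Omega> (?u k) x = ?g k x" for k
    using wgrad_AE[OF weak_gradient_lincomb[OF weak_gradient_test[OF \<phi>[of k]] w, of 1 "-1"]] by simp
  have "lset (wgrad \<Omega> (?u k)) = lset (?g k)" for k
  proof -
    have "\<rho> (%x. (1 / c) *\<^sub>R wgrad \<Omega> (?u k) x) = \<rho> (%x. (1 / c) *\<^sub>R ?g k x)" for c
      by (rule rho_cong_AE) (use wg[of k] in eventually_elim, simp)
    then show ?thesis unfolding lset_def by simp
  qed
  then have W: "W_norm \<Omega> p (?u k) = ?U k + ?G k" for k
    unfolding W_norm_def lux_norm_eq by simp
  note nn = lset_nonneg[OF l(1)] lset_nonneg[OF l(2)]
  have "(%k. ?U k + ?G k) \<longlonglongrightarrow> 0 \<longleftrightarrow> ?U \<longlonglongrightarrow> 0 \<and> ?G \<longlonglongrightarrow> 0"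
  proof (intro iffI conjI)
    assume lim: "(%k. ?U k + ?G k) \<longlonglongrightarrow> 0"
    show "?U \<longlonglongrightarrow> 0" "?G \<longlonglongrightarrow> 0" by (rule Lim_null_comparison[OF _ lim], use nn in simp)+
  next
    assume "?U \<longlonglongrightarrow> 0 \<and> ?G \<longlonglongrightarrow> 0"
    then show "(%k. ?U k + ?G k) \<longlonglongrightarrow> 0" using tendsto_add_zero by blast
  qed
  then show ?thesis unfolding W Inf_lset_tendsto_iff[OF l(1)] Inf_lset_tendsto_iff[OF l(2)] .
qed

lemma W0_approximable:
  assumes "W0 \<Omega> p u" shows "approximable u (wgrad \<Omega> u)"
proof -
  let ?g = "wgrad \<Omega> u"
  obtain g where g: "has_weak_gradient \<Omega> u g" "Lp (%x. norm (g x))" and u: "Lp u"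
    using assms by (auto simp: W0_def W1p_def in_Lp_iff)
  obtain \<phi> where \<phi>: "!!k. \<phi> k \<in> test_fns \<Omega>" "(%k. W_norm \<Omega> p (%x. \<phi> k x - u x)) \<longlonglongrightarrow> 0"
    using assms by (auto simp: W0_def)
  have w: "has_weak_gradient \<Omega> u ?g" by (rule wgrad_weak[OF g(1)])
  have m: "?g \<in> borel_measurable L" "g \<in> borel_measurable L"
    using w g(1) by (auto simp: has_weak_gradient_def intro: loc_integrable_measurable)
  have "\<rho> ?g = \<rho> g" by (rule rho_cong_AE[OF wgrad_AE[OF g(1)]])
  then have "Lp ?g" using g(2) m by (simp add: Lp_norm) (simp add: Lp_def)
  then show ?thesis unfolding approximable_def using W_norm_tendsto_iff[of \<phi>, OF \<phi>(1) w u] \<phi> u by blast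
qed

lemma approximable_W0:
  assumes "approximable u g" shows "W0 \<Omega> p u" "AE x in L. wgrad \<Omega> u x = g x"
proof -
  have w: "has_weak_gradient \<Omega> u g" by (rule approximable_weak_gradient[OF assms])
  obtain \<phi> where \<phi>: "Lp u" "Lp g" "!!k. \<phi> k \<in> test_fns \<Omega>" "mconv \<phi> u" "mconv (%k. grad (\<phi> k)) g" using assms unfolding approximable_def by blast
  have "W1p \<Omega> p u" unfolding W1p_def using w \<phi>(1,2) Lp_meas[OF \<phi>(2)] by (auto simp: in_Lp_iff Lp_norm)
  then show "W0 \<Omega> p u" using W_norm_tendsto_iff[of \<phi>, OF \<phi>(3) w \<phi>(1,2)] \<phi>(3-5) unfolding W0_def by blast
  show "AE x in L. wgrad \<Omega> u x = g x" by (rule wgrad_AE[OF w])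
qed

lemma approximable_test: "\<phi> \<in> test_fns \<Omega> ==> approximable \<phi> (grad \<phi>)"
  unfolding approximable_def using test_fn_Lp by (auto intro!: exI[of _ "%_. \<phi>"] simp: rho_def)

lemma mconv_lincomb:
  fixes F H :: "nat => 'a => 'b::euclidean_space"
  assumes l: "!!k. Lp (F k)" "!!k. Lp (H k)" "Lp f" "Lp h" and "mconv F f" "mconv H h"
  shows "mconv (%k x. a *\<^sub>R F k x + b *\<^sub>R H k x) (%x. a *\<^sub>R f x + b *\<^sub>R h x)"
proof -
  note m = Lp_meas[OF l(1)] Lp_meas[OF l(2)] Lp_meas[OF l(3)] Lp_meas[OF l(4)]
  have "(%k. \<rho> (%x. a *\<^sub>R (F k x - f x) + b *\<^sub>R (H k x - h x))) \<longlonglongrightarrow> 0"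
    by (intro rho_tendsto_add rho_tendsto_scale assms) (use m in auto)
  then show ?thesis by (simp add: algebra_simps)
qed

lemma approximable_lincomb:
  assumes "approximable u g" "approximable v h"
  shows "approximable (%x. a * u x + b * v x) (%x. a *\<^sub>R g x + b *\<^sub>R h x)"
proof -
  obtain \<phi> where \<phi>: "Lp u" "Lp g" "!!k. \<phi> k \<in> test_fns \<Omega>" "mconv \<phi> u" "mconv (%k. grad (\<phi> k)) g" using assms(1) unfolding approximable_def by blast
  obtain \<psi> where \<psi>: "Lp v" "Lp h" "!!k. \<psi> k \<in> test_fns \<Omega>" "mconv \<psi> v" "mconv (%k. grad (\<psi> k)) h" using assms(2) unfolding approximable_def by blast
  have "Lp (%x. a * u x + b * v x)" using Lp_add[OF Lp_scale[OF \<phi>(1), of a] Lp_scale[OF \<psi>(1), of b]] by simp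
  moreover have "Lp (%x. a *\<^sub>R g x + b *\<^sub>R h x)" by (intro Lp_add Lp_scale \<phi> \<psi>)
  moreover have "mconv (%k x. a * \<phi> k x + b * \<psi> k x) (%x. a * u x + b * v x)"
    using mconv_lincomb[OF test_fn_Lp(1)[OF \<phi>(3)] test_fn_Lp(1)[OF \<psi>(3)] \<phi>(1) \<psi>(1) \<phi>(4) \<psi>(4)] by simp
  moreover have "mconv (%k. grad (%x. a * \<phi> k x + b * \<psi> k x)) (%x. a *\<^sub>R g x + b *\<^sub>R h x)"
    using mconv_lincomb[OF test_fn_Lp(2)[OF \<phi>(3)] test_fn_Lp(2)[OF \<psi>(3)] \<phi>(2) \<psi>(2) \<phi>(5) \<psi>(5)] by (simp add: grad_lincomb[OF \<phi>(3) \<psi>(3)])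
  ultimately show ?thesis unfolding approximable_def using test_fns_lincomb[OF \<phi>(3) \<psi>(3)]
    by (intro conjI exI[of _ "%k x. a * \<phi> k x + b * \<psi> k x"]) auto
qed

text \<open>A diagonal choice: each u n is replaced by a test function within 1/(n + 1) of it, and
  the quasi-triangle inequality for the modular does the rest.\<close>

lemma approximable_closed:
  assumes a: "!!n. approximable (u n) (g n)" and m: "w \<in> borel_measurable L" "h \<in> borel_measurable L"
    and lim: "mconv u w" "mconv g h"
  shows "approximable w h"
proof -
  have al: "Lp (u n)" "Lp (g n)" for n using a[of n] unfolding approximable_def by auto
  let ?e = "%n. ennreal (inverse (real (Suc n)))"
  have "\<exists>\<phi>. \<phi> \<in> test_fns \<Omega> \<and> \<rho> (%x. \<phi> x - u n x) < ?e n \<and> \<rho> (%x. grad \<phi> x - g n x) < ?e n" for n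
  proof -
    obtain \<phi> where \<phi>: "!!k. \<phi> k \<in> test_fns \<Omega>" "mconv \<phi> (u n)" "mconv (%k. grad (\<phi> k)) (g n)" using a[of n] unfolding approximable_def by blast
    have "0 < ?e n" by (simp add: ennreal_less_zero_iff)
    then have "\<forall>\<^sub>F k in sequentially. \<rho> (%x. \<phi> k x - u n x) < ?e n \<and> \<rho> (%x. grad (\<phi> k) x - g n x) < ?e n"
      by (intro eventually_conj order_tendstoD(2)[OF \<phi>(2)] order_tendstoD(2)[OF \<phi>(3)])
    then show ?thesis using \<phi>(1) unfolding eventually_sequentially by blast
  qed
  then obtain \<phi> where \<phi>: "!!n. \<phi> n \<in> test_fns \<Omega>" "!!n. \<rho> (%x. \<phi> n x - u n x) < ?e n" "!!n. \<rho> (%x. grad (\<phi> n) x - g n x) < ?e n" by metis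
  have e0: "?e \<longlonglongrightarrow> 0" using tendsto_ennrealI[OF LIMSEQ_inverse_real_of_nat] by simp
  have sq: "F \<longlonglongrightarrow> 0" if "!!n. F n < ?e n" for F
    by (rule tendsto_sandwich[OF always_eventually[OF allI[OF zero_le]] always_eventually[OF allI[OF less_imp_le[OF that]]] tendsto_const e0])
  have "(%n. \<rho> (%x. (\<phi> n x - u n x) + (u n x - w x))) \<longlonglongrightarrow> 0"
    by (rule rho_tendsto_add[OF _ _ sq[OF \<phi>(2)] lim(1)]) (use al[THEN Lp_meas] m test_fn_measurable[OF \<phi>(1)] in auto)
  moreover have "(%n. \<rho> (%x. (grad (\<phi> n) x - g n x) + (g n x - h x))) \<longlonglongrightarrow> 0"
    by (rule rho_tendsto_add[OF _ _ sq[OF \<phi>(3)] lim(2)]) (use al[THEN Lp_meas] m grad_measurable[OF \<phi>(1)] in auto)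
  ultimately show ?thesis unfolding approximable_def
    using \<phi>(1) Lp_limit[OF al(1) m(1) lim(1)] Lp_limit[OF al(2) m(2) lim(2)] by auto
qed

end

section \<open>Poincare inequalities\<close>

text \<open>The Jacobian of a dilation by c \<ge> 1/2 is at least 2^-N, with N the dimension. On a
  segment one of t and 1 - t always qualifies as c.\<close>

lemma nn_integral_lborel_affine_le:
  fixes f :: "'a::euclidean_space => ennreal"
  assumes [measurable]: "f \<in> borel_measurable borel" and c: "1/2 \<le> c"
  shows "(\<integral>\<^sup>+ x. f (t + c *\<^sub>R x) \<partial>lborel) \<le> ennreal (2 ^ DIM('a)) * (\<integral>\<^sup>+ x. f x \<partial>lborel)"
proof -
  let ?I = "\<integral>\<^sup>+ x. f x \<partial>lborel"
  let ?J = "\<integral>\<^sup>+ x. f (t + c *\<^sub>R x) \<partial>lborel"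
  have "?I = (\<integral>\<^sup>+ x. f x \<partial>density (distr lborel borel (%x. t + c *\<^sub>R x)) (%_. ennreal (\<bar>c\<bar> ^ DIM('a))))"
    using lborel_affine[of c t] c by simp
  also have "\<dots> = ennreal (\<bar>c\<bar> ^ DIM('a)) * ?J"
    by (simp add: nn_integral_density nn_integral_distr nn_integral_cmult)
  finally have e: "?I = ennreal (\<bar>c\<bar> ^ DIM('a)) * ?J" .
  have "1 \<le> (2 * \<bar>c\<bar>) ^ DIM('a)" using c by (intro one_le_power) auto
  then have "1 * ?J \<le> ennreal ((2 * \<bar>c\<bar>) ^ DIM('a)) * ?J"
    by (intro mult_right_mono) (auto simp: ennreal_ge_1)
  also have "\<dots> = ennreal (2 ^ DIM('a)) * ?I"
    unfolding e using c by (simp add: power_mult_distrib ennreal_mult mult.assoc)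
  finally show ?thesis by simp
qed

lemma test_fn_diff_le:
  assumes \<phi>: "\<phi> \<in> test_fns \<Omega>"
  shows "ennreal \<bar>\<phi> x - \<phi> y\<bar> \<le> ennreal (dist x y) * (\<integral>\<^sup>+ t. indicator {0..1} t * ennreal (norm (grad \<phi> (y + t *\<^sub>R (x - y)))) \<partial>lborel)"
proof -
  let ?l = "%t::real. y + t *\<^sub>R (x - y)" and ?N = "%t. norm (grad \<phi> (y + t *\<^sub>R (x - y)))"
  have lc: "continuous_on UNIV ?l" by (intro continuous_intros)
  have gc: "continuous_on UNIV (%t. grad \<phi> (?l t))"
    by (rule continuous_on_compose2[OF test_fns_grad_continuous[OF \<phi>, of UNIV] lc]) auto
  have "((%t. grad \<phi> (?l t) \<bullet> (x - y)) has_integral (\<phi> (?l 1) - \<phi> (?l 0))) {0..1}"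
  proof (rule fundamental_theorem_of_calculus)
    fix t :: real
    have "(?l has_derivative (%s. s *\<^sub>R (x - y))) (at t within {0..1})" by (auto intro!: derivative_eq_intros)
    from has_derivative_compose[OF this test_fns_has_derivative[OF \<phi>]]
    show "((%t. \<phi> (?l t)) has_vector_derivative grad \<phi> (?l t) \<bullet> (x - y)) (at t within {0..1})"
      by (simp add: has_vector_derivative_def)
  qed simp
  then have e: "\<phi> x - \<phi> y = integral {0..1} (%t. grad \<phi> (?l t) \<bullet> (x - y))" by (simp add: integral_unique)
  have Ni: "?N integrable_on {0..1}" by (intro integrable_continuous_real continuous_intros continuous_on_subset[OF gc]) auto
  have "\<bar>\<phi> x - \<phi> y\<bar> \<le> integral {0..1} (%t. dist x y * ?N t)"
    unfolding e real_norm_def[symmetric]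
  proof (rule integral_norm_bound_integral)
    show "(%t. grad \<phi> (?l t) \<bullet> (x - y)) integrable_on {0..1}"
      by (intro integrable_continuous_real continuous_intros continuous_on_subset[OF gc]) auto
    show "(%t. dist x y * ?N t) integrable_on {0..1}"
      by (intro integrable_continuous_real continuous_intros continuous_on_subset[OF gc]) auto
    show "norm (grad \<phi> (?l t) \<bullet> (x - y)) \<le> dist x y * ?N t" for t
      using Cauchy_Schwarz_ineq2[of "grad \<phi> (?l t)" "x - y"] by (simp add: dist_norm mult.commute)
  qed
  also have "\<dots> = dist x y * integral {0..1} ?N" by simp
  finally have "ennreal \<bar>\<phi> x - \<phi> y\<bar> \<le> ennreal (dist x y) * ennreal (integral {0..1} ?N)"
    by (simp add: ennreal_leI flip: ennreal_mult')
  also have "ennreal (integral {0..1} ?N) = (\<integral>\<^sup>+ t. indicator {0..1} t * ennreal (?N t) \<partial>lborel)"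
  proof -
    have "(\<integral>\<^sup>+ t. ennreal (?N t) * indicator {0..1} t \<partial>lborel) = ennreal (integral {0..1} ?N)"
    proof (rule nn_integral_has_integral_lebesgue')
      show "(?N has_integral integral {0..1} ?N) {0..1}" using Ni by (rule integrable_integral)
    qed auto
    then show ?thesis by (simp add: mult.commute)
  qed
  finally show ?thesis .
qed

text \<open>The difference of two values is written as an integral along the segment. For t \<ge>
  1/2 the substitution is made in x, otherwise in y, so the change of variables never degenerates;
  convexity keeps the segment inside Q.\<close>

lemma convex_poincare_nn:
  fixes Q :: "'a::euclidean_space set"
  assumes \<phi>: "\<phi> \<in> test_fns \<Omega>" and Q: "convex Q" and Qb[measurable]: "Q \<in> sets borel"
    and D: "!!x y. x \<in> Q ==> y \<in> Q ==> dist x y \<le> D"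
  shows "(\<integral>\<^sup>+ x. \<integral>\<^sup>+ y. indicator Q x * (indicator Q y * ennreal \<bar>\<phi> x - \<phi> y\<bar>) \<partial>lborel \<partial>lborel)
    \<le> ennreal D * (ennreal (2 ^ DIM('a)) * emeasure lborel Q * (\<integral>\<^sup>+ x. indicator Q x * ennreal (norm (grad \<phi> x)) \<partial>lborel))"
  (is "?L \<le> ennreal D * (?c * emeasure lborel Q * ?G)")
proof -
  let ?T = "%x y. \<integral>\<^sup>+ t. indicator {0..1} t * ennreal (norm (grad \<phi> (y + t *\<^sub>R (x - y)))) \<partial>lborel"
  have gm[measurable]: "grad \<phi> \<in> borel_measurable borel" by (intro borel_measurable_continuous_onI test_fns_grad_continuous[OF \<phi>])
  let ?H = "%x y (t::real). indicator Q x * indicator Q y * (indicator {0..1} t * ennreal (norm (grad \<phi> (y + t *\<^sub>R (x - y)))))"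
  let ?HH = "%t. \<integral>\<^sup>+ x. \<integral>\<^sup>+ y. ?H x y t \<partial>lborel \<partial>lborel"
  let ?g = "%z. indicator Q z * ennreal (norm (grad \<phi> z))"
  have "?L \<le> (\<integral>\<^sup>+ x. \<integral>\<^sup>+ y. ennreal D * (\<integral>\<^sup>+ t. ?H x y t \<partial>lborel) \<partial>lborel \<partial>lborel)"
  proof (intro nn_integral_mono)
    fix x y
    show "indicator Q x * (indicator Q y * ennreal \<bar>\<phi> x - \<phi> y\<bar>) \<le> ennreal D * (\<integral>\<^sup>+ t. ?H x y t \<partial>lborel)"
    proof (cases "x \<in> Q \<and> y \<in> Q")
      case True
      have "ennreal \<bar>\<phi> x - \<phi> y\<bar> \<le> ennreal (dist x y) * ?T x y"
        by (rule test_fn_diff_le[OF \<phi>])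
      also have "\<dots> \<le> ennreal D * ?T x y"
        using True D by (intro mult_right_mono ennreal_leI) auto
      finally show ?thesis using True by simp
    qed auto
  qed
  also have "\<dots> = ennreal D * (\<integral>\<^sup>+ x. \<integral>\<^sup>+ y. \<integral>\<^sup>+ t. ?H x y t \<partial>lborel \<partial>lborel \<partial>lborel)"
    by (simp add: nn_integral_cmult)
  also have "(\<integral>\<^sup>+ x. \<integral>\<^sup>+ y. \<integral>\<^sup>+ t. ?H x y t \<partial>lborel \<partial>lborel \<partial>lborel) = (\<integral>\<^sup>+ x. \<integral>\<^sup>+ t. \<integral>\<^sup>+ y. ?H x y t \<partial>lborel \<partial>lborel \<partial>lborel)"
    by (intro nn_integral_cong lborel_pair.Fubini') measurable
  also have "\<dots> = (\<integral>\<^sup>+ t. \<integral>\<^sup>+ x. \<integral>\<^sup>+ y. ?H x y t \<partial>lborel \<partial>lborel \<partial>lborel)"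
    by (intro lborel_pair.Fubini') measurable
  also have "\<dots> \<le> (\<integral>\<^sup>+ (t::real). indicator {0..1} t * (?c * emeasure lborel Q * ?G) \<partial>lborel)"
  proof (rule nn_integral_mono)
    fix t :: real
    show "(?HH t) \<le> indicator {0..1} t * (?c * emeasure lborel Q * ?G)"
    proof (cases "t \<in> {0..1}")
      case True
      have mem: "y + t *\<^sub>R (x - y) \<in> Q" if "x \<in> Q" "y \<in> Q" for x y
      proof -
        have "(1 - t) *\<^sub>R y + t *\<^sub>R x \<in> Q" using Q that True by (intro convexD) auto
        then show ?thesis by (simp add: algebra_simps)
      qed
      show ?thesis
      proof (cases "1/2 \<le> t")
        case t: True
        have "(?HH t) = (\<integral>\<^sup>+ y. \<integral>\<^sup>+ x. ?H x y t \<partial>lborel \<partial>lborel)"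
          by (intro lborel_pair.Fubini') measurable
        also have "\<dots> \<le> (\<integral>\<^sup>+ y. indicator Q y * (?c * ?G) \<partial>lborel)"
        proof (rule nn_integral_mono)
          fix y
          show "(\<integral>\<^sup>+ x. ?H x y t \<partial>lborel) \<le> indicator Q y * (?c * ?G)"
          proof (cases "y \<in> Q")
            case y: True
            have "(\<integral>\<^sup>+ x. ?H x y t \<partial>lborel) \<le> (\<integral>\<^sup>+ x. ?g ((y - t *\<^sub>R y) + t *\<^sub>R x) \<partial>lborel)"
              using y mem True by (intro nn_integral_mono) (auto simp: indicator_def algebra_simps)
            also have "\<dots> \<le> ?c * ?G" by (rule nn_integral_lborel_affine_le[OF _ t]) measurable
            finally show ?thesis using y by simp
          qed simp
        qed
        also have "\<dots> = ?c * emeasure lborel Q * ?G" by (simp add: nn_integral_multc mult_ac)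
        finally show ?thesis using True by simp
      next
        case t: False
        have "(?HH t) \<le> (\<integral>\<^sup>+ x. indicator Q x * (?c * ?G) \<partial>lborel)"
        proof (rule nn_integral_mono)
          fix x
          show "(\<integral>\<^sup>+ y. ?H x y t \<partial>lborel) \<le> indicator Q x * (?c * ?G)"
          proof (cases "x \<in> Q")
            case x: True
            have "(\<integral>\<^sup>+ y. ?H x y t \<partial>lborel) \<le> (\<integral>\<^sup>+ y. ?g (t *\<^sub>R x + (1 - t) *\<^sub>R y) \<partial>lborel)"
              using x mem True by (intro nn_integral_mono) (auto simp: indicator_def algebra_simps)
            also have "\<dots> \<le> ?c * ?G" by (rule nn_integral_lborel_affine_le) (measurable, use t in simp)
            finally show ?thesis using x by simp
          qed simp
        qed
        also have "\<dots> = ?c * emeasure lborel Q * ?G" by (simp add: nn_integral_multc mult_ac)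
        finally show ?thesis using True by simp
      qed
    qed simp
  qed
  also have "\<dots> = ?c * emeasure lborel Q * ?G" by (simp add: nn_integral_multc)
  finally show ?thesis by (simp add: mult_left_mono)
qed

context bdomain
begin

text \<open>The integral runs over the part of Q inside the domain, the divisor is the measure of
  all of Q: this is the average of the extension by zero.\<close>

definition avg :: "'a set => ('a => real) => real" where
  "avg Q f = sint Q f / measure lborel Q"

text \<open>The mean oscillation inequality for the extension by zero, where the part of Q outside
  the domain contributes |avg| times its measure. Each term is continuous in L1, so the inequality
  passes from test functions to their limits, and cells that cross the boundary need no special
  treatment.\<close>

definition poincare :: "('a => real) => ('a => 'a) => bool" where
  "poincare u g \<longleftrightarrow> integrable L u \<and> integrable L g \<and>
     (\<forall>Q D. convex Q --> bounded Q --> Q \<in> sets borel --> measure lborel Q > 0 --> (\<forall>x\<in>Q. \<forall>y\<in>Q. dist x y \<le> D) -->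
        (sint Q (%x. \<bar>u x - avg Q u\<bar>)) + \<bar>avg Q u\<bar> * measure lborel (Q - \<Omega>)
          \<le> 2 ^ DIM('a) * D * sint Q (%x. norm (g x)))"

lemma sets_dom: "Q \<in> sets borel ==> indicat_real Q \<in> borel_measurable L"
  by (intro borel_imp_measurable_dom) simp

lemma integrable_indicator_times:
  fixes f :: "'a => real"
  assumes "Q \<in> sets borel" "integrable L f"
  shows "integrable L (%x. indicat_real Q x * f x)"
proof (rule integrable_bound[OF assms(2)])
  show "(%x. indicat_real Q x * f x) \<in> borel_measurable L"
    using sets_dom[OF assms(1)] borel_measurable_integrable[OF assms(2)] by simp
qed (auto simp: indicator_def)

lemma test_fn_poincare:
  assumes \<phi>: "\<phi> \<in> test_fns \<Omega>" and Q: "convex Q" "bounded Q" "Q \<in> sets borel" "measure lborel Q > 0"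
    and D: "!!x y. x \<in> Q ==> y \<in> Q ==> dist x y \<le> D"
  shows "sint Q (%x. \<bar>\<phi> x - avg Q \<phi>\<bar>) + \<bar>avg Q \<phi>\<bar> * measure lborel (Q - \<Omega>)
          \<le> 2 ^ DIM('a) * D * sint Q (%x. norm (grad \<phi> x))"
proof -
  let ?g = "%x. norm (grad \<phi> x)"
  let ?N = "\<integral>\<^sup>+ x. indicator Q x * ennreal (norm (grad \<phi> x)) \<partial>lborel"
  let ?I = "%x. \<integral>y. indicat_real Q y * \<bar>\<phi> x - \<phi> y\<bar> \<partial>lborel"
  note [measurable] = Q(3)
  have \<phi>m[measurable]: "\<phi> \<in> borel_measurable borel" by (intro borel_measurable_continuous_onI test_fns_continuous[OF \<phi>])
  have gm[measurable]: "grad \<phi> \<in> borel_measurable borel" by (intro borel_measurable_continuous_onI test_fns_grad_continuous[OF \<phi>])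
  obtain B where B: "!!x. \<bar>\<phi> x\<bar> \<le> B" "!!x. norm (grad \<phi> x) \<le> B" using test_fns_bounded[OF \<phi>] by metis
  have Qfin: "emeasure lborel Q < \<infinity>" using Q(2) by (rule emeasure_bounded_finite)
  have Qm: "emeasure lborel Q = ennreal (measure lborel Q)" using Qfin by (simp add: emeasure_eq_ennreal_measure)
  let ?q = "measure lborel Q"
  have D0: "D \<ge> 0"
  proof -
    have "Q \<noteq> {}" using Q(4) by auto
    then show ?thesis using D by (metis all_not_in_conv dist_self)
  qed
  have Qi: "integrable lborel (%x. indicat_real Q x * f x)" if [measurable]: "f \<in> borel_measurable borel" and "!!x. \<bar>f x\<bar> \<le> C" for f C
  proof (rule integrable_bound[of _ "%x. C * indicat_real Q x"])
    show "integrable lborel (%x. C * indicat_real Q x)" using Qfin by (intro integrable_mult_right) (simp add: integrable_indicator_iff less_top)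
    show "AE x in lborel. norm (indicat_real Q x * f x) \<le> norm (C * indicat_real Q x)"
      using that(2) by (intro AE_I2) (auto simp: indicator_def intro: order_trans[OF _ abs_ge_self])
  qed measurable
  have tr: "sint Q f = bint Q f"
    if "f \<in> borel_measurable borel" "!!x. x \<notin> \<Omega> ==> f x = 0" for f :: "'a => real"
    by (rule integral_lebesgue_on_eq_lborel[OF _ _ dom_sets]) (use that in \<open>auto intro!: borel_measurable_times\<close>)
  have c_eq: "avg Q \<phi> = bint Q (%x. \<phi> x) / ?q"
    unfolding avg_def using tr[OF \<phi>m] test_fns_zero_outside[OF \<phi>] by simp
  let ?c = "avg Q \<phi>"
  let ?d = "%x. \<bar>\<phi> x - ?c\<bar>"
  \<comment> \<open>The deviation from the average is the average of the differences, hence bounded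
    by the averaged absolute difference; this leads back to the double integral.\<close>
  have Qc: "indicat_real Q x * ?d x \<le> indicat_real Q x * (?I x / ?q)" for x
  proof -
    have "(\<integral>y. indicat_real Q y * (\<phi> x - \<phi> y) \<partial>lborel) = (\<integral>y. indicat_real Q y * \<phi> x - indicat_real Q y * \<phi> y \<partial>lborel)"
      by (simp add: right_diff_distrib)
    also have "\<dots> = (\<integral>y. indicat_real Q y * \<phi> x \<partial>lborel) - (\<integral>y. indicat_real Q y * \<phi> y \<partial>lborel)"
      using Qi[of "%_. \<phi> x" "\<bar>\<phi> x\<bar>"] Qi[OF \<phi>m B(1)] by (intro Bochner_Integration.integral_diff) auto
    also have "\<dots> = ?q * \<phi> x - ?q * ?c" using Q(4) by (simp add: c_eq)
    finally have "\<phi> x - ?c = (\<integral>y. indicat_real Q y * (\<phi> x - \<phi> y) \<partial>lborel) / ?q" using Q(4) by (simp add: field_simps)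
    also have "\<bar>\<dots>\<bar> \<le> (\<integral>y. \<bar>indicat_real Q y * (\<phi> x - \<phi> y)\<bar> \<partial>lborel) / ?q"
      using Q(4) by (simp add: divide_right_mono integral_abs_bound)
    finally have "?d x \<le> ?I x / ?q" by (simp add: abs_mult)
    then show ?thesis by (intro mult_left_mono) auto
  qed
  have bd: "\<bar>\<phi> x - \<phi> y\<bar> \<le> 2 * B" for x y using B(1)[of x] B(1)[of y] by linarith
  have inner: "ennreal (indicat_real Q x * (?I x / ?q))
      = ennreal (1 / ?q) * (\<integral>\<^sup>+ y. indicator Q x * (indicator Q y * ennreal \<bar>\<phi> x - \<phi> y\<bar>) \<partial>lborel)" for x
  proof -
    have "ennreal (?I x) = (\<integral>\<^sup>+ y. ennreal (indicat_real Q y * \<bar>\<phi> x - \<phi> y\<bar>) \<partial>lborel)"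
      by (rule nn_integral_eq_integral[symmetric]) (use bd in \<open>auto intro!: Qi\<close>)
    also have "\<dots> = (\<integral>\<^sup>+ y. indicator Q y * ennreal \<bar>\<phi> x - \<phi> y\<bar> \<partial>lborel)"
      by (intro nn_integral_cong) (auto simp: indicator_def)
    finally have e: "ennreal (?I x) = (\<integral>\<^sup>+ y. indicator Q y * ennreal \<bar>\<phi> x - \<phi> y\<bar> \<partial>lborel)" .
    show ?thesis
    proof (cases "x \<in> Q")
      case True
      then show ?thesis using Q(4) by (simp add: e[symmetric] divide_inverse mult.commute flip: ennreal_mult'')
    qed simp
  qed
  have nn: "(\<integral>\<^sup>+ x. ennreal (indicat_real Q x * ?d x) \<partial>lborel) \<le> ennreal (2 ^ DIM('a) * D) * ?N"
  proof -
    have "(\<integral>\<^sup>+ x. ennreal (indicat_real Q x * ?d x) \<partial>lborel) \<le> (\<integral>\<^sup>+ x. ennreal (1 / ?q) * (\<integral>\<^sup>+ y. indicator Q x * (indicator Q y * ennreal \<bar>\<phi> x - \<phi> y\<bar>) \<partial>lborel) \<partial>lborel)"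
      unfolding inner[symmetric] by (intro nn_integral_mono ennreal_leI Qc)
    also have "\<dots> = ennreal (1 / ?q) * (\<integral>\<^sup>+ x. \<integral>\<^sup>+ y. indicator Q x * (indicator Q y * ennreal \<bar>\<phi> x - \<phi> y\<bar>) \<partial>lborel \<partial>lborel)"
      by (rule nn_integral_cmult) measurable
    also have "\<dots> \<le> ennreal (1 / ?q) * (ennreal D * (ennreal (2 ^ DIM('a)) * emeasure lborel Q * ?N))"
      by (intro mult_left_mono convex_poincare_nn[OF \<phi> Q(1,3) D]) auto
    also have "\<dots> = (ennreal (1 / ?q) * ennreal ?q) * (ennreal (2 ^ DIM('a)) * ennreal D) * ?N"
      unfolding Qm by (simp add: mult_ac)
    also have "ennreal (1 / ?q) * ennreal ?q = 1" using Q(4) by (simp flip: ennreal_mult'')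
    finally show ?thesis using D0 by (simp add: ennreal_mult)
  qed
  have i1: "integrable lborel (%x. indicat_real Q x * ?d x)"
  proof (rule Qi[where C = "B + \<bar>?c\<bar>"])
    show "\<bar>?d x\<bar> \<le> B + \<bar>?c\<bar>" for x using B(1)[of x] by linarith
  qed measurable
  have i2: "integrable lborel (%x. indicat_real Q x * norm (grad \<phi> x))" by (rule Qi[where C = B]) (use B in auto)
  have "ennreal (bint Q ?d) \<le> ennreal (2 ^ DIM('a) * D) * ennreal (bint Q ?g)"
  proof -
    have 1: "ennreal (bint Q ?d) = (\<integral>\<^sup>+ x. ennreal (indicat_real Q x * ?d x) \<partial>lborel)"
      by (rule nn_integral_eq_integral[symmetric, OF i1]) auto
    have 2: "ennreal (bint Q ?g) = (\<integral>\<^sup>+ x. ennreal (indicat_real Q x * norm (grad \<phi> x)) \<partial>lborel)"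
      by (rule nn_integral_eq_integral[symmetric, OF i2]) auto
    have 3: "\<dots> = ?N"
      by (intro nn_integral_cong) (auto simp: indicator_def)
    show ?thesis using nn unfolding 1 2 3 .
  qed
  also have "\<dots> = ennreal (2 ^ DIM('a) * D * bint Q ?g)"
    using D0 by (simp add: ennreal_mult)
  finally have R: "bint Q ?d \<le> 2 ^ DIM('a) * D * bint Q ?g"
    using D0 by (subst (asm) ennreal_le_iff) auto
  \<comment> \<open>Outside the domain the test function is zero, so its deviation from the average
    there is the constant |avg|; this produces the extra term.\<close>
  have "bint Q ?d = (\<integral>x. indicat_real Q x * (?d x * indicat_real \<Omega> x) + \<bar>?c\<bar> * indicat_real (Q - \<Omega>) x \<partial>lborel)"
    using test_fns_zero_outside[OF \<phi>] by (intro integral_cong) (auto simp: indicator_def)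
  also have "\<dots> = bint Q (%x. (?d x * indicat_real \<Omega> x)) + \<bar>?c\<bar> * measure lborel (Q - \<Omega>)"
  proof (subst integral_add)
    have [measurable]: "\<Omega> \<in> sets borel" using open_dom by simp
    show "integrable lborel (%x. indicat_real Q x * (?d x * indicat_real \<Omega> x))"
    proof (rule Qi[where C = "B + \<bar>?c\<bar>"])
      show "\<bar>?d x * indicat_real \<Omega> x\<bar> \<le> B + \<bar>?c\<bar>" for x using B(1)[of x] by (auto simp: indicator_def)
    qed measurable
    have "emeasure lborel (Q - \<Omega>) < \<infinity>" using emeasure_mono[of "Q - \<Omega>" Q lborel] Qfin by (auto intro: le_less_trans)
    then show "integrable lborel (%x. \<bar>?c\<bar> * indicat_real (Q - \<Omega>) x)"
      by (intro integrable_mult_right) (simp add: integrable_indicator_iff less_top)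
  qed simp
  also have "bint Q (%x. (?d x * indicat_real \<Omega> x)) = sint Q (%x. (?d x * indicat_real \<Omega> x))"
    by (rule tr[symmetric]) (use open_dom in auto)
  also have "\<dots> = sint Q ?d"
    by (rule integral_cong) auto
  finally have Leq: "bint Q ?d = sint Q ?d + \<bar>?c\<bar> * measure lborel (Q - \<Omega>)" .
  have "bint Q ?g = sint Q ?g"
    by (rule tr[symmetric]) (use test_fns_zero_outside[OF \<phi>] in auto)
  then show ?thesis using R Leq by simp
qed

lemma poincare_limit:
  assumes \<phi>: "!!k. \<phi> k \<in> test_fns \<Omega>" and u: "integrable L u" and g: "integrable L g"
    and lu: "(%k. \<integral>x. \<bar>\<phi> k x - u x\<bar> \<partial>L) \<longlonglongrightarrow> 0"
    and lg: "(%k. \<integral>x. norm (grad (\<phi> k) x - g x) \<partial>L) \<longlonglongrightarrow> 0"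
  shows "poincare u g"
  unfolding poincare_def
proof (intro conjI allI impI u g)
  fix Q :: "'a set" and D assume Q: "convex Q" "bounded Q" "Q \<in> sets borel" "measure lborel Q > 0" and D: "\<forall>x\<in>Q. \<forall>y\<in>Q. dist x y \<le> D"
  let ?u = "%k. \<integral>x. \<bar>\<phi> k x - u x\<bar> \<partial>L"
  interpret finite_measure L by (rule finite_measure_dom)
  have \<phi>i: "integrable L (\<phi> k)" "integrable L (grad (\<phi> k))" for k
  proof -
    obtain B where "!!x. \<bar>\<phi> k x\<bar> \<le> B" "!!x. norm (grad (\<phi> k) x) \<le> B" using test_fns_bounded[OF \<phi>] by metis
    then show "integrable L (\<phi> k)" "integrable L (grad (\<phi> k))"
      by (auto intro!: integrable_continuous_bounded test_fns_continuous[OF \<phi>] test_fns_grad_continuous[OF \<phi>])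
  qed
  have L: "(%k. sint Q (F k)) \<longlonglongrightarrow> sint Q f"
    if i: "!!k. integrable L (F k)" "integrable L f" and l: "(%k. \<integral>x. \<bar>F k x - f x\<bar> \<partial>L) \<longlonglongrightarrow> 0" for F :: "nat => 'a => real" and f
  proof -
    have "(%k. \<integral>x. F k x * indicat_real Q x \<partial>L) \<longlonglongrightarrow> (\<integral>x. f x * indicat_real Q x \<partial>L)"
      by (rule integral_times_bounded_tendsto[where B = 1, OF _ _ sets_dom[OF Q(3)] _ i l]) (use i in \<open>auto simp: indicator_def\<close>)
    then show ?thesis by (simp add: mult.commute)
  qed
  have a: "(%k. avg Q (\<phi> k)) \<longlonglongrightarrow> avg Q u"
    unfolding avg_def using Q(4) by (intro tendsto_divide tendsto_const L \<phi>i u lu) auto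
  have 1: "(%k. sint Q (%x. \<bar>\<phi> k x - avg Q (\<phi> k)\<bar>)) \<longlonglongrightarrow> sint Q (%x. \<bar>u x - avg Q u\<bar>)"
  proof (rule L)
    let ?m = "measure L (space L)"
    show "(%k. \<integral>x. \<bar>\<bar>\<phi> k x - avg Q (\<phi> k)\<bar> - \<bar>u x - avg Q u\<bar>\<bar> \<partial>L) \<longlonglongrightarrow> 0"
    proof (rule Lim_null_comparison[OF always_eventually], intro allI)
      have "(%k. ?u k + \<bar>avg Q (\<phi> k) - avg Q u\<bar> * ?m) \<longlonglongrightarrow> 0 + \<bar>avg Q u - avg Q u\<bar> * ?m"
        by (intro tendsto_intros lu a)
      then show "(%k. ?u k + \<bar>avg Q (\<phi> k) - avg Q u\<bar> * ?m) \<longlonglongrightarrow> 0" by simp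
      fix k
      have "(\<integral>x. \<bar>\<bar>\<phi> k x - avg Q (\<phi> k)\<bar> - \<bar>u x - avg Q u\<bar>\<bar> \<partial>L) \<le> (\<integral>x. \<bar>\<phi> k x - u x\<bar> + \<bar>avg Q (\<phi> k) - avg Q u\<bar> \<partial>L)"
      proof (rule integral_mono)
        show "integrable L (%x. \<bar>\<bar>\<phi> k x - avg Q (\<phi> k)\<bar> - \<bar>u x - avg Q u\<bar>\<bar>)" using \<phi>i u by auto
        show "integrable L (%x. \<bar>\<phi> k x - u x\<bar> + \<bar>avg Q (\<phi> k) - avg Q u\<bar>)" using \<phi>i u by auto
      qed linarith
      also have "\<dots> = ?u k + \<bar>avg Q (\<phi> k) - avg Q u\<bar> * ?m"
        using \<phi>i(1)[of k] u by (subst integral_add) (auto simp: mult.commute)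
      finally show "norm (\<integral>x. \<bar>\<bar>\<phi> k x - avg Q (\<phi> k)\<bar> - \<bar>u x - avg Q u\<bar>\<bar> \<partial>L) \<le> ?u k + \<bar>avg Q (\<phi> k) - avg Q u\<bar> * ?m"
        by simp
    qed
  qed (use \<phi>i u in auto)
  have 2: "(%k. sint Q (%x. norm (grad (\<phi> k) x))) \<longlonglongrightarrow> sint Q (%x. norm (g x))"
  proof (rule L)
    show "(%k. \<integral>x. \<bar>norm (grad (\<phi> k) x) - norm (g x)\<bar> \<partial>L) \<longlonglongrightarrow> 0"
    proof (rule Lim_null_comparison[OF always_eventually lg], intro allI)
      fix k
      have "(\<integral>x. \<bar>norm (grad (\<phi> k) x) - norm (g x)\<bar> \<partial>L) \<le> (\<integral>x. norm (grad (\<phi> k) x - g x) \<partial>L)"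
        using \<phi>i(2)[of k] g by (intro integral_mono) (auto intro: norm_triangle_ineq3)
      then show "norm (\<integral>x. \<bar>norm (grad (\<phi> k) x) - norm (g x)\<bar> \<partial>L) \<le> (\<integral>x. norm (grad (\<phi> k) x - g x) \<partial>L)" by simp
    qed
  qed (use \<phi>i g in auto)
  show "sint Q (%x. \<bar>u x - avg Q u\<bar>) + \<bar>avg Q u\<bar> * measure lborel (Q - \<Omega>)
          \<le> 2 ^ DIM('a) * D * sint Q (%x. norm (g x))"
  proof (rule LIMSEQ_le)
    show "(%k. sint Q (%x. \<bar>\<phi> k x - avg Q (\<phi> k)\<bar>) + \<bar>avg Q (\<phi> k)\<bar> * measure lborel (Q - \<Omega>)) \<longlonglongrightarrow>
       (sint Q (%x. \<bar>u x - avg Q u\<bar>)) + \<bar>avg Q u\<bar> * measure lborel (Q - \<Omega>)"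
      by (intro tendsto_intros 1 a)
    show "(%k. 2 ^ DIM('a) * D * sint Q (%x. norm (grad (\<phi> k) x))) \<longlonglongrightarrow> 2 ^ DIM('a) * D * sint Q (%x. norm (g x))"
      by (intro tendsto_intros 2)
  qed (use test_fn_poincare[OF \<phi> Q] D in blast)
qed

end

lemma (in sobolev) approximable_poincare:
  assumes "approximable u g" shows "poincare u g"
proof -
  obtain \<phi> where "!!k. \<phi> k \<in> test_fns \<Omega>" "integrable L u" "integrable L g" "(%k. \<integral>x. \<bar>\<phi> k x - u x\<bar> \<partial>L) \<longlonglongrightarrow> 0"
    "(%k. \<integral>x. norm (grad (\<phi> k) x - g x) \<partial>L) \<longlonglongrightarrow> 0" using approximable_L1[OF assms] by blast
  then show ?thesis by (intro poincare_limit)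
qed

section \<open>Averages over dyadic cells\<close>

text \<open>The half-open dyadic cube of side 2^-j around z. A cell is addressed by any of its
  points, so two cells of one generation that meet are equal as sets.\<close>

definition cell :: "nat => 'a::euclidean_space => 'a set" where
  "cell j z = {x. \<forall>i\<in>Basis. \<lfloor>2 ^ j * (x \<bullet> i)\<rfloor> = \<lfloor>2 ^ j * (z \<bullet> i)\<rfloor>}"

lemma cell_self [simp]: "z \<in> cell j z" by (simp add: cell_def)

lemma cell_eq: "x \<in> cell j z ==> cell j x = cell j z" by (auto simp: cell_def)

lemma cell_Suc_subset: "cell (Suc j) z \<subseteq> cell j z"
proof
  fix x assume x: "x \<in> cell (Suc j) z"
  have half: "\<lfloor>a\<rfloor> = \<lfloor>b\<rfloor>" if "\<lfloor>2 * a\<rfloor> = \<lfloor>2 * b\<rfloor>" for a b :: real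
  proof -
    have "2 * \<lfloor>a\<rfloor> \<le> \<lfloor>2 * a\<rfloor>" by (simp add: le_floor_iff)
    moreover have "\<lfloor>2 * a\<rfloor> < 2 * \<lfloor>a\<rfloor> + 2" unfolding floor_less_iff by simp linarith
    ultimately have "real_of_int (2 * \<lfloor>a\<rfloor>) \<le> 2 * b" "2 * b < real_of_int (2 * \<lfloor>a\<rfloor> + 2)"
      unfolding that le_floor_iff floor_less_iff by auto
    then have "\<lfloor>b\<rfloor> = \<lfloor>a\<rfloor>" by (intro floor_unique) auto
    then show ?thesis by simp
  qed
  show "x \<in> cell j z" unfolding cell_def
  proof (clarify)
    fix i :: 'a assume "i \<in> Basis"
    then have "\<lfloor>2 * (2 ^ j * (x \<bullet> i))\<rfloor> = \<lfloor>2 * (2 ^ j * (z \<bullet> i))\<rfloor>" using x by (simp add: cell_def mult.assoc)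
    then show "\<lfloor>2 ^ j * (x \<bullet> i)\<rfloor> = \<lfloor>2 ^ j * (z \<bullet> i)\<rfloor>" by (rule half)
  qed
qed

lemma mem_cell:
  "x \<in> cell j z \<longleftrightarrow> (\<forall>i\<in>Basis. of_int \<lfloor>2 ^ j * (z \<bullet> i)\<rfloor> / 2 ^ j \<le> x \<bullet> i \<and> x \<bullet> i < (of_int \<lfloor>2 ^ j * (z \<bullet> i)\<rfloor> + 1) / 2 ^ j)"
  by (auto simp: cell_def floor_eq_iff field_simps)

lemma cell_halfspaces:
  "cell j z = (\<Inter>i\<in>Basis. {x. of_int \<lfloor>2 ^ j * (z \<bullet> i)\<rfloor> / 2 ^ j \<le> i \<bullet> x} \<inter> {x. i \<bullet> x < (of_int \<lfloor>2 ^ j * (z \<bullet> i)\<rfloor> + 1) / 2 ^ j})"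
  by (auto simp: cell_def floor_eq_iff field_simps inner_commute)

lemma cell_convex: "convex (cell j z)"
  unfolding cell_halfspaces by (intro convex_INT convex_Int convex_halfspace_ge convex_halfspace_lt)

lemma cell_borel [measurable]: "cell j z \<in> sets borel"
  unfolding cell_halfspaces
  by (intro sets.finite_INT sets.Int borel_closed borel_open closed_halfspace_ge open_halfspace_lt) auto

lemma cell_dist: 
  fixes x :: "'a::euclidean_space"
  assumes "x \<in> cell j z" "y \<in> cell j z" shows "dist x y \<le> real DIM('a) * (1/2) ^ j"
proof -
  have "norm (x - y) \<le> (\<Sum>i\<in>Basis. \<bar>(x - y) \<bullet> i\<bar>)" by (rule norm_le_l1)
  also have "\<dots> \<le> (\<Sum>i\<in>(Basis::'a set). (1/2) ^ j)"
  proof (rule sum_mono)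
    fix i :: 'a assume i: "i \<in> Basis"
    have "\<lfloor>2 ^ j * (x \<bullet> i)\<rfloor> = \<lfloor>2 ^ j * (y \<bullet> i)\<rfloor>" using assms i by (simp add: cell_def)
    then have "\<bar>2 ^ j * (x \<bullet> i) - 2 ^ j * (y \<bullet> i)\<bar> \<le> 1" by linarith
    then have "2 ^ j * \<bar>(x - y) \<bullet> i\<bar> \<le> 1" by (simp add: inner_diff_left abs_mult flip: right_diff_distrib)
    then show "\<bar>(x - y) \<bullet> i\<bar> \<le> (1/2) ^ j" by (simp add: field_simps power_one_over)
  qed
  finally show ?thesis by (simp add: dist_norm)
qed

lemma cell_bounded: "bounded (cell j z)"
  unfolding bounded_def using cell_dist[of z j z] by (metis cell_self)

lemma cell_measure: "measure lborel (cell j (z::'a::euclidean_space)) = (1/2) ^ (j * DIM('a))"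
proof -
  let ?n = "%i. real_of_int \<lfloor>2 ^ j * (z \<bullet> i)\<rfloor>"
  define a where "a = (\<Sum>i\<in>Basis. (?n i / 2 ^ j) *\<^sub>R i)"
  define b where "b = (\<Sum>i\<in>Basis. ((?n i + 1) / 2 ^ j) *\<^sub>R i)"
  have ab: "a \<bullet> i = ?n i / 2 ^ j" "b \<bullet> i = (?n i + 1) / 2 ^ j" if "i \<in> Basis" for i
    using that by (simp_all add: a_def b_def)
  have le: "a \<bullet> i \<le> b \<bullet> i" if "i \<in> Basis" for i using ab[OF that] by (simp add: divide_right_mono)
  have prod: "(\<Prod>i\<in>Basis. (b - a) \<bullet> i) = (1/2) ^ (j * DIM('a))"
  proof -
    have "(\<Prod>i\<in>Basis. (b - a) \<bullet> i) = (\<Prod>i\<in>(Basis::'a set). (1/2) ^ j)"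
      by (intro prod.cong) (auto simp: inner_diff_left ab power_one_over add_divide_distrib inverse_eq_divide)
    then show ?thesis by (simp add: power_mult)
  qed
  have s1: "box a b \<subseteq> cell j z" by (fastforce simp: mem_cell mem_box ab)
  have s2: "cell j z \<subseteq> cbox a b" by (fastforce simp: mem_cell mem_box ab)
  have "emeasure lborel (box a b) \<le> emeasure lborel (cell j z)" by (intro emeasure_mono s1) simp
  moreover have "emeasure lborel (cell j z) \<le> emeasure lborel (cbox a b)" by (intro emeasure_mono s2) simp
  moreover have "emeasure lborel (box a b) = ennreal ((1/2) ^ (j * DIM('a)))" "emeasure lborel (cbox a b) = ennreal ((1/2) ^ (j * DIM('a)))"
    using le prod by (simp_all add: emeasure_lborel_box emeasure_lborel_cbox)
  ultimately have "emeasure lborel (cell j z) = ennreal ((1/2) ^ (j * DIM('a)))" by simp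
  then show ?thesis by (simp add: measure_def)
qed

context bdomain
begin

lemma poincare_cell:
  assumes "poincare u g"
  shows "sint (cell j z) (%x. \<bar>u x - avg (cell j z) u\<bar>) + \<bar>avg (cell j z) u\<bar> * measure lborel (cell j z - \<Omega>)
          \<le> 2 ^ DIM('a) * (real DIM('a) * (1/2) ^ j) * sint (cell j z) (%x. norm (g x))"
  using assms unfolding poincare_def
  by (auto simp: cell_convex cell_bounded cell_borel cell_measure cell_dist)

lemma finite_cells: "\<exists>R. finite R \<and> R \<subseteq> \<Omega> \<and> (\<forall>x\<in>\<Omega>. \<exists>!r. r \<in> R \<and> x \<in> cell j r)"
proof -
  obtain B where B: "!!x. x \<in> \<Omega> ==> norm x \<le> B" using bounded_dom unfolding bounded_iff by auto
  let ?f = "%x. \<lambda>i\<in>(Basis::'a set). \<lfloor>2 ^ j * (x \<bullet> i)\<rfloor>"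
  have f_eq: "?f x = ?f y \<longleftrightarrow> x \<in> cell j y" for x y
    by (auto simp: cell_def fun_eq_iff restrict_def)
  have "?f ` \<Omega> \<subseteq> PiE Basis (%_. {\<lfloor>- (2 ^ j * B)\<rfloor>..\<lfloor>2 ^ j * B\<rfloor>})"
  proof (clarsimp)
    fix x i :: 'a assume x: "x \<in> \<Omega>" and i: "i \<in> Basis"
    have "\<bar>x \<bullet> i\<bar> \<le> B" using Basis_le_norm[OF i, of x] B[OF x] by linarith
    then have "2 ^ j * \<bar>x \<bullet> i\<bar> \<le> 2 ^ j * B" by (intro mult_left_mono) auto
    then have "\<bar>2 ^ j * (x \<bullet> i)\<bar> \<le> 2 ^ j * B" by (simp add: abs_mult)
    then show "\<lfloor>- (2 ^ j * B)\<rfloor> \<le> \<lfloor>2 ^ j * (x \<bullet> i)\<rfloor> \<and> \<lfloor>2 ^ j * (x \<bullet> i)\<rfloor> \<le> \<lfloor>2 ^ j * B\<rfloor>"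
      by (intro conjI floor_mono) (auto simp: abs_le_iff)
  qed
  then have fin: "finite (?f ` \<Omega>)" by (rule finite_subset) (intro finite_PiE, auto)
  define rep where "rep c = (SOME z. z \<in> \<Omega> \<and> ?f z = c)" for c
  have rep: "rep c \<in> \<Omega> \<and> ?f (rep c) = c" if "c \<in> ?f ` \<Omega>" for c
  proof -
    from that obtain z where "z \<in> \<Omega> \<and> ?f z = c" by blast
    then show ?thesis unfolding rep_def by (rule someI)
  qed
  show ?thesis
  proof (intro exI[of _ "rep ` (?f ` \<Omega>)"] conjI ballI)
    show "finite (rep ` (?f ` \<Omega>))" using fin by simp
    show "rep ` (?f ` \<Omega>) \<subseteq> \<Omega>" using rep by auto
    fix x assume x: "x \<in> \<Omega>"
    show "\<exists>!r. r \<in> rep ` (?f ` \<Omega>) \<and> x \<in> cell j r"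
    proof (rule ex1I[of _ "rep (?f x)"])
      show "rep (?f x) \<in> rep ` (?f ` \<Omega>) \<and> x \<in> cell j (rep (?f x))"
        using rep[of "?f x"] x f_eq[of x "rep (?f x)"] by auto
      fix r assume r: "r \<in> rep ` (?f ` \<Omega>) \<and> x \<in> cell j r"
      then obtain y where y: "y \<in> \<Omega>" "r = rep (?f y)" by auto
      have "?f x = ?f r" using r f_eq by blast
      then show "r = rep (?f x)" using rep[of "?f y"] y by auto
    qed
  qed
qed

text \<open>One point of the domain for each cell of generation j that meets it. The cardinality
  becomes the number of linear constraints in the minimax argument.\<close>

definition reps :: "nat => 'a set" where
  "reps j = (SOME R. finite R \<and> R \<subseteq> \<Omega> \<and> (\<forall>x\<in>\<Omega>. \<exists>!r. r \<in> R \<and> x \<in> cell j r))"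

lemma reps: "finite (reps j)" "reps j \<subseteq> \<Omega>" "x \<in> \<Omega> ==> \<exists>!r. r \<in> reps j \<and> x \<in> cell j r"
  using someI_ex[OF finite_cells[of j]] unfolding reps_def by auto

lemma sum_reps:
  assumes "x \<in> \<Omega>" shows "(\<Sum>r\<in>reps j. indicat_real (cell j r) x * F (cell j r)) = F (cell j x)"
proof -
  obtain r where r: "r \<in> reps j" "x \<in> cell j r" "!!r'. r' \<in> reps j ==> x \<in> cell j r' ==> r' = r"
    using reps(3)[OF assms, of j] by auto
  have "(\<Sum>r\<in>reps j. indicat_real (cell j r) x * F (cell j r)) = (\<Sum>r'\<in>{r}. indicat_real (cell j r') x * F (cell j r'))"
  proof (rule sum.mono_neutral_right)
    show "\<forall>r'\<in>reps j - {r}. indicat_real (cell j r') x * F (cell j r') = 0"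
    proof
      fix r' assume "r' \<in> reps j - {r}"
      then have "x \<notin> cell j r'" using r(3) by blast
      then show "indicat_real (cell j r') x * F (cell j r') = 0" by simp
    qed
  qed (use reps(1) r(1) in simp_all)
  then show ?thesis using r(2) cell_eq[OF r(2)] by simp
qed

lemma integral_cells:
  fixes f :: "'a => real"
  assumes "integrable L f"
  shows "(\<integral>x. f x \<partial>L) = (\<Sum>r\<in>reps j. sint (cell j r) f)"
proof -
  have "(\<integral>x. f x \<partial>L) = (\<integral>x. (\<Sum>r\<in>reps j. indicat_real (cell j r) x * f x) \<partial>L)"
  proof (rule integral_cong)
    fix x assume "x \<in> space L"
    then show "f x = (\<Sum>r\<in>reps j. indicat_real (cell j r) x * f x)"
      using sum_reps[of x j "%_. f x"] by simp
  qed simp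
  also have "\<dots> = (\<Sum>r\<in>reps j. sint (cell j r) f)"
    by (intro Bochner_Integration.integral_sum integrable_indicator_times assms cell_borel)
  finally show ?thesis .
qed

lemma cell_step_measurable: "(%x. F (cell j x)) \<in> borel_measurable L" for F :: "'a set => real"
proof -
  have "(%x. \<Sum>r\<in>reps j. indicat_real (cell j r) x * F (cell j r)) \<in> borel_measurable L"
    by (intro borel_measurable_sum borel_measurable_times sets_dom cell_borel) auto
  then show ?thesis
    by (rule measurable_cong[THEN iffD1, rotated]) (simp add: sum_reps)
qed

lemma integral_indicator_dom:
  assumes [measurable]: "Q \<in> sets borel" and "bounded Q"
  shows "(\<integral>x. indicat_real Q x \<partial>L) + measure lborel (Q - \<Omega>) = measure lborel Q"
proof -
  have [measurable]: "\<Omega> \<in> sets borel" using open_dom by simp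
  have "(\<integral>x. indicat_real Q x \<partial>L) = (\<integral>x. indicat_real (Q \<inter> \<Omega>) x \<partial>L)"
    by (rule integral_cong) (auto simp: indicator_def)
  also have "\<dots> = (\<integral>x. indicat_real (Q \<inter> \<Omega>) x \<partial>lborel)"
    by (rule integral_lebesgue_on_eq_lborel[OF _ _ dom_sets]) auto
  also have "\<dots> = measure lborel (Q \<inter> \<Omega>)" by simp
  finally have 1: "(\<integral>x. indicat_real Q x \<partial>L) = measure lborel (Q \<inter> \<Omega>)" .
  have fin: "emeasure lborel A \<noteq> \<infinity>" if "A \<subseteq> Q" for A
    using emeasure_bounded_finite[OF bounded_subset[OF assms(2) that]] by simp
  have "measure lborel ((Q \<inter> \<Omega>) \<union> (Q - \<Omega>)) = measure lborel (Q \<inter> \<Omega>) + measure lborel (Q - \<Omega>)"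
    by (rule measure_Union) (use fin[of "Q \<inter> \<Omega>"] fin[of "Q - \<Omega>"] in auto)
  moreover have "(Q \<inter> \<Omega>) \<union> (Q - \<Omega>) = Q" by auto
  ultimately show ?thesis using 1 by simp
qed

text \<open>Applied to a ball of five times the radius of the domain: this ball contains another one
  of radius B around a point at distance 3 B from the origin, disjoint from the domain. The extra
  term of the inequality on that set bounds the average, which removes it from the estimate.\<close>

lemma poincare_L1:
  assumes "\<Omega> \<noteq> {}"
  obtains C where "C \<ge> 0" "!!u g. poincare u g ==> (\<integral>x. \<bar>u x\<bar> \<partial>L) \<le> C * (\<integral>x. norm (g x) \<partial>L)"
proof -
  obtain B where B: "B > 0" "!!x. x \<in> \<Omega> ==> norm x \<le> B" using bounded_dom unfolding bounded_pos by auto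
  obtain b :: 'a where b: "b \<in> Basis" using nonempty_Basis by blast
  define Q :: "'a set" where "Q = ball 0 (5 * B)"
  have sub: "\<Omega> \<subseteq> Q" using B by (force simp: Q_def)
  have "ball ((3 * B) *\<^sub>R b) B \<subseteq> Q - \<Omega>"
  proof
    fix x assume "x \<in> ball ((3 * B) *\<^sub>R b) B"
    then have d: "norm (x - (3 * B) *\<^sub>R b) < B" by (simp add: dist_norm norm_minus_commute)
    have n: "norm ((3 * B) *\<^sub>R b) = 3 * B" using b B by simp
    have "norm x \<le> norm (x - (3 * B) *\<^sub>R b) + 3 * B" using norm_triangle_sub[of x "(3 * B) *\<^sub>R b"] n by linarith
    moreover have "3 * B \<le> norm (x - (3 * B) *\<^sub>R b) + norm x"
      using norm_triangle_ineq4[of x "x - (3 * B) *\<^sub>R b"] n by simp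
    ultimately have "norm x < 5 * B" "norm x > B" using d B(1) by linarith+
    then show "x \<in> Q - \<Omega>" using B(2)[of x] by (auto simp: Q_def)
  qed
  have \<Omega>b: "\<Omega> \<in> sets borel" using open_dom by simp
  have Qb: "Q \<in> sets borel" "bounded Q" "convex Q" by (auto simp: Q_def)
  have fin: "emeasure lborel A \<noteq> \<infinity>" if "A \<subseteq> Q" for A
    using emeasure_bounded_finite[OF bounded_subset[OF Qb(2) that]] by simp
  have "0 < measure lborel (ball ((3 * B) *\<^sub>R b) B)" using B(1) by (rule content_ball_pos)
  also have "\<dots> \<le> measure lborel (Q - \<Omega>)"
    using \<open>ball ((3 * B) *\<^sub>R b) B \<subseteq> Q - \<Omega>\<close> Qb \<Omega>b fin[of "Q - \<Omega>"]
    by (intro measure_mono_fmeasurable) (auto simp: fmeasurable_def top.not_eq_extremum)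
  finally have e: "measure lborel (Q - \<Omega>) > 0" .
  define \<epsilon> where "\<epsilon> = measure lborel (Q - \<Omega>)"
  define V where "V = (\<integral>x. indicat_real Q x \<partial>L)"
  have Vq: "V + \<epsilon> = measure lborel Q" unfolding V_def \<epsilon>_def by (rule integral_indicator_dom[OF Qb(1,2)])
  have V0: "V \<ge> 0" unfolding V_def by simp
  have q0: "measure lborel Q > 0" using Vq V0 e by (simp add: \<epsilon>_def)
  define K where "K = 2 ^ DIM('a) * (10 * B)"
  show thesis
  proof (rule that[of "K + V * (K / \<epsilon>)"])
    show "0 \<le> K + V * (K / \<epsilon>)" using B(1) V0 e by (simp add: K_def \<epsilon>_def)
    fix u g assume P: "poincare u g"
    let ?c = "avg Q u" and ?G = "\<integral>x. norm (g x) \<partial>L"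
    have ui: "integrable L u" "integrable L g" using P by (auto simp: poincare_def)
    have "\<forall>x\<in>Q. \<forall>y\<in>Q. dist x y \<le> 10 * B"
    proof (intro ballI)
      fix x y assume "x \<in> Q" "y \<in> Q"
      then have "norm x < 5 * B" "norm y < 5 * B" by (auto simp: Q_def)
      then show "dist x y \<le> 10 * B" using norm_triangle_ineq4[of x y] by (simp add: dist_norm)
    qed
    then have M: "sint Q (%x. \<bar>u x - ?c\<bar>) + \<bar>?c\<bar> * \<epsilon> \<le> K * sint Q (%x. norm (g x))"
      using P Qb q0 unfolding poincare_def \<epsilon>_def K_def by blast
    let ?U = "\<integral>x. \<bar>u x - ?c\<bar> \<partial>L"
    have G: "sint Q (%x. norm (g x)) = ?G"
      by (rule integral_cong) (use sub in auto)
    have U: "sint Q (%x. \<bar>u x - ?c\<bar>) = ?U"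
      by (rule integral_cong) (use sub in auto)
    have Vi: "V = measure L (space L)"
    proof -
      have "V = (\<integral>x. 1 \<partial>L)" unfolding V_def by (rule integral_cong) (use sub in auto)
      then show ?thesis by simp
    qed
    interpret finite_measure L by (rule finite_measure_dom)
    have 0: "0 \<le> ?U" by simp
    have 1: "?U \<le> K * ?G" using M e unfolding G U
    proof -
      assume h: "?U + \<bar>?c\<bar> * \<epsilon> \<le> K * ?G"
      have "0 \<le> \<bar>?c\<bar> * \<epsilon>" using e by (simp add: \<epsilon>_def)
      then show ?thesis using h by linarith
    qed
    have "\<bar>?c\<bar> * \<epsilon> \<le> K * ?G" using M 0 unfolding G U by linarith
    then have 2: "\<bar>?c\<bar> \<le> K * ?G / \<epsilon>" using e by (simp add: field_simps \<epsilon>_def)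
    have "(\<integral>x. \<bar>u x\<bar> \<partial>L) \<le> (\<integral>x. \<bar>u x - ?c\<bar> + \<bar>?c\<bar> \<partial>L)"
      using ui by (intro integral_mono) auto
    also have "\<dots> = ?U + V * \<bar>?c\<bar>" using ui Vi by (subst integral_add) auto
    also have "\<dots> \<le> K * ?G + V * (K * ?G / \<epsilon>)" by (intro add_mono 1 mult_left_mono 2 V0)
    finally show "(\<integral>x. \<bar>u x\<bar> \<partial>L) \<le> (K + V * (K / \<epsilon>)) * ?G" by (simp add: algebra_simps)
  qed
qed

text \<open>The smaller cell lies in the larger, so the difference of averages is controlled by the
  oscillation on the larger cell divided by the smaller volume. One factor 2^N is the Poincare
  constant, the other the ratio of the volumes.\<close>

lemma cell_avg_diff:
  assumes P: "poincare u g"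
  shows "\<bar>avg (cell (Suc j) x) u - avg (cell j x) u\<bar>
    \<le> 4 ^ DIM('a) * real DIM('a) * (1/2) ^ j * ((\<integral>y. indicat_real (cell j x) y * norm (g y) \<partial>L) / (1/2) ^ (j * DIM('a)))"
proof -
  interpret finite_measure L by (rule finite_measure_dom)
  let ?Q = "cell j x" and ?Q' = "cell (Suc j) x"
  let ?c = "avg ?Q u" and ?N = "DIM('a)"
  let ?F = "\<integral>y. indicat_real ?Q y * norm (g y) \<partial>L"
  let ?Z = "\<integral>y. indicat_real ?Q y * \<bar>u y - ?c\<bar> \<partial>L"
  have ui: "integrable L u" using P by (simp add: poincare_def)
  have uc: "integrable L (%y. u y - ?c)" using ui by simp
  have i: "integrable L (%y. indicat_real A y * \<bar>u y - ?c\<bar>)" if "A \<in> sets borel" for A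
    by (rule integrable_indicator_times[OF that integrable_abs[OF uc]])
  have q': "measure lborel ?Q' = (1/2) ^ (Suc j * ?N)" by (rule cell_measure)
  have q'0: "measure lborel ?Q' > 0" unfolding q' by simp
  have "(\<integral>y. indicat_real ?Q' y * (u y - ?c) \<partial>L) = (\<integral>y. indicat_real ?Q' y * u y - ?c * indicat_real ?Q' y \<partial>L)"
    by (simp add: algebra_simps)
  also have "\<dots> = (\<integral>y. indicat_real ?Q' y * u y \<partial>L) - ?c * (\<integral>y. indicat_real ?Q' y \<partial>L)"
    using integrable_indicator_times[OF cell_borel ui, of "Suc j" x] integrable_indicator_times[OF cell_borel integrable_const[of 1], of "Suc j" x]
    by (subst Bochner_Integration.integral_diff) auto
  also have "(\<integral>y. indicat_real ?Q' y * u y \<partial>L) = measure lborel ?Q' * avg ?Q' u" using q'0 by (simp add: avg_def)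
  also have "(\<integral>y. indicat_real ?Q' y \<partial>L) = measure lborel ?Q' - measure lborel (?Q' - \<Omega>)"
    using integral_indicator_dom[OF cell_borel cell_bounded, of "Suc j" x] by simp
  finally have "measure lborel ?Q' * (avg ?Q' u - ?c) = (\<integral>y. indicat_real ?Q' y * (u y - ?c) \<partial>L) - ?c * measure lborel (?Q' - \<Omega>)"
    by (simp add: algebra_simps)
  also have "\<bar>\<dots>\<bar> \<le> (\<integral>y. \<bar>indicat_real ?Q' y * (u y - ?c)\<bar> \<partial>L) + \<bar>?c\<bar> * measure lborel (?Q' - \<Omega>)"
    by (rule order_trans[OF abs_triangle_ineq4], intro add_mono integral_abs_bound) (simp add: abs_mult)
  also have "\<dots> \<le> ?Z + \<bar>?c\<bar> * measure lborel (?Q - \<Omega>)"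
  proof (intro add_mono mult_left_mono)
    have "(\<integral>y. indicat_real ?Q' y * \<bar>u y - ?c\<bar> \<partial>L) \<le> ?Z"
      using cell_Suc_subset by (intro integral_mono i cell_borel mult_right_mono) (auto simp: indicator_def)
    then show "(\<integral>y. \<bar>indicat_real ?Q' y * (u y - ?c)\<bar> \<partial>L) \<le> ?Z" by (simp add: abs_mult)
    have "emeasure lborel (?Q - \<Omega>) \<noteq> \<infinity>" using emeasure_bounded_finite[OF bounded_subset[OF cell_bounded, of "?Q - \<Omega>" j x]] by auto
    then show "measure lborel (?Q' - \<Omega>) \<le> measure lborel (?Q - \<Omega>)"
      using cell_Suc_subset[of j x] open_dom by (intro measure_mono_fmeasurable) (auto simp: fmeasurable_def top.not_eq_extremum)
  qed simp
  also have "\<dots> \<le> 2 ^ ?N * (real ?N * (1/2) ^ j) * ?F"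
    by (rule poincare_cell[OF P])
  finally have "measure lborel ?Q' * \<bar>avg ?Q' u - ?c\<bar> \<le> 2 ^ ?N * (real ?N * (1/2) ^ j) * ?F"
    by (simp add: abs_mult)
  then have "\<bar>avg ?Q' u - ?c\<bar> \<le> 2 ^ ?N * (real ?N * (1/2) ^ j) * ?F / measure lborel ?Q'"
    using q'0 by (simp add: field_simps)
  also have "measure lborel ?Q' = (1/2) ^ ?N * (1/2) ^ (j * ?N)" unfolding q' by (simp add: power_add)
  also have "2 ^ ?N * (real ?N * (1/2) ^ j) * ?F / ((1/2) ^ ?N * (1/2) ^ (j * ?N))
      = 4 ^ ?N * real ?N * (1/2) ^ j * (?F / (1/2) ^ (j * ?N))"
  proof -
    have "(4::real) ^ ?N = 2 ^ ?N * 2 ^ ?N" by (simp flip: power_mult_distrib)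
    then show ?thesis by (simp add: power_one_over field_simps)
  qed
  finally show ?thesis .
qed

text \<open>The L1 distance between u and its averages of generation j is at most C 2^-j.
  Summability over j gives convergence almost everywhere.\<close>

lemma avg_converges_AE:
  assumes P: "poincare u g"
  shows "AE x in L. (%j. avg (cell j x) u) \<longlonglongrightarrow> u x"
proof -
  let ?D = "%j x. \<bar>u x - avg (cell j x) u\<bar>"
  interpret finite_measure L by (rule finite_measure_dom)
  have ui: "integrable L u" "integrable L g" using P by (auto simp: poincare_def)
  define C where "C = 2 ^ DIM('a) * real DIM('a) * (\<integral>x. norm (g x) \<partial>L)"
  have C: "C \<ge> 0" by (simp add: C_def)
  have am: "(%x. avg (cell j x) u) \<in> borel_measurable L" for j by (rule cell_step_measurable)
  have ai: "integrable L (%x. avg (cell j x) u)" for j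
  proof (rule integrable_bound[of _ "%x. \<Sum>r\<in>reps j. \<bar>avg (cell j r) u\<bar>"])
    show "AE x in L. norm (avg (cell j x) u) \<le> norm (\<Sum>r\<in>reps j. \<bar>avg (cell j r) u\<bar>)"
    proof (rule AE_I2)
      fix x assume "x \<in> space L"
      then obtain r where r: "r \<in> reps j" "x \<in> cell j r" using reps(3)[of x j] by auto
      then have "\<bar>avg (cell j x) u\<bar> \<le> (\<Sum>r\<in>reps j. \<bar>avg (cell j r) u\<bar>)"
        using member_le_sum[OF r(1), of "%r. \<bar>avg (cell j r) u\<bar>"] reps(1) cell_eq[OF r(2)] by auto
      then show "norm (avg (cell j x) u) \<le> norm (\<Sum>r\<in>reps j. \<bar>avg (cell j r) u\<bar>)" by simp
    qed
  qed (use am in auto)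
  have bnd: "(\<integral>x. ?D j x \<partial>L) \<le> C * (1/2) ^ j" for j
  proof -
    have "(\<integral>x. ?D j x \<partial>L) = (\<Sum>r\<in>reps j. sint (cell j r) (%x. ?D j x))"
      by (rule integral_cells) (use ui ai in auto)
    also have "\<dots> = (\<Sum>r\<in>reps j. sint (cell j r) (%x. \<bar>u x - avg (cell j r) u\<bar>))"
      by (intro sum.cong refl integral_cong) (auto simp: indicator_def cell_eq)
    also have "\<dots> \<le> (\<Sum>r\<in>reps j. 2 ^ DIM('a) * (real DIM('a) * (1/2) ^ j) * sint (cell j r) (%x. norm (g x)))"
    proof (rule sum_mono)
      fix r
      have "0 \<le> \<bar>avg (cell j r) u\<bar> * measure lborel (cell j r - \<Omega>)" by simp
      then show "sint (cell j r) (%x. \<bar>u x - avg (cell j r) u\<bar>) \<le> 2 ^ DIM('a) * (real DIM('a) * (1/2) ^ j) * sint (cell j r) (%x. norm (g x))"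
        using poincare_cell[OF P, of j r] by linarith
    qed
    also have "\<dots> = C * (1/2) ^ j"
      using integral_cells[OF integrable_norm[OF ui(2)], of j, symmetric] by (simp add: C_def flip: sum_distrib_left)
    finally show ?thesis .
  qed
  define T where "T x = (suminf (%j. ennreal (?D j x)))" for x
  have "AE x in L. T x \<noteq> top"
    unfolding T_def
  proof (rule nn_integral_suminf_bounded(2))
    fix j
    have "(\<integral>\<^sup>+ x. ennreal (?D j x) \<partial>L) = ennreal (\<integral>x. ?D j x \<partial>L)"
      by (rule nn_integral_eq_integral) (use ui ai in auto)
    then show "(\<integral>\<^sup>+ x. ennreal (?D j x) \<partial>L) \<le> ennreal (C * (1/2) ^ j)" using bnd by (simp add: ennreal_leI)
  qed (use C am borel_measurable_integrable[OF ui(1)] in \<open>auto intro!: summable_mult simp: summable_geometric\<close>)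
  then show ?thesis
  proof eventually_elim
    case (elim x)
    have "summable (%j. ?D j x)"
      using elim unfolding T_def by (intro summable_suminf_not_top) auto
    then have "(%j. ?D j x) \<longlonglongrightarrow> 0" by (rule summable_LIMSEQ_zero)
    then have "(%j. u x - avg (cell j x) u) \<longlonglongrightarrow> 0" by (rule tendsto_rabs_zero_cancel)
    then have "(%j. u x - (u x - avg (cell j x) u)) \<longlonglongrightarrow> u x - 0" by (intro tendsto_intros)
    then show ?case by simp
  qed
qed

end

section \<open>Embedding into the modular space of a subcritical exponent\<close>

lemma (in bdomain) integral_indicator_cell_le:
  "(\<integral>y. indicat_real (cell j x) y \<partial>L) \<le> (1/2) ^ (j * DIM('a))"
  using integral_indicator_dom[OF cell_borel cell_bounded, of j x] measure_nonneg[of lborel "cell j x - \<Omega>"]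
  unfolding cell_measure by linarith

text \<open>Subcriticality is the pointwise inequality N/p - N/\<alpha> < 1, automatic for p \<ge>
  N. Compactness of the closure makes the gap uniform, and uniform continuity keeps part of it when
  p is replaced by a constant on each small cell.\<close>

lemma (in bdomain) subcritical_gap:
  assumes ne: "\<Omega> \<noteq> {}" and pc: "continuous_on (closure \<Omega>) p" "!!x. x \<in> closure \<Omega> ==> 1 < p x"
    and ac: "continuous_on (closure \<Omega>) \<alpha>" "!!x. x \<in> closure \<Omega> ==> p x \<le> \<alpha> x"
    and sub: "!!x. x \<in> closure \<Omega> ==> p x < real DIM('a) ==> \<alpha> x < real DIM('a) * p x / (real DIM('a) - p x)"
  obtains \<delta> A j0 where "0 < \<delta>" "\<delta> \<le> 1" "1 \<le> A" "!!x. x \<in> \<Omega> ==> \<alpha> x \<le> A" "!!j x. j0 \<le> j ==> x \<in> \<Omega> ==>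
    \<exists>q a. 1 \<le> q \<and> q \<le> a \<and> a \<le> A \<and> (\<forall>y\<in>cell j x \<inter> \<Omega>. q \<le> p y) \<and> \<alpha> x \<le> a \<and> real DIM('a) / q - real DIM('a) / a \<le> 1 - \<delta>"
proof -
  let ?N = "real DIM('a)" and ?C = "closure \<Omega>"
  have N: "?N \<ge> 1" by (simp add: Suc_leI)
  have C: "compact ?C" "?C \<noteq> {}" using bounded_dom ne by (auto simp: compact_closure)
  have pp: "0 < p x" "0 < \<alpha> x" if "x \<in> ?C" for x using pc(2)[OF that] ac(2)[OF that] by auto
  have "continuous_on ?C (%x. ?N / p x - ?N / \<alpha> x)"
    by (intro continuous_intros pc(1) ac(1)) (use pp in fastforce)+
  from continuous_attains_sup[OF C this] obtain x0 where x0: "x0 \<in> ?C" "!!x. x \<in> ?C ==> ?N / p x - ?N / \<alpha> x \<le> ?N / p x0 - ?N / \<alpha> x0" by blast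
  have "?N / p x0 - ?N / \<alpha> x0 < 1"
  proof (cases "p x0 < ?N")
    case True
    then have "\<alpha> x0 * (?N - p x0) < ?N * p x0" using sub[OF x0(1)] by (simp add: field_simps)
    then have "?N * \<alpha> x0 - ?N * p x0 < p x0 * \<alpha> x0" by (simp add: algebra_simps)
    moreover have "?N / p x0 - ?N / \<alpha> x0 = (?N * \<alpha> x0 - ?N * p x0) / (p x0 * \<alpha> x0)" using pp[OF x0(1)] by (simp add: field_simps)
    ultimately show ?thesis using pp[OF x0(1)] by (simp add: divide_less_eq)
  next
    case False
    then have "?N / p x0 \<le> 1" using pp[OF x0(1)] by simp
    moreover have "?N / \<alpha> x0 > 0" using pp[OF x0(1)] N by simp
    ultimately show ?thesis by linarith
  qed
  then obtain e where e: "0 < e" "?N / p x0 - ?N / \<alpha> x0 \<le> 1 - 2 * e" "e \<le> 1"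
  proof -
    let ?d = "1 - (?N / p x0 - ?N / \<alpha> x0)"
    assume "?N / p x0 - ?N / \<alpha> x0 < 1"
    then show thesis by (intro that[of "min 1 (?d / 2)"]) (auto simp: min_def field_simps)
  qed
  obtain x1 where x1: "x1 \<in> ?C" "!!x. x \<in> ?C ==> p x1 \<le> p x" using continuous_attains_inf[OF C pc(1)] by blast
  obtain x2 where x2: "x2 \<in> ?C" "!!x. x \<in> ?C ==> \<alpha> x \<le> \<alpha> x2" using continuous_attains_sup[OF C ac(1)] by blast
  \<comment> \<open>Lowering p by \<eta> and raising \<alpha> by \<eta> changes each quotient by at
    most N \<eta> \<le> e/2, since all exponents remain at least 1. The gap 2 e thus shrinks to e at
    worst.\<close>
  define \<eta> where "\<eta> = min (e / (2 * ?N)) (p x1 - 1)"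
  have \<eta>: "0 < \<eta>" "\<eta> \<le> p x1 - 1" using e N pc(2)[OF x1(1)] by (auto simp: \<eta>_def)
  have N\<eta>: "?N * \<eta> \<le> e / 2"
  proof -
    have "\<eta> \<le> e / (2 * ?N)" by (simp add: \<eta>_def)
    then show ?thesis using N by (simp add: field_simps)
  qed
  obtain d where d: "d > 0" "!!x y. x \<in> ?C ==> y \<in> ?C ==> dist y x < d ==> dist (p y) (p x) < \<eta>"
    using compact_uniformly_continuous[OF pc(1) C(1)] \<eta>(1) unfolding uniformly_continuous_on_def by metis
  obtain j0 where j0: "(1/2::real) ^ j0 < d / ?N" using real_arch_pow_inv[of "d / ?N" "1/2"] d(1) N by auto
  show thesis
  proof (rule that[of e "\<alpha> x2 + \<eta>" j0])
    show "0 < e" "e \<le> 1" by (fact e)+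
    show "1 \<le> \<alpha> x2 + \<eta>" using pc(2)[OF x2(1)] ac(2)[OF x2(1)] \<eta> by linarith
    show "\<alpha> x \<le> \<alpha> x2 + \<eta>" if "x \<in> \<Omega>" for x using x2(2)[of x] that \<eta> closure_subset by fastforce
    fix j x assume j: "j0 \<le> j" and x: "x \<in> \<Omega>"
    then have xc: "x \<in> ?C" using closure_subset by blast
    let ?q = "p x - \<eta>" and ?a = "\<alpha> x + \<eta>"
    have q1: "1 \<le> ?q" using x1(2)[OF xc] \<eta> by linarith
    have near: "?q \<le> p y" if "y \<in> cell j x \<inter> \<Omega>" for y
    proof -
      have "dist y x \<le> ?N * (1/2) ^ j" using that by (intro cell_dist[of y j x x]) auto
      also have "\<dots> \<le> ?N * (1/2) ^ j0" using j by (intro mult_left_mono power_decreasing) auto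
      also have "\<dots> < d" using j0 N by (simp add: field_simps)
      finally have "dist (p y) (p x) < \<eta>" using that xc closure_subset by (intro d(2)) auto
      then show ?thesis by (simp add: dist_real_def abs_less_iff)
    qed
    have "?N / ?q - ?N / p x \<le> ?N * \<eta>"
    proof -
      have "?N / ?q - ?N / p x = ?N * \<eta> / (?q * p x)" using q1 \<eta> by (simp add: field_simps)
      also have "\<dots> \<le> ?N * \<eta> / 1"
        using q1 \<eta> N mult_mono[of 1 ?q 1 "p x"] by (intro divide_left_mono) auto
      finally show ?thesis by simp
    qed
    moreover have "?N / \<alpha> x - ?N / ?a \<le> ?N * \<eta>"
    proof -
      have a1: "1 \<le> \<alpha> x" using pc(2)[OF xc] ac(2)[OF xc] by linarith
      have "?N / \<alpha> x - ?N / ?a = ?N * \<eta> / (\<alpha> x * ?a)" using a1 \<eta> by (simp add: field_simps)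
      also have "\<dots> \<le> ?N * \<eta> / 1"
        using a1 \<eta> N mult_mono[of 1 "\<alpha> x" 1 ?a] by (intro divide_left_mono) auto
      finally show ?thesis by simp
    qed
    ultimately have "?N / ?q - ?N / ?a \<le> 1 - e" using x0(2)[OF xc] e(2) N\<eta> by linarith
    then show "\<exists>q a. 1 \<le> q \<and> q \<le> a \<and> a \<le> \<alpha> x2 + \<eta> \<and> (\<forall>y\<in>cell j x \<inter> \<Omega>. q \<le> p y) \<and> \<alpha> x \<le> a \<and> ?N / q - ?N / a \<le> 1 - e"
      using q1 near ac(2)[OF xc] \<eta> x2(2)[OF xc] by (intro exI[of _ ?q] exI[of _ ?a]) auto
  qed
qed

context sobolev
begin

text \<open>One scale of the embedding. On the cell the exponents are frozen to q and a; the size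
  2^-j of the cell gains exactly what the excess integrability a over q loses, and the gap \<delta>
  is left over as the weight 2^(j \<delta>).\<close>

lemma cell_avg_diff_powr:
  assumes PO: "poincare u g" and gi: "integrable L (%x. norm (g x) powr p x)"
    and R: "(\<integral>x. norm (g x) powr p x \<partial>L) \<le> R" and x: "x \<in> \<Omega>"
    and qa: "1 \<le> q" "q \<le> a" "a \<le> A" "!!y. y \<in> cell j x ==> y \<in> \<Omega> ==> q \<le> p y" and \<alpha>: "1 \<le> \<alpha>" "\<alpha> \<le> a"
    and gap: "real DIM('a) / q - real DIM('a) / a \<le> 1 - \<delta>"
  shows "(2 powr (real j * \<delta>) * \<bar>avg (cell (Suc j) x) u - avg (cell j x) u\<bar>) powr \<alpha>
    \<le> 1 + (2 * 4 ^ DIM('a) * real DIM('a)) powr A * (1 + R) powr A *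
       (1 + (\<integral>y. indicat_real (cell j x) y * norm (g y) powr p y \<partial>L) / (1/2) ^ (j * DIM('a)))"
proof -
  let ?e = "real j * (1 - \<delta>)"
  let ?N = "real DIM('a)" and ?Q = "cell j x"
  let ?f = "real j * ?N * (a / q - 1)"
  define h :: real where "h = (1/2) ^ (j * DIM('a))"
  define m where "m = (\<integral>y. indicat_real ?Q y * norm (g y) powr p y \<partial>L)"
  define G where "G = (\<integral>y. indicat_real ?Q y * norm (g y) \<partial>L)"
  define \<Lambda> where "\<Lambda> = 1 + m / h"
  \<comment> \<open>The splitting level satisfies l^q = \<Lambda>, which balances the two
    contributions of \<open>le_split_powr\<close>: both are at most l h after integration over the
    cell.\<close>
  define l where "l = \<Lambda> powr (1 / q)"
  define C where "C = 2 * 4 ^ DIM('a) * ?N"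
  have N: "?N \<ge> 1" by (simp add: Suc_leI)
  have C1: "C \<ge> 1"
  proof -
    have "1 * 1 \<le> (4::real) ^ DIM('a) * ?N" using N by (intro mult_mono) auto
    then show ?thesis by (simp add: C_def)
  qed
  have h: "0 < h" "h \<le> 1" by (auto simp: h_def power_le_one)
  have hp: "h = 2 powr (- (real j * ?N))"
    by (simp add: h_def powr_minus powr_realpow[symmetric] power_one_over inverse_eq_divide)
  have gint: "integrable L g" using PO by (simp add: poincare_def)
  have i1: "integrable L (%y. indicat_real ?Q y * norm (g y))" by (rule integrable_indicator_times[OF cell_borel integrable_norm[OF gint]])
  have i2: "integrable L (%y. indicat_real ?Q y * norm (g y) powr p y)" by (rule integrable_indicator_times[OF cell_borel gi])
  have i3: "integrable L (%y. indicat_real ?Q y)" using integrable_indicator_times[OF cell_borel integrable_const[of 1]] by simp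
  have m0: "m \<ge> 0" unfolding m_def by (intro Bochner_Integration.integral_nonneg) (auto simp: indicator_def)
  have mR: "m \<le> R"
  proof -
    have "m \<le> (\<integral>x. norm (g x) powr p x \<partial>L)" unfolding m_def
      by (intro integral_mono i2 gi) (auto simp: indicator_def)
    then show ?thesis using R by linarith
  qed
  have R0: "R \<ge> 0" using m0 mR by linarith
  have \<Lambda>: "\<Lambda> \<ge> 1" using m0 h by (simp add: \<Lambda>_def)
  have l: "l \<ge> 1" unfolding l_def using \<Lambda> qa(1) by (intro ge_one_powr_ge_zero) auto
  have lq: "l powr q = \<Lambda>" using \<Lambda> qa(1) by (simp add: l_def powr_powr)
  have "G \<le> (\<integral>y. l * indicat_real ?Q y + l powr (1 - q) * (indicat_real ?Q y * norm (g y) powr p y) \<partial>L)"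
    unfolding G_def
  proof (rule integral_mono[OF i1])
    show "integrable L (%y. l * indicat_real ?Q y + l powr (1 - q) * (indicat_real ?Q y * norm (g y) powr p y))"
      using i2 i3 by simp
    fix y assume "y \<in> space L"
    then have y: "y \<in> \<Omega>" by simp
    show "indicat_real ?Q y * norm (g y) \<le> l * indicat_real ?Q y + l powr (1 - q) * (indicat_real ?Q y * norm (g y) powr p y)"
    proof (cases "y \<in> ?Q")
      case True
      have "norm (g y) \<le> l + l powr (1 - p y) * norm (g y) powr p y" using l p_ge[of y] y by (intro le_split_powr) auto
      also have "\<dots> \<le> l + l powr (1 - q) * norm (g y) powr p y" using l qa(4)[OF True y] by (intro add_left_mono mult_right_mono powr_mono) auto
      finally show ?thesis using True by simp
    qed simp
  qed
  also have "\<dots> = l * (\<integral>y. indicat_real ?Q y \<partial>L) + l powr (1 - q) * m"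
    unfolding m_def using i2 i3 by simp
  also have "\<dots> \<le> l * h + l powr (1 - q) * (h * \<Lambda>)"
  proof (intro add_mono mult_left_mono)
    show "(\<integral>y. indicat_real ?Q y \<partial>L) \<le> h" unfolding h_def by (rule integral_indicator_cell_le)
    show "m \<le> h * \<Lambda>" using h by (simp add: \<Lambda>_def field_simps)
  qed (use l in auto)
  also have "l powr (1 - q) * (h * \<Lambda>) = h * l" using l by (simp add: powr_diff flip: lq)
  finally have G: "G / h \<le> 2 * l" using h by (simp add: field_simps)
  let ?b = "\<bar>avg (cell (Suc j) x) u - avg (cell j x) u\<bar>"
  have "?b \<le> 4 ^ DIM('a) * ?N * (1/2) ^ j * (G / h)" using cell_avg_diff[OF PO, of j x] by (simp add: G_def h_def)
  also have "\<dots> \<le> 4 ^ DIM('a) * ?N * (1/2) ^ j * (2 * l)" by (intro mult_left_mono G) auto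
  also have "\<dots> = C * 2 powr (- real j) * l" by (simp add: C_def powr_minus powr_realpow power_one_over inverse_eq_divide)
  finally have b: "?b \<le> C * 2 powr (- real j) * l" .
  define B where "B = C * 2 powr (- ?e) * l"
  have "2 powr (real j * \<delta>) * ?b \<le> 2 powr (real j * \<delta>) * (C * 2 powr (- real j) * l)" by (intro mult_left_mono b) auto
  also have "\<dots> = C * (2 powr (real j * \<delta>) * 2 powr (- real j)) * l" by simp
  also have "2 powr (real j * \<delta>) * 2 powr (- real j) = 2 powr (- ?e)" by (simp add: algebra_simps flip: powr_add)
  finally have bB: "2 powr (real j * \<delta>) * ?b \<le> B" by (simp add: B_def)
  let ?t = "2 powr (real j * \<delta>) * ?b"
  have t0: "?t \<ge> 0" by simp
  have "?t powr \<alpha> \<le> 1 + B powr a"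
  proof (cases "?t \<le> 1")
    case True
    then have "?t powr \<alpha> \<le> 1" using t0 \<alpha> by (intro powr_le1) auto
    then show ?thesis by (simp add: add_increasing2)
  next
    case False
    then have "?t powr \<alpha> \<le> ?t powr a" using \<alpha> by (intro powr_mono) auto
    also have "\<dots> \<le> B powr a" using bB t0 qa by (intro powr_mono2) auto
    finally show ?thesis by simp
  qed
  also have "B powr a \<le> C powr A * (1 + R) powr A * \<Lambda>"
  proof -
    have "\<Lambda> \<le> (1 + R) * 2 powr (real j * ?N)"
    proof -
      have "\<Lambda> \<le> 1 / h + R / h" using mR h by (simp add: \<Lambda>_def add_mono divide_right_mono)
      also have "\<dots> = (1 + R) * 2 powr (real j * ?N)" by (simp add: hp powr_minus field_simps)
      finally show ?thesis .
    qed
    then have "\<Lambda> powr (a / q - 1) \<le> ((1 + R) * 2 powr (real j * ?N)) powr (a / q - 1)"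
      using \<Lambda> qa by (intro powr_mono2) auto
    also have "\<dots> = (1 + R) powr (a / q - 1) * 2 powr ?f"
      using R0 by (simp add: powr_mult powr_powr)
    also have "\<dots> \<le> (1 + R) powr A * 2 powr ?f"
    proof -
      have "a / q \<le> a" using qa by (simp add: divide_le_eq mult_left_le)
      then show ?thesis using R0 qa by (intro mult_right_mono powr_mono) auto
    qed
    finally have 1: "\<Lambda> powr (a / q - 1) \<le> (1 + R) powr A * 2 powr ?f" .
    have "B powr a = C powr a * 2 powr (- ?e * a) * \<Lambda> powr (a / q)"
      using C1 l by (simp add: B_def l_def powr_mult powr_powr)
    \<comment> \<open>One factor \<Lambda> is kept, because it is integrable over the domain. The
      remaining power is estimated by the crude bound \<Lambda> \<le> (1 + R) 2^(j N), and the gap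
      condition cancels its growth in j.\<close>
    also have "\<Lambda> powr (a / q) = \<Lambda> * \<Lambda> powr (a / q - 1)" using \<Lambda> by (simp add: powr_diff)
    also have "C powr a * 2 powr (- ?e * a) * (\<Lambda> * \<Lambda> powr (a / q - 1))
       \<le> C powr A * 2 powr (- ?e * a) * (\<Lambda> * ((1 + R) powr A * 2 powr ?f))"
    proof (rule mult_mono)
      show "C powr a * 2 powr (- ?e * a) \<le> C powr A * 2 powr (- ?e * a)"
        using C1 qa by (intro mult_right_mono powr_mono) auto
      show "\<Lambda> * \<Lambda> powr (a / q - 1) \<le> \<Lambda> * ((1 + R) powr A * 2 powr ?f)"
        using \<Lambda> by (intro mult_left_mono 1) auto
    qed (use \<Lambda> in auto)
    also have "\<dots> = C powr A * (1 + R) powr A * \<Lambda> * (2 powr (- ?e * a) * 2 powr ?f)" by simp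
    also have "\<dots> \<le> C powr A * (1 + R) powr A * \<Lambda> * 1"
    proof (rule mult_left_mono)
      have "?N * (a / q - 1) \<le> (1 - \<delta>) * a"
      proof -
        have "(?N / q - ?N / a) * a \<le> (1 - \<delta>) * a" using gap qa by (intro mult_right_mono) auto
        moreover have "(?N / q - ?N / a) * a = ?N * (a / q - 1)" using qa by (simp add: field_simps)
        ultimately show ?thesis by simp
      qed
      then have "real j * (?N * (a / q - 1)) \<le> real j * ((1 - \<delta>) * a)" by (rule mult_left_mono) simp
      then have "- ?e * a + real j * ?N * (a / q - 1) \<le> 0" by (simp add: algebra_simps)
      then show "2 powr (- ?e * a) * 2 powr ?f \<le> 1"
        unfolding powr_add[symmetric] using powr_mono[of "- ?e * a + real j * ?N * (a / q - 1)" 0 2] by simp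
    qed (use \<Lambda> in auto)
    finally show ?thesis by simp
  qed
  finally show ?thesis by (simp add: \<Lambda>_def C_def m_def h_def)
qed

text \<open>The difference between u and its average at scale J telescopes over the finer scales.
  Each scale is bounded with a weight growing like 2^(j \<delta>), so the tail from J on is
  geometrically small. The constant depends on u only through the bound R.\<close>

theorem embedding_averages:
  assumes \<delta>: "0 < \<delta>" "\<delta> \<le> 1" and A: "1 \<le> A" and \<alpha>m[measurable]: "\<alpha> \<in> borel_measurable L"
    and \<alpha>: "!!x. x \<in> \<Omega> ==> 1 \<le> \<alpha> x" "!!x. x \<in> \<Omega> ==> \<alpha> x \<le> A"
    and gap: "!!j x. j0 \<le> j ==> x \<in> \<Omega> ==> \<exists>q a. 1 \<le> q \<and> q \<le> a \<and> a \<le> A \<and> (\<forall>y\<in>cell j x \<inter> \<Omega>. q \<le> p y) \<and> \<alpha> x \<le> a \<and> real DIM('a) / q - real DIM('a) / a \<le> 1 - \<delta>"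
  obtains s j1 K where "0 < s" "s < 1" "!!u g R J. poincare u g ==> integrable L (%x. norm (g x) powr p x) ==>
     (\<integral>x. norm (g x) powr p x \<partial>L) \<le> R ==> j1 \<le> J ==> rho L \<alpha> (%x. u x - avg (cell J x) u) \<le> ennreal (K R * s ^ J)"
proof -
  \<comment> \<open>The relation s^2 2^\<delta> = 1 splits the gain in two: one factor s^j makes the
    integrals of the weighted increments decay, the other makes the pointwise telescoping sum
    converge.\<close>
  define s where "s = 2 powr (- (\<delta> / 2))"
  have s: "0 < s" "s < 1" using \<delta> by (auto simp: s_def powr_less_one)
  have "(%J. s ^ J / (1 - s)) \<longlonglongrightarrow> 0 / (1 - s)" using s by (intro tendsto_intros LIMSEQ_realpow_zero) auto
  then have "\<forall>\<^sub>F J in sequentially. s ^ J / (1 - s) < 1" using order_tendstoD(2)[of "%J. s ^ J / (1 - s)" "0 / (1 - s)" sequentially 1] by simp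
  then obtain j1' where j1': "!!J. J \<ge> j1' ==> s ^ J / (1 - s) < 1" unfolding eventually_sequentially by blast
  define K1 where "K1 R = (2 * 4 ^ DIM('a) * real DIM('a)) powr A * (1 + R) powr A" for R
  define V where "V = measure L (space L)"
  define K where "K R = (V * (1 + K1 R) + K1 R * R) / (1 - s)" for R
  show thesis
  proof (rule that[of s "max j0 j1'" K])
    fix u g R J assume PO: "poincare u g" and gi: "integrable L (%x. norm (g x) powr p x)"
      and R: "(\<integral>x. norm (g x) powr p x \<partial>L) \<le> R" and J: "max j0 j1' \<le> J"
    have R0: "0 \<le> R" by (rule order_trans[OF _ R]) (simp add: Bochner_Integration.integral_nonneg)
    let ?B = "V * (1 + K1 R) + K1 R * R"
    define b where "b j x = \<bar>avg (cell (Suc j) x) u - avg (cell j x) u\<bar>" for j x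
    let ?r = "%j x. 2 powr (real j * \<delta>) * b j x"
    have bm[measurable]: "b j \<in> borel_measurable L" for j
      unfolding b_def using cell_step_measurable[of "%Q. avg Q u"] by measurable
    define m where "m Q = (\<integral>y. indicat_real Q y * norm (g y) powr p y \<partial>L)" for Q
    have mm[measurable]: "(%x. m (cell j x)) \<in> borel_measurable L" for j by (rule cell_step_measurable)
    have m0: "0 \<le> m Q" for Q unfolding m_def by (intro Bochner_Integration.integral_nonneg) (auto simp: indicator_def)
    have K10: "K1 R \<ge> 0" by (simp add: K1_def)
    let ?h = "%j. (1/2::real) ^ (j * DIM('a))"
    let ?S = "%j x. \<Sum>r\<in>reps j. (m (cell j r) / ?h j) * indicat_real (cell j r) x"
    let ?M = "%j x. m (cell j x) / ?h j"
    have mint: "(\<integral>\<^sup>+ x. ennreal (?M j x) \<partial>L) \<le> ennreal R" for j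
    proof -
      have "(\<integral>\<^sup>+ x. ennreal (?M j x) \<partial>L) = (\<integral>\<^sup>+ x. ennreal (?S j x) \<partial>L)"
        using sum_reps[of _ j "%Q. m Q / ?h j"] by (intro nn_integral_cong) (simp add: mult.commute)
      also have "\<dots> = ennreal (\<integral>x. ?S j x \<partial>L)"
      proof (rule nn_integral_eq_integral)
        show "integrable L (%x. \<Sum>r\<in>reps j. (m (cell j r) / ?h j) * indicat_real (cell j r) x)"
          using integrable_indicator_times[OF cell_borel integrable_const[of 1]] by (intro Bochner_Integration.integrable_sum integrable_mult_right) simp
        show "AE x in L. 0 \<le> ?S j x"
          by (intro AE_I2 sum_nonneg mult_nonneg_nonneg divide_nonneg_nonneg m0) auto
      qed
      also have "(\<integral>x. ?S j x \<partial>L) = (\<Sum>r\<in>reps j. (m (cell j r) / ?h j) * (\<integral>x. indicat_real (cell j r) x \<partial>L))"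
        using integrable_indicator_times[OF cell_borel integrable_const[of 1]] by (subst Bochner_Integration.integral_sum) auto
      also have "\<dots> \<le> (\<Sum>r\<in>reps j. m (cell j r))"
      proof (rule sum_mono)
        fix r
        have "(\<integral>x. indicat_real (cell j r) x \<partial>L) \<le> ?h j"
          by (rule integral_indicator_cell_le)
        then have "(m (cell j r) / ?h j) * (\<integral>x. indicat_real (cell j r) x \<partial>L) \<le> (m (cell j r) / ?h j) * ?h j"
          by (intro mult_left_mono divide_nonneg_nonneg m0) auto
        then show "(m (cell j r) / ?h j) * (\<integral>x. indicat_real (cell j r) x \<partial>L) \<le> m (cell j r)" by simp
      qed
      also have "\<dots> = (\<integral>x. norm (g x) powr p x \<partial>L)" unfolding m_def by (rule integral_cells[OF gi, symmetric])
      finally show ?thesis using R by (meson ennreal_leI order_trans)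
    qed
    have step: "(\<integral>\<^sup>+ x. ennreal (?r j x powr \<alpha> x) \<partial>L) \<le> ennreal ?B" if j: "j0 \<le> j" for j
    proof -
      have "(\<integral>\<^sup>+ x. ennreal (?r j x powr \<alpha> x) \<partial>L) \<le> (\<integral>\<^sup>+ x. ennreal (1 + K1 R) + ennreal (K1 R) * ennreal (?M j x) \<partial>L)"
      proof (rule nn_integral_mono)
        fix x assume "x \<in> space L"
        then have x: "x \<in> \<Omega>" by simp
        obtain q a where qa: "1 \<le> q" "q \<le> a" "a \<le> A" "!!y. y \<in> cell j x \<inter> \<Omega> ==> q \<le> p y" "\<alpha> x \<le> a" "real DIM('a) / q - real DIM('a) / a \<le> 1 - \<delta>"
          using gap[OF j x] by blast
        have "?r j x powr \<alpha> x \<le> 1 + K1 R * (1 + m (cell j x) / ?h j)"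
          unfolding b_def K1_def m_def
          by (rule cell_avg_diff_powr[OF PO gi R x qa(1-3) _ \<alpha>(1)[OF x] qa(5,6)]) (use qa(4) in auto)
        also have "\<dots> = (1 + K1 R) + K1 R * ?M j x" by (simp add: algebra_simps)
        finally show "ennreal (?r j x powr \<alpha> x) \<le> ennreal (1 + K1 R) + ennreal (K1 R) * ennreal (?M j x)"
          using K10 m0[of "cell j x"] by (simp add: ennreal_leI flip: ennreal_plus ennreal_mult)
      qed
      also have "\<dots> = ennreal (1 + K1 R) * emeasure L (space L) + ennreal (K1 R) * (\<integral>\<^sup>+ x. ennreal (?M j x) \<partial>L)"
        by (subst nn_integral_add) (auto simp: nn_integral_cmult)
      also have "\<dots> \<le> ennreal (1 + K1 R) * ennreal V + ennreal (K1 R) * ennreal R"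
        unfolding V_def by (intro add_mono mult_left_mono mint) (auto simp: emeasure_eq_measure)
      also have "\<dots> = ennreal ?B"
        using K10 R0 by (simp add: V_def ennreal_mult ennreal_plus mult.commute)
      finally show ?thesis .
    qed
    \<comment> \<open>A single function that controls all increments at a point: the increment of
      generation J + i is at most s^(J + i) W^(1/\<alpha>). Their sum is at most W^(1/\<alpha>) once
      s^J/(1 - s) < 1, which is how the admissible J are chosen.\<close>
    define W where "W x = suminf (%i. ennreal ((b (J + i) x / s ^ (J + i)) powr \<alpha> x))" for x
    have "(\<integral>\<^sup>+ x. W x \<partial>L) \<le> ennreal (suminf (%i. s ^ J * ?B * s ^ i))"
      unfolding W_def
    proof (rule nn_integral_suminf_bounded(1))
      fix i
      let ?j = "J + i"
      have "(\<integral>\<^sup>+ x. ennreal ((b ?j x / s ^ ?j) powr \<alpha> x) \<partial>L) \<le> (\<integral>\<^sup>+ x. ennreal (s ^ ?j) * ennreal (?r ?j x powr \<alpha> x) \<partial>L)"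
      proof (rule nn_integral_mono)
        fix x assume "x \<in> space L"
        then have x: "x \<in> \<Omega>" by simp
        have b0: "b ?j x \<ge> 0" by (simp add: b_def)
        have sj: "s ^ ?j = 2 powr (- (real ?j * \<delta> / 2))" by (simp add: s_def powr_powr mult.commute flip: powr_realpow)
        have "s ^ ?j * s ^ ?j * 2 powr (real ?j * \<delta>) = 2 powr (- (real ?j * \<delta> / 2) + - (real ?j * \<delta> / 2) + real ?j * \<delta>)"
          unfolding sj powr_add ..
        also have "- (real ?j * \<delta> / 2) + - (real ?j * \<delta> / 2) + real ?j * \<delta> = 0" by simp
        finally have "s ^ ?j * s ^ ?j * 2 powr (real ?j * \<delta>) = 1" by simp
        then have "b ?j x = s ^ ?j * s ^ ?j * 2 powr (real ?j * \<delta>) * b ?j x" by simp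
        then have "b ?j x / s ^ ?j = s ^ ?j * ?r ?j x"
          using s by (simp add: field_simps)
        then have "(b ?j x / s ^ ?j) powr \<alpha> x = (s ^ ?j) powr \<alpha> x * ?r ?j x powr \<alpha> x"
          using s b0 by (simp add: powr_mult)
        also have "\<dots> \<le> s ^ ?j * ?r ?j x powr \<alpha> x"
          using powr_mono'[of 1 "\<alpha> x" "s ^ ?j"] \<alpha>(1)[OF x] s by (intro mult_right_mono) (auto simp: power_le_one)
        finally show "ennreal ((b ?j x / s ^ ?j) powr \<alpha> x) \<le> ennreal (s ^ ?j) * ennreal (?r ?j x powr \<alpha> x)"
          using s by (simp add: ennreal_leI flip: ennreal_mult)
      qed
      also have "\<dots> = ennreal (s ^ ?j) * (\<integral>\<^sup>+ x. ennreal (?r ?j x powr \<alpha> x) \<partial>L)"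
        by (rule nn_integral_cmult) measurable
      also have "\<dots> \<le> ennreal (s ^ ?j) * ennreal ?B" using J by (intro mult_left_mono step) auto
      also have "\<dots> = ennreal (s ^ J * ?B * s ^ i)"
        using s by (simp add: power_add mult_ac flip: ennreal_mult')
      finally show "(\<integral>\<^sup>+ x. ennreal ((b ?j x / s ^ ?j) powr \<alpha> x) \<partial>L) \<le> ennreal (s ^ J * ?B * s ^ i)" .
    qed (use s K10 R0 in \<open>auto simp: V_def intro!: summable_mult summable_geometric\<close>)
    also have "(suminf (%i. s ^ J * ?B * s ^ i)) = s ^ J * ?B * (1 / (1 - s))"
      using s by (subst suminf_mult) (auto simp: suminf_geometric summable_geometric)
    also have "\<dots> = K R * s ^ J" by (simp add: K_def)
    finally have Wint: "(\<integral>\<^sup>+ x. W x \<partial>L) \<le> ennreal (K R * s ^ J)" .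
    have "rho L \<alpha> (%x. u x - avg (cell J x) u) \<le> (\<integral>\<^sup>+ x. W x \<partial>L)"
      unfolding rho_def
    proof (rule nn_integral_mono_AE)
      show "AE x in L. ennreal (norm (u x - avg (cell J x) u) powr \<alpha> x) \<le> W x"
        using avg_converges_AE[OF PO] AE_space
      proof eventually_elim
        case (elim x)
        then have x: "x \<in> \<Omega>" by simp
        have a1: "\<alpha> x \<ge> 1" by (rule \<alpha>(1)[OF x])
        show ?case
        proof (cases "W x = top")
          case False
          define w where "w = enn2real (W x)"
          have Ww: "W x = ennreal w" using False by (simp add: w_def less_top)
          have w0: "w \<ge> 0" by (simp add: w_def)
          have le: "b (J + i) x \<le> s ^ (J + i) * w powr (1 / \<alpha> x)" for i
          proof -
            have "(\<Sum>k\<in>{i}. ennreal ((b (J + k) x / s ^ (J + k)) powr \<alpha> x)) \<le> W x"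
              unfolding W_def by (rule sum_le_suminf) auto
            then have "(b (J + i) x / s ^ (J + i)) powr \<alpha> x \<le> w" using w0 by (simp add: Ww)
            then have "((b (J + i) x / s ^ (J + i)) powr \<alpha> x) powr (1 / \<alpha> x) \<le> w powr (1 / \<alpha> x)"
              using a1 by (intro powr_mono2) auto
            moreover have b0: "b (J + i) x / s ^ (J + i) \<ge> 0" using s by (simp add: b_def)
            have "((b (J + i) x / s ^ (J + i)) powr \<alpha> x) powr (1 / \<alpha> x) = b (J + i) x / s ^ (J + i)"
              using a1 powr_one[OF b0] by (simp only: powr_powr) simp
            ultimately have "b (J + i) x / s ^ (J + i) \<le> w powr (1 / \<alpha> x)" by linarith
            then show ?thesis using s by (simp add: divide_le_eq mult.commute)
          qed
          have part: "\<bar>avg (cell (J + n) x) u - avg (cell J x) u\<bar> \<le> w powr (1 / \<alpha> x)" for n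
          proof -
            have "avg (cell (J + n) x) u - avg (cell J x) u = (\<Sum>i<n. avg (cell (J + Suc i) x) u - avg (cell (J + i) x) u)"
              using sum_lessThan_telescope[of "%i. avg (cell (J + i) x) u" n] by simp
            also have "\<bar>\<dots>\<bar> \<le> (\<Sum>i<n. s ^ (J + i) * w powr (1 / \<alpha> x))"
              using le by (intro order_trans[OF sum_abs] sum_mono) (simp add: b_def)
            also have "\<dots> = (\<Sum>i<n. s ^ i) * s ^ J * w powr (1 / \<alpha> x)" unfolding sum_distrib_right by (intro sum.cong) (auto simp: power_add)
            also have "\<dots> \<le> (1 / (1 - s)) * s ^ J * w powr (1 / \<alpha> x)"
            proof (intro mult_right_mono)
              have "(\<Sum>i<n. s ^ i) \<le> (suminf (%i. s ^ i))" by (rule sum_le_suminf) (use s in \<open>auto simp: summable_geometric\<close>)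
              then show "(\<Sum>i<n. s ^ i) \<le> 1 / (1 - s)" using s by (simp add: suminf_geometric)
            qed (use s in auto)
            also have "\<dots> \<le> 1 * w powr (1 / \<alpha> x)" using j1'[of J] J by (intro mult_right_mono) auto
            finally show ?thesis by simp
          qed
          have "(%n. \<bar>avg (cell (n + J) x) u - avg (cell J x) u\<bar>) \<longlonglongrightarrow> \<bar>u x - avg (cell J x) u\<bar>"
            by (intro tendsto_intros LIMSEQ_ignore_initial_segment elim(1))
          then have "\<bar>u x - avg (cell J x) u\<bar> \<le> w powr (1 / \<alpha> x)"
            by (rule LIMSEQ_le_const2) (use part in \<open>auto simp: add.commute\<close>)
          then have "\<bar>u x - avg (cell J x) u\<bar> powr \<alpha> x \<le> (w powr (1 / \<alpha> x)) powr \<alpha> x" using a1 by (intro powr_mono2) auto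
          also have "\<dots> = w" using a1 w0 by (cases "w = 0") (auto simp: powr_powr)
          finally show ?thesis by (simp add: Ww ennreal_leI)
        qed simp
      qed
    qed
    then show "rho L \<alpha> (%x. u x - avg (cell J x) u) \<le> ennreal (K R * s ^ J)" using Wint by (rule order_trans)
  qed (use s in auto)
qed

end

section \<open>The energy functional\<close>

lemma plap_abs_le:
  fixes \<xi> \<eta> :: "'b::real_inner"
  shows "\<bar>norm \<xi> powr (p - 2) * (\<xi> \<bullet> \<eta>)\<bar> \<le> norm \<xi> powr (p - 1) * norm \<eta>"
proof (cases "\<xi> = 0")
  case False
  have "\<bar>norm \<xi> powr (p - 2) * (\<xi> \<bullet> \<eta>)\<bar> \<le> norm \<xi> powr (p - 2) * (norm \<xi> * norm \<eta>)"
    using Cauchy_Schwarz_ineq2[of \<xi> \<eta>] by (simp add: abs_mult mult_left_mono)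
  also have "\<dots> = norm \<xi> powr (p - 1) * norm \<eta>" using False by (simp add: powr_diff power2_eq_square)
  finally show ?thesis .
qed simp

lemma plap_abs_le2:
  fixes \<xi> \<eta> :: "'b::real_inner"
  assumes "1 \<le> p" shows "\<bar>norm \<xi> powr (p - 2) * (\<xi> \<bullet> \<eta>)\<bar> \<le> norm \<eta> powr p + norm \<xi> powr p"
  using order_trans[OF plap_abs_le young_split[of "norm \<xi>" "norm \<eta>" p p 1]] assms by (simp add: add.commute)

text \<open>Away from the origin this is the chain rule for (z \<bullet> z)^(p/2). At a parameter
  where the line hits the origin the function grows like |t - s|^p with p > 1, and the convention
  that powers of 0 are 0 gives the right value 0.\<close>

lemma plap_deriv:
  fixes \<xi> \<eta> :: "'b::real_inner"
  assumes p: "1 < p"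
  shows "((%s. norm (\<xi> + s *\<^sub>R \<eta>) powr p / p) has_real_derivative norm (\<xi> + s *\<^sub>R \<eta>) powr (p - 2) * ((\<xi> + s *\<^sub>R \<eta>) \<bullet> \<eta>)) (at s)"
proof (cases "\<xi> + s *\<^sub>R \<eta> = 0")
  let ?z = "%s. \<xi> + s *\<^sub>R \<eta>"
  case False
  let ?q = "%s. (?z s) \<bullet> (?z s)"
  have q: "?q s > 0" using False by simp
  have sq: "norm v powr r = (v \<bullet> v) powr (r / 2)" if "v \<noteq> 0" for v :: 'b and r
  proof -
    have "norm v powr 2 = v \<bullet> v" by (simp add: power2_norm_eq_inner[symmetric])
    then have "(v \<bullet> v) powr (r / 2) = (norm v powr 2) powr (r / 2)" by (simp only:)
    also have "\<dots> = norm v powr r" by (simp only: powr_powr) simp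
    finally show ?thesis by (rule sym)
  qed
  have sq': "norm v powr p = (v \<bullet> v) powr (p / 2)" for v :: 'b using sq[of v p] p by (cases "v = 0") auto
  have "(?q has_real_derivative 2 * ((?z s) \<bullet> \<eta>)) (at s)"
    by (auto intro!: derivative_eq_intros simp: inner_add_left inner_add_right inner_commute)
  from DERIV_cdivide[OF DERIV_powr[OF this q DERIV_const[of "p / 2"]], of p]
  have "((%s. ?q s powr (p / 2) / p) has_real_derivative ?q s powr (p / 2) * (2 * ((?z s) \<bullet> \<eta>) * (p / 2) / ?q s) / p) (at s)"
    by simp
  moreover have "?q s powr (p / 2) * (2 * ((?z s) \<bullet> \<eta>) * (p / 2) / ?q s) / p = norm (?z s) powr (p - 2) * ((?z s) \<bullet> \<eta>)"
  proof -
    have "norm (?z s) powr (p - 2) = ?q s powr (p / 2) / ?q s"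
      using sq[OF False, of "p - 2"] q by (simp add: diff_divide_distrib powr_diff)
    then show ?thesis using p by simp
  qed
  ultimately show ?thesis by (simp add: sq')
next
  case True
  then have \<xi>: "\<xi> = - (s *\<^sub>R \<eta>)" by (simp add: eq_neg_iff_add_eq_0)
  have n: "norm (\<xi> + t *\<^sub>R \<eta>) = \<bar>t - s\<bar> * norm \<eta>" for t
    unfolding \<xi> by (metis add.commute norm_scaleR scaleR_left.diff uminus_add_conv_diff)
  have "((%t. (\<bar>t - s\<bar> * norm \<eta>) powr p / p) has_real_derivative 0) (at s)"
    unfolding has_field_derivative_iff
  proof (rule Lim_null_comparison[where g = "%t. \<bar>t - s\<bar> powr (p - 1) * (norm \<eta> powr p / p)"])
    show "\<forall>\<^sub>F t in at s. norm (((\<bar>t - s\<bar> * norm \<eta>) powr p / p - (\<bar>s - s\<bar> * norm \<eta>) powr p / p) / (t - s)) \<le> \<bar>t - s\<bar> powr (p - 1) * (norm \<eta> powr p / p)"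
    proof (rule eventually_at_filter[THEN iffD2, OF always_eventually], intro allI impI)
      fix t assume "t \<noteq> s"
      then show "norm (((\<bar>t - s\<bar> * norm \<eta>) powr p / p - (\<bar>s - s\<bar> * norm \<eta>) powr p / p) / (t - s)) \<le> \<bar>t - s\<bar> powr (p - 1) * (norm \<eta> powr p / p)"
        using p by (simp add: powr_mult powr_diff abs_mult abs_divide mult.commute)
    qed
    have "((%t. \<bar>t - s\<bar> powr (p - 1) * (norm \<eta> powr p / p)) \<longlongrightarrow> \<bar>s - s\<bar> powr (p - 1) * (norm \<eta> powr p / p)) (at s)"
      by (intro tendsto_intros tendsto_powr') (use p in auto)
    then show "((%t. \<bar>t - s\<bar> powr (p - 1) * (norm \<eta> powr p / p)) \<longlongrightarrow> 0) (at s)" by simp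
  qed
  then show ?thesis using True by (simp add: n)
qed

lemma plap_continuous:
  fixes \<eta> :: "'b::real_inner"
  assumes p: "1 < p" shows "continuous_on UNIV (%\<xi>. norm \<xi> powr (p - 2) * (\<xi> \<bullet> \<eta>))"
proof (rule continuous_at_imp_continuous_on, rule ballI)
  fix \<xi> :: 'b
  show "isCont (%\<xi>. norm \<xi> powr (p - 2) * (\<xi> \<bullet> \<eta>)) \<xi>"
  proof (cases "\<xi> = 0")
    case False
    then show ?thesis by (intro continuous_intros) auto
  next
    case True
    have "((%\<xi>. norm \<xi> powr (p - 2) * (\<xi> \<bullet> \<eta>)) \<longlongrightarrow> 0) (at 0)"
    proof (rule Lim_null_comparison[where g = "%\<xi>. norm \<xi> powr (p - 1) * norm \<eta>"])
      show "\<forall>\<^sub>F \<xi> in at 0. norm (norm \<xi> powr (p - 2) * (\<xi> \<bullet> \<eta>)) \<le> norm \<xi> powr (p - 1) * norm \<eta>"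
        using plap_abs_le[of _ p \<eta>] by (intro always_eventually) auto
      have "((%\<xi>::'b. norm \<xi> powr (p - 1) * norm \<eta>) \<longlongrightarrow> norm (0::'b) powr (p - 1) * norm \<eta>) (at 0)"
        by (intro tendsto_intros tendsto_powr') (use p in auto)
      then show "((%\<xi>::'b. norm \<xi> powr (p - 1) * norm \<eta>) \<longlongrightarrow> 0) (at 0)" by simp
    qed
    then show ?thesis using True by (simp add: isCont_def)
  qed
qed

text \<open>The Cauchy-Schwarz inequality reduces the claim to the tangent inequality for the scalar
  power at the ratio of the two norms.\<close>

lemma plap_convex:
  fixes a b :: "'b::real_inner"
  assumes p: "1 < p"
  shows "norm a powr p / p + norm a powr (p - 2) * (a \<bullet> (b - a)) \<le> norm b powr p / p"
proof (cases "a = 0")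
  case False
  then have na: "norm a > 0" by simp
  let ?y = "norm b / norm a"
  have t: "1 + p * (?y - 1) \<le> ?y powr p"
    using powr_tangent_strict[OF p, of ?y] na by (cases "?y = 1") auto
  have "a \<bullet> (b - a) \<le> norm a * norm b - norm a * norm a"
    using norm_cauchy_schwarz[of a b] by (simp add: inner_diff_right power2_norm_eq_inner[symmetric] power2_eq_square)
  then have "norm a powr (p - 2) * (a \<bullet> (b - a)) \<le> norm a powr (p - 2) * (norm a * norm b - norm a * norm a)"
    by (intro mult_left_mono) auto
  also have "\<dots> = norm a powr p * (?y - 1)"
    using na by (simp add: powr_diff field_simps power2_eq_square)
  finally have X: "norm a powr (p - 2) * (a \<bullet> (b - a)) \<le> norm a powr p * (?y - 1)" .
  have "norm a powr p / p * (1 + p * (?y - 1)) = norm a powr p / p + norm a powr p * (?y - 1)"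
    using p by (simp only: distrib_left) simp
  with X have "norm a powr p / p + norm a powr (p - 2) * (a \<bullet> (b - a)) \<le> norm a powr p / p * (1 + p * (?y - 1))"
    by linarith
  also have "\<dots> \<le> norm a powr p / p * ?y powr p" using t p by (intro mult_left_mono) auto
  also have "\<dots> = norm b powr p / p" using na by (simp add: powr_divide)
  finally show ?thesis .
qed (use p in simp)

section \<open>Caratheodory functions and their primitives\<close>

lemma caratheodory_measurable:
  fixes h :: "'x => real => real"
  assumes hm[measurable]: "!!t. (%x. h x t) \<in> borel_measurable M" and cont: "!!x. x \<in> space M ==> continuous_on UNIV (h x)"
  shows "case_prod h \<in> borel_measurable (M \<Otimes>\<^sub>M borel)"
proof (rule borel_measurable_LIMSEQ_real)
  fix n :: nat
  \<comment> \<open>The second argument is rounded down to a multiple of 1/(n + 1). Only countably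
    many values occur, so measurability in x for each fixed t suffices; continuity in t recovers the
    function in the limit.\<close>
  let ?k = "%z::'x \<times> real. \<lfloor>real (Suc n) * snd z\<rfloor>"
  show "(%z. h (fst z) (of_int (?k z) / real (Suc n))) \<in> borel_measurable (M \<Otimes>\<^sub>M borel)"
    by (rule measurable_compose_countable[where f = "%k z. h (fst z) (of_int k / real (Suc n))" and g = ?k]) measurable
next
  fix z :: "'x \<times> real" assume "z \<in> space (M \<Otimes>\<^sub>M borel)"
  then obtain x t where z: "z = (x, t)" "x \<in> space M" by (cases z) (auto simp: space_pair_measure)
  have "(%n. of_int \<lfloor>real (Suc n) * t\<rfloor> / real (Suc n)) \<longlonglongrightarrow> t"
  proof (rule tendsto_sandwich[of "%n. t - inverse (real (Suc n))" _ _ "%n. t"])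
    show "\<forall>\<^sub>F n in sequentially. t - inverse (real (Suc n)) \<le> of_int \<lfloor>real (Suc n) * t\<rfloor> / real (Suc n)"
    proof (intro always_eventually allI)
      fix n
      have "real (Suc n) * t - 1 \<le> of_int \<lfloor>real (Suc n) * t\<rfloor>" by linarith
      then have "(real (Suc n) * t - 1) / real (Suc n) \<le> of_int \<lfloor>real (Suc n) * t\<rfloor> / real (Suc n)" by (intro divide_right_mono) auto
      then show "t - inverse (real (Suc n)) \<le> of_int \<lfloor>real (Suc n) * t\<rfloor> / real (Suc n)" by (simp add: diff_divide_distrib inverse_eq_divide del: of_nat_Suc)
    qed
    show "\<forall>\<^sub>F n in sequentially. of_int \<lfloor>real (Suc n) * t\<rfloor> / real (Suc n) \<le> t"
    proof (intro always_eventually allI)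
      fix n
      have "of_int \<lfloor>real (Suc n) * t\<rfloor> / real (Suc n) \<le> (real (Suc n) * t) / real (Suc n)" by (intro divide_right_mono) auto
      then show "of_int \<lfloor>real (Suc n) * t\<rfloor> / real (Suc n) \<le> t" by (simp del: of_nat_Suc)
    qed
    show "(%n. t - inverse (real (Suc n))) \<longlonglongrightarrow> t" using tendsto_diff[OF tendsto_const[of t] LIMSEQ_inverse_real_of_nat] by simp
  qed auto
  then have "(%n. h x (of_int \<lfloor>real (Suc n) * t\<rfloor> / real (Suc n))) \<longlonglongrightarrow> h x t"
    by (intro continuous_on_tendsto_compose[OF cont[OF z(2)]]) auto
  then show "(%n. h (fst z) (of_int \<lfloor>real (Suc n) * snd z\<rfloor> / real (Suc n))) \<longlonglongrightarrow> case_prod h z" by (simp add: z)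
qed

lemma Fprim_deriv:
  assumes "continuous_on UNIV (f x)"
  shows "(Fprim f x has_real_derivative f x t) (at t)"
proof -
  have "((%u. LBINT y=ereal 0..ereal u. f x y) has_vector_derivative f x t) (at t within {- \<bar>t\<bar> - 1..\<bar>t\<bar> + 1})"
    by (rule interval_integral_FTC2[OF _ _ continuous_on_subset[OF assms]]) auto
  moreover have "at t within {- \<bar>t\<bar> - 1..\<bar>t\<bar> + 1} = at t" by (rule at_within_interior) (auto simp: interior_atLeastAtMost_real)
  ultimately show ?thesis unfolding Fprim_def by (simp add: has_real_derivative_iff_has_vector_derivative)
qed

lemma Fprim_0: "Fprim f x 0 = 0" by (simp add: Fprim_def)

lemma Fprim_even:
  assumes odd: "!!t. f x (- t) = - f x t" and c: "continuous_on UNIV (f x)"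
  shows "Fprim f x (- t) = Fprim f x t"
proof -
  have d: "((%t. Fprim f x (- t) - Fprim f x t) has_real_derivative 0) (at t)" for t
  proof -
    have "((%t. Fprim f x (- t)) has_real_derivative f x (- t) * (- 1)) (at t)"
      by (rule DERIV_chain'[OF _ Fprim_deriv[where f=f and x=x, OF c]]) (auto intro!: derivative_eq_intros)
    from DERIV_diff[OF this Fprim_deriv[where f=f and x=x and t=t, OF c]] show ?thesis by (simp add: odd)
  qed
  have "Fprim f x (- t) - Fprim f x t = Fprim f x (- 0) - Fprim f x 0"
    by (rule DERIV_isconst_all) (use d in blast)
  then show ?thesis by (simp add: Fprim_0)
qed

lemma Fprim_abs_le:
  assumes c: "continuous_on UNIV (f x)" and a: "1 \<le> a" and C: "0 \<le> C" and b: "!!t. \<bar>f x t\<bar> \<le> C * (1 + \<bar>t\<bar> powr (a - 1))"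
  shows "\<bar>Fprim f x t\<bar> \<le> 2 * C * (1 + \<bar>t\<bar> powr a)"
proof -
  let ?B = "C * (1 + \<bar>t\<bar> powr (a - 1))"
  have "norm (Fprim f x t - Fprim f x 0) \<le> ?B * norm (t - 0)"
  proof (rule field_differentiable_bound[where S = "{- \<bar>t\<bar>..\<bar>t\<bar>}" and f' = "f x"])
    show "(Fprim f x has_field_derivative f x s) (at s within {- \<bar>t\<bar>..\<bar>t\<bar>})" for s
      by (rule has_field_derivative_at_within[OF Fprim_deriv[where f=f and x=x, OF c]])
    show "norm (f x s) \<le> ?B" if s: "s \<in> {- \<bar>t\<bar>..\<bar>t\<bar>}" for s
    proof -
      have "\<bar>s\<bar> \<le> \<bar>t\<bar>" using s by auto
      then have "\<bar>s\<bar> powr (a - 1) \<le> \<bar>t\<bar> powr (a - 1)" using a by (intro powr_mono2) auto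
      then have "C * (1 + \<bar>s\<bar> powr (a - 1)) \<le> ?B" using C by (intro mult_left_mono) auto
      then show ?thesis using b[of s] by simp
    qed
  qed auto
  then have "\<bar>Fprim f x t\<bar> \<le> C * (\<bar>t\<bar> + \<bar>t\<bar> powr (a - 1) * \<bar>t\<bar>)" by (simp add: Fprim_0 algebra_simps)
  also have "\<bar>t\<bar> powr (a - 1) * \<bar>t\<bar> = \<bar>t\<bar> powr a" by (cases "t = 0") (auto simp: powr_diff)
  also have "C * (\<bar>t\<bar> + \<bar>t\<bar> powr a) \<le> C * (2 * (1 + \<bar>t\<bar> powr a))"
    using le_split_powr[of "\<bar>t\<bar>" 1 a] a C by (intro mult_left_mono) auto
  finally show ?thesis by (simp add: algebra_simps)
qed

text \<open>Integrating the Ambrosetti-Rabinowitz inequality: F(x,t) / |t|^theta is nondecreasing for |t| >= m.\<close>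

lemma Fprim_superlinear:
  assumes c: "continuous_on UNIV (f x)" and odd: "!!t. f x (- t) = - f x t" and m: "0 < m" and th: "0 < \<theta>"
    and ar: "!!t. m \<le> \<bar>t\<bar> ==> 0 < \<theta> * Fprim f x t \<and> \<theta> * Fprim f x t \<le> t * f x t" and t: "m \<le> \<bar>t\<bar>"
  shows "Fprim f x m * (\<bar>t\<bar> / m) powr \<theta> \<le> Fprim f x t"
proof -
  have "Fprim f x m * m powr (- \<theta>) \<le> Fprim f x \<bar>t\<bar> * \<bar>t\<bar> powr (- \<theta>)"
  proof (rule DERIV_nonneg_imp_nondecreasing[OF t])
    fix s assume s: "m \<le> s" "s \<le> \<bar>t\<bar>"
    then have s0: "s > 0" using m by linarith
    have "((%s. Fprim f x s * s powr (- \<theta>)) has_real_derivative f x s * s powr (- \<theta>) + (- \<theta> * s powr (- \<theta> - 1)) * Fprim f x s) (at s)"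
      by (rule DERIV_mult[OF Fprim_deriv[where f=f and x=x, OF c]]) (use s0 in \<open>auto intro!: derivative_eq_intros\<close>)
    moreover have "f x s * s powr (- \<theta>) + (- \<theta> * s powr (- \<theta> - 1)) * Fprim f x s = s powr (- \<theta> - 1) * (s * f x s - \<theta> * Fprim f x s)"
      using s0 by (simp add: powr_diff field_simps)
    moreover have "0 \<le> s * f x s - \<theta> * Fprim f x s" using ar[of s] s s0 by simp
    ultimately show "\<exists>y. ((%s. Fprim f x s * s powr (- \<theta>)) has_real_derivative y) (at s) \<and> 0 \<le> y" by (metis mult_nonneg_nonneg powr_ge_zero)
  qed
  moreover have "Fprim f x \<bar>t\<bar> = Fprim f x t" using Fprim_even[of f x t, OF odd c] by (auto simp: abs_if)
  ultimately show ?thesis using m t by (simp add: powr_minus powr_divide field_simps)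
qed

section \<open>Energies with variable exponent bounded away from 1\<close>

locale plaplace = exponent M p P for M :: "'x measure" and p :: "'x => real" and P :: real +
  fixes p0 :: real
  assumes p0: "1 < p0" and p0_le: "!!x. x \<in> space M ==> p0 \<le> p x"
begin

definition en :: "('x => 'b::euclidean_space) => real" where
  "en g = (\<integral>x. norm (g x) powr p x / p x \<partial>M)"

definition den :: "('x => 'b::euclidean_space) => ('x => 'b) => real" where
  "den g h = (\<integral>x. norm (g x) powr (p x - 2) * (g x \<bullet> h x) \<partial>M)"

lemma p_gt: "x \<in> space M ==> 1 < p x" using p0 p0_le[of x] by linarith

lemma en_integrable: assumes "Lp g" shows "integrable M (%x. norm (g x) powr p x / p x)"
proof (rule integrable_bound[OF Lp_integrable[OF assms]])
  note [measurable] = Lp_meas[OF assms]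
  show "(%x. norm (g x) powr p x / p x) \<in> borel_measurable M" by measurable
  show "AE x in M. norm (norm (g x) powr p x / p x) \<le> norm (norm (g x) powr p x)"
  proof (rule AE_I2)
    fix x assume "x \<in> space M"
    have "norm (g x) powr p x / p x \<le> norm (g x) powr p x / 1" using p_ge[OF \<open>x \<in> space M\<close>] by (intro divide_left_mono) auto
    then show "norm (norm (g x) powr p x / p x) \<le> norm (norm (g x) powr p x)" using p_ge[OF \<open>x \<in> space M\<close>] by simp
  qed
qed

lemma den_integrable: assumes "Lp g" "Lp h" shows "integrable M (%x. norm (g x) powr (p x - 2) * (g x \<bullet> h x))"
proof (rule integrable_bound)
  note [measurable] = Lp_meas[OF assms(1)] Lp_meas[OF assms(2)]
  show "integrable M (%x. norm (h x) powr p x + norm (g x) powr p x)" using Lp_integrable[OF assms(1)] Lp_integrable[OF assms(2)] by auto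
  show "(%x. norm (g x) powr (p x - 2) * (g x \<bullet> h x)) \<in> borel_measurable M" by measurable
  show "AE x in M. norm (norm (g x) powr (p x - 2) * (g x \<bullet> h x)) \<le> norm (norm (h x) powr p x + norm (g x) powr p x)"
    using plap_abs_le2[OF p_ge] by (intro AE_I2) simp
qed

lemma den_add:
  assumes "Lp g" "Lp h" "Lp k" shows "den g (%x. h x + k x) = den g h + den g k"
  unfolding den_def using den_integrable[OF assms(1,2)] den_integrable[OF assms(1,3)]
  by (simp add: inner_add_right distrib_left)

lemma den_scale: "den g (%x. c *\<^sub>R h x) = c * den g h"
proof -
  have "norm (g x) powr (p x - 2) * (g x \<bullet> c *\<^sub>R h x) = c * (norm (g x) powr (p x - 2) * (g x \<bullet> h x))" for x by simp
  then show ?thesis unfolding den_def by (simp only:) simp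
qed

lemma den_zero: "den g (%x. 0) = 0" by (simp add: den_def)

lemma den_sum:
  assumes "finite I" "Lp g" "!!i. i \<in> I ==> Lp (h i)"
  shows "den g (%x. \<Sum>i\<in>I. c i *\<^sub>R h i x) = (\<Sum>i\<in>I. c i * den g (h i)) \<and> Lp (%x. \<Sum>i\<in>I. c i *\<^sub>R h i x)"
  using assms(1,3)
proof (induction I rule: finite_induct)
  case empty
  have "Lp (%x. 0 :: 'b)" using Lp_scale[OF assms(2), of 0] by simp
  then show ?case by (simp add: den_zero)
next
  case (insert i I)
  then have "Lp (%x. \<Sum>i\<in>I. c i *\<^sub>R h i x)" "Lp (%x. c i *\<^sub>R h i x)" by (auto intro: Lp_scale)
  then show ?case using insert den_add[OF assms(2), of "%x. c i *\<^sub>R h i x" "%x. \<Sum>i\<in>I. c i *\<^sub>R h i x"]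
      Lp_add[of "%x. c i *\<^sub>R h i x" "%x. \<Sum>i\<in>I. c i *\<^sub>R h i x"] by (simp add: den_scale)
qed

lemma en_tendsto:
  fixes g :: "nat => 'x => 'b::euclidean_space"
  assumes g: "!!n. Lp (g n)" and h: "Lp h" and lim: "mconv g h"
  shows "(%n. en (g n)) \<longlonglongrightarrow> en h"
  unfolding en_def
proof (rule nemytskii_continuous[where h = "%x \<xi>. norm \<xi> powr p x / p x" and v = g and w = h and D = "%_. 0" and C = 1])
  show "AE x in M. continuous_on UNIV (%\<xi>::'b. norm \<xi> powr p x / p x)"
  proof (rule AE_I2)
    fix x assume "x \<in> space M"
    then have "p x > 0" using p_gt[of x] by linarith
    then show "continuous_on UNIV (%\<xi>::'b. norm \<xi> powr p x / p x)"
      by (intro continuous_on_divide continuous_on_powr' continuous_intros) auto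
  qed
  show "AE x in M. \<forall>\<xi>. \<bar>norm (\<xi>::'b) powr p x / p x\<bar> \<le> 0 + 1 * norm \<xi> powr p x"
  proof (rule AE_I2, rule allI)
    fix x and \<xi> :: 'b assume "x \<in> space M"
    then have "p x \<ge> 1" by (rule p_ge)
    then have "norm \<xi> powr p x / p x \<le> norm \<xi> powr p x / 1" "p x > 0"
      using divide_left_mono[of 1 "p x" "norm \<xi> powr p x"] by auto
    then show "\<bar>norm \<xi> powr p x / p x\<bar> \<le> 0 + 1 * norm \<xi> powr p x" by simp
  qed
qed (use assms in \<open>auto simp: Lp_def\<close>)

lemma den_tendsto:
  fixes g :: "nat => 'x => 'b::euclidean_space"
  assumes g: "!!n. Lp (g n)" and h: "Lp h" and k: "Lp k" and lim: "mconv g h"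
  shows "(%n. den (g n) k) \<longlonglongrightarrow> den h k"
  unfolding den_def
proof (rule nemytskii_continuous[where h = "%x \<xi>. norm \<xi> powr (p x - 2) * (\<xi> \<bullet> k x)" and v = g and w = h and D = "%x. norm (k x) powr p x" and C = 1])
  note [measurable] = Lp_meas[OF k]
  show "AE x in M. continuous_on UNIV (%\<xi>::'b. norm \<xi> powr (p x - 2) * (\<xi> \<bullet> k x))"
    by (rule AE_I2) (rule plap_continuous[OF p_gt])
  show "AE x in M. \<forall>\<xi>. \<bar>norm \<xi> powr (p x - 2) * (\<xi> \<bullet> k x)\<bar> \<le> norm (k x) powr p x + 1 * norm \<xi> powr p x"
    using plap_abs_le2[OF p_ge, of _ _ "k _"] by (intro AE_I2 allI) simp
  show "(%x. norm (v x) powr (p x - 2) * (v x \<bullet> k x)) \<in> borel_measurable M" if [measurable]: "v \<in> borel_measurable M" for v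
    by measurable
qed (use assms in \<open>auto simp: Lp_def Lp_integrable\<close>)

lemma en_deriv:
  fixes g h :: "'x => 'b::euclidean_space"
  assumes g: "Lp g" and h: "Lp h"
  shows "((%s. en (%x. g x + s *\<^sub>R h x)) has_real_derivative den g h) (at 0)"
proof -
  let ?B = "%x. norm (g x) powr p x + norm (h x) powr p x"
  let ?z = "%x s. g x + s *\<^sub>R h x"
  note [measurable] = Lp_meas[OF g] Lp_meas[OF h]
  have "((%s. \<integral>x. norm (?z x s) powr p x / p x \<partial>M) has_real_derivative
      (\<integral>x. (%s x. norm (?z x s) powr (p x - 2) * ((?z x s) \<bullet> h x)) 0 x \<partial>M)) (at 0)"
  proof (rule has_real_derivative_integral[where B = "%x. norm (h x) powr p x + 2 powr P * ?B x"])
    show "integrable M (%x. norm (?z x s) powr p x / p x)" for s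
      by (intro en_integrable Lp_add Lp_scale g h)
    show "AE x in M. \<forall>s. \<bar>s\<bar> \<le> 1 --> ((%s. norm (?z x s) powr p x / p x) has_real_derivative
        norm (?z x s) powr (p x - 2) * ((?z x s) \<bullet> h x)) (at s)"
      by (intro AE_I2 allI impI plap_deriv p_gt)
    show "integrable M (%x. norm (h x) powr p x + 2 powr P * ?B x)"
      using Lp_integrable[OF g] Lp_integrable[OF h] by auto
    show "AE x in M. \<forall>s. \<bar>s\<bar> \<le> 1 --> \<bar>norm (?z x s) powr (p x - 2) * ((?z x s) \<bullet> h x)\<bar>
        \<le> norm (h x) powr p x + 2 powr P * ?B x"
    proof (intro AE_I2 allI impI)
      fix x and s :: real assume x: "x \<in> space M" and s: "\<bar>s\<bar> \<le> 1"
      have "norm (?z x s) \<le> norm (g x) + \<bar>s\<bar> * norm (h x)" using norm_triangle_ineq[of "g x" "s *\<^sub>R h x"] by simp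
      also have "\<dots> \<le> norm (g x) + 1 * norm (h x)" using s by (intro add_left_mono mult_right_mono) auto
      finally have "norm (?z x s) powr p x \<le> (norm (g x) + norm (h x)) powr p x"
        using p_gt[OF x] by (intro powr_mono2) auto
      also have "\<dots> \<le> 2 powr P * ?B x"
        using p_gt[OF x] p_le[OF x] by (intro powr_add_le) auto
      finally show "\<bar>norm (?z x s) powr (p x - 2) * ((?z x s) \<bullet> h x)\<bar>
        \<le> norm (h x) powr p x + 2 powr P * ?B x"
        using plap_abs_le2[OF p_ge[OF x], of "g x + s *\<^sub>R h x" "h x"] by linarith
    qed
  qed measurable
  then show ?thesis by (simp add: en_def den_def)
qed

lemma en_convex:
  assumes g: "Lp g" and h: "Lp h" shows "en g + den g (%x. h x - g x) \<le> en h"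
proof -
  have d: "Lp (%x. h x - g x)" by (rule Lp_diff[OF h g])
  have "en g + den g (%x. h x - g x) = (\<integral>x. norm (g x) powr p x / p x + norm (g x) powr (p x - 2) * (g x \<bullet> (h x - g x)) \<partial>M)"
    unfolding en_def den_def using en_integrable[OF g] den_integrable[OF g d] by simp
  also have "\<dots> \<le> en h" unfolding en_def
    by (rule integral_mono) (use en_integrable[OF g] den_integrable[OF g d] en_integrable[OF h] plap_convex[OF p_gt] in auto)
  finally show ?thesis .
qed

lemma en_nonneg: "0 \<le> en g"
  unfolding en_def by (rule integral_nonneg_AE) (use p_gt in \<open>auto intro!: AE_I2 divide_nonneg_nonneg intro: less_imp_le order_trans[OF zero_le_one]\<close>)

lemma integral_le_en: assumes "Lp g" shows "(\<integral>x. norm (g x) powr p x \<partial>M) \<le> P * en g"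
proof -
  have "(\<integral>x. norm (g x) powr p x \<partial>M) \<le> (\<integral>x. P * (norm (g x) powr p x / p x) \<partial>M)"
  proof (rule integral_mono)
    fix x assume x: "x \<in> space M"
    have "p x * (norm (g x) powr p x / p x) \<le> P * (norm (g x) powr p x / p x)"
      using p_le[OF x] p_gt[OF x] by (intro mult_right_mono) auto
    then show "norm (g x) powr p x \<le> P * (norm (g x) powr p x / p x)" using p_gt[OF x] by simp
  qed (rule Lp_integrable[OF assms] integrable_mult_right en_integrable[OF assms])+
  then show ?thesis by (simp only: en_def integral_mult_right_zero)
qed

lemma en_scale:
  assumes g: "Lp g" and t: "1 \<le> t"
  shows "en (%x. t *\<^sub>R g x) \<le> t powr P * en g" "t * en g \<le> en (%x. t *\<^sub>R g x)"
proof -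
  have e: "norm (t *\<^sub>R g x) powr p x / p x = t powr p x * (norm (g x) powr p x / p x)" if "x \<in> space M" for x
    using t by (simp add: powr_mult)
  have "en (%x. t *\<^sub>R g x) \<le> (\<integral>x. t powr P * (norm (g x) powr p x / p x) \<partial>M)"
    unfolding en_def
  proof (rule integral_mono)
    fix x assume x: "x \<in> space M"
    have "t powr p x \<le> t powr P" using p_le[OF x] t by (intro powr_mono) auto
    then show "norm (t *\<^sub>R g x) powr p x / p x \<le> t powr P * (norm (g x) powr p x / p x)"
      unfolding e[OF x] using p_gt[OF x] by (intro mult_right_mono) auto
  qed (rule integrable_mult_right en_integrable[OF g] en_integrable[OF Lp_scale[OF g]])+
  then show "en (%x. t *\<^sub>R g x) \<le> t powr P * en g" by (simp only: en_def integral_mult_right_zero)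
  have "(\<integral>x. t * (norm (g x) powr p x / p x) \<partial>M) \<le> en (%x. t *\<^sub>R g x)"
    unfolding en_def
  proof (rule integral_mono)
    fix x assume x: "x \<in> space M"
    have "t powr 1 \<le> t powr p x" using p_ge[OF x] t by (intro powr_mono) auto
    then have "t \<le> t powr p x" using t by simp
    then show "t * (norm (g x) powr p x / p x) \<le> norm (t *\<^sub>R g x) powr p x / p x"
      unfolding e[OF x] using p_gt[OF x] by (intro mult_right_mono) auto
  qed (rule integrable_mult_right en_integrable[OF g] en_integrable[OF Lp_scale[OF g]])+
  then show "t * en g \<le> en (%x. t *\<^sub>R g x)" by (simp only: en_def integral_mult_right_zero)
qed

lemma en_midpoint:
  assumes g: "Lp g" and h: "Lp h" shows "en (%x. (1/2) *\<^sub>R (g x + h x)) \<le> (en g + en h) / 2"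
proof -
  have "en (%x. (1/2) *\<^sub>R (g x + h x)) \<le> (\<integral>x. (norm (g x) powr p x / p x + norm (h x) powr p x / p x) / 2 \<partial>M)"
    unfolding en_def
  proof (rule integral_mono)
    fix x assume x: "x \<in> space M"
    from norm_powr_midpoint[OF p_gt[OF x], of "g x" "h x"] p_gt[OF x]
    have "norm ((1/2) *\<^sub>R (g x + h x)) powr p x / p x \<le> (norm (g x) powr p x + norm (h x) powr p x) / 2 / p x" by (intro divide_right_mono) auto
    then show "norm ((1/2) *\<^sub>R (g x + h x)) powr p x / p x \<le> (norm (g x) powr p x / p x + norm (h x) powr p x / p x) / 2"
      by (simp add: add_divide_distrib)
  qed (rule en_integrable Lp_scale Lp_add g h integrable_divide integrable_add)+
  then show ?thesis using en_integrable[OF g] en_integrable[OF h] by (simp add: en_def)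
qed

lemma en_uniformly_convex:
  assumes e: "0 < e"
  obtains C where "C \<ge> 0" "!!g h :: 'x => 'b::euclidean_space. Lp g ==> Lp h ==>
    \<rho> (%x. g x - h x) \<le> ennreal (e * (en g + en h) + C * ((en g + en h) / 2 - en (%x. (1/2) *\<^sub>R (g x + h x))))"
proof -
  have P0: "P > 0" using P_ge by linarith
  have "1 < max p0 P" using p0 by simp
  \<comment> \<open>The upper bound is max p0 P because p0 \<le> P cannot be derived on an empty
    space. Dividing e by P absorbs the factor p x between the power of the norm and the integrand of
    \<open>en\<close>.\<close>
  obtain C where C: "C \<ge> 0" "!!(a::'b) b q. p0 \<le> q ==> q \<le> max p0 P ==>
    norm (a - b) powr q \<le> (e / P) * (norm a powr q + norm b powr q) + C * ((norm a powr q + norm b powr q) / 2 - norm ((1/2) *\<^sub>R (a + b)) powr q)"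
    using norm_powr_uniformly_convex[OF p0, of "max p0 P" "e / P"] e P0 by (metis divide_pos_pos max.cobounded1)
  show ?thesis
  proof (rule that[of "C * P"])
    show "0 \<le> C * P" using C P0 by simp
    fix g h :: "'x => 'b" assume g: "Lp g" and h: "Lp h"
    let ?m = "%x. (1/2) *\<^sub>R (g x + h x)"
    have m: "Lp ?m" by (intro Lp_scale Lp_add g h)
    let ?E = "%x. norm (g x) powr p x / p x + norm (h x) powr p x / p x"
    note I = en_integrable[OF g] en_integrable[OF h] en_integrable[OF m]
    have r: "\<rho> (%x. g x - h x) = ennreal (\<integral>x. norm (g x - h x) powr p x \<partial>M)"
      by (rule rho_eq_integral[OF Lp_integrable[OF Lp_diff[OF g h]]])
    have i: "integrable M (%x. norm (g x) powr p x / p x + norm (h x) powr p x / p x)" by (intro integrable_add I)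
    have j: "integrable M (%x. ?E x / 2 - norm (?m x) powr p x / p x)"
      by (intro Bochner_Integration.integrable_diff integrable_divide i I)
    have "(\<integral>x. norm (g x - h x) powr p x \<partial>M) \<le> (\<integral>x. e * ?E x
        + C * P * (?E x / 2 - norm (?m x) powr p x / p x) \<partial>M)"
    proof (rule integral_mono)
      fix x assume x: "x \<in> space M"
      define A where "A = (norm (g x) powr p x + norm (h x) powr p x) / p x"
      define B where "B = ((norm (g x) powr p x + norm (h x) powr p x) / 2 - norm (?m x) powr p x) / p x"
      have q: "p x > 0" "p x \<le> P" using p_gt[OF x] p_le[OF x] by auto
      have A0: "A \<ge> 0" using q by (simp add: A_def)
      have B0: "B \<ge> 0" using q norm_powr_midpoint[OF p_gt[OF x], of "g x" "h x"] by (simp add: B_def)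
      have "norm (g x - h x) powr p x \<le> (e / P) * (p x * A) + C * (p x * B)"
        using C(2)[OF p0_le[OF x], of "g x" "h x"] q by (simp add: A_def B_def)
      also have "\<dots> \<le> (e / P) * (P * A) + C * (P * B)"
        using q A0 B0 C e P0 by (intro add_mono mult_left_mono mult_right_mono) auto
      also have "\<dots> = e * A + C * P * B" using P0 by simp
      also have "A = norm (g x) powr p x / p x + norm (h x) powr p x / p x" by (simp add: A_def add_divide_distrib)
      also have "B = ?E x / 2 - norm (?m x) powr p x / p x"
        by (simp add: B_def add_divide_distrib diff_divide_distrib)
      finally show "norm (g x - h x) powr p x \<le> e * ?E x
        + C * P * (?E x / 2 - norm (?m x) powr p x / p x)" .
    next
      show "integrable M (%x. norm (g x - h x) powr p x)" by (rule Lp_integrable[OF Lp_diff[OF g h]])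
    next
      show "integrable M (%x. e * ?E x
        + C * P * (?E x / 2 - norm (?m x) powr p x / p x))"
        by (rule integrable_add[OF integrable_mult_right[OF i] integrable_mult_right[OF j]])
    qed
    also have "\<dots> = e * (en g + en h) + C * P * ((en g + en h) / 2 - en ?m)"
      unfolding en_def
        by (simp only: integral_add[OF integrable_mult_right[OF i] integrable_mult_right[OF j]] integral_mult_right_zero
            Bochner_Integration.integral_diff[OF integrable_divide[OF i] I(3)] integral_divide_zero integral_add[OF I(1,2)])
    finally show "\<rho> (%x. g x - h x) \<le> ennreal (e * (en g + en h) + C * P * ((en g + en h) / 2 - en ?m))"
      unfolding r by (rule ennreal_leI)
  qed
qed

end

section \<open>Superposition with a function that is Caratheodory only almost everywhere\<close>

lemma (in bdomain) measurable_AE_cong: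
  fixes g h :: "'a => real"
  assumes g: "g \<in> borel_measurable L" and e: "AE x in L. g x = h x"
  shows "h \<in> borel_measurable L"
proof (rule borel_measurable_if_D)
  have "AE x in lebesgue. x \<in> \<Omega> --> g x = h x" using e dom_sets by (simp add: AE_restrict_space_iff)
  then have "AE x in lebesgue. (if x \<in> \<Omega> then g x else 0) = (if x \<in> \<Omega> then h x else 0)" by eventually_elim auto
  then show "(%x. if x \<in> \<Omega> then h x else 0) \<in> borel_measurable lebesgue"
    by (rule borel_measurable_AE[OF borel_measurable_if_I[OF g dom_sets]])
qed

text \<open>Setting h to zero at the points x where continuity fails makes it continuous everywhere,
  hence jointly measurable. Only a null set of points is touched, so compositions and primitives
  inherit measurability from the modified function.\<close>

lemma (in bdomain) caratheodory_cont_modification: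
  assumes "caratheodory \<Omega> h"
  defines "h' \<equiv> %x. if continuous_on UNIV (h x) then h x else (%_. 0)"
  shows "AE x in L. h' x = h x" "case_prod h' \<in> borel_measurable (L \<Otimes>\<^sub>M borel)"
proof -
  have "AE x in L. continuous_on UNIV (h x)" using assms by (simp add: caratheodory_def)
  then show ae: "AE x in L. h' x = h x" by eventually_elim (simp add: h'_def)
  show "case_prod h' \<in> borel_measurable (L \<Otimes>\<^sub>M borel)"
  proof (rule caratheodory_measurable)
    show "(%x. h' x t) \<in> borel_measurable L" for t
    proof (rule measurable_AE_cong)
      show "(%x. h x t) \<in> borel_measurable L" using assms by (simp add: caratheodory_def)
      show "AE x in L. h x t = h' x t" using ae by eventually_elim simp
    qed
    show "continuous_on UNIV (h' x)" for x by (simp add: h'_def)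
  qed
qed

lemma (in bdomain) caratheodory_composed_measurable:
  assumes c: "caratheodory \<Omega> h" and [measurable]: "v \<in> borel_measurable L"
  shows "(%x. h x (v x)) \<in> borel_measurable L"
proof (rule measurable_AE_cong)
  let ?h = "%x. if continuous_on UNIV (h x) then h x else (%_. 0)"
  have "(%x. case_prod ?h (x, v x)) \<in> borel_measurable L"
    by (rule measurable_compose[OF _ caratheodory_cont_modification(2)[OF c]]) measurable
  then show "(%x. ?h x (v x)) \<in> borel_measurable L" by simp
  show "AE x in L. ?h x (v x) = h x (v x)"
    using caratheodory_cont_modification(1)[OF c] by eventually_elim metis
qed

lemma (in bdomain) caratheodory_Fprim:
  assumes c: "caratheodory \<Omega> h" shows "caratheodory \<Omega> (Fprim h)"
  unfolding caratheodory_def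
proof (intro conjI allI)
  have "AE x in L. continuous_on UNIV (h x)" using c by (simp add: caratheodory_def)
  then show "AE x in L. continuous_on UNIV (Fprim h x)"
  proof eventually_elim
    case (elim x)
    show ?case
      by (intro continuous_at_imp_continuous_on ballI) (rule DERIV_isCont[OF Fprim_deriv[where f = h and x = x, OF elim]])
  qed
  fix t
  define h' where "h' = (%x. if continuous_on UNIV (h x) then h x else (%_. 0))"
  have [measurable]: "case_prod h' \<in> borel_measurable (L \<Otimes>\<^sub>M borel)"
    unfolding h'_def by (rule caratheodory_cont_modification(2)[OF c])
  have "(%x. Fprim h' x t) \<in> borel_measurable L"
    unfolding Fprim_def interval_lebesgue_integral_def set_lebesgue_integral_def by measurable
  moreover have "AE x in L. Fprim h' x t = Fprim h x t"
    using caratheodory_cont_modification(1)[OF c] unfolding h'_def Fprim_def by eventually_elim simp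
  ultimately show "(%x. Fprim h x t) \<in> borel_measurable L" by (rule measurable_AE_cong)
qed

text \<open>Collects what the variational argument uses: bounds for the exponents, growth,
  superlinearity and oddness of f, and the embedding in the form of its conclusion
  \<open>emb\<close>. Here \<alpha> already dominates p1 and p2, and P stands for an upper bound of
  both, strictly below \<theta>.\<close>

locale problem = bdomain \<Omega> for \<Omega> :: "'a::euclidean_space set" +
  fixes p1 p2 \<alpha> :: "'a => real" and f :: "'a => real => real" and P p0 A C m \<theta> s :: real and K :: "real => real" and j1 :: nat
  assumes ne: "\<Omega> \<noteq> {}"
    and meas: "p1 \<in> borel_measurable L" "p2 \<in> borel_measurable L" "\<alpha> \<in> borel_measurable L"
    and p0: "1 < p0"
    and p1_bd: "!!x. x \<in> \<Omega> ==> p0 \<le> p1 x" "!!x. x \<in> \<Omega> ==> p1 x \<le> P" "!!x. x \<in> \<Omega> ==> p1 x \<le> \<alpha> x"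
    and p2_bd: "!!x. x \<in> \<Omega> ==> p0 \<le> p2 x" "!!x. x \<in> \<Omega> ==> p2 x \<le> P" "!!x. x \<in> \<Omega> ==> p2 x \<le> \<alpha> x"
    and \<alpha>_le: "!!x. x \<in> \<Omega> ==> \<alpha> x \<le> A"
    and car: "caratheodory \<Omega> f" and C: "0 \<le> C"
    and growth: "!!x t. x \<in> \<Omega> ==> \<bar>f x t\<bar> \<le> C * (1 + \<bar>t\<bar> powr (\<alpha> x - 1))"
    and m: "0 < m" and \<theta>: "P < \<theta>"
    and ar: "!!x t. x \<in> \<Omega> ==> m \<le> \<bar>t\<bar> ==> 0 < \<theta> * Fprim f x t \<and> \<theta> * Fprim f x t \<le> t * f x t"
    and odd: "!!x t. x \<in> \<Omega> ==> f x (- t) = - f x t"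
    and s: "0 < s" "s < 1"
    and emb: "!!u g R J. poincare u g ==> integrable L (%x. norm (g x) powr max (p1 x) (p2 x)) ==>
      (\<integral>x. norm (g x) powr max (p1 x) (p2 x) \<partial>L) \<le> R ==> j1 \<le> J ==>
      rho L \<alpha> (%x. u x - avg (cell J x) u) \<le> ennreal (K R * s ^ J)"
begin

lemma P_ge1: "1 \<le> P" "1 \<le> A"
proof -
  obtain x where "x \<in> \<Omega>" using ne by auto
  then show "1 \<le> P" "1 \<le> A" using p1_bd[of x] \<alpha>_le[of x] p0 by linarith+
qed

sublocale E1: plaplace L p1 P p0
  using finite_measure_dom meas P_ge1 p0 p1_bd
  by (auto simp: plaplace_def exponent_def exponent_axioms_def plaplace_axioms_def intro: order_trans[of 1 p0])

sublocale E2: plaplace L p2 P p0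
  using finite_measure_dom meas P_ge1 p0 p2_bd
  by (auto simp: plaplace_def exponent_def exponent_axioms_def plaplace_axioms_def intro: order_trans[of 1 p0])

sublocale EA: plaplace L \<alpha> A p0
proof -
  have "p0 \<le> \<alpha> x" if "x \<in> \<Omega>" for x using p1_bd[OF that] by linarith
  then show "plaplace L \<alpha> A p0"
    using finite_measure_dom meas P_ge1 p0 \<alpha>_le
    by (auto simp: plaplace_def exponent_def exponent_axioms_def plaplace_axioms_def intro: order_trans[of 1 p0])
qed

sublocale S1: sobolev \<Omega> p1 P by unfold_locales
sublocale S2: sobolev \<Omega> p2 P by unfold_locales
sublocale SA: sobolev \<Omega> \<alpha> A by unfold_locales

lemma good_AE: "AE x in L. x \<in> \<Omega> \<and> continuous_on UNIV (f x)"
proof -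
  have "AE x in L. continuous_on UNIV (f x)" using car by (simp add: caratheodory_def)
  then show ?thesis using AE_space by eventually_elim simp
qed

lemma \<alpha>_ge: "x \<in> \<Omega> ==> 1 \<le> \<alpha> x" using p1_bd[of x] p0 by linarith

lemma F_abs_le: "x \<in> \<Omega> ==> continuous_on UNIV (f x) ==> \<bar>Fprim f x t\<bar> \<le> 2 * C + 2 * C * \<bar>t\<bar> powr \<alpha> x"
  using Fprim_abs_le[where f = f and x = x and a = "\<alpha> x" and C = C and t = t] growth \<alpha>_ge C by (simp add: algebra_simps)

lemma f_times_abs_le: assumes x: "x \<in> \<Omega>" shows "\<bar>f x t * v\<bar> \<le> (C + 2 * C * \<bar>v\<bar> powr \<alpha> x) + C * \<bar>t\<bar> powr \<alpha> x"
proof -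
  have "\<bar>f x t * v\<bar> \<le> C * (1 + \<bar>t\<bar> powr (\<alpha> x - 1)) * \<bar>v\<bar>"
    using growth[OF x, of t] by (simp add: abs_mult mult_right_mono)
  also have "\<dots> = C * (\<bar>v\<bar> + \<bar>t\<bar> powr (\<alpha> x - 1) * \<bar>v\<bar>)" by (simp add: algebra_simps)
  also have "\<dots> \<le> C * ((1 + \<bar>v\<bar> powr \<alpha> x) + (\<bar>t\<bar> powr \<alpha> x + \<bar>v\<bar> powr \<alpha> x))"
    using young_split[of "\<bar>t\<bar>" "\<bar>v\<bar>" "\<alpha> x" "\<alpha> x" 1] le_split_powr[of "\<bar>v\<bar>" 1 "\<alpha> x"] \<alpha>_ge[OF x] C
    by (intro mult_left_mono add_mono) auto
  finally show ?thesis by (simp add: algebra_simps)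
qed

definition \<Phi> :: "('a => real) => real" where "\<Phi> u = (\<integral>x. Fprim f x (u x) \<partial>L)"

definition d\<Phi> :: "('a => real) => ('a => real) => real" where "d\<Phi> u v = (\<integral>x. f x (u x) * v x \<partial>L)"

lemma F_bound_AE: "AE x in L. \<forall>\<xi>. \<bar>Fprim f x \<xi>\<bar> \<le> (%_. 2 * C) x + 2 * C * norm \<xi> powr \<alpha> x"
  using good_AE by eventually_elim (simp add: F_abs_le)

lemma f_bound_AE: "AE x in L. \<forall>\<xi>. \<bar>f x \<xi> * v x\<bar> \<le> (%x. C + 2 * C * \<bar>v x\<bar> powr \<alpha> x) x + C * norm \<xi> powr \<alpha> x"
  using good_AE by eventually_elim (simp add: f_times_abs_le)

lemma F_meas: "v \<in> borel_measurable L ==> (%x. Fprim f x (v x)) \<in> borel_measurable L"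
  by (rule caratheodory_composed_measurable[OF caratheodory_Fprim[OF car]])

lemma f_meas: "v \<in> borel_measurable L ==> (%x. f x (v x)) \<in> borel_measurable L"
  by (rule caratheodory_composed_measurable[OF car])

lemma integrable_alpha: "EA.Lp v ==> integrable L (%x. \<bar>v x\<bar> powr \<alpha> x)" for v :: "'a => real"
  using EA.Lp_integrable[of v] by simp

lemma \<Phi>_integrable: assumes "EA.Lp u" shows "integrable L (%x. Fprim f x (u x))"
  by (rule EA.nemytskii_integrable[OF _ F_meas _ _ F_bound_AE]) (use assms in \<open>auto simp: EA.Lp_def\<close>)

lemma d\<Phi>_integrable: assumes u: "EA.Lp u" and v: "EA.Lp v" shows "integrable L (%x. f x (u x) * v x)"
proof (rule EA.nemytskii_integrable[OF _ _ _ _ f_bound_AE[of v], of u])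
  show "integrable L (%x. C + 2 * C * \<bar>v x\<bar> powr \<alpha> x)" using integrable_alpha[OF v] by auto
  show "(%x. f x (u x) * v x) \<in> borel_measurable L"
    by (rule borel_measurable_times[OF f_meas[OF EA.Lp_meas[OF u]] EA.Lp_meas[OF v]])
qed (use u in \<open>simp_all add: EA.Lp_def\<close>)

lemma \<Phi>_tendsto:
  assumes "!!n. EA.Lp (u n)" "EA.Lp w" "EA.mconv u w"
  shows "(%n. \<Phi> (u n)) \<longlonglongrightarrow> \<Phi> w"
  unfolding \<Phi>_def
proof (rule EA.nemytskii_continuous[where h = "Fprim f" and v = u and w = w, OF _ _ F_meas _ _ _ F_bound_AE])
  show "AE x in L. continuous_on UNIV (Fprim f x)" using caratheodory_Fprim[OF car] by (simp add: caratheodory_def)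
qed (use assms C in \<open>auto simp: EA.Lp_def\<close>)

lemma d\<Phi>_tendsto:
  assumes "!!n. EA.Lp (u n)" "EA.Lp w" "EA.mconv u w" and v: "EA.Lp v"
  shows "(%n. d\<Phi> (u n) v) \<longlonglongrightarrow> d\<Phi> w v"
  unfolding d\<Phi>_def
proof (rule EA.nemytskii_continuous[where h = "%x \<xi>. f x \<xi> * v x" and v = u and w = w, OF _ _ _ _ _ _ f_bound_AE[of v]])
  show "AE x in L. continuous_on UNIV (%\<xi>. f x \<xi> * v x)" using good_AE by eventually_elim (intro continuous_intros, auto)
  show "integrable L (%x. C + 2 * C * \<bar>v x\<bar> powr \<alpha> x)" using integrable_alpha[OF v] by auto
  show "(%x. f x (w x) * v x) \<in> borel_measurable L" if "w \<in> borel_measurable L" for w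
    using f_meas[OF that] EA.Lp_meas[OF v] by simp
qed (use assms C in \<open>auto simp: EA.Lp_def\<close>)

lemma d\<Phi>_add: "EA.Lp u ==> EA.Lp v ==> EA.Lp w ==> d\<Phi> u (%x. v x + w x) = d\<Phi> u v + d\<Phi> u w"
  using d\<Phi>_integrable[of u v] d\<Phi>_integrable[of u w] by (simp add: d\<Phi>_def distrib_left)

lemma d\<Phi>_scale: "d\<Phi> u (%x. c * v x) = c * d\<Phi> u v"
proof -
  have "f x (u x) * (c * v x) = c * (f x (u x) * v x)" for x by simp
  then show ?thesis unfolding d\<Phi>_def by (simp only: integral_mult_right_zero)
qed

lemma \<Phi>_deriv:
  assumes u: "EA.Lp u" and v: "EA.Lp v"
  shows "((%s. \<Phi> (%x. u x + s * v x)) has_real_derivative d\<Phi> u v) (at 0)"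
proof -
  let ?v = "%x. C + 2 * C * \<bar>v x\<bar> powr \<alpha> x"
  let ?w = "%x. \<bar>u x\<bar> powr \<alpha> x + \<bar>v x\<bar> powr \<alpha> x"
  note [measurable] = EA.Lp_meas[OF u] EA.Lp_meas[OF v]
  have uv: "EA.Lp (%x. u x + s * v x)" for s using EA.Lp_add[OF u EA.Lp_scale[OF v, of s]] by simp
  have "((%s. \<integral>x. Fprim f x (u x + s * v x) \<partial>L) has_real_derivative
      (\<integral>x. (%s x. f x (u x + s * v x) * v x) 0 x \<partial>L)) (at 0)"
  proof (rule has_real_derivative_integral[where B = "%x. ?v x + C * (2 powr A * ?w x)"])
    show "integrable L (%x. Fprim f x (u x + s * v x))" for s by (rule \<Phi>_integrable[OF uv])
    show "AE x in L. \<forall>s. \<bar>s\<bar> \<le> 1 --> ((%s. Fprim f x (u x + s * v x)) has_real_derivative f x (u x + s * v x) * v x) (at s)"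
      using good_AE
    proof eventually_elim
      case (elim x)
      show ?case
      proof (intro allI impI)
        fix s
        show "((%s. Fprim f x (u x + s * v x)) has_real_derivative f x (u x + s * v x) * v x) (at s)"
          by (rule DERIV_chain'[OF _ Fprim_deriv[where f = f and x = x]]) (use elim in \<open>auto intro!: derivative_eq_intros\<close>)
      qed
    qed
    show "integrable L (%x. ?v x + C * (2 powr A * ?w x))"
      using integrable_alpha[OF u] integrable_alpha[OF v] by auto
    show "AE x in L. \<forall>s. \<bar>s\<bar> \<le> 1 --> \<bar>f x (u x + s * v x) * v x\<bar> \<le> ?v x + C * (2 powr A * ?w x)"
      using good_AE
    proof eventually_elim
      case (elim x)
      show ?case
      proof (intro allI impI)
        fix s :: real assume s: "\<bar>s\<bar> \<le> 1"
        have "\<bar>u x + s * v x\<bar> \<le> \<bar>u x\<bar> + \<bar>s\<bar> * \<bar>v x\<bar>" using abs_triangle_ineq[of "u x" "s * v x"] by (simp add: abs_mult)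
        also have "\<dots> \<le> \<bar>u x\<bar> + 1 * \<bar>v x\<bar>" using s by (intro add_left_mono mult_right_mono) auto
        finally have "\<bar>u x + s * v x\<bar> powr \<alpha> x \<le> (\<bar>u x\<bar> + \<bar>v x\<bar>) powr \<alpha> x"
          using \<alpha>_ge[of x] elim by (intro powr_mono2) auto
        also have "\<dots> \<le> 2 powr A * ?w x"
          using \<alpha>_ge[of x] \<alpha>_le[of x] elim by (intro powr_add_le) auto
        finally have "C * \<bar>u x + s * v x\<bar> powr \<alpha> x \<le> C * (2 powr A * ?w x)"
          using C by (rule mult_left_mono)
        then show "\<bar>f x (u x + s * v x) * v x\<bar> \<le> ?v x + C * (2 powr A * ?w x)"
          using f_times_abs_le[of x "u x + s * v x" "v x"] elim by linarith
      qed
    qed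
    show "(%x. f x (u x + 0 * v x) * v x) \<in> borel_measurable L" using f_meas[OF EA.Lp_meas[OF u]] by simp
  qed
  then show ?thesis by (simp add: \<Phi>_def d\<Phi>_def)
qed

lemma \<Phi>_uminus: "\<Phi> (%x. - u x) = \<Phi> u" if "EA.Lp u"
  unfolding \<Phi>_def
proof (rule integral_cong_AE)
  show "AE x in L. Fprim f x (- u x) = Fprim f x (u x)"
    using good_AE by eventually_elim (rule Fprim_even, auto intro: odd)
qed (use F_meas EA.Lp_meas[OF that] in auto)

text \<open>Bounds |t f| and |F| where the superlinearity condition says nothing, i.e. for |t| < m.\<close>

definition K0 :: real where "K0 = (2 * C + 2 * C * max 1 m powr A) + (C + 3 * C * max 1 m powr A)"

lemma small_bounds:
  assumes x: "x \<in> \<Omega>" "continuous_on UNIV (f x)" and t: "\<bar>t\<bar> \<le> m"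
  shows "\<bar>Fprim f x t\<bar> \<le> K0" "\<bar>t * f x t\<bar> \<le> K0" "0 \<le> K0"
proof -
  have "\<bar>t\<bar> powr \<alpha> x \<le> max 1 m powr \<alpha> x" using t \<alpha>_ge[OF x(1)] by (intro powr_mono2) auto
  also have "\<dots> \<le> max 1 m powr A" using \<alpha>_le[OF x(1)] by (intro powr_mono) auto
  finally have "C * \<bar>t\<bar> powr \<alpha> x \<le> C * max 1 m powr A" using C by (rule mult_left_mono)
  moreover have "0 \<le> C * max 1 m powr A" using C by simp
  moreover have "\<bar>t * f x t\<bar> \<le> (C + 2 * C * \<bar>t\<bar> powr \<alpha> x) + C * \<bar>t\<bar> powr \<alpha> x" using f_times_abs_le[OF x(1), of t t] by (simp add: mult.commute)
  moreover note F_abs_le[OF x, of t] C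
  ultimately show "\<bar>Fprim f x t\<bar> \<le> K0" "\<bar>t * f x t\<bar> \<le> K0" "0 \<le> K0" by (auto simp: K0_def)
qed

text \<open>The superlinearity condition integrated over the domain; where |u| < m it is silent and
  both sides differ by at most a constant built from \<open>K0\<close>.\<close>

lemma d\<Phi>_self_ge:
  assumes u: "EA.Lp u" shows "\<theta> * \<Phi> u \<le> d\<Phi> u u + (\<theta> + 1) * K0 * measure L \<Omega>"
proof -
  have th: "\<theta> \<ge> 1" using \<theta> P_ge1 by linarith
  have "(\<integral>x. \<theta> * Fprim f x (u x) \<partial>L) \<le> (\<integral>x. f x (u x) * u x + (\<theta> + 1) * K0 \<partial>L)"
  proof (rule integral_mono_AE)
    show "AE x in L. \<theta> * Fprim f x (u x) \<le> f x (u x) * u x + (\<theta> + 1) * K0"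
      using good_AE
    proof eventually_elim
      case (elim x)
      show ?case
      proof (cases "m \<le> \<bar>u x\<bar>")
        case True
        have "0 \<le> (\<theta> + 1) * K0" using small_bounds(3)[of x 0] elim m th by simp
        moreover have "\<theta> * Fprim f x (u x) \<le> u x * f x (u x)" using ar[OF _ True] elim by blast
        ultimately show ?thesis by (simp add: mult.commute[of "u x"])
      next
        case False
        then have b: "\<bar>Fprim f x (u x)\<bar> \<le> K0" "\<bar>u x * f x (u x)\<bar> \<le> K0" using small_bounds[of x "u x"] elim by auto
        have "\<theta> * Fprim f x (u x) \<le> \<theta> * K0" using b th by (intro mult_left_mono) auto
        moreover have "- K0 \<le> f x (u x) * u x" using b(2) by (simp add: mult.commute)
        ultimately show ?thesis by (simp add: algebra_simps)
      qed
    qed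
  qed (use \<Phi>_integrable[OF u] d\<Phi>_integrable[OF u u] in auto)
  then show ?thesis using d\<Phi>_integrable[OF u u] by (simp add: \<Phi>_def d\<Phi>_def mult_ac)
qed

text \<open>The coefficient of |t|^\<theta> in the superlinear lower bound for the primitive. It is
  positive at almost every point, but no positive lower bound in x is assumed.\<close>

definition cf :: "'a => real" where "cf x = Fprim f x m / m powr \<theta>"

lemma F_ge_superlinear:
  assumes x: "x \<in> \<Omega>" "continuous_on UNIV (f x)"
  shows "0 < cf x" "cf x * \<bar>t\<bar> powr \<theta> - 2 * K0 \<le> Fprim f x t"
proof -
  have th: "\<theta> > 0" using \<theta> P_ge1 by linarith
  have Fm: "0 < Fprim f x m" using ar[OF x(1), of m] m th by (simp add: zero_less_mult_iff)
  then show "0 < cf x" using m by (simp add: cf_def)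
  have e: "cf x * \<bar>t\<bar> powr \<theta> = Fprim f x m * (\<bar>t\<bar> / m) powr \<theta>" using m by (simp add: cf_def powr_divide)
  have K: "0 \<le> K0" using small_bounds(3)[OF x, of 0] m by simp
  show "cf x * \<bar>t\<bar> powr \<theta> - 2 * K0 \<le> Fprim f x t"
  proof (cases "m \<le> \<bar>t\<bar>")
    case True
    have "Fprim f x m * (\<bar>t\<bar> / m) powr \<theta> \<le> Fprim f x t"
      by (rule Fprim_superlinear[OF x(2) odd[OF x(1)] m th ar[OF x(1)] True])
    then show ?thesis using K e by linarith
  next
    case False
    then have "(\<bar>t\<bar> / m) powr \<theta> \<le> 1" using m th by (intro powr_le1) auto
    then have "Fprim f x m * (\<bar>t\<bar> / m) powr \<theta> \<le> Fprim f x m * 1" using Fm by (intro mult_left_mono) auto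
    moreover have "\<bar>Fprim f x m\<bar> \<le> K0" "\<bar>Fprim f x t\<bar> \<le> K0" using small_bounds(1)[OF x] False m by auto
    ultimately show ?thesis using e by linarith
  qed
qed

end

context plaplace
begin

lemma en_cong: 
  assumes "Lp g" "Lp h" "AE x in M. g x = h x" shows "en g = en h"
  unfolding en_def by (rule integral_cong_AE) (use en_integrable[OF assms(1)] en_integrable[OF assms(2)] assms(3) in auto)

lemma den_cong:
  assumes "Lp g" "Lp g'" "Lp h" "Lp h'" "AE x in M. g x = g' x" "AE x in M. h x = h' x" shows "den g h = den g' h'"
  unfolding den_def
  by (rule integral_cong_AE) (use den_integrable[OF assms(1,3)] den_integrable[OF assms(2,4)] assms(5,6) in auto)

end

section \<open>The solution space, its functionals and critical points\<close>

context problem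
begin

text \<open>Pairs of a function and a gradient. The approximating test functions for the two
  exponents may differ, as in the intersection of two closures.\<close>

definition X :: "('a => real) => ('a => 'a) => bool" where
  "X u g \<longleftrightarrow> S1.approximable u g \<and> S2.approximable u g"

lemma X_Xsp: "u \<in> Xsp \<Omega> p1 p2 \<longleftrightarrow> X u (wgrad \<Omega> u)"
  unfolding X_def Xsp_def using S1.W0_approximable S2.W0_approximable S1.approximable_W0(1) S2.approximable_W0(1) by blast

lemma X_imp_Xsp: "X u g ==> u \<in> Xsp \<Omega> p1 p2"
  unfolding X_def Xsp_def using S1.approximable_W0(1) S2.approximable_W0(1) by blast

lemma X_wgrad: "X u g ==> AE x in L. wgrad \<Omega> u x = g x"
  unfolding X_def using S1.approximable_W0(2) by blast

lemma X_meas: "X u g ==> u \<in> borel_measurable L" "X u g ==> g \<in> borel_measurable L"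
  by (auto simp: X_def S1.approximable_def E1.Lp_def)

lemma X_Lp: "X u g ==> E1.Lp g" "X u g ==> E2.Lp g"
  by (auto simp: X_def S1.approximable_def S2.approximable_def)

lemma X_lincomb: "X u g ==> X v h ==> X (%x. a * u x + b * v x) (%x. a *\<^sub>R g x + b *\<^sub>R h x)"
  unfolding X_def using S1.approximable_lincomb S2.approximable_lincomb by blast

lemma X_scale: "X u g ==> X (%x. a * u x) (%x. a *\<^sub>R g x)"
  using X_lincomb[of u g u g a 0] by simp

lemma X_add: "X u g ==> X v h ==> X (%x. u x + v x) (%x. g x + h x)"
  using X_lincomb[of u g v h 1 1] by simp

lemma X_test: "\<phi> \<in> test_fns \<Omega> ==> X \<phi> (grad \<phi>)"
  unfolding X_def using S1.approximable_test S2.approximable_test by blast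

lemma X_zero: "X (%x. 0) (%x. 0)"
proof -
  obtain x a b where "x \<in> \<Omega>" and ab: "cbox a b \<subseteq> \<Omega>"
    using ne open_dom open_contains_cbox by (metis all_not_in_conv)
  from X_scale[OF X_test[OF bump_test_fns[of 1 a b, OF _ ab]], of 0] show ?thesis by simp
qed

lemma X_sum:
  assumes "finite I" "!!i. i \<in> I ==> X (u i) (g i)"
  shows "X (%x. \<Sum>i\<in>I. c i * u i x) (%x. \<Sum>i\<in>I. c i *\<^sub>R g i x)"
  using assms
proof (induction I rule: finite_induct)
  case (insert i I)
  then show ?case using X_add[OF X_scale[of "u i" "g i" "c i"], of "%x. \<Sum>i\<in>I. c i * u i x" "%x. \<Sum>i\<in>I. c i *\<^sub>R g i x"] by simp
qed (simp add: X_zero)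

lemma X_cong:
  assumes X: "X u g" and e: "AE x in L. u x = u' x"
  shows "X u' g"
proof -
  have m: "u' \<in> borel_measurable L" by (rule measurable_AE_cong[OF X_meas(1)[OF X] e])
  have 1: "rho L q u' = rho L q u" for q unfolding rho_def by (intro nn_integral_cong_AE) (use e in \<open>eventually_elim, simp\<close>)
  have 2: "rho L q (%x. \<phi> x - u' x) = rho L q (%x. \<phi> x - u x)" for q \<phi>
    unfolding rho_def by (intro nn_integral_cong_AE) (use e in \<open>eventually_elim, simp\<close>)
  show ?thesis using X m unfolding X_def S1.approximable_def S2.approximable_def E1.Lp_def E2.Lp_def 1 2 by simp
qed

lemma X_poincare: "X u g ==> poincare u g"
  unfolding X_def using S1.approximable_poincare by blast

definition J :: "('a => 'a) => real" where "J g = E1.en g + E2.en g"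

definition dJ :: "('a => 'a) => ('a => 'a) => real" where "dJ g h = E1.den g h + E2.den g h"

lemma J_nonneg: "0 \<le> J g" using E1.en_nonneg[of g] E2.en_nonneg[of g] by (simp add: J_def)

lemma integral_max_le:
  assumes g: "E1.Lp g" "E2.Lp g"
  shows "integrable L (%x. norm (g x) powr max (p1 x) (p2 x))" "(\<integral>x. norm (g x) powr max (p1 x) (p2 x) \<partial>L) \<le> P * J g"
proof -
  note I = E1.Lp_integrable[OF g(1)] E2.Lp_integrable[OF g(2)]
  note [measurable] = E1.Lp_meas[OF g(1)] meas
  have b: "norm (g x) powr max (p1 x) (p2 x) \<le> norm (g x) powr p1 x + norm (g x) powr p2 x" for x by (simp add: max_def)
  show i: "integrable L (%x. norm (g x) powr max (p1 x) (p2 x))"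
    by (rule integrable_bound[OF integrable_add[OF I]]) (use b in \<open>auto intro!: AE_I2\<close>)
  have "(\<integral>x. norm (g x) powr max (p1 x) (p2 x) \<partial>L) \<le> (\<integral>x. norm (g x) powr p1 x + norm (g x) powr p2 x \<partial>L)"
    by (rule integral_mono[OF i integrable_add[OF I] b])
  also have "\<dots> = (\<integral>x. norm (g x) powr p1 x \<partial>L) + (\<integral>x. norm (g x) powr p2 x \<partial>L)" using I by simp
  also have "\<dots> \<le> P * J g" using E1.integral_le_en[OF g(1)] E2.integral_le_en[OF g(2)] by (simp add: J_def distrib_left)
  finally show "(\<integral>x. norm (g x) powr max (p1 x) (p2 x) \<partial>L) \<le> P * J g" .
qed

lemma X_embedding:
  assumes X: "X u g" and R: "J g \<le> R" and j: "j1 \<le> j"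
  shows "rho L \<alpha> (%x. u x - avg (cell j x) u) \<le> ennreal (K (P * R) * s ^ j)"
proof (rule emb[OF X_poincare[OF X] integral_max_le(1)[OF X_Lp[OF X]] _ j])
  have "P * J g \<le> P * R" using R P_ge1 by (intro mult_left_mono) auto
  then show "(\<integral>x. norm (g x) powr max (p1 x) (p2 x) \<partial>L) \<le> P * R" using integral_max_le(2)[OF X_Lp[OF X]] by linarith
qed

lemma cell_step_Lp: "EA.Lp (%x. F (cell j x))" for F :: "'a set => real"
proof -
  let ?S = "%x. \<Sum>r\<in>reps j. indicat_real (cell j r) x * F (cell j r)"
  have "EA.Lp ?S"
  proof (rule SA.bounded_Lp)
    show "?S \<in> borel_measurable L" by (intro borel_measurable_sum borel_measurable_times sets_dom cell_borel) simp
    show "norm (?S x) \<le> (\<Sum>r\<in>reps j. \<bar>F (cell j r)\<bar>)" for x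
      by (intro sum_norm_le) (auto simp: indicator_def)
  qed
  moreover have "rho L \<alpha> ?S = rho L \<alpha> (%x. F (cell j x))"
    by (rule SA.rho_cong_AE) (auto intro!: AE_I2 simp: sum_reps)
  ultimately show ?thesis by (simp add: EA.Lp_def cell_step_measurable)
qed

text \<open>The difference between u and its cell averages has finite modular by the embedding, and
  the averages themselves form a bounded step function.\<close>

lemma X_alpha: assumes X: "X u g" shows "EA.Lp u"
proof -
  have "rho L \<alpha> (%x. u x - avg (cell j1 x) u) < top"
    using X_embedding[OF X order_refl order_refl] by (rule le_less_trans) simp
  then have "EA.Lp (%x. u x - avg (cell j1 x) u)"
    using X_meas[OF X] cell_step_measurable[of "%Q. avg Q u" j1] by (simp add: EA.Lp_def)
  from EA.Lp_add[OF this cell_step_Lp[of "%Q. avg Q u" j1]] show ?thesis by simp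
qed

lemma energy_eq: assumes X: "X u g" shows "energy \<Omega> p1 p2 f u = J g - \<Phi> u"
proof -
  have w: "X u (wgrad \<Omega> u)" using X_imp_Xsp[OF X] X_Xsp by simp
  have "energy \<Omega> p1 p2 f u = J (wgrad \<Omega> u) - \<Phi> u" by (simp add: energy_def J_def E1.en_def E2.en_def \<Phi>_def)
  also have "J (wgrad \<Omega> u) = J g"
    using E1.en_cong[OF X_Lp(1)[OF w] X_Lp(1)[OF X] X_wgrad[OF X]] E2.en_cong[OF X_Lp(2)[OF w] X_Lp(2)[OF X] X_wgrad[OF X]] by (simp add: J_def)
  finally show ?thesis .
qed

lemma J_deriv:
  assumes g: "E1.Lp g" "E2.Lp g" and h: "E1.Lp h" "E2.Lp h"
  shows "((%s. J (%x. g x + s *\<^sub>R h x)) has_real_derivative dJ g h) (at 0)"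
  unfolding J_def dJ_def by (intro DERIV_add E1.en_deriv E2.en_deriv g h)

lemma E_deriv:
  assumes X: "X u g" and Y: "X v h"
  shows "((%s. J (%x. g x + s *\<^sub>R h x) - \<Phi> (%x. u x + s * v x)) has_real_derivative dJ g h - d\<Phi> u v) (at 0)"
  by (intro DERIV_diff J_deriv \<Phi>_deriv X_Lp[OF X] X_Lp[OF Y] X_alpha[OF X] X_alpha[OF Y])

lemma dJ_cong:
  assumes "X u g" "X u' g'" "X v h" "X v' h'" "AE x in L. g x = g' x" "AE x in L. h x = h' x"
  shows "dJ g h = dJ g' h'"
  unfolding dJ_def
  using E1.den_cong[OF X_Lp(1)[OF assms(1)] X_Lp(1)[OF assms(2)] X_Lp(1)[OF assms(3)] X_Lp(1)[OF assms(4)] assms(5,6)]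
    E2.den_cong[OF X_Lp(2)[OF assms(1)] X_Lp(2)[OF assms(2)] X_Lp(2)[OF assms(3)] X_Lp(2)[OF assms(4)] assms(5,6)] by simp

lemma critical_pointI:
  assumes X: "X u g" and crit: "!!v h. X v h ==> dJ g h = d\<Phi> u v"
  shows "critical_point \<Omega> p1 p2 f u" "weak_solution \<Omega> p1 p2 f u"
proof -
  show "critical_point \<Omega> p1 p2 f u"
    unfolding critical_point_def
  proof (intro conjI ballI)
    fix v assume "v \<in> Xsp \<Omega> p1 p2"
    then have v: "X v (wgrad \<Omega> v)" by (simp add: X_Xsp)
    have "energy \<Omega> p1 p2 f (%x. u x + s * v x) = J (%x. g x + s *\<^sub>R wgrad \<Omega> v x) - \<Phi> (%x. u x + s * v x)" for s
      by (rule energy_eq[OF X_add[OF X X_scale[OF v]]])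
    then show "((%s. energy \<Omega> p1 p2 f (%x. u x + s * v x)) has_real_derivative 0) (at 0)"
      using E_deriv[OF X v] crit[OF v] by simp
  qed (rule X_imp_Xsp[OF X])
  show "weak_solution \<Omega> p1 p2 f u"
    unfolding weak_solution_def
  proof (intro conjI ballI)
    fix v assume "v \<in> Xsp \<Omega> p1 p2"
    then have v: "X v (wgrad \<Omega> v)" by (simp add: X_Xsp)
    have w: "X u (wgrad \<Omega> u)" using X_imp_Xsp[OF X] X_Xsp by simp
    have "dJ (wgrad \<Omega> u) (wgrad \<Omega> v) = dJ g (wgrad \<Omega> v)" by (rule dJ_cong[OF w X v v X_wgrad[OF X]]) simp
    then have "dJ (wgrad \<Omega> u) (wgrad \<Omega> v) = d\<Phi> u v" using crit[OF v] by simp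
    then show "(\<integral>x. norm (wgrad \<Omega> u x) powr (p1 x - 2) * (wgrad \<Omega> u x \<bullet> wgrad \<Omega> v x) \<partial>L)
      + (\<integral>x. norm (wgrad \<Omega> u x) powr (p2 x - 2) * (wgrad \<Omega> u x \<bullet> wgrad \<Omega> v x) \<partial>L) = (\<integral>x. f x (u x) * v x \<partial>L)"
      by (simp add: dJ_def E1.den_def E2.den_def d\<Phi>_def)
  qed (rule X_imp_Xsp[OF X])
qed

end

section \<open>Galerkin spaces\<close>

lemma (in plaplace) rho_sum_tendsto:
  fixes e :: "'i => 'x => 'b::euclidean_space" and c :: "nat => 'i => real"
  assumes "finite I" "!!i. i \<in> I ==> Lp (e i)" "!!i. i \<in> I ==> (%n. c n i) \<longlonglongrightarrow> 0"
  shows "(%n. \<rho> (%x. \<Sum>i\<in>I. c n i *\<^sub>R e i x)) \<longlonglongrightarrow> 0"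
  using assms
proof (induction I rule: finite_induct)
  case empty
  then show ?case by (simp add: rho_def)
next
  case (insert i I)
  have Le: "Lp (e i)" using insert.prems by simp
  have 1: "(%n. \<rho> (%x. c n i *\<^sub>R e i x)) \<longlonglongrightarrow> 0"
  proof (rule tendsto_sandwich[of "%_. 0" _ _ "%n. ennreal \<bar>c n i\<bar> * \<rho> (e i)"])
    have ci: "(%n. c n i) \<longlonglongrightarrow> 0" using insert.prems by simp
    then have ci': "(%n. \<bar>c n i\<bar>) \<longlonglongrightarrow> 0" by (rule tendsto_rabs_zero)
    then have "\<forall>\<^sub>F n in sequentially. \<bar>c n i\<bar> < 1" by (rule order_tendstoD) simp
    then show "\<forall>\<^sub>F n in sequentially. \<rho> (%x. c n i *\<^sub>R e i x) \<le> ennreal \<bar>c n i\<bar> * \<rho> (e i)"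
      by eventually_elim (intro rho_small_scale Lp_meas[OF Le], simp)
    have "(%n. ennreal \<bar>c n i\<bar> * \<rho> (e i)) \<longlonglongrightarrow> ennreal 0 * \<rho> (e i)"
      by (intro tendsto_mult_ennreal tendsto_ennrealI ci' tendsto_const) (use Le in \<open>auto simp: Lp_def\<close>)
    then show "(%n. ennreal \<bar>c n i\<bar> * \<rho> (e i)) \<longlonglongrightarrow> 0" by simp
  qed auto
  have "(%n. \<rho> (%x. c n i *\<^sub>R e i x + (\<Sum>i\<in>I. c n i *\<^sub>R e i x))) \<longlonglongrightarrow> 0"
  proof (rule rho_tendsto_add[OF _ _ 1])
    show "(%x. c n i *\<^sub>R e i x) \<in> borel_measurable M" for n using Lp_meas[OF Le] by simp
    show "(%x. \<Sum>i\<in>I. c n i *\<^sub>R e i x) \<in> borel_measurable M" for n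
      using insert.prems Lp_meas by (intro borel_measurable_sum borel_measurable_scaleR) auto
  qed (use insert in auto)
  then show ?case using insert.hyps by simp
qed

lemma continuous_on_coords:
  fixes F :: "(nat => real) => real"
  assumes "!!y w. (!!i. (%k. y k i) \<longlonglongrightarrow> w i) ==> (%k::nat. F (y k)) \<longlonglongrightarrow> F w"
  shows "continuous_on S F"
  unfolding continuous_on_sequentially
proof (intro allI ballI impI)
  fix y w assume "w \<in> S" and y: "(\<forall>k. y k \<in> S) \<and> y \<longlonglongrightarrow> w"
  have "(%k. y k i) \<longlonglongrightarrow> w i" for i
    using continuous_on_tendsto_compose[OF continuous_on_coord[of UNIV i], of y w sequentially] y by simp
  then show "(F \<circ> y) \<longlonglongrightarrow> F w" using assms[of y w] by (simp add: o_def)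
qed

context problem
begin

definition V :: "nat => (nat => real) set" where "V n = {y. \<forall>i\<ge>n. y i = 0}"

definition T :: "(nat => 'a => real) => nat => (nat => real) => 'a => real" where
  "T e n y = (%x. \<Sum>i<n. y i * e i x)"

definition G :: "(nat => 'a => 'a) => nat => (nat => real) => 'a => 'a" where
  "G d n y = (%x. \<Sum>i<n. y i *\<^sub>R d i x)"

text \<open>Linear independence is understood modulo null sets; it makes J positive on nonzero
  coordinate vectors, so that level sets of J can be parametrised by a sphere.\<close>

definition frame :: "(nat => 'a => real) => (nat => 'a => 'a) => nat => bool" where
  "frame e d n \<longleftrightarrow> (\<forall>i<n. X (e i) (d i)) \<and> (\<forall>y\<in>V n. (AE x in L. T e n y x = 0) --> (\<forall>i. y i = 0))"

definition EG :: "(nat => 'a => real) => (nat => 'a => 'a) => nat => (nat => real) => real" where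
  "EG e d n y = J (G d n y) - \<Phi> (T e n y)"

definition DEG :: "(nat => 'a => real) => (nat => 'a => 'a) => nat => (nat => real) => nat => real" where
  "DEG e d n y i = dJ (G d n y) (d i) - d\<Phi> (T e n y) (e i)"

lemma frame_X: "frame e d n ==> X (T e n y) (G d n y)"
  unfolding T_def G_def frame_def by (intro X_sum) auto

lemma T_lin: "T e n (%i. y i + c * v i) = (%x. T e n y x + c * T e n v x)"
  by (simp add: T_def fun_eq_iff sum.distrib sum_distrib_left distrib_right mult.assoc)

lemma G_lin: "G d n (%i. y i + c * v i) = (%x. G d n y x + c *\<^sub>R G d n v x)"
  by (simp add: G_def fun_eq_iff sum.distrib scaleR_sum_right scaleR_add_left)

lemma T_scale: "T e n (%i. c * v i) = (%x. c * T e n v x)"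
  by (simp add: T_def fun_eq_iff sum_distrib_left mult.assoc)

lemma G_scale: "G d n (%i. c * v i) = (%x. c *\<^sub>R G d n v x)"
  by (simp add: G_def fun_eq_iff scaleR_sum_right)

lemma frame_rho_tendsto:
  assumes F: "frame e d n" and y: "!!i. (%k::nat. y k i) \<longlonglongrightarrow> w i"
  shows "(%k. rho L p1 (%x. G d n (y k) x - G d n w x)) \<longlonglongrightarrow> 0" "(%k. rho L p2 (%x. G d n (y k) x - G d n w x)) \<longlonglongrightarrow> 0"
    "(%k. rho L \<alpha> (%x. T e n (y k) x - T e n w x)) \<longlonglongrightarrow> 0"
proof -
  have X: "X (e i) (d i)" if "i < n" for i using F that by (simp add: frame_def)
  have c: "(%k. y k i - w i) \<longlonglongrightarrow> 0" for i using y[of i] by (simp add: LIM_zero_iff)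
  have e: "G d n (y k) x - G d n w x = (\<Sum>i<n. (y k i - w i) *\<^sub>R d i x)" "T e n (y k) x - T e n w x = (\<Sum>i<n. (y k i - w i) *\<^sub>R e i x)" for k x
    by (simp_all add: G_def T_def sum_subtractf scaleR_diff_left left_diff_distrib)
  show "(%k. rho L p1 (%x. G d n (y k) x - G d n w x)) \<longlonglongrightarrow> 0"
    unfolding e by (rule E1.rho_sum_tendsto[OF _ _ c]) (use X_Lp(1)[OF X] in auto)
  show "(%k. rho L p2 (%x. G d n (y k) x - G d n w x)) \<longlonglongrightarrow> 0"
    unfolding e by (rule E2.rho_sum_tendsto[OF _ _ c]) (use X_Lp(2)[OF X] in auto)
  show "(%k. rho L \<alpha> (%x. T e n (y k) x - T e n w x)) \<longlonglongrightarrow> 0"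
    unfolding e by (rule EA.rho_sum_tendsto[OF _ _ c]) (use X_alpha X in auto)
qed

lemma J_tendsto:
  assumes g: "!!k. X (u k) (g k)" and h: "E1.Lp h" "E2.Lp h"
    and lim: "E1.mconv g h" "E2.mconv g h"
  shows "(%k. J (g k)) \<longlonglongrightarrow> J h" "E1.Lp q ==> E2.Lp q ==> (%k. dJ (g k) q) \<longlonglongrightarrow> dJ h q"
  unfolding J_def dJ_def
  by (intro tendsto_add E1.en_tendsto E2.en_tendsto X_Lp[OF g] h lim)
    (intro tendsto_add E1.den_tendsto E2.den_tendsto X_Lp[OF g] h lim; assumption)

lemma frame_continuous:
  assumes F: "frame e d n"
  shows "continuous_on S (%y. J (G d n y))" "continuous_on S (EG e d n)" "i < n ==> continuous_on S (%y. DEG e d n y i)"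
proof -
  note X = frame_X[OF F]
  note R = frame_rho_tendsto[OF F]
  show J: "continuous_on S (%y. J (G d n y))"
    by (rule continuous_on_coords, rule J_tendsto(1)[OF X X_Lp[OF X]]; rule R)
  have "continuous_on S (%y. \<Phi> (T e n y))"
    by (rule continuous_on_coords, rule \<Phi>_tendsto[OF X_alpha[OF X] X_alpha[OF X]]; rule R)
  then show "continuous_on S (EG e d n)" unfolding EG_def[abs_def] by (intro continuous_on_diff J)
  assume "i < n"
  then have i: "X (e i) (d i)" using F by (simp add: frame_def)
  have "continuous_on S (%y. dJ (G d n y) (d i))"
    by (rule continuous_on_coords, rule J_tendsto(2)[OF X X_Lp[OF X] _ _ X_Lp[OF i]]; rule R)
  moreover have "continuous_on S (%y. d\<Phi> (T e n y) (e i))"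
    by (rule continuous_on_coords, rule d\<Phi>_tendsto[OF X_alpha[OF X] X_alpha[OF X] _ X_alpha[OF i]]; rule R)
  ultimately show "continuous_on S (%y. DEG e d n y i)" unfolding DEG_def by (rule continuous_on_diff)
qed

lemma d\<Phi>_sum:
  assumes "finite I" "EA.Lp u" "!!i. i \<in> I ==> EA.Lp (e i)"
  shows "d\<Phi> u (%x. \<Sum>i\<in>I. c i * e i x) = (\<Sum>i\<in>I. c i * d\<Phi> u (e i)) \<and> EA.Lp (%x. \<Sum>i\<in>I. c i * e i x)"
  using assms(1,3)
proof (induction I rule: finite_induct)
  case empty
  have "EA.Lp (%x. 0 :: real)" using EA.Lp_scale[OF assms(2), of 0] by simp
  then show ?case by (simp add: d\<Phi>_def)
next
  case (insert i I)
  then have "EA.Lp (%x. \<Sum>i\<in>I. c i * e i x)" "EA.Lp (%x. c i * e i x)" using EA.Lp_scale[of "e i" "c i"] by auto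
  then show ?case using insert d\<Phi>_add[OF assms(2), of "%x. c i * e i x" "%x. \<Sum>i\<in>I. c i * e i x"]
      EA.Lp_add[of "%x. c i * e i x" "%x. \<Sum>i\<in>I. c i * e i x"] by (simp add: d\<Phi>_scale)
qed

lemma frame_derivative:
  assumes F: "frame e d n"
  shows "dJ (G d n y) (G d n v) - d\<Phi> (T e n y) (T e n v) = (\<Sum>i<n. v i * DEG e d n y i)"
proof -
  note X = frame_X[OF F]
  have i: "X (e i) (d i)" if "i < n" for i using F that by (simp add: frame_def)
  have "E1.den (G d n y) (G d n v) = (\<Sum>i<n. v i * E1.den (G d n y) (d i))"
    unfolding G_def[of d n v] using E1.den_sum[of "{..<n}" "G d n y" d v] X_Lp[OF X] X_Lp[OF i] by simp
  moreover have "E2.den (G d n y) (G d n v) = (\<Sum>i<n. v i * E2.den (G d n y) (d i))"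
    unfolding G_def[of d n v] using E2.den_sum[of "{..<n}" "G d n y" d v] X_Lp[OF X] X_Lp[OF i] by simp
  moreover have "d\<Phi> (T e n y) (T e n v) = (\<Sum>i<n. v i * d\<Phi> (T e n y) (e i))"
    unfolding T_def[of e n v] using d\<Phi>_sum[of "{..<n}" "T e n y" e v] X_alpha[OF X] X_alpha[OF i] by simp
  ultimately show ?thesis
    by (simp add: DEG_def dJ_def sum.distrib sum_subtractf distrib_left right_diff_distrib)
qed

lemma frame_line_derivative:
  assumes F: "frame e d n"
  shows "((%t. EG e d n (%i. y i + t * v i)) has_real_derivative (\<Sum>i<n. v i * DEG e d n (%i. y i + c * v i) i)) (at c)"
proof -
  let ?w = "%i. y i + c * v i"
  have "EG e d n (%i. y i + (t + c) * v i) = J (%x. G d n ?w x + t *\<^sub>R G d n v x) - \<Phi> (%x. T e n ?w x + t * T e n v x)" for t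
    unfolding EG_def T_lin[symmetric] G_lin[symmetric] by (simp add: algebra_simps)
  then have "((%t. EG e d n (%i. y i + (t + c) * v i)) has_real_derivative (\<Sum>i<n. v i * DEG e d n ?w i)) (at 0)"
    using E_deriv[OF frame_X[OF F, of ?w] frame_X[OF F, of v]] unfolding frame_derivative[OF F] by simp
  then show ?thesis using DERIV_shift[of "%t. EG e d n (%i. y i + t * v i)" "\<Sum>i<n. v i * DEG e d n ?w i" 0 c] by simp
qed

lemma EG_uminus: "frame e d n ==> EG e d n (%i. - y i) = EG e d n y"
  using T_scale[of e n "-1" y] G_scale[of d n "-1" y] \<Phi>_uminus[OF X_alpha[OF frame_X]]
  by (simp add: EG_def J_def E1.en_def E2.en_def)

text \<open>A vanishing first energy kills the gradient almost everywhere, and the Poincare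
  inequality for zero boundary values then kills the function.\<close>

lemma J_zero_imp:
  assumes X: "X u g" and z: "J g = 0" shows "AE x in L. u x = 0"
proof -
  have "E1.en g = 0" using z E1.en_nonneg[of g] E2.en_nonneg[of g] by (simp add: J_def)
  then have "(\<integral>x. norm (g x) powr p1 x \<partial>L) \<le> 0" using E1.integral_le_en[OF X_Lp(1)[OF X]] by simp
  moreover have "(\<integral>x. norm (g x) powr p1 x \<partial>L) \<ge> 0" by (intro integral_nonneg_AE) simp
  ultimately have "AE x in L. norm (g x) powr p1 x = 0"
    using integral_nonneg_eq_0_iff_AE[OF E1.Lp_integrable[OF X_Lp(1)[OF X]]] by simp
  then have "AE x in L. norm (g x) = 0" by eventually_elim simp
  then have "(\<integral>x. norm (g x) \<partial>L) = 0" by (rule integral_eq_zero_AE)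
  moreover obtain c where c: "0 \<le> c" "!!u g. poincare u g ==> (\<integral>x. \<bar>u x\<bar> \<partial>L) \<le> c * (\<integral>x. norm (g x) \<partial>L)"
    by (rule poincare_L1[OF ne], erule that, blast)
  ultimately have "(\<integral>x. \<bar>u x\<bar> \<partial>L) \<le> 0" using c(2)[OF X_poincare[OF X]] by simp
  moreover have "(\<integral>x. \<bar>u x\<bar> \<partial>L) \<ge> 0" by (intro integral_nonneg_AE) simp
  moreover have "integrable L (%x. \<bar>u x\<bar>)" using X_poincare[OF X] by (simp add: poincare_def)
  ultimately show ?thesis using integral_nonneg_eq_0_iff_AE[of L "%x. \<bar>u x\<bar>"] by simp
qed

lemma Sph_V: "x \<in> Sph n ==> x \<in> V n" by (simp add: Sph_def V_def)

lemma Sph_nonzero: "x \<in> Sph n ==> \<exists>i. x i \<noteq> 0"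
proof (rule ccontr)
  assume "x \<in> Sph n" "\<not> (\<exists>i. x i \<noteq> 0)"
  then show False by (simp add: Sph_def)
qed

lemma J_scale:
  assumes X: "X u g" and t: "1 \<le> t"
  shows "J (%x. t *\<^sub>R g x) \<le> t powr P * J g" "t * J g \<le> J (%x. t *\<^sub>R g x)"
  using E1.en_scale[OF X_Lp(1)[OF X] t] E2.en_scale[OF X_Lp(2)[OF X] t] by (simp_all add: J_def distrib_left)

text \<open>Radial projection onto a level set of J. Strict monotonicity along rays turns the order
  topology into continuity of the scaling factor.\<close>

lemma level_set:
  assumes F: "frame e d n" and r: "0 < r"
  obtains t where "!!x. x \<in> Sph n ==> 0 < t x" "!!x. x \<in> Sph n ==> J (G d n (%i. t x * x i)) = r"
    "continuous_on (Sph n) t" "!!x. x \<in> Sph n ==> t (%i. - x i) = t x"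
proof -
  define H where "H x c = J (G d n (%i. c * x i))" for x :: "nat => real" and c
  note X = frame_X[OF F]
  have Hg: "H x c = J (%y. c *\<^sub>R G d n x y)" for x c by (simp add: H_def G_scale)
  have pos: "H x c > 0" if x: "x \<in> Sph n" and c: "c > 0" for x c
  proof (rule ccontr)
    assume "\<not> H x c > 0"
    then have z: "J (G d n (%i. c * x i)) = 0" using J_nonneg[of "G d n (%i. c * x i)"] by (simp add: H_def)
    have "(%i. c * x i) \<in> V n" using Sph_V[OF x] by (simp add: V_def)
    then have "\<forall>i. c * x i = 0" using J_zero_imp[OF X z] F unfolding frame_def by blast
    then show False using Sph_nonzero[OF x] c by auto
  qed
  have scale: "(b / c) * H x c \<le> H x b" if "0 < c" "c \<le> b" for x b c
  proof -
    have "(b / c) * J (G d n (%i. c * x i)) \<le> J (%y. (b / c) *\<^sub>R G d n (%i. c * x i) y)"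
      by (rule J_scale(2)[OF X]) (use that in simp)
    then show ?thesis using that by (simp add: H_def G_scale)
  qed
  have H0: "H x 0 = 0" for x by (simp add: Hg J_def E1.en_def E2.en_def)
  have mono: "H x c < H x b" if x: "x \<in> Sph n" and cb: "0 \<le> c" "c < b" for x b c
  proof (cases "c = 0")
    case True
    then show ?thesis using pos[OF x, of b] cb by (simp add: H0)
  next
    case False
    then have c: "c > 0" using cb by simp
    have "1 * H x c < (b / c) * H x c" using pos[OF x c] c cb by (intro mult_strict_right_mono) auto
    then show ?thesis using scale[OF c, of b x] cb by simp
  qed
  have contc: "continuous_on S (%c. H x c)" for x and S :: "real set"
    unfolding H_def
    by (rule continuous_on_compose2[OF frame_continuous(1)[OF F, of UNIV]]) (auto intro!: continuous_on_coordinatewise_then_product continuous_intros)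
  have contx: "continuous_on S (%x. H x c)" for c S
    unfolding H_def
    by (rule continuous_on_compose2[OF frame_continuous(1)[OF F, of UNIV]]) (auto intro!: continuous_on_coordinatewise_then_product continuous_intros continuous_on_coord)
  have ex: "\<exists>c>0. H x c = r" if x: "x \<in> Sph n" for x
  proof -
    define b where "b = max 1 (r / H x 1)"
    have p: "H x 1 > 0" by (rule pos[OF x]) simp
    have "r \<le> (b / 1) * H x 1" using p by (simp add: b_def max_def field_simps)
    also have "\<dots> \<le> H x b" by (rule scale) (auto simp: b_def)
    finally have "r \<le> H x b" .
    moreover have "0 \<le> b" by (simp add: b_def)
    ultimately obtain c where "0 \<le> c" "H x c = r" using IVT'[of "H x" 0 r b] H0 r contc by auto
    then show ?thesis using H0 r by (intro exI[of _ c]) (cases "c = 0", auto)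
  qed
  \<comment> \<open>The choice depends on x only through the function \<open>H x\<close>, which is
    the same for x and -x, so t is even by construction.\<close>
  define t where "t x = (SOME c. c > 0 \<and> H x c = r)" for x
  have t: "t x > 0 \<and> H x (t x) = r" if "x \<in> Sph n" for x
    unfolding t_def by (rule someI_ex) (use ex[OF that] in blast)
  have less: "c < t x \<longleftrightarrow> H x c < r" "t x < c \<longleftrightarrow> r < H x c" if x: "x \<in> Sph n" and c: "0 \<le> c" for x c
    using mono[OF x, of c "t x"] mono[OF x, of "t x" c] t[OF x] c by (cases "c < t x"; cases "c = t x"; force)+
  show ?thesis
  proof (rule that[of t])
    show "0 < t x" "J (G d n (%i. t x * x i)) = r" if "x \<in> Sph n" for x using t[OF that] by (auto simp: H_def)
    show "continuous_on (Sph n) t" unfolding continuous_on_def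
    proof (intro ballI order_tendstoI)
      fix x c assume x: "x \<in> Sph n" and c: "c < t x"
      have S: "\<forall>\<^sub>F y in at x within Sph n. y \<in> Sph n" by (simp add: eventually_at_filter)
      show "\<forall>\<^sub>F y in at x within Sph n. c < t y"
      proof (cases "c < 0")
        case True
        then show ?thesis using S by (auto elim!: eventually_mono dest!: t)
      next
        case False
        have "((%x. H x c) \<longlongrightarrow> H x c) (at x within Sph n)" using contx x by (auto simp: continuous_on_def)
        moreover have "H x c < r" using less(1)[OF x, of c] c False by simp
        ultimately have "\<forall>\<^sub>F y in at x within Sph n. H y c < r" by (rule order_tendstoD(2))
        then show ?thesis using S by eventually_elim (use less False in auto)
      qed
    next
      fix x c assume x: "x \<in> Sph n" and c: "t x < c"
      have S: "\<forall>\<^sub>F y in at x within Sph n. y \<in> Sph n" by (simp add: eventually_at_filter)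
      have c0: "0 \<le> c" using c t[OF x] by linarith
      have "((%x. H x c) \<longlongrightarrow> H x c) (at x within Sph n)" using contx x by (auto simp: continuous_on_def)
      moreover have "r < H x c" using less(2)[OF x c0] c by simp
      ultimately have "\<forall>\<^sub>F y in at x within Sph n. r < H y c" by (rule order_tendstoD(1))
      then show "\<forall>\<^sub>F y in at x within Sph n. t y < c" using S by eventually_elim (use less c0 in auto)
    qed
    show "t (%i. - x i) = t x" if "x \<in> Sph n" for x
    proof -
      have "H (%i. - x i) c = H x c" for c
        using G_scale[of d n "- 1" x] by (simp add: Hg J_def E1.en_def E2.en_def)
      then show ?thesis by (simp add: t_def)
    qed
  qed
qed

end

section \<open>Superlinear growth and critical points in Galerkin spaces\<close>

context problem
begin

lemma cf_measurable: "cf \<in> borel_measurable L"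
  using F_meas[of "%_. m"] by (simp add: cf_def[abs_def])

text \<open>A minorant of \<Phi> up to a constant, homogeneous of degree \<theta>. On a
  finite-dimensional sphere it has a positive minimum by compactness, which makes up for the missing
  lower bound of \<open>cf\<close>.\<close>

definition \<Psi> :: "('a => real) => real" where "\<Psi> u = (\<integral>x. cf x * \<bar>u x\<bar> powr \<theta> \<partial>L)"

lemma \<Psi>_bound_AE: "AE x in L. \<forall>\<xi>. \<bar>cf x * \<bar>\<xi>\<bar> powr \<theta>\<bar> \<le> (%_. 2 * C + 2 * K0) x + 2 * C * norm \<xi> powr \<alpha> x"
  using good_AE
proof eventually_elim
  case (elim x)
  show ?case
  proof
    fix \<xi>
    have "0 \<le> cf x * \<bar>\<xi>\<bar> powr \<theta>" using F_ge_superlinear(1)[of x] elim by (simp add: less_imp_le)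
    then show "\<bar>cf x * \<bar>\<xi>\<bar> powr \<theta>\<bar> \<le> (%_. 2 * C + 2 * K0) x + 2 * C * norm \<xi> powr \<alpha> x"
      using F_ge_superlinear(2)[of x \<xi>] F_abs_le[of x \<xi>] elim by simp
  qed
qed

lemma \<Psi>_integrable: assumes "EA.Lp u" shows "integrable L (%x. cf x * \<bar>u x\<bar> powr \<theta>)"
  by (rule EA.nemytskii_integrable[OF _ _ _ _ \<Psi>_bound_AE])
    (use assms cf_measurable in \<open>auto simp: EA.Lp_def\<close>)

lemma \<Psi>_tendsto:
  assumes "!!n. EA.Lp (u n)" "EA.Lp w" "EA.mconv u w"
  shows "(%n. \<Psi> (u n)) \<longlonglongrightarrow> \<Psi> w"
  unfolding \<Psi>_def
proof (rule EA.nemytskii_continuous[where h = "%x \<xi>. cf x * \<bar>\<xi>\<bar> powr \<theta>" and v = u and w = w, OF _ _ _ _ _ _ \<Psi>_bound_AE])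
  have "\<theta> > 0" using \<theta> P_ge1 by linarith
  then show "AE x in L. continuous_on UNIV (%\<xi>. cf x * \<bar>\<xi>\<bar> powr \<theta>)"
    by (intro AE_I2 continuous_intros continuous_on_powr') auto
qed (use assms C cf_measurable in \<open>auto simp: EA.Lp_def\<close>)

lemma \<Psi>_scale: "0 \<le> c ==> \<Psi> (%x. c * u x) = c powr \<theta> * \<Psi> u"
proof -
  assume "0 \<le> c"
  then have "cf x * \<bar>c * u x\<bar> powr \<theta> = c powr \<theta> * (cf x * \<bar>u x\<bar> powr \<theta>)" for x by (simp add: abs_mult powr_mult)
  then show ?thesis unfolding \<Psi>_def by (simp only: integral_mult_right_zero)
qed

lemma \<Psi>_pos: assumes u: "EA.Lp u" and nz: "\<not> (AE x in L. u x = 0)" shows "0 < \<Psi> u"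
proof (rule ccontr)
  assume "\<not> 0 < \<Psi> u"
  have nn: "AE x in L. 0 \<le> cf x * \<bar>u x\<bar> powr \<theta>"
    using good_AE by eventually_elim (intro mult_nonneg_nonneg less_imp_le[OF F_ge_superlinear(1)], auto)
  then have "0 \<le> \<Psi> u" unfolding \<Psi>_def by (rule integral_nonneg_AE)
  then have "\<Psi> u = 0" using \<open>\<not> 0 < \<Psi> u\<close> by simp
  then have z: "AE x in L. cf x * \<bar>u x\<bar> powr \<theta> = 0"
    using integral_nonneg_eq_0_iff_AE[OF \<Psi>_integrable[OF u] nn] by (simp add: \<Psi>_def)
  have "AE x in L. u x = 0" using z good_AE
  proof eventually_elim
    case (elim x)
    then have "cf x > 0" using F_ge_superlinear(1) by blast
    then show ?case using elim by simp
  qed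
  then show False using nz by simp
qed

lemma \<Phi>_ge_\<Psi>: assumes u: "EA.Lp u" shows "\<Psi> u - 2 * K0 * measure L \<Omega> \<le> \<Phi> u"
proof -
  have "(\<integral>x. cf x * \<bar>u x\<bar> powr \<theta> - 2 * K0 \<partial>L) \<le> \<Phi> u"
    unfolding \<Phi>_def
  proof (rule integral_mono_AE)
    show "AE x in L. cf x * \<bar>u x\<bar> powr \<theta> - 2 * K0 \<le> Fprim f x (u x)"
      using good_AE by eventually_elim (simp add: F_ge_superlinear)
  qed (use \<Phi>_integrable[OF u] \<Psi>_integrable[OF u] in auto)
  then show ?thesis using \<Psi>_integrable[OF u] by (simp add: \<Psi>_def mult_ac)
qed

lemma \<Phi>_le: assumes u: "EA.Lp u" and le: "rho L \<alpha> u \<le> 1" shows "\<Phi> u \<le> 2 * C * (measure L \<Omega> + 1)"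
proof -
  have "\<Phi> u \<le> (\<integral>x. 2 * C + 2 * C * \<bar>u x\<bar> powr \<alpha> x \<partial>L)"
    unfolding \<Phi>_def
  proof (rule integral_mono_AE)
    show "AE x in L. Fprim f x (u x) \<le> 2 * C + 2 * C * \<bar>u x\<bar> powr \<alpha> x"
      using good_AE by eventually_elim (use F_abs_le in \<open>auto dest: abs_le_D1\<close>)
  qed (use \<Phi>_integrable[OF u] integrable_alpha[OF u] in auto)
  also have "\<dots> = 2 * C * measure L \<Omega> + 2 * C * (\<integral>x. \<bar>u x\<bar> powr \<alpha> x \<partial>L)"
    using integrable_alpha[OF u] by simp
  also have "(\<integral>x. \<bar>u x\<bar> powr \<alpha> x \<partial>L) \<le> 1"
  proof -
    have "rho L \<alpha> u = ennreal (\<integral>x. \<bar>u x\<bar> powr \<alpha> x \<partial>L)" using EA.rho_eq_integral[OF EA.Lp_integrable[OF u]] by simp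
    then show ?thesis using le by simp
  qed
  finally show ?thesis using C by (simp add: distrib_left mult_left_mono)
qed

text \<open>Along a ray J grows at most like N^P while the potential grows at least like N^\<theta>
  with \<theta> > P. Hence the energy is bounded below only on a bounded set of coordinates.\<close>

lemma frame_coercive:
  assumes F: "frame e d n" and n: "1 \<le> n"
  shows "\<exists>R. \<forall>y\<in>V n. a \<le> EG e d n y --> (\<forall>i. \<bar>y i\<bar> \<le> R)"
proof -
  note X = frame_X[OF F]
  have ne: "Sph n \<noteq> {}"
  proof -
    have "(%i. if i = 0 then 1 else 0) \<in> Sph n"
      using n by (auto simp: Sph_def sum.delta if_distrib[of "%x. x\<^sup>2"] cong: if_cong)
    then show ?thesis by auto
  qed
  have cJ: "continuous_on (Sph n) (%y. J (G d n y))" by (rule frame_continuous(1)[OF F])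
  have c\<Psi>: "continuous_on (Sph n) (%y. \<Psi> (T e n y))"
    by (rule continuous_on_coords, rule \<Psi>_tendsto[OF X_alpha[OF X] X_alpha[OF X]]; rule frame_rho_tendsto(3)[OF F])
  obtain xJ where xJ: "!!x. x \<in> Sph n ==> J (G d n x) \<le> J (G d n xJ)"
    using continuous_attains_sup[OF compact_Sph ne cJ] by blast
  obtain x\<Psi> where x\<Psi>: "x\<Psi> \<in> Sph n" "!!x. x \<in> Sph n ==> \<Psi> (T e n x\<Psi>) \<le> \<Psi> (T e n x)"
    using continuous_attains_inf[OF compact_Sph ne c\<Psi>] by blast
  define B where "B = J (G d n xJ)"
  define \<delta> where "\<delta> = \<Psi> (T e n x\<Psi>)"
  define D where "D = \<bar>2 * K0 * measure L \<Omega> - a\<bar>"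
  have "\<not> (AE x in L. T e n x\<Psi> x = 0)"
    using F Sph_V[where n = n and x = x\<Psi>, OF x\<Psi>(1)] Sph_nonzero[where n = n and x = x\<Psi>, OF x\<Psi>(1)] unfolding frame_def by blast
  then have \<delta>: "\<delta> > 0" unfolding \<delta>_def by (rule \<Psi>_pos[OF X_alpha[OF X]])
  have B0: "0 \<le> B" by (simp add: B_def J_nonneg)
  \<comment> \<open>For N > 1 the comparison of growth reads N^(\<theta> - P) \<le> (B +
    D)/\<delta>, where B bounds J on the sphere, \<delta> is the minimum of \<Psi> there and D
    collects the constants.\<close>
  define R where "R = max 1 (((B + D) / \<delta>) powr (1 / (\<theta> - P)))"
  show ?thesis
  proof (intro exI[of _ R] ballI impI allI)
    fix y i assume y: "y \<in> V n" and a: "a \<le> EG e d n y"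
    define N where "N = sqrt (\<Sum>i<n. (y i)\<^sup>2)"
    have yN: "\<bar>y i\<bar> \<le> N"
    proof (cases "i < n")
      case True
      then have "(y i)\<^sup>2 \<le> (\<Sum>i<n. (y i)\<^sup>2)" by (intro member_le_sum) auto
      then show ?thesis unfolding N_def using real_sqrt_le_mono by fastforce
    next
      case False
      then show ?thesis using y by (simp add: V_def N_def sum_nonneg)
    qed
    have "N \<le> R"
    proof (cases "N \<le> 1")
      case True
      then show ?thesis by (simp add: R_def)
    next
      case False
      then have N1: "N > 1" by simp
      define x where "x = (%i. y i / N)"
      have yx: "y = (%i. N * x i)" using N1 by (simp add: x_def)
      have "(\<Sum>i<n. (y i)\<^sup>2) = N\<^sup>2" by (simp add: N_def sum_nonneg)
      then have "x \<in> Sph n" using y N1 by (simp add: Sph_def x_def V_def power_divide flip: sum_divide_distrib)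
      then have x: "J (G d n x) \<le> B" "\<delta> \<le> \<Psi> (T e n x)" using xJ x\<Psi>(2) by (auto simp: B_def \<delta>_def)
      have "J (G d n y) \<le> N powr P * J (G d n x)" unfolding yx G_scale using N1 by (intro J_scale(1)[OF X]) auto
      also have "\<dots> \<le> N powr P * B" using x by (intro mult_left_mono) auto
      finally have 1: "J (G d n y) \<le> N powr P * B" .
      have "N powr \<theta> * \<delta> \<le> N powr \<theta> * \<Psi> (T e n x)" using x by (intro mult_left_mono) auto
      also have "\<dots> = \<Psi> (T e n y)" unfolding yx T_scale using N1 by (simp add: \<Psi>_scale)
      also have "\<dots> \<le> \<Phi> (T e n y) + 2 * K0 * measure L \<Omega>" using \<Phi>_ge_\<Psi>[OF X_alpha[OF X], of y] by linarith
      finally have 2: "N powr \<theta> * \<delta> \<le> N powr P * B + (2 * K0 * measure L \<Omega> - a)" using 1 a unfolding EG_def by linarith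
      have "1 powr P \<le> N powr P" using N1 P_ge1 by (intro powr_mono2) auto
      then have "1 * D \<le> N powr P * D" by (intro mult_right_mono) (auto simp: D_def)
      then have "N powr \<theta> * \<delta> \<le> N powr P * (B + D)" using 2 by (simp add: D_def distrib_left)
      then have "N powr (\<theta> - P) \<le> (B + D) / \<delta>" using N1 \<delta> by (simp add: powr_diff field_simps)
      then have "(N powr (\<theta> - P)) powr (1 / (\<theta> - P)) \<le> ((B + D) / \<delta>) powr (1 / (\<theta> - P))"
        using \<theta> by (intro powr_mono2) auto
      then show ?thesis using N1 \<theta> by (simp add: powr_powr R_def)
    qed
    then show "\<bar>y i\<bar> \<le> R" using yN by linarith
  qed
qed

lemma closed_V: "closed (V n)" unfolding V_def by (rule closed_tail_zero)

lemma frame_bounded_above: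
  assumes F: "frame e d n" and n: "1 \<le> n"
  shows "\<exists>b\<ge>a. \<forall>y\<in>V n. EG e d n y \<le> b"
proof -
  obtain R where R: "!!y i. y \<in> V n ==> a \<le> EG e d n y ==> \<bar>y i\<bar> \<le> R" using frame_coercive[OF F n, of a] by blast
  let ?S = "{y::nat => real. \<forall>i. \<bar>y i\<bar> \<le> max 0 R} \<inter> V n"
  have "compact ?S" by (rule compact_Int_closed[OF compact_box_fun closed_V])
  moreover have "(%_. 0) \<in> ?S" by (simp add: V_def)
  ultimately obtain z where z: "!!y. y \<in> ?S ==> EG e d n y \<le> EG e d n z"
    using continuous_attains_sup[of ?S "EG e d n"] frame_continuous(2)[OF F] by blast
  show ?thesis
  proof (intro exI[of _ "max a (EG e d n z)"] conjI ballI)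
    fix y assume y: "y \<in> V n"
    show "EG e d n y \<le> max a (EG e d n z)"
    proof (cases "a \<le> EG e d n y")
      case True
      then have "y \<in> ?S" using R[OF y True] y by (auto intro: order_trans[OF _ max.cobounded2])
      then show ?thesis using z by (simp add: le_max_iff_disj)
    qed simp
  qed simp
qed

text \<open>The level set J = r plays the sphere, and the integrals over cells of generation j are
  the k - 1 odd constraints. Where they all vanish, u is its own deviation from the averages, so the
  embedding makes its modular at most 1; this bounds \<Phi> and keeps the energy above a.\<close>

lemma frame_critical:
  assumes F: "frame e d n" and k: "k = card (reps j) + 1" "k \<le> n" and r: "0 < r" and j: "j1 \<le> j" and small: "K (P * r) * s ^ j \<le> 1"
    and a: "a = r - 2 * C * (measure L \<Omega> + 1)" and b: "a \<le> b" "!!y. y \<in> V k ==> EG e d n y \<le> b"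
  shows "\<exists>y\<in>V n. a \<le> EG e d n y \<and> EG e d n y \<le> b \<and> (\<forall>i<n. DEG e d n y i = 0)"
proof -
  note X = frame_X[OF F]
  obtain R where R: "!!y i. y \<in> V n ==> a \<le> EG e d n y ==> \<bar>y i\<bar> \<le> R" using frame_coercive[OF F, of a] k by fastforce
  obtain t where t: "!!x. x \<in> Sph n ==> 0 < t x" "!!x. x \<in> Sph n ==> J (G d n (%i. t x * x i)) = r"
    "continuous_on (Sph n) t" "!!x. x \<in> Sph n ==> t (%i. - x i) = t x" by (rule level_set[OF F r]) blast
  obtain z where z: "bij_betw z {0..<card (reps j)} (reps j)" using ex_bij_betw_nat_finite[OF reps(1)] by blast
  define lam where "lam i y = (\<Sum>l<n. y l * (\<integral>x. indicat_real (cell j (z i)) x * e l x \<partial>L))" for i and y :: "nat => real"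
  have ei: "integrable L (e l)" if "l < n" for l
    using X_poincare[of "e l" "d l"] F that by (auto simp: frame_def poincare_def)
  have lamT: "(\<integral>x. indicat_real (cell j (z i)) x * T e n y x \<partial>L) = lam i y" for i y
  proof -
    have "(\<integral>x. indicat_real (cell j (z i)) x * T e n y x \<partial>L) = (\<integral>x. (\<Sum>l<n. y l * (indicat_real (cell j (z i)) x * e l x)) \<partial>L)"
      by (simp add: T_def sum_distrib_left mult_ac)
    also have "\<dots> = (\<Sum>l<n. \<integral>x. y l * (indicat_real (cell j (z i)) x * e l x) \<partial>L)"
      by (rule Bochner_Integration.integral_sum) (intro integrable_mult_right integrable_indicator_times cell_borel ei, simp)
    finally show ?thesis by (simp add: lam_def)
  qed
  show ?thesis
  proof (rule finite_dim_critical_point[where k = k and R = R and \<sigma> = "%x i. t x * x i" and lam = lam, folded V_def])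
    show "1 \<le> k" "k \<le> n" "a \<le> b" using k b by auto
    show "EG e d n (%i. - y i) = EG e d n y" for y by (rule EG_uminus[OF F])
    show "continuous_on (V n) (EG e d n)" by (rule frame_continuous(2)[OF F])
    show "i < n ==> continuous_on (V n) (%y. DEG e d n y i)" for i by (rule frame_continuous(3)[OF F])
    show "((%s. EG e d n (%i. y i + s * v i)) has_real_derivative (\<Sum>i<n. v i * DEG e d n (%i. y i + s * v i) i)) (at s)" for y v s
      by (rule frame_line_derivative[OF F])
    show "y \<in> V n ==> a \<le> EG e d n y ==> \<bar>y i\<bar> \<le> R" for y i by (rule R)
    show "y \<in> V k ==> EG e d n y \<le> b" for y by (rule b(2))
    show "continuous_on (Sph n) (%x i. t x * x i)"
      by (intro continuous_on_coordinatewise_then_product continuous_on_mult t continuous_on_coord)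
    show "x \<in> Sph n ==> (%i. t x * x i) \<in> V n" for x by (simp add: Sph_def V_def)
    show "x \<in> Sph n ==> (%i. t (%i. - x i) * - x i) = (%i. - (t x * x i))" for x by (simp add: t)
    show "continuous_on (Sph n) (lam i)" for i unfolding lam_def
      by (intro continuous_on_sum continuous_on_mult continuous_on_coord continuous_on_const)
    show "lam i (%i. - x i) = - lam i x" for i x by (simp add: lam_def sum_negf)
    fix x assume x: "x \<in> Sph n" and l0: "\<forall>i<k - 1. lam i x = 0"
    let ?y = "%i. t x * x i"
    \<comment> \<open>Every point of the domain lies in a cell with a representative, so finitely
      many vanishing integrals make all averages of generation j vanish.\<close>
    have av: "avg (cell j w) (T e n ?y) = 0" if w: "w \<in> \<Omega>" for w
    proof -
      obtain q where q: "q \<in> reps j" "w \<in> cell j q" using reps(3)[OF w] by blast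
      then have "q \<in> z ` {0..<card (reps j)}" using z by (simp add: bij_betw_def)
      then obtain i where i: "i < card (reps j)" "q = z i" by auto
      have "lam i ?y = t x * lam i x" by (simp add: lam_def sum_distrib_left mult.assoc)
      then show ?thesis using l0 i k cell_eq[OF q(2)] lamT[of i ?y] by (simp add: avg_def)
    qed
    have "rho L \<alpha> (T e n ?y) = rho L \<alpha> (%w. T e n ?y w - avg (cell j w) (T e n ?y))"
      by (rule SA.rho_cong_AE) (auto intro!: AE_I2 simp: av)
    also have "\<dots> \<le> ennreal (K (P * r) * s ^ j)" by (rule X_embedding[OF X _ j]) (simp add: t(2)[OF x])
    also have "\<dots> \<le> 1" using small by simp
    finally show "a \<le> EG e d n ?y" using \<Phi>_le[OF X_alpha[OF X]] t(2)[OF x] unfolding EG_def a by force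
  qed
qed

text \<open>A direction is appended only if it is not already a combination of the frame almost
  everywhere; this preserves independence and leaves the earlier entries alone.\<close>

lemma frame_extend:
  assumes F: "frame e d n" and v: "X v h"
  shows "\<exists>e' d' n'. n \<le> n' \<and> frame e' d' n' \<and> (\<forall>i<n. e' i = e i \<and> d' i = d i) \<and> (\<exists>y\<in>V n'. AE x in L. T e' n' y x = v x)"
proof (cases "\<exists>y\<in>V n. AE x in L. T e n y x = v x")
  case True
  then show ?thesis using F by blast
next
  case False
  let ?e = "e(n := v)" and ?d = "d(n := h)"
  have T: "T ?e (Suc n) y = (%x. T e n y x + y n * v x)" for y by (simp add: T_def)
  have "frame ?e ?d (Suc n)"
    unfolding frame_def
  proof (intro conjI ballI allI impI)
    show "X (?e i) (?d i)" if "i < Suc n" for i using F v that by (auto simp: frame_def)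
    fix y i assume y: "y \<in> V (Suc n)" and z: "AE x in L. T ?e (Suc n) y x = 0"
    show "y i = 0"
    proof (cases "y n = 0")
      case True
      have "y i = 0" if "n \<le> i" for i using y True that by (cases "i = n") (simp_all add: V_def)
      then have "y \<in> V n" by (simp add: V_def)
      moreover have "AE x in L. T e n y x = 0" using z by (simp add: T True)
      ultimately show ?thesis using F unfolding frame_def by blast
    next
      case n0: False
      let ?w = "%i. if i < n then (- 1 / y n) * y i else 0"
      have "T e n ?w = T e n (%i. (- 1 / y n) * y i)" by (simp add: T_def)
      then have Tw: "T e n ?w x = (- 1 / y n) * T e n y x" for x by (simp only: T_scale)
      have "AE x in L. T e n ?w x = v x" using z
      proof eventually_elim
        case (elim x)
        then have "T e n y x = - (y n * v x)" by (simp add: T)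
        then show ?case using n0 by (simp only: Tw) simp
      qed
      moreover have "?w \<in> V n" by (simp add: V_def)
      ultimately show ?thesis using \<open>\<not> (\<exists>y\<in>V n. AE x in L. T e n y x = v x)\<close> by blast
    qed
  qed
  moreover have "(%i. if i = n then 1 else 0) \<in> V (Suc n)" by (simp add: V_def)
  moreover have "T ?e (Suc n) (%i. if i = n then 1 else 0) x = v x" for x by (simp add: T) (simp add: T_def)
  ultimately show ?thesis by (intro exI[of _ ?e] exI[of _ ?d] exI[of _ "Suc n"]) (auto intro!: bexI[of _ "%i. if i = n then 1 else 0"])
qed

lemma T_agree: "n \<le> n' ==> y \<in> V n ==> (!!i. i < n ==> e' i = e i) ==> T e' n' y = T e n y"
  by (auto simp: T_def V_def fun_eq_iff intro!: sum.mono_neutral_cong_right) (meson not_le)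

lemma G_agree: "n \<le> n' ==> y \<in> V n ==> (!!i. i < n ==> d' i = d i) ==> G d' n' y = G d n y"
  by (auto simp: G_def V_def fun_eq_iff intro!: sum.mono_neutral_cong_right) (meson not_le)

lemma V_mono: "n \<le> n' ==> y \<in> V n ==> y \<in> V n'" by (simp add: V_def)

lemma frame_extend_finite:
  assumes F: "frame e d n" and Z: "finite Z" "!!v. v \<in> Z ==> \<exists>h. X v h"
  shows "\<exists>e' d' n'. n \<le> n' \<and> frame e' d' n' \<and> (\<forall>i<n. e' i = e i \<and> d' i = d i) \<and> (\<forall>v\<in>Z. \<exists>y\<in>V n'. AE x in L. T e' n' y x = v x)"
  using Z
proof (induction Z rule: finite_induct)
  case empty
  then show ?case using F by blast
next
  case (insert v Z)
  then obtain e1 d1 n1 where 1: "n \<le> n1" "frame e1 d1 n1" "!!i. i < n ==> e1 i = e i \<and> d1 i = d i" "!!v. v \<in> Z ==> \<exists>y\<in>V n1. AE x in L. T e1 n1 y x = v x"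
    by blast
  obtain h where "X v h" using insert.prems by blast
  from frame_extend[OF 1(2) this] obtain e2 d2 n2 where 2: "n1 \<le> n2" "frame e2 d2 n2" "!!i. i < n1 ==> e2 i = e1 i \<and> d2 i = d1 i" "\<exists>y\<in>V n2. AE x in L. T e2 n2 y x = v x"
    by blast
  have "\<exists>y\<in>V n2. AE x in L. T e2 n2 y x = w x" if w: "w \<in> Z" for w
  proof -
    obtain y where y: "y \<in> V n1" "AE x in L. T e1 n1 y x = w x" using 1(4)[OF w] by blast
    have "T e2 n2 y = T e1 n1 y" by (rule T_agree[OF 2(1) y(1)]) (use 2(3) in blast)
    then show ?thesis using y V_mono[OF 2(1) y(1)] by (intro bexI[of _ y]) simp_all
  qed
  then show ?case using 1 2 by (intro exI[of _ e2] exI[of _ d2] exI[of _ n2]) auto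
qed

text \<open>Bumps on k disjoint boxes strung along the diagonal of a box inside the domain. At a
  point of one box only one bump is nonzero, which gives independence modulo null sets.\<close>

lemma base_frame: "\<exists>e d. frame e d k"
proof -
  obtain x a b where ab: "x \<in> box a b" "cbox a b \<subseteq> \<Omega>"
    using ne open_dom open_contains_cbox by (metis all_not_in_conv)
  have le: "a \<bullet> i < b \<bullet> i" if "i \<in> Basis" for i using ab(1) that by (auto simp: box_def intro: less_trans)
  define c where "c l = a + (real l / real k) *\<^sub>R (b - a)" for l
  have ci: "c l \<bullet> i = a \<bullet> i + (real l / real k) * (b \<bullet> i - a \<bullet> i)" for l i by (simp add: c_def inner_add_left inner_diff_left)
  have c_mono: "c l \<bullet> i \<le> c l' \<bullet> i" if "l \<le> l'" "i \<in> Basis" for l l' i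
    unfolding ci using le[OF that(2)] that(1) by (intro add_left_mono mult_right_mono divide_right_mono) auto
  have c_less: "c l \<bullet> i < c (Suc l) \<bullet> i" if "l < k" "i \<in> Basis" for l i
    unfolding ci using le[OF that(2)] that(1) by (intro add_strict_left_mono mult_strict_right_mono divide_strict_right_mono) auto
  have c0: "c 0 = a" by (simp add: c_def)
  have ck: "c k = b" if "0 < k" using that by (simp add: c_def)
  define e where "e l = bump 1 (c l) (c (Suc l))" for l
  have et: "e l \<in> test_fns \<Omega>" if l: "l < k" for l
    unfolding e_def
  proof (rule bump_test_fns)
    have "cbox (c l) (c (Suc l)) \<subseteq> cbox a b"
    proof
      fix y assume y: "y \<in> cbox (c l) (c (Suc l))"
      have "a \<bullet> i \<le> y \<bullet> i \<and> y \<bullet> i \<le> b \<bullet> i" if i: "i \<in> Basis" for i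
        using y i c_mono[of 0 l i] c_mono[of "Suc l" k i] l by (force simp: mem_box c0 ck)
      then show "y \<in> cbox a b" by (simp add: mem_box)
    qed
    then show "cbox (c l) (c (Suc l)) \<subseteq> \<Omega>" using ab by blast
  qed simp
  have disj: "e l' y = 0" if l: "l < k" "l' < k" "l \<noteq> l'" and y: "y \<in> box (c l) (c (Suc l))" for l l' y
  proof -
    obtain i :: 'a where i: "i \<in> Basis" using nonempty_Basis by blast
    have "y \<notin> box (c l') (c (Suc l'))"
      using y i l c_mono[of "Suc l" l' i] c_mono[of "Suc l'" l i] by (cases "l < l'") (force simp: mem_box)+
    then show ?thesis using bump_pos_iff[of 1 "c l'" "c (Suc l')" y] by (auto simp: e_def)
  qed
  have "frame e (%l. grad (e l)) k"
    unfolding frame_def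
  proof (intro conjI allI impI ballI)
    show "X (e l) (grad (e l))" if "l < k" for l by (rule X_test[OF et[OF that]])
    fix y l assume y: "y \<in> V k" and z: "AE x in L. T e k y x = 0"
    show "y l = 0"
    proof (cases "l < k")
      case True
      have sub: "box (c l) (c (Suc l)) \<subseteq> \<Omega>"
      proof
        fix x assume "x \<in> box (c l) (c (Suc l))"
        then have "e l x \<noteq> 0" using bump_pos_iff[of 1 "c l" "c (Suc l)" x] by (simp add: e_def)
        then show "x \<in> \<Omega>" using test_fns_zero_outside[OF et[OF True]] by blast
      qed
      have "box (c l) (c (Suc l)) \<noteq> {}" using c_less[OF True] by (simp add: box_ne_empty)
      have "AE x in lebesgue. x \<in> \<Omega> --> T e k y x = 0" using z dom_sets by (simp add: AE_restrict_space_iff)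
      then have N: "negligible {x \<in> \<Omega>. T e k y x \<noteq> 0}"
        by (simp add: completion.AE_iff_null_sets negligible_iff_null_sets)
      have "\<not> negligible (box (c l) (c (Suc l)))"
        using open_not_negligible[OF open_box \<open>box (c l) (c (Suc l)) \<noteq> {}\<close>] .
      then obtain x where x: "x \<in> box (c l) (c (Suc l))" "T e k y x = 0"
        using N negligible_subset[OF N, of "box (c l) (c (Suc l))"] sub by blast
      have "T e k y x = y l * e l x" unfolding T_def
      proof (subst sum.remove[of _ l])
        show "y l * e l x + (\<Sum>i\<in>{..<k} - {l}. y i * e i x) = y l * e l x"
          using disj[OF True _ _ x(1)] by (simp add: sum.neutral)
      qed (use True in auto)
      moreover have "e l x \<noteq> 0" using bump_pos_iff[of 1 "c l" "c (Suc l)" x] x(1) by (simp add: e_def)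
      ultimately show ?thesis using x(2) by simp
    qed (use y in \<open>simp add: V_def\<close>)
  qed
  then show ?thesis by blast
qed

text \<open>The order of the quantifiers is the point: b is found before Z. Level, mesh and base
  frame are fixed first, and enlarging the frame to cover Z does not change the energies on the
  first k coordinates. Directions in Z lie in the span only almost everywhere, which the derivatives
  do not notice.\<close>

lemma finite_critical:
  obtains b where "a \<le> b" "!!Z. finite Z ==> (!!v. v \<in> Z ==> \<exists>h. X v h) ==>
    \<exists>u g. X u g \<and> a \<le> J g - \<Phi> u \<and> J g - \<Phi> u \<le> b \<and> dJ g g = d\<Phi> u u \<and> (\<forall>v\<in>Z. \<forall>h. X v h --> dJ g h = d\<Phi> u v)"
proof -
  \<comment> \<open>With this level the lower bound r - 2 C (measure L \<Omega> + 1) is at least the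
    requested a; the maximum with 1 keeps r positive.\<close>
  define r where "r = max 1 (a + 2 * C * (measure L \<Omega> + 1))"
  define a' where "a' = r - 2 * C * (measure L \<Omega> + 1)"
  have r: "0 < r" "a \<le> a'" by (auto simp: r_def a'_def)
  have "(%j. K (P * r) * s ^ j) \<longlonglongrightarrow> K (P * r) * 0" using s by (intro tendsto_intros LIMSEQ_realpow_zero) auto
  then have "\<forall>\<^sub>F j in sequentially. K (P * r) * s ^ j < 1" by (rule order_tendstoD) simp
  then obtain j0 where j0: "!!j. j0 \<le> j ==> K (P * r) * s ^ j < 1" by (auto simp: eventually_sequentially)
  define j where "j = max j0 j1"
  have j: "j1 \<le> j" "K (P * r) * s ^ j \<le> 1" using j0[of j] by (auto simp: j_def)
  define k where "k = card (reps j) + 1"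
  obtain e d where F: "frame e d k" using base_frame by blast
  obtain b where b: "a' \<le> b" "!!y. y \<in> V k ==> EG e d k y \<le> b" using frame_bounded_above[OF F, of a'] by (auto simp: k_def)
  show ?thesis
  proof (rule that[of b])
    show "a \<le> b" using r b by simp
    fix Z assume Z: "finite Z" "!!v. v \<in> Z ==> \<exists>h. X v h"
    obtain e' d' n' where F': "k \<le> n'" "frame e' d' n'" "!!i. i < k ==> e' i = e i \<and> d' i = d i" "!!v. v \<in> Z ==> \<exists>y\<in>V n'. AE x in L. T e' n' y x = v x"
      using frame_extend_finite[OF F Z] by blast
    have "EG e' d' n' y \<le> b" if y: "y \<in> V k" for y
      using b(2)[OF y] T_agree[OF F'(1) y, of e' e] G_agree[OF F'(1) y, of d' d] F'(3) by (simp add: EG_def)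
    from frame_critical[OF F'(2) k_def F'(1) r(1) j a'_def b(1) this]
    obtain y where y: "a' \<le> EG e' d' n' y" "EG e' d' n' y \<le> b" "!!i. i < n' ==> DEG e' d' n' y i = 0" by blast
    note X = frame_X[OF F'(2)]
    have D: "dJ (G d' n' y) (G d' n' v) = d\<Phi> (T e' n' y) (T e' n' v)" for v
      using frame_derivative[OF F'(2), of y v] y(3) by simp
    show "\<exists>u g. X u g \<and> a \<le> J g - \<Phi> u \<and> J g - \<Phi> u \<le> b \<and> dJ g g = d\<Phi> u u \<and> (\<forall>v\<in>Z. \<forall>h. X v h --> dJ g h = d\<Phi> u v)"
    proof (intro exI[of _ "T e' n' y"] exI[of _ "G d' n' y"] conjI ballI allI impI)
      show "X (T e' n' y) (G d' n' y)" by (rule X)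
      show "a \<le> J (G d' n' y) - \<Phi> (T e' n' y)" "J (G d' n' y) - \<Phi> (T e' n' y) \<le> b" using y r by (auto simp: EG_def)
      show "dJ (G d' n' y) (G d' n' y) = d\<Phi> (T e' n' y) (T e' n' y)" by (rule D)
      fix v h assume v: "v \<in> Z" and h: "X v h"
      obtain w where w: "AE x in L. T e' n' w x = v x" using F'(4)[OF v] by blast
      have Xv: "X v (G d' n' w)" by (rule X_cong[OF X w])
      have "AE x in L. h x = G d' n' w x" using X_wgrad[OF Xv] X_wgrad[OF h] by eventually_elim simp
      then have "dJ (G d' n' y) h = dJ (G d' n' y) (G d' n' w)" by (intro dJ_cong[OF X X h Xv]) auto
      also have "\<dots> = d\<Phi> (T e' n' y) (T e' n' w)" by (rule D)
      also have "\<dots> = d\<Phi> (T e' n' y) v"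
        unfolding d\<Phi>_def
      proof (rule integral_cong_AE)
        show "AE x in L. f x (T e' n' y x) * T e' n' w x = f x (T e' n' y x) * v x" using w by eventually_elim simp
      qed (use d\<Phi>_integrable[OF X_alpha[OF X] X_alpha[OF X]] d\<Phi>_integrable[OF X_alpha[OF X] X_alpha[OF Xv]] in auto)
      finally show "dJ (G d' n' y) h = d\<Phi> (T e' n' y) v" .
    qed
  qed
qed

end

section \<open>Passage to the limit\<close>

context plaplace
begin

lemma den_self: "den g g = (\<integral>x. norm (g x) powr p x \<partial>M)"
  unfolding den_def
proof (rule integral_cong)
  fix x
  show "norm (g x) powr (p x - 2) * (g x \<bullet> g x) = norm (g x) powr p x"
    by (cases "g x = 0") (simp_all add: powr_diff power2_norm_eq_inner[symmetric])
qed simp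

text \<open>The bound t^q \<le> 1 + t^p on a space of finite measure makes the smaller modular a
  continuous superposition functional for the larger one.\<close>

lemma rho_tendsto_smaller_exponent:
  fixes u :: "nat => 'x => 'b::euclidean_space"
  assumes q[measurable]: "q \<in> borel_measurable M" "!!x. x \<in> space M ==> 0 < q x" "!!x. x \<in> space M ==> q x \<le> p x"
    and u: "!!n. Lp (u n)" and lim: "(%n. \<rho> (u n)) \<longlonglongrightarrow> 0"
  shows "(%n. rho M q (u n)) \<longlonglongrightarrow> 0"
proof -
  note [measurable] = Lp_meas[OF u]
  have b: "AE x in M. \<forall>\<xi>::'b. \<bar>norm \<xi> powr q x\<bar> \<le> (%_. 1) x + 1 * norm \<xi> powr p x"
  proof (rule AE_I2, rule allI)
    fix x and \<xi> :: 'b assume x: "x \<in> space M"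
    show "\<bar>norm \<xi> powr q x\<bar> \<le> (%_. 1) x + 1 * norm \<xi> powr p x"
    proof (cases "norm \<xi> \<le> 1")
      case True
      then have "norm \<xi> powr q x \<le> 1" using q(2)[OF x] by (intro powr_le1) auto
      then show ?thesis by (simp add: add_increasing2)
    next
      case False
      then have "norm \<xi> powr q x \<le> norm \<xi> powr p x" using q(3)[OF x] by (intro powr_mono) auto
      then show ?thesis by simp
    qed
  qed
  have "(%n. \<integral>x. norm (u n x) powr q x \<partial>M) \<longlonglongrightarrow> (\<integral>x. norm ((%_. 0 :: 'b) x) powr q x \<partial>M)"
  proof (rule nemytskii_continuous[where h = "%x \<xi>. norm \<xi> powr q x" and v = u and w = "%_. 0", OF _ _ _ _ _ _ b])
    show "AE x in M. continuous_on UNIV (%\<xi>::'b. norm \<xi> powr q x)"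
      by (rule AE_I2) (intro continuous_on_powr' continuous_intros, use q in auto)
  qed (use lim in \<open>auto simp: rho_def\<close>)
  then have "(%n. ennreal (\<integral>x. norm (u n x) powr q x \<partial>M)) \<longlonglongrightarrow> ennreal 0" by (intro tendsto_ennrealI) simp
  moreover have "rho M q (u n) = ennreal (\<integral>x. norm (u n x) powr q x \<partial>M)" for n
  proof -
    have "integrable M (%x. norm (u n x) powr q x)"
      by (rule nemytskii_integrable[OF _ _ _ _ b]) (use u[of n] in \<open>auto simp: Lp_def\<close>)
    then show ?thesis unfolding rho_def by (subst nn_integral_eq_integral) auto
  qed
  ultimately show ?thesis by simp
qed

end

text \<open>Past an index that nearly attains the infimum of a tail, later terms can neither rise
  much above that value nor fall below the infimum.\<close>

lemma almost_decreasing_Cauchy: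
  fixes a :: "nat => real"
  assumes dec: "!!e. e > 0 ==> \<exists>N. \<forall>m\<ge>N. \<forall>n\<ge>m. a n \<le> a m + e" and nn: "!!n. 0 \<le> a n" and e: "e > 0"
  shows "\<exists>N. \<forall>m\<ge>N. \<forall>n\<ge>N. a m \<le> a n + e"
proof -
  obtain N where N: "!!m n. N \<le> m ==> m \<le> n ==> a n \<le> a m + e / 2" using dec[of "e / 2"] e by fastforce
  have bdd: "bdd_below (a ` {N..})" using nn by (auto intro!: bdd_belowI[of _ 0])
  have "Inf (a ` {N..}) < Inf (a ` {N..}) + e / 2" using e by simp
  then obtain M where M: "N \<le> M" "a M < Inf (a ` {N..}) + e / 2" using cInf_lessD[of "a ` {N..}" "Inf (a ` {N..}) + e / 2"] by auto
  have "a m \<le> a n + e" if "m \<ge> M" "n \<ge> M" for m n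
  proof -
    have "Inf (a ` {N..}) \<le> a n" using bdd that M by (intro cInf_lower) auto
    moreover have "a m \<le> a M + e / 2" by (rule N[OF M(1) that(1)])
    ultimately show ?thesis using M by linarith
  qed
  then show ?thesis by blast
qed

section \<open>A priori bounds and compactness from cell integrals\<close>

context problem
begin

text \<open>Gradients are completed in the modular of the larger exponent, so that a single limit
  serves both p1 and p2.\<close>

sublocale EM: plaplace L "%x. max (p1 x) (p2 x)" P p0
proof -
  have "(%x. max (p1 x) (p2 x)) \<in> borel_measurable L" using meas by measurable
  moreover have "p0 \<le> max (p1 x) (p2 x)" "1 \<le> max (p1 x) (p2 x)" "max (p1 x) (p2 x) \<le> P" if "x \<in> \<Omega>" for x
    using p1_bd[OF that] p2_bd[OF that] p0 by auto
  ultimately show "plaplace L (%x. max (p1 x) (p2 x)) P p0"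
    using finite_measure_dom P_ge1 p0
    by (auto simp: plaplace_def exponent_def exponent_axioms_def plaplace_axioms_def)
qed

lemma rho_max_le:
  fixes g :: "'a => 'a"
  assumes [measurable]: "g \<in> borel_measurable L"
  shows "rho L (%x. max (p1 x) (p2 x)) g \<le> rho L p1 g + rho L p2 g"
proof -
  note [measurable] = meas
  have "rho L (%x. max (p1 x) (p2 x)) g \<le> (\<integral>\<^sup>+ x. ennreal (norm (g x) powr p1 x) + ennreal (norm (g x) powr p2 x) \<partial>L)"
    unfolding rho_def by (intro nn_integral_mono) (simp add: max_def add_increasing add_increasing2 del: ennreal_plus)
  also have "\<dots> = rho L p1 g + rho L p2 g" unfolding rho_def by (rule nn_integral_add) measurable
  finally show ?thesis .
qed

text \<open>Testing the equation with u itself: \<theta> times the energy minus the derivative at u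
  leaves (\<theta> - P) J up to constants, so an upper bound for the energy bounds J.\<close>

lemma J_bound:
  assumes X: "X u g" and c: "dJ g g = d\<Phi> u u" and b: "J g - \<Phi> u \<le> b"
  shows "J g \<le> (\<theta> * b + (\<theta> + 1) * K0 * measure L \<Omega>) / (\<theta> - P)"
proof -
  have "dJ g g \<le> P * J g"
    using E1.integral_le_en[OF X_Lp(1)[OF X]] E2.integral_le_en[OF X_Lp(2)[OF X]]
    by (simp add: dJ_def J_def E1.den_self E2.den_self distrib_left)
  then have 1: "\<theta> * \<Phi> u \<le> P * J g + (\<theta> + 1) * K0 * measure L \<Omega>"
    using d\<Phi>_self_ge[OF X_alpha[OF X]] c by linarith
  have "\<theta> * (J g - \<Phi> u) \<le> \<theta> * b" using b \<theta> P_ge1 by (intro mult_left_mono) auto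
  then have "(\<theta> - P) * J g \<le> \<theta> * b + (\<theta> + 1) * K0 * measure L \<Omega>" using 1 by (simp add: algebra_simps)
  then show ?thesis using \<theta> by (simp add: field_simps)
qed

lemma X_integral_abs_le:
  obtains c where "!!u g. X u g ==> (\<integral>x. \<bar>u x\<bar> \<partial>L) \<le> c * (measure L \<Omega> + P * J g)"
proof (rule poincare_L1[OF ne])
  fix c assume c: "0 \<le> c" "!!u g. poincare u g ==> (\<integral>x. \<bar>u x\<bar> \<partial>L) \<le> c * (\<integral>x. norm (g x) \<partial>L)"
  show ?thesis
  proof (rule that[of c])
    fix u g assume X: "X u g"
    have gi: "integrable L (%x. norm (g x))" using X_poincare[OF X] by (simp add: poincare_def)
    have "(\<integral>x. norm (g x) \<partial>L) \<le> (\<integral>x. 1 + norm (g x) powr p1 x \<partial>L)"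
    proof (rule integral_mono[OF gi])
      show "integrable L (%x. 1 + norm (g x) powr p1 x)" using E1.Lp_integrable[OF X_Lp(1)[OF X]] by auto
      fix x assume "x \<in> space L"
      from le_split_powr[of "norm (g x)" 1 "p1 x"] E1.p_ge[OF this] show "norm (g x) \<le> 1 + norm (g x) powr p1 x" by simp
    qed
    also have "\<dots> = measure L \<Omega> + (\<integral>x. norm (g x) powr p1 x \<partial>L)" using E1.Lp_integrable[OF X_Lp(1)[OF X]] by simp
    also have "\<dots> \<le> measure L \<Omega> + P * J g"
    proof -
      have "P * E1.en g \<le> P * J g" using P_ge1 E2.en_nonneg[of g] by (intro mult_left_mono) (auto simp: J_def)
      then show ?thesis using E1.integral_le_en[OF X_Lp(1)[OF X]] by linarith
    qed
    finally have "c * (\<integral>x. norm (g x) \<partial>L) \<le> c * (measure L \<Omega> + P * J g)" using c(1) by (rule mult_left_mono)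
    then show "(\<integral>x. \<bar>u x\<bar> \<partial>L) \<le> c * (measure L \<Omega> + P * J g)" using c(2)[OF X_poincare[OF X]] by linarith
  qed
qed

text \<open>Averages without the normalising factor, indexed by generation and point, so that a
  function becomes one vector in a product of lines.\<close>

definition cint :: "('a => real) => nat \<times> 'a => real" where
  "cint u = (%(j, z). \<integral>x. indicat_real (cell j z) x * u x \<partial>L)"

lemma cint_abs_le: assumes "integrable L u" shows "\<bar>cint u jz\<bar> \<le> (\<integral>x. \<bar>u x\<bar> \<partial>L)"
proof (cases jz)
  case (Pair j z)
  have "\<bar>cint u jz\<bar> \<le> (\<integral>x. \<bar>indicat_real (cell j z) x * u x\<bar> \<partial>L)"
    unfolding Pair cint_def by (simp only: prod.case) (rule integral_abs_bound)
  also have "\<dots> \<le> (\<integral>x. \<bar>u x\<bar> \<partial>L)"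
  proof (rule integral_mono)
    show "integrable L (%x. \<bar>indicat_real (cell j z) x * u x\<bar>)" by (intro integrable_abs integrable_indicator_times cell_borel assms)
    show "\<bar>indicat_real (cell j z) x * u x\<bar> \<le> \<bar>u x\<bar>" for x by (simp add: indicator_def)
  qed (use assms in auto)
  finally show ?thesis .
qed

lemma X_integrable: "X u g ==> integrable L u" using X_poincare by (auto simp: poincare_def)

text \<open>Equal integrals over the represented cells mean equal averages at every point and scale,
  and the averages converge to the function almost everywhere.\<close>

lemma cint_determines:
  assumes X: "X u g" "X v h" and e: "!!j z. z \<in> reps j ==> cint u (j, z) = cint v (j, z)"
  shows "AE x in L. u x = v x"
proof -
  have av: "avg (cell j x) u = avg (cell j x) v" if x: "x \<in> \<Omega>" for j x
  proof -
    obtain q where q: "q \<in> reps j" "x \<in> cell j q" using reps(3)[OF x] by blast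
    then show ?thesis using e[OF q(1)] cell_eq[OF q(2)] by (simp add: avg_def cint_def)
  qed
  show ?thesis using avg_converges_AE[OF X_poincare[OF X(1)]] avg_converges_AE[OF X_poincare[OF X(2)]] AE_space
  proof eventually_elim
    case (elim x)
    then have "(%j. avg (cell j x) v) \<longlonglongrightarrow> u x" using av by simp
    then show ?case using elim LIMSEQ_unique by blast
  qed
qed

text \<open>The difference of two terms splits at their cell averages of generation j. The
  deviations from the averages are small uniformly in n by the embedding, and the averages are
  finitely many convergent numbers.\<close>

lemma alpha_Cauchy:
  assumes X: "!!n. X (u n) (g n)" and R: "!!n. J (g n) \<le> R" and c: "!!j z. z \<in> reps j ==> (%n. cint (u n) (j, z)) \<longlonglongrightarrow> c (j, z)" and e: "e > 0"
  shows "\<exists>N. \<forall>m\<ge>N. \<forall>n\<ge>N. rho L \<alpha> (%x. u n x - u m x) < ennreal e"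
proof -
  \<comment> \<open>The constant of the quasi-triangle inequality for the modular. Splitting into
    three pieces uses it twice, which explains the products c1 c1 below.\<close>
  define c1 where "c1 = (2::real) powr A"
  have c1: "c1 > 0" by (simp add: c1_def)
  define k where "k j = max 0 (K (P * R)) * s ^ j" for j
  have k0: "0 \<le> k j" for j using s by (simp add: k_def)
  have "(%j. c1 * k j + c1 * (c1 * k j)) \<longlonglongrightarrow> c1 * (max 0 (K (P * R)) * 0) + c1 * (c1 * (max 0 (K (P * R)) * 0))"
    unfolding k_def using s by (intro tendsto_intros LIMSEQ_realpow_zero) auto
  then have "\<forall>\<^sub>F j in sequentially. c1 * k j + c1 * (c1 * k j) < e / 2" by (rule order_tendstoD) (use e in simp)
  then obtain j0 where j0: "!!j. j0 \<le> j ==> c1 * k j + c1 * (c1 * k j) < e / 2" by (auto simp: eventually_sequentially)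
  define j where "j = max j0 j1"
  have j: "j1 \<le> j" "c1 * k j + c1 * (c1 * k j) < e / 2" using j0[of j] by (auto simp: j_def)
  \<comment> \<open>The tolerance for differences of averages: at most 1, so that its powers with
    exponent at least 1 stay below it, and small enough for the middle piece to use at most e/2. The
    summand 1 keeps the denominator positive.\<close>
  define \<delta> where "\<delta> = min 1 (e / (2 * (c1 * (c1 * (measure L \<Omega> + 1)))))"
  have mL: "measure L \<Omega> + 1 > 0" by (simp add: add_nonneg_pos)
  have \<delta>: "0 < \<delta>" "\<delta> \<le> 1" using e c1 mL by (auto simp: \<delta>_def)
  have "\<delta> * (c1 * (c1 * (measure L \<Omega> + 1))) \<le> e / (2 * (c1 * (c1 * (measure L \<Omega> + 1)))) * (c1 * (c1 * (measure L \<Omega> + 1)))"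
    using c1 mL by (intro mult_right_mono) (auto simp: \<delta>_def)
  also have "\<dots> = e / 2" using c1 mL by simp
  finally have \<delta>e: "c1 * (c1 * (\<delta> * (measure L \<Omega> + 1))) \<le> e / 2" by (simp add: mult_ac)
  define q where "q = (1/2 :: real) ^ (j * DIM('a))"
  have q: "q > 0" by (simp add: q_def)
  have "\<exists>N. \<forall>z\<in>reps j. \<forall>n\<ge>N. \<bar>cint (u n) (j, z) - c (j, z)\<bar> < \<delta> * q / 2"
  proof -
    have "\<forall>\<^sub>F n in sequentially. \<forall>z\<in>reps j. \<bar>cint (u n) (j, z) - c (j, z)\<bar> < \<delta> * q / 2"
    proof (rule eventually_ball_finite[OF reps(1)], rule ballI)
      fix z assume "z \<in> reps j"
      have "\<forall>\<^sub>F n in sequentially. dist (cint (u n) (j, z)) (c (j, z)) < \<delta> * q / 2"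
        by (rule tendstoD[OF c[OF \<open>z \<in> reps j\<close>]]) (use \<delta> q in simp)
      then show "\<forall>\<^sub>F n in sequentially. \<bar>cint (u n) (j, z) - c (j, z)\<bar> < \<delta> * q / 2" by (simp add: dist_real_def)
    qed
    then show ?thesis by (auto simp: eventually_sequentially)
  qed
  then obtain N where N: "!!z n. z \<in> reps j ==> N \<le> n ==> \<bar>cint (u n) (j, z) - c (j, z)\<bar> < \<delta> * q / 2" by blast
  show ?thesis
  proof (intro exI[of _ N] allI impI)
    fix m n assume mn: "N \<le> m" "N \<le> n"
    let ?A = "%n x. avg (cell j x) (u n)"
    have dA: "\<bar>?A n x - ?A m x\<bar> \<le> \<delta>" if x: "x \<in> \<Omega>" for x
    proof -
      obtain z where z: "z \<in> reps j" "x \<in> cell j z" using reps(3)[OF x] by blast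
      have "?A n x - ?A m x = (cint (u n) (j, z) - cint (u m) (j, z)) / q"
        using cell_eq[OF z(2)] by (simp add: avg_def cint_def cell_measure q_def diff_divide_distrib)
      moreover have "\<bar>cint (u n) (j, z) - cint (u m) (j, z)\<bar> \<le> \<delta> * q" using N[OF z(1) mn(1)] N[OF z(1) mn(2)] by linarith
      ultimately show ?thesis using q by (simp add: abs_divide pos_divide_le_eq)
    qed
    have mA: "(%x. ?A n x) \<in> borel_measurable L" for n by (rule cell_step_measurable)
    note mu = X_meas(1)[OF X]
    have rA: "rho L \<alpha> (%x. ?A n x - ?A m x) \<le> ennreal (\<delta> * measure L \<Omega>)"
    proof -
      have "rho L \<alpha> (%x. ?A n x - ?A m x) \<le> (\<integral>\<^sup>+ x. ennreal \<delta> \<partial>L)"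
        unfolding rho_def
      proof (rule nn_integral_mono)
        fix x assume "x \<in> space L"
        then have x: "x \<in> \<Omega>" by simp
        have "norm (?A n x - ?A m x) powr \<alpha> x \<le> \<delta> powr \<alpha> x" using dA[OF x] \<alpha>_ge[OF x] by (intro powr_mono2) auto
        also have "\<dots> \<le> \<delta> powr 1" using \<alpha>_ge[OF x] \<delta> by (intro powr_mono') auto
        finally show "ennreal (norm (?A n x - ?A m x) powr \<alpha> x) \<le> ennreal \<delta>" using \<delta> by (intro ennreal_leI) simp
      qed
      also have "\<dots> = ennreal (\<delta> * measure L \<Omega>)" using \<delta> by (simp add: E1.emeasure_eq_measure ennreal_mult)
      finally show ?thesis .
    qed
    have ru: "rho L \<alpha> (%x. u n x - ?A n x) \<le> ennreal (k j)" for n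
    proof -
      have "K (P * R) * s ^ j \<le> k j" unfolding k_def using s by (intro mult_right_mono) auto
      then show ?thesis using X_embedding[OF X R j(1), of n] by (meson ennreal_leI order_trans)
    qed
    have "rho L \<alpha> (%x. (?A n x - ?A m x) + (?A m x - u m x)) \<le> ennreal c1 * (rho L \<alpha> (%x. ?A n x - ?A m x) + rho L \<alpha> (%x. ?A m x - u m x))"
      unfolding c1_def by (rule EA.rho_add) (intro borel_measurable_diff mA mu)+
    also have "rho L \<alpha> (%x. ?A m x - u m x) = rho L \<alpha> (%x. u m x - ?A m x)" by (rule EA.rho_diff_commute)
    also have "ennreal c1 * (rho L \<alpha> (%x. ?A n x - ?A m x) + rho L \<alpha> (%x. u m x - ?A m x)) \<le> ennreal c1 * (ennreal (\<delta> * measure L \<Omega>) + ennreal (k j))"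
      by (intro mult_left_mono add_mono rA ru) simp
    also have "\<dots> = ennreal (c1 * (\<delta> * measure L \<Omega> + k j))" using c1 \<delta> k0 by (simp add: ennreal_mult ennreal_plus)
    finally have 1: "rho L \<alpha> (%x. ?A n x - u m x) \<le> ennreal (c1 * (\<delta> * measure L \<Omega> + k j))" by simp
    have "rho L \<alpha> (%x. (u n x - ?A n x) + (?A n x - u m x)) \<le> ennreal c1 * (rho L \<alpha> (%x. u n x - ?A n x) + rho L \<alpha> (%x. ?A n x - u m x))"
      unfolding c1_def by (rule EA.rho_add) (intro borel_measurable_diff mA mu)+
    also have "\<dots> \<le> ennreal c1 * (ennreal (k j) + ennreal (c1 * (\<delta> * measure L \<Omega> + k j)))"
      by (intro mult_left_mono add_mono 1 ru) simp
    also have "\<dots> = ennreal (c1 * (k j + c1 * (\<delta> * measure L \<Omega> + k j)))" using c1 \<delta> k0 by (simp add: ennreal_mult ennreal_plus)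
    also have "\<dots> < ennreal e"
    proof (rule ennreal_lessI[OF e])
      have "c1 * (c1 * (\<delta> * measure L \<Omega>)) \<le> c1 * (c1 * (\<delta> * (measure L \<Omega> + 1)))" using c1 \<delta> by (intro mult_left_mono) auto
      then show "c1 * (k j + c1 * (\<delta> * measure L \<Omega> + k j)) < e" using \<delta>e j(2) by (simp add: algebra_simps)
    qed
    finally show "rho L \<alpha> (%x. u n x - u m x) < ennreal e" by simp
  qed
qed

end

section \<open>Strong convergence of mutually tested solutions\<close>

lemma (in plaplace) den_diff:
  assumes "Lp g" "Lp h" "Lp k" shows "den g (%x. h x - k x) = den g h - den g k"
  unfolding den_def using den_integrable[OF assms(1,2)] den_integrable[OF assms(1,3)]
  by (simp add: inner_diff_right right_diff_distrib)

context problem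
begin

lemma d\<Phi>_diff: "EA.Lp u ==> EA.Lp v ==> EA.Lp w ==> d\<Phi> u (%x. v x - w x) = d\<Phi> u v - d\<Phi> u w"
  using d\<Phi>_integrable[of u v] d\<Phi>_integrable[of u w] by (simp add: d\<Phi>_def right_diff_distrib)

text \<open>The part depending on u carries a factor e that can be chosen small, so for bounded u
  the derivative tends to zero as soon as the modular of v does. This replaces a duality
  estimate.\<close>

lemma d\<Phi>_abs_le:
  assumes u: "EA.Lp u" and v: "EA.Lp v" and e: "0 < e" "e \<le> 1"
  shows "\<bar>d\<Phi> u v\<bar> \<le> C * (e * (measure L \<Omega> + (\<integral>x. \<bar>u x\<bar> powr \<alpha> x \<partial>L)) + 2 * e powr (1 - A) * (\<integral>x. \<bar>v x\<bar> powr \<alpha> x \<partial>L))"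
proof -
  let ?w = "%x. e + e * \<bar>u x\<bar> powr \<alpha> x + 2 * e powr (1 - A) * \<bar>v x\<bar> powr \<alpha> x"
  have "\<bar>d\<Phi> u v\<bar> \<le> (\<integral>x. \<bar>f x (u x) * v x\<bar> \<partial>L)" unfolding d\<Phi>_def by (rule integral_abs_bound)
  also have "\<dots> \<le> (\<integral>x. C * ?w x \<partial>L)"
  proof (rule integral_mono)
    show "integrable L (%x. \<bar>f x (u x) * v x\<bar>)" by (intro integrable_abs d\<Phi>_integrable u v)
    show "integrable L (%x. C * ?w x)"
      using integrable_alpha[OF u] integrable_alpha[OF v] by auto
    fix x assume "x \<in> space L"
    then have x: "x \<in> \<Omega>" by simp
    have "\<bar>v x\<bar> \<le> e + e powr (1 - \<alpha> x) * \<bar>v x\<bar> powr \<alpha> x" using \<alpha>_ge[OF x] e by (intro le_split_powr) auto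
    also have "e powr (1 - \<alpha> x) * \<bar>v x\<bar> powr \<alpha> x \<le> e powr (1 - A) * \<bar>v x\<bar> powr \<alpha> x"
      using \<alpha>_le[OF x] e by (intro mult_right_mono powr_mono') auto
    finally have 1: "\<bar>v x\<bar> \<le> e + e powr (1 - A) * \<bar>v x\<bar> powr \<alpha> x" by simp
    have 2: "\<bar>u x\<bar> powr (\<alpha> x - 1) * \<bar>v x\<bar> \<le> e * \<bar>u x\<bar> powr \<alpha> x + e powr (1 - A) * \<bar>v x\<bar> powr \<alpha> x"
      using \<alpha>_ge[OF x] \<alpha>_le[OF x] e by (intro young_split) auto
    have "\<bar>f x (u x) * v x\<bar> \<le> C * (1 + \<bar>u x\<bar> powr (\<alpha> x - 1)) * \<bar>v x\<bar>"
      using growth[OF x, of "u x"] by (simp add: abs_mult mult_right_mono)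
    also have "\<dots> = C * (\<bar>v x\<bar> + \<bar>u x\<bar> powr (\<alpha> x - 1) * \<bar>v x\<bar>)" by (simp add: algebra_simps)
    also have "\<dots> \<le> C * ?w x"
      using 1 2 by (intro mult_left_mono C) linarith
    finally show "\<bar>f x (u x) * v x\<bar> \<le> C * ?w x" .
  qed
  also have "\<dots> = C * (e * (measure L \<Omega> + (\<integral>x. \<bar>u x\<bar> powr \<alpha> x \<partial>L)) + 2 * e powr (1 - A) * (\<integral>x. \<bar>v x\<bar> powr \<alpha> x \<partial>L))"
    using integrable_alpha[OF u] integrable_alpha[OF v] by (simp add: distrib_left mult_ac)
  finally show ?thesis .
qed

lemma J_convex:
  assumes X: "X u g" "X v h" shows "J g + dJ g (%x. h x - g x) \<le> J h"
  using E1.en_convex[OF X_Lp(1)[OF X(1)] X_Lp(1)[OF X(2)]] E2.en_convex[OF X_Lp(2)[OF X(1)] X_Lp(2)[OF X(2)]]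
  by (simp add: J_def dJ_def)

lemma dJ_diff:
  assumes X: "X u g" "X v h" "X w k" shows "dJ g (%x. h x - k x) = dJ g h - dJ g k"
  using E1.den_diff[OF X_Lp(1)[OF X(1)] X_Lp(1)[OF X(2)] X_Lp(1)[OF X(3)]] E2.den_diff[OF X_Lp(2)[OF X(1)] X_Lp(2)[OF X(2)] X_Lp(2)[OF X(3)]]
  by (simp add: dJ_def)

lemma J_half_difference:
  assumes X: "X u g" "X v h" shows "J g + (dJ g h - dJ g g) / 2 \<le> J (%x. (1/2) *\<^sub>R (g x + h x))"
proof -
  have m: "X (%x. (1/2) * (u x + v x)) (%x. (1/2) *\<^sub>R (g x + h x))" by (rule X_scale[OF X_add[OF X]])
  have e: "(1/2) *\<^sub>R (g x + h x) - g x = (1/2) *\<^sub>R (h x - g x)" for x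
  proof -
    have "(1/2) *\<^sub>R (g x + h x) - (1/2) *\<^sub>R (g x + g x) = (1/2) *\<^sub>R (h x - g x)"
      by (simp only: scaleR_diff_right[symmetric]) simp
    then show ?thesis by (simp only: scaleR_half_double)
  qed
  have "dJ g (%x. (1/2) *\<^sub>R (h x - g x)) = (1/2) * dJ g (%x. h x - g x)"
    unfolding dJ_def E1.den_scale E2.den_scale by (simp only: distrib_left)
  then have "dJ g (%x. (1/2) *\<^sub>R (h x - g x)) = (dJ g h - dJ g g) / 2"
    unfolding dJ_diff[OF X(1) X(2) X(1)] by simp
  then show ?thesis using J_convex[OF X(1) m] unfolding e by (simp only:)
qed

text \<open>The hypothesis \<open>crit\<close> lets the n-th equation be tested with all earlier
  solutions. By convexity of J this bounds J (g n) by J (g m), and by its value at the midpoint, up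
  to a derivative of \<Phi> in the direction u n - u m, which is small because the functions are
  Cauchy in the modular of \<alpha>. Uniform convexity then turns a small midpoint deficit into
  closeness of gradients.\<close>

theorem almost_critical_limit:
  fixes u :: "nat => 'a => real" and g :: "nat => 'a => 'a"
  assumes X: "!!n. X (u n) (g n)" and R: "!!n. J (g n) \<le> R"
    and c: "!!j z. z \<in> reps j ==> (%n. cint (u n) (j, z)) \<longlonglongrightarrow> c (j, z)"
    and crit: "!!m n. m \<le> n ==> dJ (g n) (g m) = d\<Phi> (u n) (u m)"
  shows "\<exists>w G. X w G \<and> EA.mconv u w \<and>
    E1.mconv g G \<and> E2.mconv g G"
proof -
  let ?m = "%n m. %x. (1/2) *\<^sub>R (g n x + g m x)"
  note Xa = X_alpha[OF X] and mu = X_meas(1)[OF X] and mg = X_meas(2)[OF X]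
  note aC = alpha_Cauchy[OF X R c]
  obtain w where w: "w \<in> borel_measurable L" "EA.mconv u w"
    using EA.rho_complete[of u, OF mu aC] by blast
  have wL: "EA.Lp w" by (rule EA.Lp_limit[OF Xa w])
  obtain B where B: "!!n. (\<integral>x. \<bar>u n x\<bar> powr \<alpha> x \<partial>L) \<le> B" "0 \<le> B"
  proof -
    have "convergent (%n. EA.en (u n))" using EA.en_tendsto[OF Xa wL w(2)] by (auto simp: convergent_def)
    then obtain D where D: "D > 0" "!!n. norm (EA.en (u n)) \<le> D" using convergent_imp_Bseq BseqE by metis
    have "(\<integral>x. \<bar>u n x\<bar> powr \<alpha> x \<partial>L) \<le> A * D" for n
    proof -
      have "A * EA.en (u n) \<le> A * D" using D(2)[of n] P_ge1 by (intro mult_left_mono) auto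
      then show ?thesis using EA.integral_le_en[OF Xa, of n] by simp
    qed
    moreover have "0 \<le> A * D" using D P_ge1 by simp
    ultimately show ?thesis by (rule that)
  qed
  have small: "\<exists>N. \<forall>m\<ge>N. \<forall>n\<ge>N. \<bar>d\<Phi> (u n) (u n) - d\<Phi> (u n) (u m)\<bar> \<le> \<eta>" if \<eta>: "\<eta> > 0" for \<eta>
  proof -
    \<comment> \<open>The parameter e makes the contribution of the bounded factor u n at most
      \<eta>/2. Once e is fixed, the coefficient of the other part is fixed too (D below), and
      closeness of the functions handles it.\<close>
    define q where "q = (C + 1) * (measure L \<Omega> + B + 1)"
    define e where "e = min 1 (\<eta> / (2 * q))"
    have p: "q > 0" unfolding q_def using C B(2) by (intro mult_pos_pos) (auto intro: add_nonneg_pos)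
    have e: "0 < e" "e \<le> 1" using \<eta> p by (auto simp: e_def)
    have "e * q \<le> \<eta> / (2 * q) * q"
      using p by (intro mult_right_mono) (auto simp: e_def)
    also have "\<dots> = \<eta> / 2" using p by simp
    finally have e1: "e * q \<le> \<eta> / 2" .
    have "C * (measure L \<Omega> + B) \<le> q" unfolding q_def using C B(2) by (intro mult_mono) auto
    then have "e * (C * (measure L \<Omega> + B)) \<le> \<eta> / 2" using e(1) e1 by (meson less_imp_le mult_left_mono order_trans)
    then have e2: "C * (e * (measure L \<Omega> + B)) \<le> \<eta> / 2" by (simp add: mult_ac)
    define D where "D = (C + 1) * (2 * e powr (1 - A))"
    have D: "D > 0" using C e by (simp add: D_def)
    obtain N where N: "!!m n. N \<le> m ==> N \<le> n ==> rho L \<alpha> (%x. u n x - u m x) < ennreal (\<eta> / (2 * D))"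
      using aC[of "\<eta> / (2 * D)"] \<eta> D by (metis divide_pos_pos mult_pos_pos zero_less_numeral)
    have "\<bar>d\<Phi> (u n) (u n) - d\<Phi> (u n) (u m)\<bar> \<le> \<eta>" if mn: "N \<le> m" "N \<le> n" for m n
    proof -
      have L: "EA.Lp (%x. u n x - u m x)" by (rule EA.Lp_diff[OF Xa Xa])
      let ?I = "\<integral>x. \<bar>u n x - u m x\<bar> powr \<alpha> x \<partial>L"
      have "rho L \<alpha> (%x. u n x - u m x) = ennreal ?I" using EA.rho_eq_integral[OF EA.Lp_integrable[OF L]] by simp
      then have I: "?I \<le> \<eta> / (2 * D)" using N[OF mn] \<eta> D by (simp add: ennreal_less_iff)
      have I0: "0 \<le> ?I" by (rule integral_nonneg_AE) simp
      have "d\<Phi> (u n) (u n) - d\<Phi> (u n) (u m) = d\<Phi> (u n) (%x. u n x - u m x)" by (rule d\<Phi>_diff[OF Xa Xa Xa, symmetric])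
      also have "\<bar>\<dots>\<bar> \<le> C * (e * (measure L \<Omega> + (\<integral>x. \<bar>u n x\<bar> powr \<alpha> x \<partial>L)) + 2 * e powr (1 - A) * ?I)"
        by (rule d\<Phi>_abs_le[OF Xa L e])
      also have "\<dots> \<le> C * (e * (measure L \<Omega> + B) + 2 * e powr (1 - A) * ?I)"
        using B(1)[of n] e C by (intro mult_left_mono add_right_mono add_left_mono) auto
      also have "\<dots> = C * (e * (measure L \<Omega> + B)) + C * (2 * e powr (1 - A)) * ?I" by (simp only: distrib_left mult.assoc)
      also have "C * (2 * e powr (1 - A)) * ?I \<le> D * (\<eta> / (2 * D))"
        using I I0 C D by (intro mult_mono) (auto simp: D_def mult_right_mono)
      also have "D * (\<eta> / (2 * D)) = \<eta> / 2" using D by simp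
      finally show ?thesis using e2 by linarith
    qed
    then show ?thesis by blast
  qed
  \<comment> \<open>The tangent inequality at g n, evaluated at g m; both derivatives of J are
    replaced by derivatives of \<Phi> through the tested equations.\<close>
  have dec: "J (g n) \<le> J (g m) + \<bar>d\<Phi> (u n) (u n) - d\<Phi> (u n) (u m)\<bar>" if "m \<le> n" for m n
    using J_convex[OF X X, of n m] crit[OF that] crit[of n n] dJ_diff[OF X X X, of n m n] by simp
  have mid: "J (g n) \<le> J (?m n m) + \<bar>d\<Phi> (u n) (u n) - d\<Phi> (u n) (u m)\<bar>" if "m \<le> n" for m n
  proof -
    have aux: "a \<le> t + \<bar>y - x\<bar>" if "a + (x - y) / 2 \<le> t" for a t x y :: real
      using that abs_ge_self[of "y - x"] abs_ge_zero[of "y - x"] by argo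
    show ?thesis by (rule aux) (use J_half_difference[OF X X, of n m] crit[OF that] crit[of n n] in simp)
  qed
  \<comment> \<open>An almost decreasing sequence that is bounded below is Cauchy, so J (g m) is
    also close to J (g n), and J at the midpoint is almost as large as their mean.\<close>
  have brk: "\<exists>N. \<forall>m\<ge>N. \<forall>n\<ge>m. (J (g n) + J (g m)) / 2 - J (?m n m) \<le> \<eta>" if \<eta>: "\<eta> > 0" for \<eta>
  proof -
    have "\<exists>N. \<forall>m\<ge>N. \<forall>n\<ge>N. J (g m) \<le> J (g n) + \<eta> / 2"
    proof (rule almost_decreasing_Cauchy[where a = "%n. J (g n)"])
      show "\<exists>N. \<forall>m\<ge>N. \<forall>n\<ge>m. J (g n) \<le> J (g m) + e" if "e > 0" for e
        using small[OF that] dec by (meson add_left_mono order_trans)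
    qed (use J_nonneg \<eta> in auto)
    then obtain N1 where N1: "!!m n. N1 \<le> m ==> N1 \<le> n ==> J (g m) \<le> J (g n) + \<eta> / 2" by blast
    obtain N2 where N2: "!!m n. N2 \<le> m ==> N2 \<le> n ==> \<bar>d\<Phi> (u n) (u n) - d\<Phi> (u n) (u m)\<bar> \<le> \<eta> / 2"
      using small[of "\<eta> / 2"] \<eta> by auto
    have aux: "(a + b) / 2 - t \<le> \<eta>" if "b \<le> a + \<eta> / 2" "a \<le> t + d" "d \<le> \<eta> / 2" for a b t d using that \<eta> by argo
    have "(J (g n) + J (g m)) / 2 - J (?m n m) \<le> \<eta>" if "max N1 N2 \<le> m" "m \<le> n" for m n
      by (rule aux[OF N1[of m n] mid[OF that(2)] N2[of m n]]) (use that in auto)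
    then show ?thesis by blast
  qed
  have cau: "\<exists>N. \<forall>m\<ge>N. \<forall>n\<ge>N. rho L (%x. max (p1 x) (p2 x)) (%x. g n x - g m x) < ennreal e" if e: "e > 0" for e
  proof -
    have R0: "R + 1 > 0" using R[of 0] J_nonneg[of "g 0"] by linarith
    \<comment> \<open>The budget for e: in each of the two modulars the first term costs at most
      e/4, since the energies add up to at most 2 (R + 1), and the deficit term at most e/8.
      Together this is 3 e/4.\<close>
    define \<epsilon> where "\<epsilon> = e / (8 * (R + 1))"
    have e': "\<epsilon> > 0" using e R0 by (simp add: \<epsilon>_def)
    obtain C1 where C1: "C1 \<ge> 0" "!!g h :: 'a => 'a. E1.Lp g ==> E1.Lp h ==> rho L p1 (%x. g x - h x)
        \<le> ennreal (\<epsilon> * (E1.en g + E1.en h) + C1 * ((E1.en g + E1.en h) / 2 - E1.en (%x. (1/2) *\<^sub>R (g x + h x))))"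
      using E1.en_uniformly_convex[OF e', where ?'b = 'a] by blast
    obtain C2 where C2: "C2 \<ge> 0" "!!g h :: 'a => 'a. E2.Lp g ==> E2.Lp h ==> rho L p2 (%x. g x - h x)
        \<le> ennreal (\<epsilon> * (E2.en g + E2.en h) + C2 * ((E2.en g + E2.en h) / 2 - E2.en (%x. (1/2) *\<^sub>R (g x + h x))))"
      using E2.en_uniformly_convex[OF e', where ?'b = 'a] by blast
    define \<eta> where "\<eta> = e / (8 * (C1 + C2 + 1))"
    have \<eta>: "\<eta> > 0" using e C1 C2 by (simp add: \<eta>_def)
    have "C1 * \<eta> \<le> (C1 + C2 + 1) * \<eta>" "C2 * \<eta> \<le> (C1 + C2 + 1) * \<eta>" using C1 C2 \<eta> by (auto intro!: mult_right_mono)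
    moreover have "(C1 + C2 + 1) * \<eta> = e / 8" using C1 C2 by (simp add: \<eta>_def field_simps add_nonneg_eq_0_iff)
    ultimately have C\<eta>: "C1 * \<eta> \<le> e / 8" "C2 * \<eta> \<le> e / 8" by auto
    obtain N where N: "!!m n. N \<le> m ==> m \<le> n ==> (J (g n) + J (g m)) / 2 - J (?m n m) \<le> \<eta>"
      using brk[OF \<eta>] by blast
    have main: "rho L (%x. max (p1 x) (p2 x)) (%x. g n x - g m x) < ennreal e" if mn: "N \<le> m" "m \<le> n" for m n
    proof -
      note L1 = X_Lp(1)[OF X[of n]] X_Lp(1)[OF X[of m]] and L2 = X_Lp(2)[OF X[of n]] X_Lp(2)[OF X[of m]]
      let ?b1 = "(E1.en (g n) + E1.en (g m)) / 2 - E1.en (?m n m)"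
      let ?b2 = "(E2.en (g n) + E2.en (g m)) / 2 - E2.en (?m n m)"
      have b: "0 \<le> ?b1" "0 \<le> ?b2" using E1.en_midpoint[OF L1] E2.en_midpoint[OF L2] by auto
      have aux: "x \<le> \<eta> \<and> y \<le> \<eta>" if "x + y \<le> \<eta>" "0 \<le> x" "0 \<le> y" for x y using that by linarith
      have "?b1 + ?b2 \<le> \<eta>" using N[OF mn] unfolding J_def by (simp add: field_simps)
      from aux[OF this b] have "?b1 \<le> \<eta>" "?b2 \<le> \<eta>" by (rule conjunct1, rule conjunct2)
      then have "C1 * ?b1 \<le> C1 * \<eta>" "C2 * ?b2 \<le> C2 * \<eta>" using C1(1) C2(1) by (auto intro: mult_left_mono)
      then have cb: "C1 * ?b1 \<le> e / 8" "C2 * ?b2 \<le> e / 8" using C\<eta> by auto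
      have "E1.en (g n) + E1.en (g m) \<le> 2 * (R + 1)" "E2.en (g n) + E2.en (g m) \<le> 2 * (R + 1)"
        using R[of n] R[of m] E1.en_nonneg[of "g n"] E1.en_nonneg[of "g m"] E2.en_nonneg[of "g n"] E2.en_nonneg[of "g m"]
        unfolding J_def by auto
      then have "\<epsilon> * (E1.en (g n) + E1.en (g m)) \<le> \<epsilon> * (2 * (R + 1))"
        "\<epsilon> * (E2.en (g n) + E2.en (g m)) \<le> \<epsilon> * (2 * (R + 1))"
        using e' by (auto intro!: mult_left_mono)
      moreover have "\<epsilon> * (2 * (R + 1)) = e / 4" using R0 by (simp add: \<epsilon>_def field_simps)
      ultimately have eb: "\<epsilon> * (E1.en (g n) + E1.en (g m)) \<le> e / 4" "\<epsilon> * (E2.en (g n) + E2.en (g m)) \<le> e / 4"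
        by (simp_all only:)
      have "rho L p1 (%x. g n x - g m x) \<le> ennreal (3 * e / 8)"
        by (rule order_trans[OF C1(2)[OF L1]], rule ennreal_leI) (use cb eb in linarith)
      moreover have "rho L p2 (%x. g n x - g m x) \<le> ennreal (3 * e / 8)"
        by (rule order_trans[OF C2(2)[OF L2]], rule ennreal_leI) (use cb eb in linarith)
      moreover have "rho L (%x. max (p1 x) (p2 x)) (%x. g n x - g m x) \<le> rho L p1 (%x. g n x - g m x) + rho L p2 (%x. g n x - g m x)"
        by (rule rho_max_le) (intro borel_measurable_diff mg)
      ultimately have "rho L (%x. max (p1 x) (p2 x)) (%x. g n x - g m x) \<le> ennreal (3 * e / 8) + ennreal (3 * e / 8)"
        by (meson add_mono order_trans)
      also have "\<dots> = ennreal (3 * e / 4)" using e by (simp flip: ennreal_plus)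
      also have "\<dots> < ennreal e" using e by (intro ennreal_lessI) auto
      finally show ?thesis .
    qed
    show ?thesis
    proof (intro exI[of _ N] allI impI)
      fix m n assume "N \<le> m" "N \<le> n"
      then show "rho L (%x. max (p1 x) (p2 x)) (%x. g n x - g m x) < ennreal e"
        using main[of m n] main[of n m] EM.rho_diff_commute[of "g n" "g m"] by (cases "m \<le> n") auto
    qed
  qed
  obtain G where G: "G \<in> borel_measurable L" "EM.mconv g G"
    using EM.rho_complete[of g, OF mg cau] by blast
  have gM: "EM.Lp (g n)" for n
    using le_less_trans[OF rho_max_le[OF mg[of n]], of top] X_Lp[OF X[of n]] mg[of n] unfolding EM.Lp_def E1.Lp_def E2.Lp_def
    by auto
  have GM: "EM.Lp G" by (rule EM.Lp_limit[OF gM G])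
  have L1: "E1.mconv g G"
    by (rule EM.rho_tendsto_smaller_exponent[OF _ _ _ EM.Lp_diff[OF gM GM] G(2)])
      (use meas p1_bd(1) p0 in \<open>force intro: less_le_trans\<close>)+
  have L2: "E2.mconv g G"
    by (rule EM.rho_tendsto_smaller_exponent[OF _ _ _ EM.Lp_diff[OF gM GM] G(2)])
      (use meas p2_bd(1) p0 in \<open>force intro: less_le_trans\<close>)+
  \<comment> \<open>Membership in X also asks for convergence of the functions in the modulars of p1
    and p2. It follows from convergence for \<alpha> because \<alpha> dominates both
    exponents.\<close>
  have U1: "E1.mconv u w"
    by (rule EA.rho_tendsto_smaller_exponent[OF _ _ _ EA.Lp_diff[OF Xa wL] w(2)])
      (use meas p1_bd p0 in \<open>force intro: less_le_trans\<close>)+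
  have U2: "E2.mconv u w"
    by (rule EA.rho_tendsto_smaller_exponent[OF _ _ _ EA.Lp_diff[OF Xa wL] w(2)])
      (use meas p2_bd p0 in \<open>force intro: less_le_trans\<close>)+
  have "S1.approximable w G" by (rule S1.approximable_closed[OF _ w(1) G(1) U1 L1]) (use X in \<open>simp add: X_def\<close>)
  moreover have "S2.approximable w G" by (rule S2.approximable_closed[OF _ w(1) G(1) U2 L2]) (use X in \<open>simp add: X_def\<close>)
  ultimately have "X w G" by (simp add: X_def)
  then show ?thesis using w L1 L2 by blast
qed

end

section \<open>Cluster points of the Galerkin net\<close>

context problem
begin

text \<open>The equation is required in the directions of Z and in the direction u itself; the
  latter need not belong to Z and supplies the a priori bound for J.\<close>

definition galerkin :: "real => real => ('a => real) set => ('a => real) => ('a => 'a) => bool" where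
  "galerkin a b Z u g \<longleftrightarrow> X u g \<and> a \<le> J g - \<Phi> u \<and> J g - \<Phi> u \<le> b \<and> dJ g g = d\<Phi> u u \<and> (\<forall>v\<in>Z. \<forall>h. X v h --> dJ g h = d\<Phi> u v)"

definition adm :: "('a => real) set => bool" where "adm Z \<longleftrightarrow> finite Z \<and> (\<forall>v\<in>Z. \<exists>h. X v h)"

lemma closure_product_approx:
  fixes S :: "('i => real) set"
  assumes c: "c \<in> closure S" and W: "finite W" and e: "0 < e"
  shows "\<exists>y\<in>S. \<forall>w\<in>W. \<bar>y w - c w\<bar> < e"
proof -
  let ?O = "\<Inter>w\<in>W. (%y::'i => real. y w) -` ball (c w) e"
  have "open ?O" by (intro open_INT[OF W] ballI open_vimage open_ball continuous_on_product_coordinates)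
  moreover have "c \<in> ?O" using e by simp
  ultimately have "?O \<inter> S \<noteq> {}" using open_Int_closure_eq_empty[of ?O S] c by blast
  then obtain y where "y \<in> S" "y \<in> ?O" by blast
  then show ?thesis by (intro bexI[of _ y]) (auto simp: dist_real_def abs_minus_commute)
qed

text \<open>The a priori bound puts the cell integrals of all Galerkin solutions into one compact
  box. The closures of the tails over larger sets have the finite intersection property, since
  finitely many admissible sets have their union as a common upper bound.\<close>

lemma cluster_point:
  assumes U: "!!Z. adm Z ==> \<exists>g. galerkin a b Z (U Z) g"
  obtains c where "!!Z W e. adm Z ==> finite W ==> 0 < e ==> \<exists>Z'. Z \<subseteq> Z' \<and> adm Z' \<and> (\<forall>w\<in>W. \<bar>cint (U Z') w - c w\<bar> < e)"
proof -
  define R where "R = (\<theta> * b + (\<theta> + 1) * K0 * measure L \<Omega>) / (\<theta> - P)"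
  obtain k where k: "!!u g. X u g ==> (\<integral>x. \<bar>u x\<bar> \<partial>L) \<le> k * (measure L \<Omega> + P * J g)" using X_integral_abs_le by blast
  define B where "B = \<bar>k\<bar> * (measure L \<Omega> + P * R)"
  have cB: "\<bar>cint (U Z) w\<bar> \<le> B" if Z: "adm Z" for Z w
  proof -
    obtain g where g: "X (U Z) g" "J g - \<Phi> (U Z) \<le> b" "dJ g g = d\<Phi> (U Z) (U Z)" using U[OF Z] by (auto simp: galerkin_def)
    have J: "J g \<le> R" unfolding R_def by (rule J_bound[OF g(1,3,2)])
    have "\<bar>cint (U Z) w\<bar> \<le> k * (measure L \<Omega> + P * J g)" using cint_abs_le[OF X_integrable[OF g(1)], of w] k[OF g(1)] by linarith
    also have "\<dots> \<le> \<bar>k\<bar> * (measure L \<Omega> + P * J g)" using J_nonneg[of g] P_ge1 by (intro mult_right_mono) auto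
    also have "\<dots> \<le> B" unfolding B_def using J P_ge1 by (intro mult_left_mono add_left_mono) auto
    finally show ?thesis .
  qed
  define S where "S Z = (%Z'. cint (U Z')) ` {Z'. Z \<subseteq> Z' \<and> adm Z'}" for Z
  have "{y. \<forall>i. \<bar>y i\<bar> \<le> B} \<inter> (\<Inter>Z\<in>Collect adm. closure (S Z)) \<noteq> {}"
  proof (rule compact_imp_fip_image[OF compact_box_fun])
    fix I assume I: "finite I" "I \<subseteq> Collect adm"
    then have "\<forall>Z\<in>I. adm Z" by blast
    then have Z: "adm (\<Union>I)" using I(1) by (simp add: adm_def)
    have "cint (U (\<Union>I)) \<in> closure (S Z)" if "Z \<in> I" for Z
      using Z that by (intro subsetD[OF closure_subset]) (auto simp: S_def)
    then show "{y. \<forall>i. \<bar>y i\<bar> \<le> B} \<inter> (\<Inter>Z\<in>I. closure (S Z)) \<noteq> {}" using cB[OF Z] by blast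
  qed simp
  then obtain c where c: "!!Z. adm Z ==> c \<in> closure (S Z)" by blast
  show ?thesis
  proof (rule that[of c])
    fix Z and W :: "(nat \<times> 'a) set" and e :: real assume Z: "adm Z" "finite W" "0 < e"
    show "\<exists>Z'. Z \<subseteq> Z' \<and> adm Z' \<and> (\<forall>w\<in>W. \<bar>cint (U Z') w - c w\<bar> < e)"
      using closure_product_approx[OF c[OF Z(1)] Z(2,3)] unfolding S_def by blast
  qed
qed

lemma cint_tendsto:
  assumes u: "!!n. X (u n) (g n)" and w: "X w h" and lim: "EA.mconv u w"
  shows "(%n. cint (u n) jz) \<longlonglongrightarrow> cint w jz"
proof (rule LIM_zero_cancel, rule Lim_null_comparison)
  have L: "EA.Lp (%x. u n x - w x)" for n by (rule EA.Lp_diff[OF X_alpha[OF u] X_alpha[OF w]])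
  have "(%n. \<integral>x. norm (u n x - w x) \<partial>L) \<longlonglongrightarrow> 0"
    by (rule SA.mconv_L1[OF X_alpha[OF u] X_alpha[OF w] lim])
  then show "(%n. \<integral>x. \<bar>u n x - w x\<bar> \<partial>L) \<longlonglongrightarrow> 0" by simp
  show "\<forall>\<^sub>F n in sequentially. norm (cint (u n) jz - cint w jz) \<le> (\<integral>x. \<bar>u n x - w x\<bar> \<partial>L)"
  proof (rule always_eventually, rule allI)
    fix n
    note i = X_integrable[OF u[of n]] X_integrable[OF w]
    have "cint (u n) jz - cint w jz = cint (%x. u n x - w x) jz"
      using integrable_indicator_times[OF cell_borel i(1)] integrable_indicator_times[OF cell_borel i(2)]
      by (cases jz) (simp add: cint_def right_diff_distrib)
    then show "norm (cint (u n) jz - cint w jz) \<le> (\<integral>x. \<bar>u n x - w x\<bar> \<partial>L)"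
      using cint_abs_le[of "%x. u n x - w x" jz] i by simp
  qed
qed

text \<open>A cluster point of a net does not come with a sequence. For one fixed direction v,
  dependent choice extracts admissible sets that contain v and all earlier solutions and whose cell
  integrals approach c; the limit obtained may at first depend on v.\<close>

lemma limit_for_direction:
  assumes U: "!!Z. adm Z ==> \<exists>g. galerkin a b Z (U Z) g"
    and c: "!!Z W e. adm Z ==> finite W ==> 0 < e ==> \<exists>Z'. Z \<subseteq> Z' \<and> adm Z' \<and> (\<forall>w\<in>W. \<bar>cint (U Z') w - c w\<bar> < e)"
    and v: "X v h"
  shows "\<exists>w G. X w G \<and> a \<le> J G - \<Phi> w \<and> dJ G h = d\<Phi> w v \<and> (\<forall>j. \<forall>z\<in>reps j. cint w (j, z) = c (j, z))"
proof -
  \<comment> \<open>The finitely many cells of generations up to n. Their union over n exhausts all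
    represented cells, so closeness on \<open>W n\<close> yields convergence of each cell
    integral.\<close>
  define W where "W n = (SIGMA j:{..n}. reps j)" for n :: nat
  have W: "finite (W n)" for n by (auto simp: W_def reps(1))
  define near where "near n Z \<longleftrightarrow> adm Z \<and> v \<in> Z \<and> (\<forall>w\<in>W n. \<bar>cint (U Z) w - c w\<bar> < inverse (real (Suc n)))" for n Z
  have "\<exists>Z. \<forall>n. near n (Z n) \<and> insert (U (Z n)) (Z n) \<subseteq> Z (Suc n)"
  proof (rule dependent_nat_choice)
    have "adm {v}" using v by (auto simp: adm_def)
    from c[OF this W[of 0], of "inverse (real (Suc 0))"] show "\<exists>Z. near 0 Z" by (auto simp: near_def)
    fix Z n assume Z: "near n Z"
    then have "adm Z" by (simp add: near_def)
    then have "adm (insert (U Z) Z)" using U[of Z] by (auto simp: adm_def galerkin_def)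
    from c[OF this W[of "Suc n"], of "inverse (real (Suc (Suc n)))"]
    obtain Z' where "insert (U Z) Z \<subseteq> Z'" "adm Z'" "\<forall>w\<in>W (Suc n). \<bar>cint (U Z') w - c w\<bar> < inverse (real (Suc (Suc n)))" by auto
    then show "\<exists>Z'. near (Suc n) Z' \<and> insert (U Z) Z \<subseteq> Z'" using Z by (auto simp: near_def)
  qed
  then obtain Z where Z: "!!n. near n (Z n)" "!!n. insert (U (Z n)) (Z n) \<subseteq> Z (Suc n)" by blast
  have mono: "Z m \<subseteq> Z n" if "m \<le> n" for m n using that by (induction rule: dec_induct) (use Z(2) in blast)+
  have mem: "U (Z m) \<in> Z n" if "m < n" for m n using mono[of "Suc m" n] Z(2)[of m] that by auto
  define u where "u n = U (Z n)" for n
  have "\<exists>g. galerkin a b (Z n) (u n) g" for n unfolding u_def using U Z(1)[of n] by (simp add: near_def)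
  then obtain g where g: "!!n. galerkin a b (Z n) (u n) (g n)" by metis
  have X: "X (u n) (g n)" for n using g[of n] by (simp add: galerkin_def)
  have R: "J (g n) \<le> (\<theta> * b + (\<theta> + 1) * K0 * measure L \<Omega>) / (\<theta> - P)" for n
    using J_bound[OF X, of n b] g[of n] by (simp add: galerkin_def)
  have crit: "dJ (g n) (g m) = d\<Phi> (u n) (u m)" if "m \<le> n" for m n
  proof (cases "m = n")
    case True
    then show ?thesis using g[of n] by (simp add: galerkin_def)
  next
    case False
    then have "u m \<in> Z n" using mem[of m n] that by (simp add: u_def)
    then show ?thesis using g[of n] X[of m] by (simp add: galerkin_def)
  qed
  have lim: "(%n. cint (u n) (j, z)) \<longlonglongrightarrow> c (j, z)" if z: "z \<in> reps j" for j z
  proof (rule LIM_zero_cancel, rule Lim_null_comparison[OF _ LIMSEQ_inverse_real_of_nat])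
    show "\<forall>\<^sub>F n in sequentially. norm (cint (u n) (j, z) - c (j, z)) \<le> inverse (real (Suc n))"
    proof (rule eventually_sequentiallyI[of j])
      fix n assume "j \<le> n"
      then have "(j, z) \<in> W n" using z by (simp add: W_def)
      then show "norm (cint (u n) (j, z) - c (j, z)) \<le> inverse (real (Suc n))"
        using Z(1)[of n] by (auto simp: near_def u_def intro: less_imp_le)
    qed
  qed
  obtain w G where w: "X w G" and l: "EA.mconv u w"
    "E1.mconv g G" "E2.mconv g G"
    using almost_critical_limit[of u g _ c, OF X R lim crit] by blast
  note JT = J_tendsto[OF X X_Lp[OF w] l(2,3)]
  note \<Phi>T = \<Phi>_tendsto[OF X_alpha[OF X] X_alpha[OF w] l(1)]
  have "a \<le> J G - \<Phi> w"
    by (rule LIMSEQ_le_const[OF tendsto_diff[OF JT(1) \<Phi>T]]) (use g in \<open>auto simp: galerkin_def\<close>)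
  moreover have "dJ G h = d\<Phi> w v"
  proof (rule LIMSEQ_unique[OF JT(2)[OF X_Lp[OF v]]])
    have "dJ (g n) h = d\<Phi> (u n) v" for n using g[of n] Z(1)[of n] v by (auto simp: galerkin_def near_def)
    then show "(%n. dJ (g n) h) \<longlonglongrightarrow> d\<Phi> w v"
      using d\<Phi>_tendsto[OF X_alpha[OF X] X_alpha[OF w] l(1) X_alpha[OF v]] by simp
  qed
  moreover have "cint w (j, z) = c (j, z)" if "z \<in> reps j" for j z
    by (rule LIMSEQ_unique[OF cint_tendsto[OF X w l(1)] lim[OF that]])
  ultimately show ?thesis using w by blast
qed

theorem critical_above: "\<exists>u g. X u g \<and> a \<le> J g - \<Phi> u \<and> (\<forall>v h. X v h --> dJ g h = d\<Phi> u v)"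
proof -
  obtain b where b: "!!Z. adm Z ==> \<exists>u g. galerkin a b Z u g"
  proof (rule finite_critical[of a])
    fix b assume "!!Z. finite Z ==> (!!v. v \<in> Z ==> \<exists>h. X v h) ==>
      \<exists>u g. X u g \<and> a \<le> J g - \<Phi> u \<and> J g - \<Phi> u \<le> b \<and> dJ g g = d\<Phi> u u \<and> (\<forall>v\<in>Z. \<forall>h. X v h --> dJ g h = d\<Phi> u v)"
    then show ?thesis using that[of b] by (simp add: galerkin_def adm_def)
  qed
  define U where "U Z = (SOME u. \<exists>g. galerkin a b Z u g)" for Z
  have U: "\<exists>g. galerkin a b Z (U Z) g" if "adm Z" for Z
    unfolding U_def by (rule someI_ex[OF b[OF that]])
  obtain c where c: "!!Z W e. adm Z ==> finite W ==> 0 < e ==> \<exists>Z'. Z \<subseteq> Z' \<and> adm Z' \<and> (\<forall>w\<in>W. \<bar>cint (U Z') w - c w\<bar> < e)"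
    using cluster_point[of a b U, OF U] by blast
  have lim: "\<exists>w G. X w G \<and> a \<le> J G - \<Phi> w \<and> dJ G h = d\<Phi> w v \<and> (\<forall>j. \<forall>z\<in>reps j. cint w (j, z) = c (j, z))" if "X v h" for v h
    by (rule limit_for_direction[of a b U c, OF _ _ that]; (rule U c; assumption))
  \<comment> \<open>The direction zero supplies a candidate. The limit found for any other direction
    has the same cell integrals c, hence agrees with the candidate almost everywhere and passes its
    equation on to it.\<close>
  obtain u g where u: "X u g" "a \<le> J g - \<Phi> u" "!!j z. z \<in> reps j ==> cint u (j, z) = c (j, z)"
    using lim[OF X_zero] by blast
  have "dJ g h = d\<Phi> u v" if v: "X v h" for v h
  proof -
    obtain w G where w: "X w G" "dJ G h = d\<Phi> w v" "!!j z. z \<in> reps j ==> cint w (j, z) = c (j, z)"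
      using lim[OF v] by blast
    have e: "AE x in L. u x = w x" by (rule cint_determines[OF u(1) w(1)]) (simp add: u(3) w(3))
    have "AE x in L. g x = G x" using X_wgrad[OF X_cong[OF u(1) e]] X_wgrad[OF w(1)] by eventually_elim simp
    then have "dJ g h = dJ G h" by (intro dJ_cong[OF u(1) w(1) v v]) auto
    also have "\<dots> = d\<Phi> u v" unfolding w(2) d\<Phi>_def
    proof (rule integral_cong_AE)
      show "AE x in L. f x (w x) * v x = f x (u x) * v x" using e by eventually_elim simp
    qed (use d\<Phi>_integrable[OF X_alpha[OF w(1)] X_alpha[OF v]] d\<Phi>_integrable[OF X_alpha[OF u(1)] X_alpha[OF v]] in auto)
    finally show ?thesis .
  qed
  then show ?thesis using u by blast
qed

end

section \<open>Unbounded energies and distinct pairs of solutions\<close>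

context problem
begin

lemma unbounded_critical:
  obtains u where "critical_point \<Omega> p1 p2 f u" "weak_solution \<Omega> p1 p2 f u" "a \<le> energy \<Omega> p1 p2 f u"
proof -
  obtain u g where u: "X u g" "a \<le> J g - \<Phi> u" "\<And>v h. X v h \<Longrightarrow> dJ g h = d\<Phi> u v" using critical_above by blast
  show ?thesis
    by (rule that[of u]) (use critical_pointI[OF u(1,3)] u(2) energy_eq[OF u(1)] in auto)
qed

lemma energy_cong_AE:
  assumes "u \<in> Xsp \<Omega> p1 p2" "AE x in L. u x = v x"
  shows "energy \<Omega> p1 p2 f u = energy \<Omega> p1 p2 f v"
proof -
  have X: "X u (wgrad \<Omega> u)" using assms by (simp add: X_Xsp)
  have Y: "X v (wgrad \<Omega> u)" by (rule X_cong[OF X assms(2)])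
  have "\<Phi> u = \<Phi> v" unfolding \<Phi>_def
  proof (rule integral_cong_AE)
    show "AE x in L. Fprim f x (u x) = Fprim f x (v x)" using assms(2) by eventually_elim simp
  qed (use \<Phi>_integrable[OF X_alpha[OF X]] \<Phi>_integrable[OF X_alpha[OF Y]] in auto)
  then show ?thesis by (simp add: energy_eq[OF X] energy_eq[OF Y])
qed

lemma energy_uminus:
  assumes "u \<in> Xsp \<Omega> p1 p2" shows "energy \<Omega> p1 p2 f (\<lambda>x. - u x) = energy \<Omega> p1 p2 f u" "(\<lambda>x. - u x) \<in> Xsp \<Omega> p1 p2"
proof -
  have X: "X u (wgrad \<Omega> u)" using assms by (simp add: X_Xsp)
  have Y: "X (\<lambda>x. - u x) (\<lambda>x. - wgrad \<Omega> u x)" using X_scale[OF X, of "-1"] by simp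
  show "(\<lambda>x. - u x) \<in> Xsp \<Omega> p1 p2" by (rule X_imp_Xsp[OF Y])
  show "energy \<Omega> p1 p2 f (\<lambda>x. - u x) = energy \<Omega> p1 p2 f u"
    unfolding energy_eq[OF X] energy_eq[OF Y] \<Phi>_uminus[OF X_alpha[OF X]] by (simp add: J_def E1.en_def E2.en_def)
qed

theorem infinitely_many_solutions:
  "(\<exists>u::nat \<Rightarrow> 'a \<Rightarrow> real. (\<forall>n. critical_point \<Omega> p1 p2 f (u n)) \<and>
             filterlim (\<lambda>n. energy \<Omega> p1 p2 f (u n)) at_top sequentially)
       \<and> (\<exists>w::nat \<Rightarrow> 'a \<Rightarrow> real. (\<forall>n. weak_solution \<Omega> p1 p2 f (w n)) \<and>
             (\<forall>n m. n \<noteq> m \<longrightarrow>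
                \<not> (AE x in L. w n x = w m x) \<and>
                \<not> (AE x in L. w n x = - w m x)))"
proof -
  let ?E = "energy \<Omega> p1 p2 f"
  \<comment> \<open>Asking for one more unit of energy at each step makes the energies both strictly
    increasing and unbounded, so one sequence serves both conclusions.\<close>
  have "\<exists>u. \<forall>n. (critical_point \<Omega> p1 p2 f (u n) \<and> weak_solution \<Omega> p1 p2 f (u n)) \<and> ?E (u n) + 1 \<le> ?E (u (Suc n))"
  proof (rule dependent_nat_choice)
    show "\<exists>u. critical_point \<Omega> p1 p2 f u \<and> weak_solution \<Omega> p1 p2 f u" using unbounded_critical[of 0] by blast
    show "\<exists>v. (critical_point \<Omega> p1 p2 f v \<and> weak_solution \<Omega> p1 p2 f v) \<and> ?E u + 1 \<le> ?E v" for u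
      using unbounded_critical[of "?E u + 1"] by blast
  qed
  then obtain u where u: "\<And>n. critical_point \<Omega> p1 p2 f (u n)" "\<And>n. weak_solution \<Omega> p1 p2 f (u n)" "\<And>n. ?E (u n) + 1 \<le> ?E (u (Suc n))"
    by blast
  have ge: "?E (u 0) + real n \<le> ?E (u n)" for n
  proof (induction n)
    case (Suc n)
    then show ?case using u(3)[of n] by simp
  qed simp
  have "filterlim (\<lambda>n. ?E (u 0) + real n) at_top sequentially"
    by (rule filterlim_tendsto_add_at_top[OF tendsto_const filterlim_real_sequentially])
  then have lim: "filterlim (\<lambda>n. ?E (u n)) at_top sequentially"
    by (rule filterlim_at_top_mono) (use ge in auto)
  have "?E (u n) < ?E (u (Suc n))" for n using u(3)[of n] by simp
  then have sm: "strict_mono (\<lambda>n. ?E (u n))" by (simp add: strict_mono_Suc_iff)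
  have X: "u n \<in> Xsp \<Omega> p1 p2" for n using u(1)[of n] by (simp add: critical_point_def)
  have "\<not> (AE x in L. u n x = u m x) \<and> \<not> (AE x in L. u n x = - u m x)" if "n \<noteq> m" for n m
  proof -
    \<comment> \<open>The energy is even and insensitive to null sets, so different energies exclude
      agreement almost everywhere with either sign.\<close>
    have "?E (u n) \<noteq> ?E (u m)" using strict_mono_eq[OF sm, of n m] that by simp
    then show ?thesis
      using energy_cong_AE[OF X, of n "u m"] energy_cong_AE[OF X, of n "\<lambda>x. - u m x"] energy_uminus(1)[OF X, of m] by auto
  qed
  then show ?thesis using u lim by blast
qed

end

theorem theorem3p7:
  fixes \<Omega> :: "'a::euclidean_space set"
    and p1 p2 \<alpha> :: "'a \<Rightarrow> real"
    and f :: "'a \<Rightarrow> real \<Rightarrow> real"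
  assumes dom: "smooth_bounded_domain \<Omega>"
    and p1: "C_plus \<Omega> p1" and p2: "C_plus \<Omega> p2"
    and f0_car: "caratheodory \<Omega> f"
    and f0_alpha: "C_plus \<Omega> \<alpha>"
    and f0_crit: "\<forall>x\<in>closure \<Omega>. max (p1 x) (p2 x) < real DIM('a) \<longrightarrow>
                    \<alpha> x < real DIM('a) * max (p1 x) (p2 x) / (real DIM('a) - max (p1 x) (p2 x))"
    and f0_growth: "\<exists>C1 C2. \<forall>x\<in>\<Omega>. \<forall>t. \<bar>f x t\<bar> \<le> C1 + C2 * \<bar>t\<bar> powr (\<alpha> x - 1)"
    and f1: "\<exists>M>0. \<exists>\<theta>>sup_cl \<Omega> (\<lambda>x. max (p1 x) (p2 x)).
               \<forall>x\<in>\<Omega>. \<forall>t. \<bar>t\<bar> \<ge> M \<longrightarrow> 0 < \<theta> * Fprim f x t \<and> \<theta> * Fprim f x t \<le> t * f x t"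
    and f3: "\<forall>x\<in>\<Omega>. \<forall>t. f x (- t) = - f x t"
    and growth_gap: "sup_cl \<Omega> (\<lambda>x. max (p1 x) (p2 x)) < sup_cl \<Omega> \<alpha>"
  shows "(\<exists>u::nat \<Rightarrow> 'a \<Rightarrow> real. (\<forall>n. critical_point \<Omega> p1 p2 f (u n)) \<and>
             filterlim (\<lambda>n. energy \<Omega> p1 p2 f (u n)) at_top sequentially)
       \<and> (\<exists>w::nat \<Rightarrow> 'a \<Rightarrow> real. (\<forall>n. weak_solution \<Omega> p1 p2 f (w n)) \<and>
             (\<forall>n m. n \<noteq> m \<longrightarrow>
                \<not> (AE x in lebesgue_on \<Omega>. w n x = w m x) \<and>
                \<not> (AE x in lebesgue_on \<Omega>. w n x = - w m x)))"
proof -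
  let ?C = "closure \<Omega>" and ?p = "\<lambda>x. max (p1 x) (p2 x)"
  have ne: "\<Omega> \<noteq> {}" and op: "open \<Omega>" and bd: "bounded \<Omega>" using dom by (auto simp: smooth_bounded_domain_def)
  then interpret B: bdomain \<Omega> by unfold_locales
  have sub: "x \<in> ?C" if "x \<in> \<Omega>" for x using closure_subset that by blast
  have c: "continuous_on ?C p1" "continuous_on ?C p2" "continuous_on ?C \<alpha>" using p1 p2 f0_alpha by (auto simp: C_plus_def)
  have gt: "1 < p1 x" "1 < p2 x" if "x \<in> ?C" for x using p1 p2 that by (auto simp: C_plus_def)
  have comp: "compact ?C" "?C \<noteq> {}" using bd ne by auto
  have cp: "continuous_on ?C ?p" by (intro continuous_on_max c)
  \<comment> \<open>Enlarging the growth exponent keeps it subcritical and puts it above both p1 and p2.\<close>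
  define \<alpha>' where "\<alpha>' x = max (\<alpha> x) (?p x)" for x
  have c\<alpha>: "continuous_on ?C \<alpha>'" unfolding \<alpha>'_def[abs_def] by (intro continuous_on_max c cp)
  have \<alpha>': "?p x \<le> \<alpha>' x" "\<alpha> x \<le> \<alpha>' x" "p1 x \<le> \<alpha>' x" "p2 x \<le> \<alpha>' x" for x by (auto simp: \<alpha>'_def)
  have crit: "\<alpha>' x < real DIM('a) * ?p x / (real DIM('a) - ?p x)" if x: "x \<in> ?C" "?p x < real DIM('a)" for x
  proof -
    have aux: "q < N * q / (N - q)" if "0 < q" "q < N" for q N :: real using that by (simp add: pos_less_divide_eq algebra_simps)
    have "?p x < real DIM('a) * ?p x / (real DIM('a) - ?p x)" by (rule aux) (use gt[OF x(1)] x(2) in auto)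
    then show ?thesis using f0_crit x by (simp add: \<alpha>'_def)
  qed
  obtain \<delta> A j0 where gap: "0 < \<delta>" "\<delta> \<le> 1" "1 \<le> A" "\<And>x. x \<in> \<Omega> \<Longrightarrow> \<alpha>' x \<le> A" "\<And>j x. j0 \<le> j \<Longrightarrow> x \<in> \<Omega> \<Longrightarrow>
    \<exists>q a. 1 \<le> q \<and> q \<le> a \<and> a \<le> A \<and> (\<forall>y\<in>cell j x \<inter> \<Omega>. q \<le> ?p y) \<and> \<alpha>' x \<le> a \<and> real DIM('a) / q - real DIM('a) / a \<le> 1 - \<delta>"
    by (rule B.subcritical_gap[OF ne cp _ c\<alpha> \<alpha>'(1) crit]) (use gt in \<open>auto simp: less_max_iff_disj\<close>)
  define P where "P = sup_cl \<Omega> ?p"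
  have P: "?p x \<le> P" if "x \<in> ?C" for x
    unfolding P_def sup_cl_def
    by (rule cSUP_upper[OF that]) (intro bounded_imp_bdd_above compact_imp_bounded compact_continuous_image cp comp)
  have "continuous_on ?C (\<lambda>x. min (p1 x) (p2 x))" by (intro continuous_on_min c)
  from continuous_attains_inf[OF comp this] obtain x0 where x0: "x0 \<in> ?C" "\<And>x. x \<in> ?C \<Longrightarrow> min (p1 x0) (p2 x0) \<le> min (p1 x) (p2 x)" by blast
  define p0 where "p0 = min (p1 x0) (p2 x0)"
  have p0: "1 < p0" using gt[OF x0(1)] by (simp add: p0_def)
  have meas: "h \<in> borel_measurable (lebesgue_on \<Omega>)" if "continuous_on ?C h" for h :: "'a \<Rightarrow> real"
    by (rule continuous_imp_measurable_on_sets_lebesgue[OF continuous_on_subset[OF that closure_subset] B.dom_sets])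
  have P1: "1 \<le> P" using P[OF x0(1)] gt[OF x0(1)] by linarith
  \<comment> \<open>The embedding is used for the larger exponent max p1 p2, to which the
    subcriticality condition refers; gradients of functions in X have finite modular for it because
    its powers are bounded by the sum of the two.\<close>
  interpret S: sobolev \<Omega> ?p P
  proof (intro sobolev.intro B.bdomain_axioms exponent.intro B.finite_measure_dom exponent_axioms.intro meas cp P1)
    fix x assume "x \<in> space (lebesgue_on \<Omega>)"
    then have x: "x \<in> ?C" using sub by simp
    show "1 \<le> ?p x" "?p x \<le> P" using gt[OF x] P[OF x] by auto
  qed
  have \<alpha>1: "1 \<le> \<alpha>' x" if "x \<in> \<Omega>" for x using \<alpha>'(3)[of x] gt[OF sub[OF that]] by linarith
  obtain s j1 K where emb: "0 < s" "s < 1" "\<And>u g R J. B.poincare u g \<Longrightarrow> integrable (lebesgue_on \<Omega>) (\<lambda>x. norm (g x) powr ?p x) \<Longrightarrow>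
     (\<integral>x. norm (g x) powr ?p x \<partial>lebesgue_on \<Omega>) \<le> R \<Longrightarrow> j1 \<le> J \<Longrightarrow> rho (lebesgue_on \<Omega>) \<alpha>' (\<lambda>x. u x - B.avg (cell J x) u) \<le> ennreal (K R * s ^ J)"
    using S.embedding_averages[OF gap(1,2,3) meas[OF c\<alpha>] \<alpha>1 gap(4,5)] by blast
  obtain C1 C2 where C12: "\<And>x t. x \<in> \<Omega> \<Longrightarrow> \<bar>f x t\<bar> \<le> C1 + C2 * \<bar>t\<bar> powr (\<alpha> x - 1)" using f0_growth by blast
  define C where "C = \<bar>C1\<bar> + \<bar>C2\<bar>"
  have growth: "\<bar>f x t\<bar> \<le> C * (1 + \<bar>t\<bar> powr (\<alpha>' x - 1))" if x: "x \<in> \<Omega>" for x t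
  proof -
    \<comment> \<open>For |t| \<le> 1 raising the exponent lowers the power, and the constant 1
      makes up for it.\<close>
    have "\<bar>t\<bar> powr (\<alpha> x - 1) \<le> 1 + \<bar>t\<bar> powr (\<alpha>' x - 1)"
    proof (cases "\<bar>t\<bar> \<le> 1")
      case True
      then have "\<bar>t\<bar> powr (\<alpha> x - 1) \<le> 1" using f0_alpha sub[OF x] by (intro powr_le1) (auto simp: C_plus_def intro: less_imp_le)
      then show ?thesis by (simp add: add_increasing2)
    next
      case False
      then have "\<bar>t\<bar> powr (\<alpha> x - 1) \<le> \<bar>t\<bar> powr (\<alpha>' x - 1)" using \<alpha>'(2) by (intro powr_mono) auto
      then show ?thesis by simp
    qed
    then have "\<bar>C2\<bar> * \<bar>t\<bar> powr (\<alpha> x - 1) \<le> \<bar>C2\<bar> * (1 + \<bar>t\<bar> powr (\<alpha>' x - 1))" by (intro mult_left_mono) auto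
    moreover have "C2 * \<bar>t\<bar> powr (\<alpha> x - 1) \<le> \<bar>C2\<bar> * \<bar>t\<bar> powr (\<alpha> x - 1)" by (intro mult_right_mono) auto
    moreover have "C1 \<le> \<bar>C1\<bar> * (1 + \<bar>t\<bar> powr (\<alpha>' x - 1))" by (simp add: distrib_left add_increasing2 add_increasing)
    ultimately show ?thesis using C12[OF x, of t] by (simp add: C_def distrib_right)
  qed
  obtain M \<theta> where ar: "0 < M" "P < \<theta>" "\<And>x t. x \<in> \<Omega> \<Longrightarrow> M \<le> \<bar>t\<bar> \<Longrightarrow> 0 < \<theta> * Fprim f x t \<and> \<theta> * Fprim f x t \<le> t * f x t"
    using f1 unfolding P_def by blast
  have bds: "p0 \<le> p1 x" "p1 x \<le> P" "p0 \<le> p2 x" "p2 x \<le> P" if "x \<in> \<Omega>" for x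
    using x0(2)[OF sub[OF that]] P[OF sub[OF that]] by (auto simp: p0_def)
  interpret problem \<Omega> p1 p2 \<alpha>' f P p0 A C M \<theta> s K j1
    by (intro problem.intro problem_axioms.intro B.bdomain_axioms)
      (use ne meas c c\<alpha> p0 bds \<alpha>' gap f0_car growth ar f3 emb in \<open>auto simp: C_def\<close>)
  show ?thesis by (rule infinitely_many_solutions)
qed

end
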